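(* Let $J$ be endowed with a prior $\pi$ on the positive integers such that $e^{-b_1J^d\log J}\le\pi(J)\le e^{-b_2J^d\log J}$ for all integers $J\ge2$ and some $b_1,b_2>0$, and suppose that $a_2n^{-a_3}\le\alpha_{\boldsymbol j}\le a_1$ for some constants $a_1,a_2,a_3>0$. Consider the test $$\phi_n=\mathbb 1\big\{\Pi\big(d_1(g,\mathcal F^* )\le M_0\sqrt{(J^d\log n)/n}\,\big|\,\mathbb D_n\big)<\gamma\big\}$$ for testing the hypothesis of multivariate monotonicity of $g$, where $M_0$ is a sufficiently large constant and $\gamma\in(0,1)$ is predetermined. Then: (i) for fixed $g_0\in\mathcal G^*$ bounded away from zero, $\mathrm E_0(\phi_n)\to0$; (ii) for a fixed density $g_0$ bounded away from zero and not belonging to the $\mathbb L_1$-closure of $\mathcal G^*$, $\mathrm E_0(1-\phi_n)\to0$; (iii) for $\alpha\in(0,1]$, $L>0$ and a constant $l>0$, there exists a sufficiently large constant $C>0$ depending only on $\alpha$, $L$ and $d$ such that $$\sup\{\mathrm E_0(1-\phi_n): g_0\in\mathcal H(\alpha,L),\ g_0\ge l>0,\ d_1(g_0,\mathcal G^* )>C(n/\log n)^{-\alpha/(2\alpha+d)}\}\to0 .$$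
   Context: Data: $\mathbb{D}_n=(\boldsymbol{X}_1,\dots,\boldsymbol{X}_n)$ are i.i.d. from a probability density on $[0,1]^d$; $g_0$ is the true density, and $\mathrm E_0$ is expectation under $g_0$. Write $\boldsymbol{x}\succeq\boldsymbol{y}$ iff $x_k\ge y_k$ for all $k$. $\mathcal F^*$ is the set of $f:[0,1]^d\to\mathbb R$ with $f(\boldsymbol x)\le f(\boldsymbol y)$ whenever $\boldsymbol x\succeq\boldsymbol y$; $\mathcal{G}^*$ is the set of $g\in\mathcal F^*$ with $g\ge0$ and $\int g=1$. $\mathcal H(\alpha,L)$ is the class of Hölder continuous functions on $[0,1]^d$ with Hölder smoothness index $\alpha$ and Hölder constant $L$ (for $\alpha\in(0,1]$: $|f(\boldsymbol x)-f(\boldsymbol y)|\le L\|\boldsymbol x-\boldsymbol y\|^\alpha$); in the supremum $g_0$ ranges over probability densities in this class. $d_1(f,\mathcal S)=\inf\{\|f-s\|_1:s\in\mathcal S\}$ with the $\mathbb L_1$-norm on $[0,1]^d$. Prior and posterior: $\mathbf 1$ is the all-one vector; given $J$, $\boldsymbol{J}=(J,\dots,J)$, $[\mathbf 1:\boldsymbol J]=\{\boldsymbol j\in\mathbb Z_{>0}^d:1\le j_k\le J\text{ for all }k\}$; $I_{\mathbf 1}=[0,1/J]^d$ and $I_{\boldsymbol j}=\prod_{k=1}^d((j_k-1)/J,j_k/J]$ for $\boldsymbol j\ne\mathbf 1$. Given $J$, the random density is $g=J^d\sum_{\boldsymbol j\in[\mathbf 1:\boldsymbol J]}\theta_{\boldsymbol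 j}\mathbb 1_{I_{\boldsymbol j}}$ with $(\theta_{\boldsymbol j})\sim\mathrm{Dir}(J^d;(\alpha_{\boldsymbol j}))$, and $J\sim\pi$. $\Pi(\cdot|\mathbb D_n)$ is the resulting joint posterior of $(J,g)$ given $\mathbb D_n$; the event in the definition of $\phi_n$ is an event about the pair $(J,g)$.
   Formalization: In (iii) the constant C may depend also on l, M_0 and the constants a_i, b_i, not only on α, L and d (it is still independent of π, the α_j, γ, n and g_0); with C independent of l the claim fails as l tends to 0. *)

theory Defs
  imports "HOL-Probability.Probability"
begin

definition unit_cube :: "(real ^ 'd) set" where
  "unit_cube = cbox 0 1"

(* Functions on the cube are total functions on real ^ 'd of which only the values on
   unit_cube matter.  The measure is the completed Lebesgue measure, because coordinatewise
   monotone functions are Lebesgue but in general not Borel measurable. *)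
abbreviation cube_measure :: "(real ^ 'd) measure" where
  "cube_measure \<equiv> lebesgue_on unit_cube"

definition L1_norm :: "(real ^ 'd \<Rightarrow> real) \<Rightarrow> ennreal" where
  "L1_norm f = (\<integral>\<^sup>+ x. ennreal \<bar>f x\<bar> \<partial>cube_measure)"

definition d1 :: "(real ^ 'd \<Rightarrow> real) \<Rightarrow> (real ^ 'd \<Rightarrow> real) set \<Rightarrow> ennreal" where
  "d1 f S = (INF s\<in>S. L1_norm (\<lambda>x. f x - s x))"

definition L1_closure :: "(real ^ 'd \<Rightarrow> real) set \<Rightarrow> (real ^ 'd \<Rightarrow> real) set" where
  "L1_closure S =
    {f. integrable cube_measure f \<and> (\<forall>\<epsilon>>0. \<exists>s\<in>S. L1_norm (\<lambda>x. f x - s x) < ennreal \<epsilon>)}"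

definition prob_densities :: "(real ^ 'd \<Rightarrow> real) set" where
  "prob_densities =
    {g. (\<forall>x\<in>unit_cube. 0 \<le> g x) \<and> has_bochner_integral cube_measure g 1}"

(* The order on real ^ 'd is the coordinatewise one. *)
definition F_star :: "(real ^ 'd \<Rightarrow> real) set" where
  "F_star = {f. \<forall>x\<in>unit_cube. \<forall>y\<in>unit_cube. y \<le> x \<longrightarrow> f x \<le> f y}"

definition G_star :: "(real ^ 'd \<Rightarrow> real) set" where
  "G_star = F_star \<inter> prob_densities"

(* Only meant for smoothness index 0 < \<alpha> \<le> 1. *)
definition holder_class :: "real \<Rightarrow> real \<Rightarrow> (real ^ 'd \<Rightarrow> real) set" where
  "holder_class \<alpha> L =
    {f. \<forall>x\<in>unit_cube. \<forall>y\<in>unit_cube. \<bar>f x - f y\<bar> \<le> L * norm (x - y) powr \<alpha>}"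

definition bounded_away_from_zero :: "(real ^ 'd \<Rightarrow> real) \<Rightarrow> bool" where
  "bounded_away_from_zero g \<longleftrightarrow> (\<exists>l>0. \<forall>x\<in>unit_cube. l \<le> g x)"

definition multi_indices :: "nat \<Rightarrow> (nat ^ 'd) set" where
  "multi_indices J = {j. \<forall>k. 1 \<le> j $ k \<and> j $ k \<le> J}"

definition bin :: "nat \<Rightarrow> nat ^ 'd \<Rightarrow> (real ^ 'd) set" where
  "bin J j =
    (if j = 1 then {x. \<forall>k. 0 \<le> x $ k \<and> x $ k \<le> 1 / real J}
     else {x. \<forall>k. (real (j $ k) - 1) / real J < x $ k \<and> x $ k \<le> real (j $ k) / real J})"

definition histogram :: "nat \<Rightarrow> (nat ^ 'd \<Rightarrow> real) \<Rightarrow> real ^ 'd \<Rightarrow> real" where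
  "histogram J \<theta> x =
    real J ^ CARD('d) * (\<Sum>j\<in>multi_indices J. \<theta> j * indicator (bin J j) x)"

(* Dirichlet distribution with parameters (w i) for i in the finite set I, given by its density
     Gamma (sum w) / (prod (Gamma o w)) * prod (\<lambda>i. \<theta> i powr (w i - 1))
   on the unit simplex of dimension card I - 1.  The simplex is parametrised by the coordinates
   other than r \<in> I, with \<theta> r = 1 - (sum of the others); the resulting law does not depend
   on r.  For I = {r} it is the point mass at \<theta> r = 1. *)
definition simplex_point :: "'i set \<Rightarrow> 'i \<Rightarrow> ('i \<Rightarrow> real) \<Rightarrow> ('i \<Rightarrow> real)" where
  "simplex_point I r t = t(r := 1 - (\<Sum>i\<in>I - {r}. t i))"

definition dirichlet_pdf :: "'i set \<Rightarrow> ('i \<Rightarrow> real) \<Rightarrow> ('i \<Rightarrow> real) \<Rightarrow> real" where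
  "dirichlet_pdf I w \<theta> =
    (if \<forall>i\<in>I. 0 \<le> \<theta> i
     then Gamma (\<Sum>i\<in>I. w i) / (\<Prod>i\<in>I. Gamma (w i)) * (\<Prod>i\<in>I. \<theta> i powr (w i - 1))
     else 0)"

definition dirichlet :: "'i set \<Rightarrow> 'i \<Rightarrow> ('i \<Rightarrow> real) \<Rightarrow> ('i \<Rightarrow> real) measure" where
  "dirichlet I r w =
    distr
      (density (PiM (I - {r}) (\<lambda>_. lborel)) (\<lambda>t. ennreal (dirichlet_pdf I w (simplex_point I r t))))
      (PiM I (\<lambda>_. borel))
      (simplex_point I r)"

(* Bayes' formula.  For an event B about the pair (J, g), the prior integral of the likelihood
   over B, where \<pi> is the prior of J and w J are the Dirichlet parameters given J. *)
definition marginal_likelihood ::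
  "nat pmf \<Rightarrow> (nat \<Rightarrow> nat ^ 'd \<Rightarrow> real) \<Rightarrow> nat \<Rightarrow> (nat \<Rightarrow> real ^ 'd)
    \<Rightarrow> (nat \<times> (real ^ 'd \<Rightarrow> real)) set \<Rightarrow> ennreal" where
  "marginal_likelihood \<pi> w n X B =
    (\<integral>\<^sup>+ J. (\<integral>\<^sup>+ \<theta>. indicator B (J, histogram J \<theta>)
                     * ennreal (\<Prod>i<n. histogram J \<theta> (X i))
             \<partial>dirichlet (multi_indices J) 1 (w J))
     \<partial>measure_pmf \<pi>)"

definition posterior ::
  "nat pmf \<Rightarrow> (nat \<Rightarrow> nat ^ 'd \<Rightarrow> real) \<Rightarrow> nat \<Rightarrow> (nat \<Rightarrow> real ^ 'd)
    \<Rightarrow> (nat \<times> (real ^ 'd \<Rightarrow> real)) set \<Rightarrow> real" where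
  "posterior \<pi> w n X B =
    enn2real (marginal_likelihood \<pi> w n X B / marginal_likelihood \<pi> w n X UNIV)"

definition monotonicity_test ::
  "nat pmf \<Rightarrow> (nat \<Rightarrow> nat ^ 'd \<Rightarrow> real) \<Rightarrow> real \<Rightarrow> real \<Rightarrow> nat \<Rightarrow> (nat \<Rightarrow> real ^ 'd) \<Rightarrow> real" where
  "monotonicity_test \<pi> w M0 \<gamma> n X =
    (if posterior \<pi> w n X
          {(J, g). d1 g F_star \<le> ennreal (M0 * sqrt (real J ^ CARD('d) * ln (real n) / real n))} < \<gamma>
     then 1 else 0)"

(* Expectation of a statistic T of n i.i.d. observations with density g0; the sample is indexed
   by {..<n}. *)
definition expectation_iid ::
  "(real ^ 'd \<Rightarrow> real) \<Rightarrow> nat \<Rightarrow> ((nat \<Rightarrow> real ^ 'd) \<Rightarrow> real) \<Rightarrow> real" where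
  "expectation_iid g0 n T =
    integral\<^sup>L (PiM {..<n} (\<lambda>_. density cube_measure (\<lambda>x. ennreal (g0 x)))) T"

(* In prior_on_J the type parameter fixes the dimension d = CARD('d). *)
definition prior_on_J :: "'d::finite itself \<Rightarrow> real \<Rightarrow> real \<Rightarrow> nat pmf \<Rightarrow> bool" where
  "prior_on_J _ b1 b2 \<pi> \<longleftrightarrow>
    pmf \<pi> 0 = 0 \<and>
    (\<forall>J\<ge>2. exp (- b1 * real J ^ CARD('d) * ln (real J)) \<le> pmf \<pi> J \<and>
            pmf \<pi> J \<le> exp (- b2 * real J ^ CARD('d) * ln (real J)))"

(* w n J j is the Dirichlet parameter of bin j at resolution J; it may vary with the sample
   size n. *)
definition dirichlet_weights ::
  "real \<Rightarrow> real \<Rightarrow> real \<Rightarrow> (nat \<Rightarrow> nat \<Rightarrow> nat ^ 'd \<Rightarrow> real) \<Rightarrow> bool" where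
  "dirichlet_weights a1 a2 a3 w \<longleftrightarrow>
    (\<forall>n\<ge>1. \<forall>J\<ge>1. \<forall>j\<in>multi_indices J. a2 * real n powr (- a3) \<le> w n J j \<and> w n J j \<le> a1)"

end

theory Submission
  imports Defs "HOL-Real_Asymp.Real_Asymp"
begin

text \<open>The posterior is a mixture over the resolutions J, so it is governed by the evidence of each
  resolution: the likelihood of a histogram with J^d bins, integrated over its Dirichlet
  prior. Two facts about the evidence carry the proof. It is never small: for every sample it
  is at least n powr (- C * J^d) times the likelihood of any fixed histogram with the same
  bins (evidence_rate_exists), because Dirichlet moments are explicit and the multinomial
  theorem bounds the maximal likelihood by the reciprocal of a multinomial coefficient. And it
  is never large on average: by Tonelli, the evidence divided by the likelihood of the true
  density, or of its bin averages, has expectation 1 (evidence_ratio_true,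
  evidence_ratio_projection).

  Concentration within one resolution (posterior_concentration). Let p be the vector of true
  bin probabilities. If the weights \<theta> differ from p by more than t in the sum norm,
  some set A of bins has \<theta>-probability exceeding its p-probability by t / 2. The
  frequency of A in the sample cannot be close to both, and Chernoff bounds on either side,
  summed over the 2 ^ (J^d) sets A, show that the posterior mass of such \<theta> is of the
  order 2 ^ (J^d) * n powr (C * J^d) * exp (- n * t^2 / 64). This is negligible as soon as t^2
  is a large multiple of J^d * ln n / n, which fixes the constant of the test. The likelihood
  of a histogram only sees bin counts, so p, and not the approximation error of the
  histograms, matters here; hence the bound holds at all resolutions simultaneously and for
  every true density that is bounded away from zero.

  Under the hypothesis, the bin averages of a decreasing density form a decreasing histogram
  (bin_prob_antimono). So at every resolution the distance of the random histogram to the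
  decreasing functions is at most its distance to p, and rejection is improbable
  (rejection_bound).

  Under an alternative, acceptance together with concentration forces the true density to be
  close to the decreasing functions, up to the L1 error of its own bin averages and twice the
  threshold of the test (d1_F_star_near). This is impossible unless J is a bad resolution: so
  fine that the threshold is large, or so coarse that the bin averages are far from the true
  density. It remains to see that bad resolutions have little posterior weight (weight_boundI,
  acceptance_bound). The total evidence is bounded below by \<kappa> times the likelihood of a
  density q, where \<kappa> is the price of one well-chosen resolution J'. Fine resolutions
  lose against this because of the prior on J; for misspecified ones the likelihood ratio is
  exponentially small, by the Hellinger affinity.

  For Hoelder densities the chi-square distance between the true density and its bin averages
  at resolution J' is small, which allows q to be the true density itself
  (smooth_alternative_power). For a fixed alternative the entropy of the true density may be
  infinite, and its likelihood cannot be compared with that of a histogram. There q comes from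
  resolution J'. Against misspecified resolutions it is the histogram of bin averages
  (misspecified_affinity). Against fine ones this histogram is mixed with a small proportion
  of its averages over adjacent bins; then the ratio of a finer histogram of bin averages to q
  is bounded (projection_le_smoothed), and its expectation stays close to 1
  (smoothed_ratio_integral, fixed_alternative_power).

  The test measures distances to all decreasing functions, while the alternatives are defined
  by distances to decreasing densities; for a density these distances differ by a factor of at
  most 2 (d1_F_star_ge).\<close>

section \<open>Moments of the Dirichlet distribution\<close>

text \<open>The substitution y = R * t turns the left-hand side into a Beta integral. The case R = 0,
  where the integrand lives on one point, is included because the length left over by the
  other coordinates of a simplex can vanish.\<close>

lemma nn_integral_scaled_Beta:
  fixes a b R :: real
  assumes "0 < a" "0 < b"
  shows "(\<integral>\<^sup>+ y. ennreal (if 0 \<le> y \<and> y \<le> R then y powr (a - 1) * (R - y) powr (b - 1) else 0) \<partial>lborel)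
    = ennreal (if 0 \<le> R then R powr (a + b - 1) * Beta a b else 0)"
proof (cases "0 < R")
  case True
  let ?f = "\<lambda>y. if 0 \<le> y \<and> y \<le> R then y powr (a - 1) * (R - y) powr (b - 1) else 0"
  let ?g = "\<lambda>t::real. t powr (a - 1) * (1 - t) powr (b - 1)"
  have "((\<lambda>t. if t \<in> {0..1} then ?g t else 0) has_integral Beta a b) UNIV"
    using has_integral_Beta_real[OF assms] by (subst has_integral_restrict_UNIV)
  then have base: "(\<integral>\<^sup>+ t. ennreal (if t \<in> {0..1} then ?g t else 0) \<partial>lborel) = ennreal (Beta a b)"
    by (intro nn_integral_has_integral_lborel) auto
  have scale: "?f (0 + R * t) = R powr (a + b - 2) * (if t \<in> {0..1} then ?g t else 0)" for t
  proof (cases "t \<in> {0..1}")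
    case t: True
    have "R - R * t = R * (1 - t)" by (simp add: algebra_simps)
    moreover have "R powr (a - 1) * R powr (b - 1) = R powr (a + b - 2)"
      by (simp flip: powr_add add: algebra_simps)
    moreover have "(R - R * t) powr (b - 1) = R powr (b - 1) * (1 - t) powr (b - 1)"
      using t True by (subst \<open>R - R * t = _\<close>) (auto simp: powr_mult)
    moreover have "(R * t) powr (a - 1) = R powr (a - 1) * t powr (a - 1)"
      using t True by (auto simp: powr_mult)
    ultimately show ?thesis
      using t True by (auto simp: mult_le_cancel_left1)
  next
    case False
    then have "\<not> (0 \<le> R * t \<and> R * t \<le> R)"
      using True by (auto simp: zero_le_mult_iff)
    then show ?thesis using False by auto
  qed
  have "(\<integral>\<^sup>+ y. ennreal (?f y) \<partial>lborel) = ennreal \<bar>R\<bar> * (\<integral>\<^sup>+ t. ennreal (?f (0 + R * t)) \<partial>lborel)"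
    using True by (intro nn_integral_real_affine) auto
  also have "\<dots> = ennreal R * (\<integral>\<^sup>+ t. ennreal (R powr (a + b - 2)) * ennreal (if t \<in> {0..1} then ?g t else 0) \<partial>lborel)"
    using True unfolding scale by (simp add: ennreal_mult')
  also have "\<dots> = ennreal R * (ennreal (R powr (a + b - 2)) * ennreal (Beta a b))"
    by (subst nn_integral_cmult, measurable) (simp only: base)
  also have "\<dots> = ennreal (R powr (a + b - 1) * Beta a b)"
  proof -
    have "R * R powr (a + b - 2) = R powr (a + b - 1)"
      using True powr_add[of R 1 "a + b - 2"] by (simp add: algebra_simps)
    then show ?thesis
      using True by (simp add: ennreal_mult' [symmetric] mult.assoc [symmetric])
  qed
  finally show ?thesis using True by simp
next
  case False
  \<comment> \<open>For R = 0 the integrand can be non-zero only at y = 0.\<close>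
  have "AE y in lborel. (if 0 \<le> y \<and> y \<le> R then y powr (a - 1) * (R - y) powr (b - 1) else 0) = 0"
    using AE_lborel_singleton[of "0::real"] by eventually_elim (use False in auto)
  then have "(\<integral>\<^sup>+ y. ennreal (if 0 \<le> y \<and> y \<le> R then y powr (a - 1) * (R - y) powr (b - 1) else 0) \<partial>lborel) = 0"
    by (subst nn_integral_0_iff_AE) auto
  moreover have "0 \<le> R \<Longrightarrow> R = 0" using False by simp
  ultimately show ?thesis by auto
qed

text \<open>Integrating out one coordinate produces a Beta factor and the kernel in the remaining
  coordinates, with the exponent b of the leftover length increased by the parameter of that
  coordinate; the Beta factors telescope to a quotient of Gamma values.\<close>

lemma nn_integral_Dirichlet_kernel:
  fixes w :: "'i \<Rightarrow> real"
  assumes "finite K" "\<And>i. i \<in> K \<Longrightarrow> 0 < w i" "0 < b"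
  shows "(\<integral>\<^sup>+ t. ennreal (if (\<forall>i\<in>K. 0 \<le> t i) \<and> (\<Sum>i\<in>K. t i) \<le> 1
            then (\<Prod>i\<in>K. t i powr (w i - 1)) * (1 - (\<Sum>i\<in>K. t i)) powr (b - 1) else 0)
          \<partial>PiM K (\<lambda>_. lborel))
    = ennreal ((\<Prod>i\<in>K. Gamma (w i)) * Gamma b / Gamma ((\<Sum>i\<in>K. w i) + b))"
  using assms
proof (induction K arbitrary: b)
  case empty
  interpret product_sigma_finite "\<lambda>_. lborel :: real measure" by standard
  have "Gamma b > 0" using empty by simp
  then show ?case by (simp add: PiM_empty nn_integral_count_space_finite)
next
  case (insert s K b)
  interpret product_sigma_finite "\<lambda>_. lborel :: real measure" by standard
  let ?k = "\<lambda>K w b t. if (\<forall>i\<in>K. 0 \<le> t i) \<and> (\<Sum>i\<in>K. t i) \<le> 1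
            then (\<Prod>i\<in>K. t i powr (w i - 1)) * (1 - (\<Sum>i\<in>K. t i)) powr (b - 1) else (0::real)"
  have ws: "0 < w s" using insert by auto
  note fin = insert.hyps
  have finK [measurable]: "finite K" "finite (insert s K)" using fin by auto
  have [measurable]: "(\<lambda>t. ennreal (?k (insert s K) w b t)) \<in> borel_measurable (PiM (insert s K) (\<lambda>_. lborel))"
    by measurable
  have "(\<integral>\<^sup>+ t. ennreal (?k (insert s K) w b t) \<partial>PiM (insert s K) (\<lambda>_. lborel)) =
     (\<integral>\<^sup>+ t. (\<integral>\<^sup>+ y. ennreal (?k (insert s K) w b (t(s := y))) \<partial>lborel) \<partial>PiM K (\<lambda>_. lborel))"
    using fin by (intro product_nn_integral_insert) auto
  also have "\<dots> = (\<integral>\<^sup>+ t. ennreal (Beta (w s) b) * ennreal (?k K w (w s + b) t) \<partial>PiM K (\<lambda>_. lborel))"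
  proof (intro nn_integral_cong)
    fix t :: "'i \<Rightarrow> real"
    define R where "R = 1 - (\<Sum>i\<in>K. t i)"
    define Q where "Q = (\<Prod>i\<in>K. t i powr (w i - 1))"
    have Q: "0 \<le> Q" unfolding Q_def by (intro prod_nonneg) auto
    have sums: "(\<Sum>i\<in>K. (t(s := y)) i) = (\<Sum>i\<in>K. t i)" "(\<Prod>i\<in>K. (t(s := y)) i powr (w i - 1)) = Q"
       "(\<forall>i\<in>K. 0 \<le> (t(s := y)) i) = (\<forall>i\<in>K. 0 \<le> t i)" for y
      using fin by (auto simp: Q_def intro!: sum.cong prod.cong)
    have k: "?k (insert s K) w b (t(s := y)) =
       (if \<forall>i\<in>K. 0 \<le> t i then Q else 0) * (if 0 \<le> y \<and> y \<le> R then y powr (w s - 1) * (R - y) powr (b - 1) else 0)" for y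
      using fin by (auto simp: sums R_def algebra_simps simp del: fun_upd_apply) (auto simp: algebra_simps)
    have "(\<integral>\<^sup>+ y. ennreal (?k (insert s K) w b (t(s := y))) \<partial>lborel)
       = (\<integral>\<^sup>+ y. ennreal (if \<forall>i\<in>K. 0 \<le> t i then Q else 0) *
            ennreal (if 0 \<le> y \<and> y \<le> R then y powr (w s - 1) * (R - y) powr (b - 1) else 0) \<partial>lborel)"
      unfolding k using Q by (intro nn_integral_cong ennreal_mult) auto
    also have "\<dots> = ennreal (if \<forall>i\<in>K. 0 \<le> t i then Q else 0) *
        ennreal (if 0 \<le> R then R powr (w s + b - 1) * Beta (w s) b else 0)"
      by (subst nn_integral_cmult) (auto simp: nn_integral_scaled_Beta[OF ws insert.prems(2)])
    also have "\<dots> = ennreal (Beta (w s) b) * ennreal (?k K w (w s + b) t)"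
      using Q by (auto simp: R_def Q_def ennreal_mult'[symmetric] ennreal_mult''[symmetric] algebra_simps)
    finally show "(\<integral>\<^sup>+ y. ennreal (?k (insert s K) w b (t(s := y))) \<partial>lborel)
        = ennreal (Beta (w s) b) * ennreal (?k K w (w s + b) t)" .
  qed
  also have "\<dots> = ennreal (Beta (w s) b) * (\<integral>\<^sup>+ t. ennreal (?k K w (w s + b) t) \<partial>PiM K (\<lambda>_. lborel))"
    using fin by (subst nn_integral_cmult) auto
  also have "\<dots> = ennreal (Beta (w s) b) * ennreal ((\<Prod>i\<in>K. Gamma (w i)) * Gamma (w s + b) / Gamma ((\<Sum>i\<in>K. w i) + (w s + b)))"
    using insert.prems ws by (subst insert.IH) (auto intro: add_pos_pos)
  also have "\<dots> = ennreal ((\<Prod>i\<in>insert s K. Gamma (w i)) * Gamma b / Gamma ((\<Sum>i\<in>insert s K. w i) + b))"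
  proof -
    have G: "Gamma (w s + b) > 0" "Gamma (w s) > 0" "Gamma b > 0"
      using ws insert.prems by (auto intro!: Gamma_real_pos add_pos_pos)
    have B: "Beta (w s) b \<ge> 0" using G by (simp add: Beta_def)
    have "Beta (w s) b * (Q * Gamma (w s + b) / H) = Gamma (w s) * Q * Gamma b / H" for Q H :: real
      using G by (simp add: Beta_def)
    moreover have "(\<Sum>i\<in>K. w i) + (w s + b) = (\<Sum>i\<in>insert s K. w i) + b" using fin by simp
    moreover have "(\<Prod>i\<in>insert s K. Gamma (w i)) = Gamma (w s) * (\<Prod>i\<in>K. Gamma (w i))" using fin by simp
    ultimately show ?thesis by (simp only: ennreal_mult'[OF B, symmetric])
  qed
  finally show ?case .
qed

lemma simplex_point_measurable [measurable]:
  assumes "finite I" "r \<in> I"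
  shows "simplex_point I r \<in> measurable (PiM (I - {r}) (\<lambda>_. lborel)) (PiM I (\<lambda>_. borel :: real measure))"
proof -
  have eq: "I = (I - {r}) \<union> {r}" using assms by auto
  have "(\<lambda>t. t(r := 1 - (\<Sum>i\<in>I - {r}. t i))) \<in> measurable (PiM (I - {r}) (\<lambda>_. lborel)) (PiM I (\<lambda>_. borel :: real measure))"
  proof (rule measurable_fun_upd[OF eq])
    have "PiM (I - {r}) (\<lambda>_. lborel :: real measure) \<rightarrow>\<^sub>M PiM (I - {r}) (\<lambda>_. borel :: real measure)
      = PiM (I - {r}) (\<lambda>_. lborel :: real measure) \<rightarrow>\<^sub>M PiM (I - {r}) (\<lambda>_. lborel :: real measure)"
      by (intro measurable_cong_sets sets_PiM_cong) auto
    then show "(\<lambda>x. x) \<in> PiM (I - {r}) (\<lambda>_. lborel :: real measure) \<rightarrow>\<^sub>M PiM (I - {r}) (\<lambda>_. borel :: real measure)"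
      by auto
    show "(\<lambda>t. 1 - (\<Sum>i\<in>I - {r}. t i)) \<in> borel_measurable (PiM (I - {r}) (\<lambda>_. lborel))"
      by measurable
  qed
  then show ?thesis unfolding simplex_point_def[abs_def] by simp
qed

lemma sets_dirichlet [measurable_cong, simp]: "sets (dirichlet I r w) = sets (PiM I (\<lambda>_. borel))"
  by (simp add: dirichlet_def)

lemma space_dirichlet [simp]: "space (dirichlet I r w) = space (PiM I (\<lambda>_. borel))"
  by (simp add: dirichlet_def)

lemma dirichlet_pdf_measurable [measurable]:
  "finite I \<Longrightarrow> dirichlet_pdf I w \<in> borel_measurable (PiM I (\<lambda>_. borel))"
  unfolding dirichlet_pdf_def[abs_def] by measurable

lemma nn_integral_dirichlet:
  assumes "finite I" "r \<in> I" and [measurable]: "h \<in> borel_measurable (PiM I (\<lambda>_. borel))"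
  shows "(\<integral>\<^sup>+ \<theta>. h \<theta> \<partial>dirichlet I r w) =
    (\<integral>\<^sup>+ t. ennreal (dirichlet_pdf I w (simplex_point I r t)) * h (simplex_point I r t)
       \<partial>PiM (I - {r}) (\<lambda>_. lborel))"
proof -
  note [measurable] = simplex_point_measurable[OF assms(1,2)] dirichlet_pdf_measurable[OF assms(1)]
  show ?thesis unfolding dirichlet_def
    by (subst nn_integral_distr) (auto simp: nn_integral_density)
qed

lemma simplex_point_sum:
  assumes "finite I" "r \<in> I" shows "(\<Sum>i\<in>I. simplex_point I r t i) = 1"
  unfolding sum.remove[OF assms] by (auto simp: simplex_point_def intro!: sum.cong)

lemma nn_integral_dirichlet_pdf:
  assumes "finite I" "r \<in> I" "\<And>i. i \<in> I \<Longrightarrow> 0 < w i"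
  shows "(\<integral>\<^sup>+ t. ennreal (dirichlet_pdf I w (simplex_point I r t)) \<partial>PiM (I - {r}) (\<lambda>_. lborel)) = 1"
proof -
  let ?K = "I - {r}"
  define C where "C = Gamma (\<Sum>i\<in>I. w i) / (\<Prod>i\<in>I. Gamma (w i))"
  have ne: "I \<noteq> {}" using assms by auto
  have "(\<Sum>i\<in>I. w i) > 0" using assms ne by (intro sum_pos) auto
  then have G: "Gamma (\<Sum>i\<in>I. w i) > 0" "(\<Prod>i\<in>I. Gamma (w i)) > 0"
    using assms by (auto intro!: prod_pos)
  have C: "0 \<le> C" using G by (simp add: C_def)
  let ?k = "\<lambda>t. if (\<forall>i\<in>?K. 0 \<le> t i) \<and> (\<Sum>i\<in>?K. t i) \<le> 1
            then (\<Prod>i\<in>?K. t i powr (w i - 1)) * (1 - (\<Sum>i\<in>?K. t i)) powr (w r - 1) else (0::real)"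
  have pdf: "dirichlet_pdf I w (simplex_point I r t) = C * ?k t" for t
  proof -
    have "(\<forall>i\<in>I. 0 \<le> simplex_point I r t i) \<longleftrightarrow> (\<forall>i\<in>?K. 0 \<le> t i) \<and> (\<Sum>i\<in>?K. t i) \<le> 1"
      using assms by (auto simp: simplex_point_def)
    moreover have "(\<Prod>i\<in>I. simplex_point I r t i powr (w i - 1)) =
       (\<Prod>i\<in>?K. t i powr (w i - 1)) * (1 - (\<Sum>i\<in>?K. t i)) powr (w r - 1)"
      unfolding prod.remove[OF assms(1,2)] by (auto simp: simplex_point_def mult.commute intro!: prod.cong)
    ultimately show ?thesis by (simp add: dirichlet_pdf_def C_def)
  qed
  have "(\<integral>\<^sup>+ t. ennreal (dirichlet_pdf I w (simplex_point I r t)) \<partial>PiM ?K (\<lambda>_. lborel)) =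
     ennreal C * (\<integral>\<^sup>+ t. ennreal (?k t) \<partial>PiM ?K (\<lambda>_. lborel))"
    unfolding pdf ennreal_mult'[OF C] using assms(1) by (subst nn_integral_cmult) auto
  also have "\<dots> = ennreal C * ennreal ((\<Prod>i\<in>?K. Gamma (w i)) * Gamma (w r) / Gamma ((\<Sum>i\<in>?K. w i) + w r))"
    using assms by (subst nn_integral_Dirichlet_kernel) auto
  also have "(\<Prod>i\<in>?K. Gamma (w i)) * Gamma (w r) / Gamma ((\<Sum>i\<in>?K. w i) + w r) = 1 / C"
    unfolding C_def using assms by (simp add: prod.remove[OF assms(1,2)] sum.remove[OF assms(1,2)] add.commute mult.commute)
  finally show ?thesis using G C by (simp add: ennreal_mult'[symmetric] C_def)
qed

lemma prob_space_dirichlet: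
  assumes "finite I" "r \<in> I" "\<And>i. i \<in> I \<Longrightarrow> 0 < w i"
  shows "prob_space (dirichlet I r w)"
proof
  have "emeasure (dirichlet I r w) (space (dirichlet I r w)) = (\<integral>\<^sup>+ \<theta>. 1 \<partial>dirichlet I r w)"
    by simp
  also have "\<dots> = 1"
    using assms by (subst nn_integral_dirichlet) (auto simp: nn_integral_dirichlet_pdf)
  finally show "emeasure (dirichlet I r w) (space (dirichlet I r w)) = 1" .
qed

lemma AE_dirichlet_simplex:
  assumes "finite I" "r \<in> I"
  shows "AE \<theta> in dirichlet I r w. (\<forall>i\<in>I. 0 \<le> \<theta> i) \<and> (\<Sum>i\<in>I. \<theta> i) = 1"
proof -
  note [measurable] = simplex_point_measurable[OF assms(1,2)] dirichlet_pdf_measurable[OF assms(1)]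
  show ?thesis unfolding dirichlet_def
    using assms
    by (subst AE_distr_iff) (auto simp: AE_density simplex_point_sum dirichlet_pdf_def)
qed

text \<open>A Dirichlet density times a monomial is, up to the quotient of the normalising constants,
  the Dirichlet density with the exponents added to the parameters.\<close>

lemma nn_integral_dirichlet_monomial:
  assumes "finite I" "r \<in> I" "\<And>i. i \<in> I \<Longrightarrow> 0 < w i"
  shows "(\<integral>\<^sup>+ \<theta>. ennreal (\<Prod>i\<in>I. \<theta> i ^ N i) \<partial>dirichlet I r w) =
    ennreal ((\<Prod>i\<in>I. pochhammer (w i) (N i)) / pochhammer (\<Sum>i\<in>I. w i) (\<Sum>i\<in>I. N i))"
proof -
  let ?v = "\<lambda>i. w i + real (N i)"
  define C where "C = (\<Prod>i\<in>I. pochhammer (w i) (N i)) / pochhammer (\<Sum>i\<in>I. w i) (\<Sum>i\<in>I. N i)"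
  have ne: "I \<noteq> {}" using assms by auto
  have pos: "(\<Sum>i\<in>I. w i) > 0" using assms ne by (intro sum_pos) auto
  have C: "0 \<le> C" unfolding C_def using assms pos
    by (intro divide_nonneg_nonneg prod_nonneg ballI) (auto intro: less_imp_le pochhammer_pos)
  have v: "0 < ?v i" if "i \<in> I" for i using assms(3)[OF that] by linarith
  have poch: "pochhammer (w i) (N i) = Gamma (?v i) / Gamma (w i)" if "i \<in> I" for i
    using assms(3)[OF that] by (intro pochhammer_Gamma) (auto simp: nonpos_Ints_def)
  have poch': "pochhammer (\<Sum>i\<in>I. w i) (\<Sum>i\<in>I. N i) = Gamma (\<Sum>i\<in>I. ?v i) / Gamma (\<Sum>i\<in>I. w i)"
    using pos by (subst pochhammer_Gamma) (auto simp: nonpos_Ints_def sum.distrib)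
  have G: "Gamma (\<Sum>i\<in>I. w i) > 0" "(\<Prod>i\<in>I. Gamma (w i)) > 0" "(\<Prod>i\<in>I. Gamma (?v i)) > 0" "Gamma (\<Sum>i\<in>I. ?v i) > 0"
    using assms pos v ne by (auto intro!: prod_pos sum_pos Gamma_real_pos)
  have key: "ennreal (dirichlet_pdf I w \<theta>) * ennreal (\<Prod>i\<in>I. \<theta> i ^ N i) = ennreal C * ennreal (dirichlet_pdf I ?v \<theta>)" for \<theta>
  proof (cases "\<forall>i\<in>I. 0 \<le> \<theta> i")
    case True
    have p: "\<theta> i powr (w i - 1) * \<theta> i ^ N i = \<theta> i powr (?v i - 1)" if "i \<in> I" for i
    proof (cases "\<theta> i = 0")
      case True then show ?thesis by (cases "N i") auto
    next
      case False
      then have "\<theta> i > 0" using \<open>\<forall>i\<in>I. 0 \<le> \<theta> i\<close> that by force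
      then have "\<theta> i ^ N i = \<theta> i powr real (N i)" by (simp add: powr_realpow)
      then show ?thesis by (simp flip: powr_add add: algebra_simps)
    qed
    have C_eq: "C = (\<Prod>i\<in>I. Gamma (?v i)) / (\<Prod>i\<in>I. Gamma (w i)) / (Gamma (\<Sum>i\<in>I. ?v i) / Gamma (\<Sum>i\<in>I. w i))"
      unfolding C_def poch' by (simp add: poch prod_dividef)
    have powers: "(\<Prod>i\<in>I. \<theta> i powr (w i - 1)) * (\<Prod>i\<in>I. \<theta> i ^ N i) = (\<Prod>i\<in>I. \<theta> i powr (?v i - 1))"
      by (simp add: p flip: prod.distrib)
    have "dirichlet_pdf I w \<theta> * (\<Prod>i\<in>I. \<theta> i ^ N i)
        = Gamma (\<Sum>i\<in>I. w i) / (\<Prod>i\<in>I. Gamma (w i)) * (\<Prod>i\<in>I. \<theta> i powr (?v i - 1))"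
      using True unfolding powers[symmetric] by (simp add: dirichlet_pdf_def)
    also have "\<dots> = C * dirichlet_pdf I ?v \<theta>"
    proof -
      have "a / b * P = c / b / (d / a) * (d / c * P)" if "0 < a" "0 < b" "0 < c" "0 < d" for a b c d P :: real
        using that by simp
      from this[OF G(1,2,3,4)] show ?thesis
        unfolding C_eq dirichlet_pdf_def using True by simp
    qed
    finally have "dirichlet_pdf I w \<theta> * (\<Prod>i\<in>I. \<theta> i ^ N i) = C * dirichlet_pdf I ?v \<theta>" .
    moreover have "0 \<le> (\<Prod>i\<in>I. \<theta> i ^ N i)" "0 \<le> C" using True C by (auto intro!: prod_nonneg)
    ultimately show ?thesis by (simp flip: ennreal_mult' ennreal_mult'')
  next
    case False
    then have "dirichlet_pdf I w' \<theta> = 0" for w' by (simp only: dirichlet_pdf_def if_False)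
    then show ?thesis by simp
  qed
  have "(\<integral>\<^sup>+ \<theta>. ennreal (\<Prod>i\<in>I. \<theta> i ^ N i) \<partial>dirichlet I r w) =
    (\<integral>\<^sup>+ t. ennreal C * ennreal (dirichlet_pdf I ?v (simplex_point I r t)) \<partial>PiM (I - {r}) (\<lambda>_. lborel))"
    using assms by (subst nn_integral_dirichlet) (auto simp: key)
  also have "\<dots> = ennreal C"
  proof -
    note [measurable] = simplex_point_measurable[OF assms(1,2)] dirichlet_pdf_measurable[OF assms(1)]
    show ?thesis using assms v
      by (subst nn_integral_cmult) (auto simp: nn_integral_dirichlet_pdf)
  qed
  finally show ?thesis by (simp add: C_def)
qed

text \<open>The left-hand side is, up to the factorials, one term of the multinomial expansion of the
  right-hand side; adding one index at a time reduces this to the binomial theorem.\<close>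

lemma multinomial_term_le:
  fixes p :: "'i \<Rightarrow> real"
  assumes "finite I" "\<And>i. i \<in> I \<Longrightarrow> 0 \<le> p i"
  shows "(\<Prod>i\<in>I. p i ^ N i) * fact (\<Sum>i\<in>I. N i) \<le> (\<Sum>i\<in>I. p i) ^ (\<Sum>i\<in>I. N i) * (\<Prod>i\<in>I. fact (N i))"
  using assms
proof (induction I)
  case (insert s I)
  let ?n = "\<Sum>i\<in>I. N i" and ?S = "\<Sum>i\<in>I. p i" and ?m = "N s + (\<Sum>i\<in>I. N i)"
  have S: "0 \<le> ?S" "0 \<le> p s" using insert by (auto intro!: sum_nonneg)
  have "(?m choose N s) * p s ^ N s * ?S ^ (?m - N s) \<le> (\<Sum>k\<le>?m. (?m choose k) * p s ^ k * ?S ^ (?m - k))"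
    using S by (intro member_le_sum) auto
  then have b: "(?m choose N s) * p s ^ N s * ?S ^ ?n \<le> (p s + ?S) ^ ?m"
    unfolding binomial_ring by simp
  have f: "fact (N s) * fact ?n * real (?m choose N s) = fact ?m"
  proof -
    have "fact (N s) * fact ?n * (?m choose N s) = (fact ?m :: nat)"
      using binomial_fact_lemma[of "N s" ?m] by simp
    then have "real (fact (N s) * fact ?n * (?m choose N s)) = real (fact ?m)" by (rule arg_cong)
    then show ?thesis by (simp only: of_nat_mult of_nat_fact)
  qed
  have "p s ^ N s * (\<Prod>i\<in>I. p i ^ N i) * fact ?m
      = p s ^ N s * real (?m choose N s) * fact (N s) * ((\<Prod>i\<in>I. p i ^ N i) * fact ?n)"
    unfolding f[symmetric] by (simp only: mult_ac)
  also have "\<dots> \<le> p s ^ N s * real (?m choose N s) * fact (N s) * (?S ^ ?n * (\<Prod>i\<in>I. fact (N i)))"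
    using insert S by (intro mult_left_mono insert.IH) auto
  also have "\<dots> = ((?m choose N s) * p s ^ N s * ?S ^ ?n) * (fact (N s) * (\<Prod>i\<in>I. fact (N i)))"
    by simp
  also have "\<dots> \<le> (p s + ?S) ^ ?m * (fact (N s) * (\<Prod>i\<in>I. fact (N i)))"
    by (intro mult_right_mono b mult_nonneg_nonneg prod_nonneg) auto
  finally show ?case using insert by simp
qed simp

lemma pochhammer_ge:
  fixes w :: real
  assumes "0 < c" "c \<le> 1" "c \<le> w" "N \<le> n" "1 \<le> n"
  shows "c / real n * fact N \<le> pochhammer w N"
proof (cases N)
  case 0
  have "c / real n \<le> 1" using assms by (simp add: divide_le_eq)
  then show ?thesis using 0 by simp
next
  case (Suc m)
  have "(\<Prod>i<m. real i + 1) \<le> (\<Prod>i<m. w + real i + 1)"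
    using assms by (intro prod_mono) auto
  moreover have "(\<Prod>i<m. real i + 1) = fact m"
    by (induction m) (auto simp: algebra_simps)
  moreover have "pochhammer w N = w * (\<Prod>i<m. w + real i + 1)"
    unfolding Suc pochhammer_rec by (simp add: pochhammer_prod lessThan_atLeast0 algebra_simps)
  ultimately have 1: "w * fact m \<le> pochhammer w N" using assms by (simp add: mult_left_mono)
  have "fact N = real N * fact m" by (simp add: Suc)
  then have "c / real n * fact N = c * fact m * (real N / real n)" by simp
  also have "\<dots> \<le> c * fact m * 1" using assms by (intro mult_left_mono) (auto simp: divide_le_eq)
  also have "\<dots> \<le> w * fact m" using assms by (simp add: mult_right_mono)
  finally show ?thesis using 1 by simp
qed

lemma pochhammer_le:
  fixes W :: real
  assumes "0 < W" "W \<le> real k" "1 \<le> k"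
  shows "pochhammer W n \<le> fact n * (real n + 1) ^ k"
proof -
  have "pochhammer W n \<le> pochhammer (real k) n"
    unfolding pochhammer_prod using assms by (intro prod_mono) auto
  also have "\<dots> \<le> fact n * (real n + 1) ^ k"
  proof (induction n)
    case 0 then show ?case by simp
  next
    case (Suc n)
    have "1 + real k * (1 / (real n + 1)) \<le> (1 + 1 / (real n + 1)) ^ k"
      by (intro Bernoulli_inequality) (auto intro: order_trans[of _ 0])
    moreover have "1 + 1 / (real n + 1) = (real n + 2) / (real n + 1)" by (simp add: field_simps)
    moreover have "1 + real k * (1 / (real n + 1)) = (real n + 1 + real k) / (real n + 1)" by (simp add: field_simps)
    ultimately have "(real n + 1 + real k) / (real n + 1) \<le> (real n + 2) ^ k / (real n + 1) ^ k"
      by (simp only: power_divide)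
    have b: "(real n + 1 + real k) * (real n + 1) ^ k \<le> (real n + 1) * (real n + 2) ^ k"
    proof -
      note a = \<open>(real n + 1 + real k) / (real n + 1) \<le> (real n + 2) ^ k / (real n + 1) ^ k\<close>
      have "0 < (real n + 1) ^ k" "0 < real n + 1" by simp_all
      from mult_right_mono[OF a, of "(real n + 1) * (real n + 1) ^ k"] this
      show ?thesis by (simp add: mult_ac)
    qed
    have "pochhammer (real k) (Suc n) = pochhammer (real k) n * (real k + real n)"
      by (simp add: pochhammer_Suc)
    also have "\<dots> \<le> fact n * (real n + 1) ^ k * (real k + real n)"
      using Suc by (intro mult_right_mono) auto
    also have "\<dots> \<le> fact n * ((real n + 1 + real k) * (real n + 1) ^ k)"
    proof -
      have "(real n + 1) ^ k * (real k + real n) \<le> (real n + 1 + real k) * (real n + 1) ^ k"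
        by (subst mult.commute) (intro mult_right_mono, auto)
      then show ?thesis unfolding mult.assoc by (intro mult_left_mono) auto
    qed
    also have "\<dots> \<le> fact n * ((real n + 1) * (real n + 2) ^ k)"
      by (intro mult_left_mono b) auto
    also have "\<dots> = fact (Suc n) * (real (Suc n) + 1) ^ k"
    proof -
      have "real (Suc n) + 1 = real n + 2" "fact (Suc n) = (real n + 1) * fact n" by simp_all
      then show ?thesis by (simp only: mult_ac)
    qed
    finally show ?case .
  qed
  finally show ?thesis .
qed

text \<open>Up to factors polynomial in n for each index, the Dirichlet moment is the product of the
  factorials of the N i divided by the factorial of n. This is the reciprocal of the
  multinomial coefficient, hence at least the value of the monomial at any sub-probability
  vector p.\<close>

lemma dirichlet_monomial_ge:
  fixes w p :: "'i \<Rightarrow> real"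
  assumes I: "finite I" "r \<in> I" and n: "1 \<le> n" "n = (\<Sum>i\<in>I. N i)"
    and w: "\<And>i. i \<in> I \<Longrightarrow> c \<le> w i" "\<And>i. i \<in> I \<Longrightarrow> w i \<le> real A" and c: "0 < c" "c \<le> 1" and A: "1 \<le> A"
    and p: "\<And>i. i \<in> I \<Longrightarrow> 0 \<le> p i" "(\<Sum>i\<in>I. p i) \<le> 1"
  shows "ennreal ((c / real n / (real n + 1) ^ A) ^ card I * (\<Prod>i\<in>I. p i ^ N i))
    \<le> (\<integral>\<^sup>+ \<theta>. ennreal (\<Prod>i\<in>I. \<theta> i ^ N i) \<partial>dirichlet I r w)"
proof -
  have wpos: "0 < w i" if "i \<in> I" for i using w(1)[OF that] c by linarith
  have ne: "I \<noteq> {}" "card I \<ge> 1" using I by (auto simp: Suc_le_eq card_gt_0_iff)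
  have W: "0 < (\<Sum>i\<in>I. w i)" using wpos ne I by (intro sum_pos) auto
  have "(\<Sum>i\<in>I. w i) \<le> (\<Sum>i\<in>I. real A)" by (intro sum_mono w)
  then have W2: "(\<Sum>i\<in>I. w i) \<le> real (A * card I)" by (simp add: mult.commute)
  have low: "(c / real n) ^ card I * (\<Prod>i\<in>I. fact (N i)) \<le> (\<Prod>i\<in>I. pochhammer (w i) (N i))"
  proof -
    have "(\<Prod>i\<in>I. c / real n * fact (N i)) \<le> (\<Prod>i\<in>I. pochhammer (w i) (N i))"
    proof (intro prod_mono conjI)
      fix i assume i: "i \<in> I"
      have "N i \<le> n" unfolding n using I i by (intro member_le_sum) auto
      then show "c / real n * fact (N i) \<le> pochhammer (w i) (N i)"
        using w(1)[OF i] c n by (intro pochhammer_ge) auto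
      show "0 \<le> c / real n * fact (N i)" using c by auto
    qed
    then show ?thesis by (simp only: prod.distrib prod_constant)
  qed
  have up: "pochhammer (\<Sum>i\<in>I. w i) n \<le> fact n * ((real n + 1) ^ A) ^ card I"
    using pochhammer_le[OF W W2, of n] A ne by (simp add: power_mult)
  have multi: "(\<Prod>i\<in>I. p i ^ N i) * fact n \<le> (\<Prod>i\<in>I. fact (N i))"
  proof -
    have "(\<Prod>i\<in>I. p i ^ N i) * fact n \<le> (\<Sum>i\<in>I. p i) ^ n * (\<Prod>i\<in>I. fact (N i))"
      unfolding n(2) using I p by (intro multinomial_term_le) auto
    also have "\<dots> \<le> 1 * (\<Prod>i\<in>I. fact (N i))"
      using p by (intro mult_right_mono power_le_one prod_nonneg sum_nonneg) auto
    finally show ?thesis by simp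
  qed
  define F where "F = (\<Prod>i\<in>I. fact (N i) :: real)"
  define P where "P = (\<Prod>i\<in>I. p i ^ N i)"
  have P0: "0 \<le> P" unfolding P_def using p by (intro prod_nonneg) auto
  have ph: "0 < pochhammer (\<Sum>i\<in>I. w i) n" using W by (rule pochhammer_pos)
  have "(c / real n / (real n + 1) ^ A) ^ card I * P * pochhammer (\<Sum>i\<in>I. w i) n
     \<le> (c / real n / (real n + 1) ^ A) ^ card I * P * (fact n * ((real n + 1) ^ A) ^ card I)"
    using P0 c by (intro mult_left_mono up mult_nonneg_nonneg) auto
  also have "\<dots> = (c / real n) ^ card I * (P * fact n)"
  proof -
    have "((real n + 1) ^ A) ^ card I \<noteq> 0" by simp
    then show ?thesis unfolding power_divide by simp
  qed
  also have "\<dots> \<le> (c / real n) ^ card I * F"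
    using multi c unfolding P_def F_def by (intro mult_left_mono) auto
  also have "\<dots> \<le> (\<Prod>i\<in>I. pochhammer (w i) (N i))" using low unfolding F_def .
  finally have "(c / real n / (real n + 1) ^ A) ^ card I * P
      \<le> (\<Prod>i\<in>I. pochhammer (w i) (N i)) / pochhammer (\<Sum>i\<in>I. w i) n"
    using ph by (simp add: le_divide_eq)
  then show ?thesis
    using nn_integral_dirichlet_monomial[OF I wpos, where N = N] unfolding n(2)[symmetric] P_def
    by (simp add: ennreal_leI)
qed

section \<open>Bins and samples\<close>

text \<open>The bins partition this set: a point of the unit cube with a vanishing coordinate lies in no
  bin unless it is in the first one, which is closed. The difference to the unit cube is a
  null set.\<close>

definition half_open_cube :: "(real ^ 'd) set" where
  "half_open_cube = {x. \<forall>k. 0 < x $ k \<and> x $ k \<le> 1}"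

definition cell :: "nat \<Rightarrow> real ^ 'd \<Rightarrow> nat ^ 'd" where
  "cell J x = (\<chi> k. nat \<lceil>real J * x $ k\<rceil>)"

lemma bij_multi_indices:
  "bij_betw vec_nth (multi_indices J :: (nat ^ 'd) set) (PiE UNIV (\<lambda>_. {1..J}))"
  by (rule bij_betwI[where g = vec_lambda]) (auto simp: multi_indices_def)

lemma card_multi_indices: "card (multi_indices J :: (nat ^ 'd) set) = J ^ CARD('d)"
  using bij_betw_same_card[OF bij_multi_indices] by (simp add: card_PiE)

lemma finite_multi_indices [simp, intro]: "finite (multi_indices J :: (nat ^ 'd) set)"
  using bij_betw_finite[OF bij_multi_indices] by (simp add: finite_PiE)

lemma one_in_multi_indices [simp, intro]: "1 \<le> J \<Longrightarrow> 1 \<in> multi_indices J"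
  by (simp add: multi_indices_def)

lemma cell_nth: "1 \<le> J \<Longrightarrow> x \<in> half_open_cube \<Longrightarrow>
    real (cell J x $ k) - 1 < real J * x $ k \<and> real J * x $ k \<le> real (cell J x $ k)"
proof -
  assume a: "1 \<le> J" "x \<in> half_open_cube"
  then have "0 < real J * x $ k" by (auto simp: half_open_cube_def)
  then have "real (cell J x $ k) = of_int \<lceil>real J * x $ k\<rceil>" by (simp add: cell_def)
  then show ?thesis by linarith
qed

lemma cell_in_multi_indices [intro]:
  assumes "1 \<le> J" "x \<in> half_open_cube" shows "cell J x \<in> multi_indices J"
proof -
  have "1 \<le> cell J x $ k \<and> cell J x $ k \<le> J" for k
  proof -
    have x: "0 < real J * x $ k" "real J * x $ k \<le> real J * 1"
      using assms by (auto simp: half_open_cube_def intro!: mult_left_mono)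
    from x(1) have "1 \<le> \<lceil>real J * x $ k\<rceil>" by linarith
    moreover from x(2) have "\<lceil>real J * x $ k\<rceil> \<le> int J" by (simp add: ceiling_le_iff)
    ultimately show ?thesis unfolding cell_def by (simp add: nat_le_iff le_nat_iff)
  qed
  then show ?thesis by (simp add: multi_indices_def)
qed

lemma cell_eq_iff:
  assumes "1 \<le> J" "x \<in> half_open_cube"
  shows "cell J x = j \<longleftrightarrow> (\<forall>k. real (j $ k) - 1 < real J * x $ k \<and> real J * x $ k \<le> real (j $ k))"
proof
  assume "\<forall>k. real (j $ k) - 1 < real J * x $ k \<and> real J * x $ k \<le> real (j $ k)"
  then have "\<lceil>real J * x $ k\<rceil> = int (j $ k)" for k by (intro ceiling_unique) auto
  then show "cell J x = j" by (simp add: cell_def vec_eq_iff)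
qed (use cell_nth[OF assms] in auto)

lemma mem_bin_iff:
  assumes "1 \<le> J" "x \<in> half_open_cube"
  shows "x \<in> bin J j \<longleftrightarrow> cell J x = j"
proof -
  have "x $ k * real J = real J * x $ k" for k by simp
  moreover have "real J > 0" using assms by simp
  ultimately show ?thesis using assms(2)
    unfolding cell_eq_iff[OF assms] bin_def
    by (auto simp: half_open_cube_def divide_less_eq le_divide_eq less_imp_le mult.commute)
qed

lemma histogram_cell:
  fixes x :: "real ^ 'd"
  assumes "1 \<le> J" "x \<in> half_open_cube"
  shows "histogram J \<theta> x = real J ^ CARD('d) * \<theta> (cell J x)"
proof -
  have "(\<Sum>j\<in>multi_indices J. \<theta> j * indicator (bin J j) x) = (\<Sum>j\<in>multi_indices J. if j = cell J x then \<theta> j else 0)"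
    by (intro sum.cong) (auto simp: indicator_def mem_bin_iff[OF assms])
  then show ?thesis using assms by (auto simp: histogram_def)
qed

lemma bin_borel [measurable]: "(bin J j :: (real ^ 'd) set) \<in> sets borel"
proof -
  have 1: "{x :: real ^ 'd. \<forall>k. a \<le> x $ k \<and> x $ k \<le> b} = (\<Inter>k. {x. a \<le> x $ k} \<inter> {x. x $ k \<le> b})" for a b :: real
    by auto
  have 2: "{x :: real ^ 'd. \<forall>k. a k < x $ k \<and> x $ k \<le> b k} = (\<Inter>k. {x. a k < x $ k} \<inter> {x. x $ k \<le> b k})" for a b :: "'d \<Rightarrow> real"
    by auto
  show ?thesis unfolding bin_def 1 2
    by (auto intro!: sets.finite_INT sets.Int borel_closed borel_open closed_halfspace_component_le_cart
        closed_halfspace_component_ge_cart open_halfspace_component_gt_cart)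
qed

lemma half_open_cube_borel [measurable]: "half_open_cube \<in> sets (borel :: (real ^ 'd) measure)"
proof -
  have 2: "half_open_cube = (\<Inter>k. {x :: real ^ 'd. 0 < x $ k} \<inter> {x. x $ k \<le> 1})"
    by (auto simp: half_open_cube_def)
  show ?thesis unfolding 2
    by (auto intro!: sets.finite_INT sets.Int borel_closed borel_open closed_halfspace_component_le_cart
        open_halfspace_component_gt_cart)
qed

lemma half_open_cube_subset: "half_open_cube \<subseteq> unit_cube"
  by (auto simp: half_open_cube_def unit_cube_def mem_box_cart less_imp_le)

lemma borel_to_cube_measure:
  "f \<in> measurable borel N \<Longrightarrow> f \<in> measurable cube_measure N"
  by (intro measurable_restrict_space1 measurable_completion) simp

lemma cell_measurable [measurable]: "cell J \<in> measurable borel (count_space (UNIV :: (nat ^ 'd) set))"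
proof -
  have "cell J -` {j} \<inter> space borel \<in> sets borel" for j :: "nat ^ 'd"
  proof -
    have "cell J -` {j} = (\<Inter>k. {x :: real ^ 'd. nat \<lceil>real J * x $ k\<rceil> = j $ k})"
      by (auto simp: cell_def vec_eq_iff)
    moreover have "{x :: real ^ 'd. nat \<lceil>real J * x $ k\<rceil> = j $ k} \<in> sets borel" for k
      by measurable
    ultimately show ?thesis by auto
  qed
  then show ?thesis by (subst measurable_count_space_eq2_countable) auto
qed

lemma unit_cube_sets: "unit_cube \<inter> space lebesgue \<in> sets lebesgue"
  by (simp add: unit_cube_def)

lemma emeasure_cube_measure [simp]: "emeasure cube_measure (space cube_measure) = 1"
proof -
  have "emeasure lborel (cbox (0 :: real ^ 'd) 1) = 1"
    by (subst emeasure_lborel_cbox_eq) (auto simp: Basis_vec_def inner_axis inner_commute intro!: prod.neutral)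
  then show ?thesis
    by (simp add: emeasure_restrict_space unit_cube_sets unit_cube_def emeasure_completion)
qed

lemma prob_space_cube_measure: "prob_space cube_measure"
  by (rule prob_spaceI) (fact emeasure_cube_measure)

lemma AE_half_open_cube: "AE x in cube_measure. x \<in> half_open_cube"
proof -
  have "negligible (\<Union>k. {x :: real ^ 'd. x $ k = 0})"
    by (intro negligible_Union finite_imageI) (auto intro: negligible_standard_hyperplane_cart)
  then have "AE x in lebesgue. x \<notin> (\<Union>k. {x :: real ^ 'd. x $ k = 0})"
    unfolding negligible_iff_null_sets by (rule AE_not_in)
  then have "AE x in lebesgue. x \<in> unit_cube \<longrightarrow> x \<in> (half_open_cube :: (real ^ 'd) set)"
    by eventually_elim (auto simp: unit_cube_def half_open_cube_def mem_box_cart order.strict_iff_order)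
  then show ?thesis
    by (subst AE_restrict_space_iff[OF unit_cube_sets]) auto
qed

abbreviation obs :: "(real ^ 'd \<Rightarrow> real) \<Rightarrow> (real ^ 'd) measure" where
  "obs g \<equiv> density cube_measure (\<lambda>x. ennreal (g x))"

abbreviation sample :: "(real ^ 'd \<Rightarrow> real) \<Rightarrow> nat \<Rightarrow> (nat \<Rightarrow> real ^ 'd) measure" where
  "sample g n \<equiv> PiM {..<n} (\<lambda>_. obs g)"

lemma prob_densities_measurable: "g \<in> prob_densities \<Longrightarrow> g \<in> borel_measurable cube_measure"
  by (auto simp: prob_densities_def has_bochner_integral_iff)

lemma nn_integral_prob_density:
  assumes "g \<in> prob_densities"
  shows "(\<integral>\<^sup>+ x. ennreal (g x) \<partial>cube_measure) = 1"
proof -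
  have "(\<integral>\<^sup>+ x. ennreal (g x) \<partial>cube_measure) = ennreal (integral\<^sup>L cube_measure g)"
    using assms by (intro nn_integral_eq_integral) (auto simp: prob_densities_def has_bochner_integral_iff)
  then show ?thesis using assms by (auto simp: prob_densities_def has_bochner_integral_iff)
qed

lemma prob_space_obs: "g \<in> prob_densities \<Longrightarrow> prob_space (obs g)"
proof (rule prob_spaceI)
  assume g: "g \<in> prob_densities"
  have "emeasure (obs g) (space (obs g)) = (\<integral>\<^sup>+ x. ennreal (g x) * indicator (space cube_measure) x \<partial>cube_measure)"
    using prob_densities_measurable[OF g] by (subst emeasure_density[symmetric]) (auto simp del: space_lebesgue_on)
  also have "\<dots> = (\<integral>\<^sup>+ x. ennreal (g x) \<partial>cube_measure)"
    by (intro nn_integral_cong) auto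
  finally show "emeasure (obs g) (space (obs g)) = 1" by (simp add: nn_integral_prob_density[OF g])
qed

lemma product_sigma_finite_obs:
  assumes "g \<in> prob_densities" shows "product_sigma_finite (\<lambda>_ :: nat. obs g)"
proof -
  interpret prob_space "obs g" by (rule prob_space_obs[OF assms])
  show ?thesis by standard
qed

lemma prob_space_sample: "g \<in> prob_densities \<Longrightarrow> prob_space (sample g n)"
  by (intro prob_space_PiM prob_space_obs)

lemma nn_integral_sample_prod:
  assumes g: "g \<in> prob_densities" and h: "h \<in> borel_measurable cube_measure"
  shows "(\<integral>\<^sup>+ X. (\<Prod>i<n. h (X i)) \<partial>sample g n) = (\<integral>\<^sup>+ x. h x * ennreal (g x) \<partial>cube_measure) ^ n"
proof -
  interpret product_sigma_finite "\<lambda>_ :: nat. obs g" by (rule product_sigma_finite_obs[OF g])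
  note [measurable] = h prob_densities_measurable[OF g]
  have "(\<integral>\<^sup>+ X. (\<Prod>i<n. h (X i)) \<partial>sample g n) = (\<Prod>i<n. integral\<^sup>N (obs g) h)"
    by (rule product_nn_integral_prod) auto
  also have "integral\<^sup>N (obs g) h = (\<integral>\<^sup>+ x. h x * ennreal (g x) \<partial>cube_measure)"
    by (subst nn_integral_density) (auto simp: mult.commute)
  finally show ?thesis by simp
qed

lemma AE_sample:
  assumes g: "g \<in> prob_densities" and "AE x in cube_measure. Q x"
  shows "AE X in sample g n. \<forall>i<n. Q (X i)"
proof -
  have "AE x in obs g. Q x"
    using assms prob_densities_measurable[OF g] by (subst AE_density) auto
  then have "AE X in sample g n. Q (X i)" if "i < n" for i
    using that by (intro AE_PiM_component prob_space_obs g) auto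
  then show ?thesis by (simp add: AE_all_countable)
qed

lemma sample_component_measurable [measurable]:
  assumes "i < n" shows "(\<lambda>X. X i) \<in> measurable (sample g n) cube_measure"
proof -
  have "measurable (sample g n) (obs g) = measurable (sample g n) cube_measure"
    by (intro measurable_cong_sets refl sets_density)
  moreover have "(\<lambda>X. X i) \<in> measurable (sample g n) (obs g)"
    using assms by (intro measurable_component_singleton) simp
  ultimately show ?thesis by simp
qed

lemma histogram_joint_measurable:
  assumes "i < n"
  shows "(\<lambda>z. histogram J (snd z) (fst z i)) \<in> borel_measurable (sample g n \<Otimes>\<^sub>M PiM (multi_indices J) (\<lambda>_. borel))"
proof -
  note [measurable] = sample_component_measurable[OF assms]
  have [measurable]: "indicator (bin J j) \<in> borel_measurable (cube_measure :: (real ^ 'd) measure)" for j :: "nat ^ 'd"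
    by (rule borel_to_cube_measure) measurable
  have [measurable]: "(\<lambda>z. snd z j) \<in> borel_measurable (sample g n \<Otimes>\<^sub>M PiM (multi_indices J) (\<lambda>_. borel :: real measure))"
    if "j \<in> multi_indices J" for j
    using that by measurable
  show ?thesis unfolding histogram_def by measurable
qed

lemma histogram_measurable [measurable]: "histogram J \<theta> \<in> borel_measurable borel"
  unfolding histogram_def[abs_def] by measurable

text \<open>Exchanging the integrals over the sample and over the weights leaves, for fixed weights, a
  product of n equal integrals. With v the reciprocal of a density, this computes expectations
  of the evidence relative to the likelihood of that density.\<close>

lemma tonelli_likelihood:
  fixes J :: nat
  defines "I \<equiv> multi_indices J"
  assumes g: "g \<in> prob_densities" and J: "1 \<le> J" and w: "\<And>i. i \<in> I \<Longrightarrow> 0 < w i"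
    and F [measurable]: "F \<in> borel_measurable (PiM I (\<lambda>_. borel))"
    and v [measurable]: "v \<in> borel_measurable cube_measure"
  shows "(\<integral>\<^sup>+ X. (\<integral>\<^sup>+ \<theta>. F \<theta> * ennreal (\<Prod>i<n. histogram J \<theta> (X i)) \<partial>dirichlet I 1 w) * (\<Prod>i<n. v (X i)) \<partial>sample g n)
    = (\<integral>\<^sup>+ \<theta>. F \<theta> * (\<integral>\<^sup>+ x. ennreal (histogram J \<theta> x) * v x * ennreal (g x) \<partial>cube_measure) ^ n \<partial>dirichlet I 1 w)" (is "?L = ?R")
    and "(\<lambda>X. (\<integral>\<^sup>+ \<theta>. F \<theta> * ennreal (\<Prod>i<n. histogram J \<theta> (X i)) \<partial>dirichlet I 1 w) * (\<Prod>i<n. v (X i)))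
       \<in> borel_measurable (sample g n)" (is ?M)
proof -
  interpret D: prob_space "dirichlet I 1 w"
    using J w by (intro prob_space_dirichlet) (auto simp: I_def)
  interpret S: prob_space "sample g n" by (rule prob_space_sample[OF g])
  interpret SD: pair_sigma_finite "sample g n" "dirichlet I 1 w" ..
  have sets_eq: "sets (sample g n \<Otimes>\<^sub>M dirichlet I 1 w) = sets (sample g n \<Otimes>\<^sub>M PiM I (\<lambda>_. borel))"
    by (intro sets_pair_measure_cong) auto
  have [measurable]: "(\<lambda>z. histogram J (snd z) (fst z i)) \<in> borel_measurable (sample g n \<Otimes>\<^sub>M dirichlet I 1 w)" if "i < n" for i
    using histogram_joint_measurable[OF that, of J g] measurable_cong_sets[OF sets_eq refl, of borel] unfolding I_def by blast
  have [measurable]: "F \<in> borel_measurable (dirichlet I 1 w)" 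
    using F measurable_cong_sets[OF sets_dirichlet refl, of I 1 w borel] by blast
  have meas: "(\<lambda>z. F (snd z) * ennreal (\<Prod>i<n. histogram J (snd z) (fst z i))) \<in> borel_measurable (sample g n \<Otimes>\<^sub>M dirichlet I 1 w)"
    by measurable
  have vm [measurable]: "(\<lambda>X. \<Prod>i<n. v (X i)) \<in> borel_measurable (sample g n)"
    by measurable
  have int [measurable]: "(\<lambda>X. \<integral>\<^sup>+ \<theta>. F \<theta> * ennreal (\<Prod>i<n. histogram J \<theta> (X i)) \<partial>dirichlet I 1 w) \<in> borel_measurable (sample g n)"
    using D.borel_measurable_nn_integral_fst[OF meas] by simp
  show ?M by measurable
  have slice: "(\<lambda>\<theta>. F \<theta> * ennreal (\<Prod>i<n. histogram J \<theta> (X i))) \<in> borel_measurable (dirichlet I 1 w)" if "X \<in> space (sample g n)" for X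
    using measurable_Pair2[OF meas that] by simp
  have "?L = (\<integral>\<^sup>+ X. (\<integral>\<^sup>+ \<theta>. F \<theta> * ennreal (\<Prod>i<n. histogram J \<theta> (X i)) * (\<Prod>i<n. v (X i)) \<partial>dirichlet I 1 w) \<partial>sample g n)"
    by (intro nn_integral_cong nn_integral_multc[symmetric] slice)
  also have "\<dots> = (\<integral>\<^sup>+ \<theta>. (\<integral>\<^sup>+ X. F \<theta> * ennreal (\<Prod>i<n. histogram J \<theta> (X i)) * (\<Prod>i<n. v (X i)) \<partial>sample g n) \<partial>dirichlet I 1 w)"
    by (rule SD.Fubini'[symmetric]) (auto simp: split_beta' intro!: borel_measurable_times_ennreal meas)
  also have "\<dots> = ?R"
  proof (intro nn_integral_cong_AE)
    have "AE \<theta> in dirichlet I 1 w. (\<forall>i\<in>I. 0 \<le> \<theta> i) \<and> (\<Sum>i\<in>I. \<theta> i) = 1"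
      using J by (intro AE_dirichlet_simplex) (auto simp: I_def)
    then show "AE \<theta> in dirichlet I 1 w.
      (\<integral>\<^sup>+ X. F \<theta> * ennreal (\<Prod>i<n. histogram J \<theta> (X i)) * (\<Prod>i<n. v (X i)) \<partial>sample g n) =
      F \<theta> * (\<integral>\<^sup>+ x. ennreal (histogram J \<theta> x) * v x * ennreal (g x) \<partial>cube_measure) ^ n"
    proof eventually_elim
      case (elim \<theta>)
      have nn: "0 \<le> histogram J \<theta> x" for x
        using elim unfolding histogram_def I_def by (auto intro!: mult_nonneg_nonneg sum_nonneg)
      have hm [measurable]: "histogram J \<theta> \<in> borel_measurable cube_measure"
        by (rule borel_to_cube_measure) measurable
      have "(\<integral>\<^sup>+ X. F \<theta> * ennreal (\<Prod>i<n. histogram J \<theta> (X i)) * (\<Prod>i<n. v (X i)) \<partial>sample g n)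
         = (\<integral>\<^sup>+ X. F \<theta> * (\<Prod>i<n. ennreal (histogram J \<theta> (X i)) * v (X i)) \<partial>sample g n)"
        by (intro nn_integral_cong) (simp add: prod_ennreal[OF nn, symmetric] prod.distrib mult.assoc)
      also have "\<dots> = F \<theta> * (\<integral>\<^sup>+ X. (\<Prod>i<n. ennreal (histogram J \<theta> (X i)) * v (X i)) \<partial>sample g n)"
        by (intro nn_integral_cmult) measurable
      also have "(\<integral>\<^sup>+ X. (\<Prod>i<n. ennreal (histogram J \<theta> (X i)) * v (X i)) \<partial>sample g n)
         = (\<integral>\<^sup>+ x. ennreal (histogram J \<theta> x) * v x * ennreal (g x) \<partial>cube_measure) ^ n"
        using g by (intro nn_integral_sample_prod) measurable
      finally show ?case .
    qed
  qed
  finally show "?L = ?R" .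
qed

lemma prod_cells:
  fixes \<theta> :: "nat ^ 'd \<Rightarrow> real"
  assumes "1 \<le> J" "\<And>i. i < n \<Longrightarrow> X i \<in> half_open_cube"
  shows "(\<Prod>i<n. histogram J \<theta> (X i)) = (real J ^ CARD('d)) ^ n *
    (\<Prod>j\<in>multi_indices J. \<theta> j ^ card {i\<in>{..<n}. cell J (X i) = j})"
proof -
  have "(\<Prod>i<n. histogram J \<theta> (X i)) = (\<Prod>i<n. real J ^ CARD('d) * \<theta> (cell J (X i)))"
    using assms by (intro prod.cong) (auto simp: histogram_cell)
  also have "\<dots> = (real J ^ CARD('d)) ^ n * (\<Prod>i<n. \<theta> (cell J (X i)))"
    by (simp add: prod.distrib)
  also have "(\<Prod>i<n. \<theta> (cell J (X i))) = (\<Prod>j\<in>multi_indices J. \<Prod>i\<in>{i\<in>{..<n}. cell J (X i) = j}. \<theta> (cell J (X i)))"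
    using assms by (intro prod.group[symmetric]) auto
  also have "\<dots> = (\<Prod>j\<in>multi_indices J. \<theta> j ^ card {i\<in>{..<n}. cell J (X i) = j})"
  proof (intro prod.cong refl)
    fix j
    have "(\<Prod>i\<in>{i\<in>{..<n}. cell J (X i) = j}. \<theta> (cell J (X i))) = (\<Prod>i\<in>{i\<in>{..<n}. cell J (X i) = j}. \<theta> j)"
      by (intro prod.cong) auto
    then show "(\<Prod>i\<in>{i\<in>{..<n}. cell J (X i) = j}. \<theta> (cell J (X i))) = \<theta> j ^ card {i\<in>{..<n}. cell J (X i) = j}"
      by (simp only: prod_constant)
  qed
  finally show ?thesis .
qed

section \<open>The evidence of a resolution\<close>

abbreviation evidence :: "(nat \<Rightarrow> nat ^ 'd \<Rightarrow> real) \<Rightarrow> nat \<Rightarrow> (nat \<Rightarrow> real ^ 'd) \<Rightarrow> nat \<Rightarrow> ennreal" where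
  "evidence w n X J \<equiv> (\<integral>\<^sup>+ \<theta>. ennreal (\<Prod>i<n. histogram J \<theta> (X i)) \<partial>dirichlet (multi_indices J) 1 (w J))"

text \<open>C is a constant for which the evidence of resolution J is at least n powr (- C * J^d) times
  the likelihood of every J-histogram of mass at most 1, whatever the sample is. The bound is
  required for all Dirichlet parameters in the given range, so that C, and with it the
  constant of the test, depends only on a1, a2, a3 and d.\<close>

definition evidence_rate :: "'d::finite itself \<Rightarrow> real \<Rightarrow> real \<Rightarrow> real \<Rightarrow> real \<Rightarrow> bool" where
  "evidence_rate _ a1 a2 a3 C \<longleftrightarrow> 0 < C \<and> (\<forall>(w :: nat \<Rightarrow> nat \<Rightarrow> nat ^ 'd \<Rightarrow> real) n J X \<theta>.
     dirichlet_weights a1 a2 a3 w \<longrightarrow> 2 \<le> n \<longrightarrow> 1 \<le> J \<longrightarrow> (\<forall>i<n. X i \<in> half_open_cube) \<longrightarrow>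
     (\<forall>j\<in>multi_indices J. 0 \<le> \<theta> j) \<longrightarrow> (\<Sum>j\<in>multi_indices J. \<theta> j) \<le> 1 \<longrightarrow>
     ennreal (real n powr (- C * real J ^ CARD('d)) * (\<Prod>i<n. histogram J \<theta> (X i))) \<le> evidence (w n) n X J)"

text \<open>The likelihood of a histogram is a monomial in its weights, with the bin counts as
  exponents. So dirichlet_monomial_ge applies, and it remains to bound its polynomial factors
  by one power of n per bin. The constant s serves to absorb a2: for n \<ge> 2, a2 is at least
  n powr (- s).\<close>

lemma evidence_rate_exists:
  assumes "0 < a1" "0 < a2" "0 < a3"
  obtains C where "evidence_rate TYPE('d::finite) a1 a2 a3 C"
proof -
  define A where "A = max 1 (nat \<lceil>a1\<rceil>)"
  define s where "s = max 0 (- log 2 a2)"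
  define C where "C = s + a3 + 1 + 2 * real A"
  have A: "1 \<le> A" "a1 \<le> real A" unfolding A_def by linarith+
  have s: "0 \<le> s" by (simp add: s_def)
  have s2: "2 powr (- s) \<le> a2"
  proof -
    have "2 powr (- s) \<le> 2 powr (log 2 a2)" by (intro powr_mono) (auto simp: s_def)
    then show ?thesis using assms by simp
  qed
  have C: "0 < C" using s assms by (auto simp: C_def)
  have "ennreal (real n powr (- C * real J ^ CARD('d)) * (\<Prod>i<n. histogram J \<theta> (X i))) \<le> evidence (w n) n X J"
    if w: "dirichlet_weights a1 a2 a3 w" and n: "2 \<le> n" and J: "1 \<le> J" and X: "\<forall>i<n. X i \<in> half_open_cube"
      and \<theta>: "\<forall>j\<in>multi_indices J. 0 \<le> \<theta> j" "(\<Sum>j\<in>multi_indices J. \<theta> j) \<le> 1"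
    for w :: "nat \<Rightarrow> nat \<Rightarrow> nat ^ 'd \<Rightarrow> real" and n J X and \<theta> :: "nat ^ 'd \<Rightarrow> real"
  proof -
    let ?I = "multi_indices J :: (nat ^ 'd) set"
    let ?N = "\<lambda>j. card {i\<in>{..<n}. cell J (X i) = j}"
    define c where "c = real n powr (- s - a3)"
    have c: "0 < c" "c \<le> 1"
    proof -
      have "real n powr (- s - a3) \<le> real n powr 0" using n s assms by (intro powr_mono) auto
      then show "c \<le> 1" using n by (simp add: c_def)
      show "0 < c" using n by (simp add: c_def)
    qed
    have cw: "c \<le> w n J j" if "j \<in> ?I" for j
    proof -
      have "real n powr (- s) \<le> 2 powr (- s)" using n s by (intro powr_mono2') auto
      then have "real n powr (- s) \<le> a2" using s2 by linarith
      then have "c \<le> a2 * real n powr (- a3)"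
        unfolding c_def by (simp add: powr_diff powr_minus divide_inverse mult_right_mono)
      also have "\<dots> \<le> w n J j"
      proof -
        have "1 \<le> n" using n by simp
        then show ?thesis using w J that unfolding dirichlet_weights_def by blast
      qed
      finally show ?thesis .
    qed
    have wA: "w n J j \<le> real A" if "j \<in> ?I" for j
    proof -
      have "1 \<le> n" using n by simp
      then have "w n J j \<le> a1" using w J that unfolding dirichlet_weights_def by blast
      then show ?thesis using A by simp
    qed
    have nsum: "n = (\<Sum>j\<in>?I. ?N j)"
    proof -
      have "(\<Sum>j\<in>?I. ?N j) = (\<Sum>j\<in>?I. \<Sum>i\<in>{i\<in>{..<n}. cell J (X i) = j}. 1)" by simp
      also have "\<dots> = (\<Sum>i<n. 1)" using X J by (intro sum.group) auto
      finally show ?thesis by simp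
    qed
    have "real n powr (- C) \<le> c / real n / (real n + 1) ^ A"
    proof -
      have "(real n + 1) ^ A \<le> (real n ^ 2) ^ A"
      proof (intro power_mono)
        have "2 * real n \<le> real n * real n" using n by (intro mult_right_mono) auto
        then show "real n + 1 \<le> real n ^ 2" using n unfolding power2_eq_square by linarith
      qed auto
      also have "\<dots> = real n powr (2 * real A)"
      proof -
        have "(real n ^ 2) ^ A = real n ^ (2 * A)" by (simp add: power_mult)
        also have "\<dots> = real n powr real (2 * A)" using n by (intro powr_realpow[symmetric]) auto
        finally show ?thesis by simp
      qed
      finally have "c / real n / real n powr (2 * real A) \<le> c / real n / (real n + 1) ^ A"
        using c n by (intro divide_left_mono) auto
      moreover have "real n powr (- C) = c / real n / real n powr (2 * real A)"
      proof -
        have "c / real n / real n powr (2 * real A) = real n powr (- s - a3) / real n powr 1 / real n powr (2 * real A)"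
          using n by (simp add: c_def)
        also have "\<dots> = real n powr (- s - a3 - 1 - 2 * real A)" by (simp only: powr_diff)
        also have "- s - a3 - 1 - 2 * real A = - C" by (simp add: C_def)
        finally show ?thesis by (rule sym)
      qed
      ultimately show ?thesis by simp
    qed
    then have "(real n powr (- C)) ^ card ?I \<le> (c / real n / (real n + 1) ^ A) ^ card ?I"
      by (intro power_mono) auto
    have const: "real n powr (- C * real J ^ CARD('d)) \<le> (c / real n / (real n + 1) ^ A) ^ card ?I"
    proof -
      have "(real n powr (- C)) ^ card ?I = real n powr (real (card ?I) * (- C))"
        using n by (intro powr_power) auto
      also have "real (card ?I) * (- C) = - C * real J ^ CARD('d)" by (simp add: card_multi_indices)
      finally show ?thesis
        using \<open>(real n powr (- C)) ^ card ?I \<le> (c / real n / (real n + 1) ^ A) ^ card ?I\<close> by simp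
    qed
    have P: "0 \<le> (\<Prod>j\<in>?I. \<theta> j ^ ?N j)" using \<theta> by (intro prod_nonneg) auto
    have "ennreal (real n powr (- C * real J ^ CARD('d)) * (\<Prod>i<n. histogram J \<theta> (X i)))
       \<le> ennreal ((real J ^ CARD('d)) ^ n * ((c / real n / (real n + 1) ^ A) ^ card ?I * (\<Prod>j\<in>?I. \<theta> j ^ ?N j)))"
      using X J P const by (subst prod_cells) (auto intro!: ennreal_leI simp: mult.left_commute mult_left_mono mult_right_mono)
    also have "\<dots> \<le> ennreal ((real J ^ CARD('d)) ^ n) * (\<integral>\<^sup>+ \<theta>. ennreal (\<Prod>j\<in>?I. \<theta> j ^ ?N j) \<partial>dirichlet ?I 1 (w n J))"
      unfolding ennreal_mult'[of "(real J ^ CARD('d)) ^ n", simplified]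
      using J n nsum cw wA c A \<theta> by (intro mult_left_mono dirichlet_monomial_ge) auto
    also have "\<dots> = (\<integral>\<^sup>+ \<theta>. ennreal ((real J ^ CARD('d)) ^ n) * ennreal (\<Prod>j\<in>?I. \<theta> j ^ ?N j) \<partial>dirichlet ?I 1 (w n J))"
      by (rule nn_integral_cmult[symmetric]) measurable
    also have "\<dots> = evidence (w n) n X J"
      using X J by (intro nn_integral_cong) (simp add: prod_cells ennreal_mult')
    finally show ?thesis .
  qed
  then have "evidence_rate TYPE('d) a1 a2 a3 C" using C unfolding evidence_rate_def by blast
  then show ?thesis by (rule that)
qed

section \<open>Bin probabilities and the projection onto histograms\<close>

lemma bin_subset_unit_cube: "1 \<le> J \<Longrightarrow> j \<in> multi_indices J \<Longrightarrow> bin J j \<subseteq> unit_cube"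
  for j :: "nat ^ 'd"
proof -
  assume J: "1 \<le> J" and j: "j \<in> multi_indices J"
  have b: "1 \<le> real (j $ k)" "real (j $ k) \<le> real J" for k
    using j by (auto simp: multi_indices_def of_nat_le_iff intro: order_trans)
  have l: "0 \<le> (real (j $ k) - 1) / real J" and u: "real (j $ k) / real J \<le> 1" for k
    using b[of k] J by (auto simp: divide_le_eq)
  have o: "1 / real J \<le> 1" using J by (auto simp: divide_le_eq)
  show ?thesis
  proof
    fix x assume x: "x \<in> bin J j"
    have "0 \<le> x $ k \<and> x $ k \<le> 1" for k
      using x l[of k] u[of k] o by (auto simp: bin_def split: if_splits) (meson order_trans less_imp_le)+
    then show "x \<in> unit_cube" by (simp add: unit_cube_def mem_box_cart)
  qed
qed

lemma bin_cube_sets [measurable]: "1 \<le> J \<Longrightarrow> j \<in> multi_indices J \<Longrightarrow> bin J j \<in> sets cube_measure"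
  using bin_subset_unit_cube[of J j] bin_borel[of J j] unit_cube_sets
  by (subst sets_restrict_space_iff) auto

lemma emeasure_bin:
  fixes j :: "nat ^ 'd"
  assumes J: "1 \<le> J" and j: "j \<in> multi_indices J"
  shows "emeasure cube_measure (bin J j) = ennreal (1 / real J ^ CARD('d))"
proof -
  define a b :: "real ^ 'd" where "a = (\<chi> k. (real (j $ k) - 1) / real J)" and "b = (\<chi> k. real (j $ k) / real J)"
  have ab: "b $ k - a $ k = 1 / real J" for k by (simp add: a_def b_def flip: diff_divide_distrib)
  have sub: "box a b \<subseteq> bin J j" "bin J j \<subseteq> cbox a b"
    by (auto simp: bin_def a_def b_def mem_box_cart less_imp_le)
  have d: "(b - a) \<bullet> i = 1 / real J" if i: "i \<in> Basis" for i :: "real ^ 'd"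
  proof -
    obtain k where "i = axis k 1" using i by (auto simp: Basis_vec_def)
    then show ?thesis using ab[of k] by (simp add: inner_axis)
  qed
  have le: "a \<bullet> i \<le> b \<bullet> i" if "i \<in> Basis" for i
  proof -
    have "0 \<le> (b - a) \<bullet> i" unfolding d[OF that] by simp
    then show ?thesis by (simp add: inner_diff_left)
  qed
  have prod: "(\<Prod>i\<in>Basis. (b - a) \<bullet> i) = 1 / real J ^ CARD('d)"
    by (simp add: d power_divide)
  have "emeasure lborel (box a b) = ennreal (1 / real J ^ CARD('d))" "emeasure lborel (cbox a b) = ennreal (1 / real J ^ CARD('d))"
    by (simp_all add: emeasure_lborel_box_eq emeasure_lborel_cbox_eq le prod[symmetric] del: inner_diff_left cong: prod.cong)
  then have "emeasure lborel (bin J j) = ennreal (1 / real J ^ CARD('d))"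
    using emeasure_mono[OF sub(1), of lborel] emeasure_mono[OF sub(2), of lborel] by auto
  then show ?thesis
    using bin_subset_unit_cube[OF J j]
    by (subst emeasure_restrict_space[OF unit_cube_sets]) (auto simp: emeasure_completion)
qed

lemma nn_integral_cell:
  fixes F :: "nat ^ 'd \<Rightarrow> ennreal"
  assumes "sets M = sets cube_measure" "AE x in M. x \<in> half_open_cube" "1 \<le> J"
  shows "(\<integral>\<^sup>+ x. F (cell J x) \<partial>M) = (\<Sum>j\<in>multi_indices J. F j * emeasure M (bin J j))"
proof -
  have bins [measurable]: "bin J j \<in> sets M" if "j \<in> multi_indices J" for j
    using that assms bin_cube_sets by auto
  have "(\<integral>\<^sup>+ x. F (cell J x) \<partial>M) = (\<integral>\<^sup>+ x. (\<Sum>j\<in>multi_indices J. F j * indicator (bin J j) x) \<partial>M)"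
  proof (intro nn_integral_cong_AE, use assms(2) in eventually_elim)
    case (elim x)
    have "(\<Sum>j\<in>multi_indices J. F j * indicator (bin J j) x) = (\<Sum>j\<in>multi_indices J. if j = cell J x then F j else 0)"
      by (intro sum.cong) (auto simp: indicator_def mem_bin_iff[OF assms(3) elim])
    then show ?case using elim assms(3) by auto
  qed
  also have "\<dots> = (\<Sum>j\<in>multi_indices J. F j * emeasure M (bin J j))"
    by (subst nn_integral_sum) (auto intro!: sum.cong nn_integral_cmult_indicator)
  finally show ?thesis .
qed

definition bin_prob :: "(real ^ 'd \<Rightarrow> real) \<Rightarrow> nat \<Rightarrow> nat ^ 'd \<Rightarrow> real" where
  "bin_prob g J j = measure (obs g) (bin J j)"

text \<open>The histogram of the bin averages of g; it is the conditional expectation of g given the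
  bins.\<close>

abbreviation projection :: "(real ^ 'd \<Rightarrow> real) \<Rightarrow> nat \<Rightarrow> real ^ 'd \<Rightarrow> real" where
  "projection g J \<equiv> histogram J (bin_prob g J)"

lemma bin_prob_nonneg [simp]: "0 \<le> bin_prob g J j"
  by (simp add: bin_prob_def)

lemma AE_obs: "g \<in> prob_densities \<Longrightarrow> AE x in cube_measure. Q x \<Longrightarrow> AE x in obs g. Q x"
  using prob_densities_measurable[of g] by (subst AE_density) auto

lemma emeasure_obs_bin: "g \<in> prob_densities \<Longrightarrow> emeasure (obs g) (bin J j) = ennreal (bin_prob g J j)"
  unfolding bin_prob_def
  by (rule finite_measure.emeasure_eq_measure) (simp add: prob_space_obs prob_space.finite_measure)

lemma nn_integral_obs_cell:
  fixes F :: "nat ^ 'd \<Rightarrow> ennreal"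
  assumes "g \<in> prob_densities" "1 \<le> J"
  shows "(\<integral>\<^sup>+ x. F (cell J x) \<partial>obs g) = (\<Sum>j\<in>multi_indices J. F j * ennreal (bin_prob g J j))"
  using nn_integral_cell[of "obs g" J F] AE_obs[OF assms(1) AE_half_open_cube] assms
  by (simp add: emeasure_obs_bin)

lemma nn_integral_cube_cell:
  fixes F :: "nat ^ 'd \<Rightarrow> ennreal"
  assumes "1 \<le> J"
  shows "(\<integral>\<^sup>+ x. F (cell J x) \<partial>cube_measure) = (\<Sum>j\<in>multi_indices J. F j * ennreal (1 / real J ^ CARD('d)))"
  using nn_integral_cell[OF refl AE_half_open_cube assms, of F] assms by (simp add: emeasure_bin)

lemma nn_integral_obs:
  assumes "g \<in> prob_densities" "f \<in> borel_measurable cube_measure"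
  shows "(\<integral>\<^sup>+ x. f x \<partial>obs g) = (\<integral>\<^sup>+ x. f x * ennreal (g x) \<partial>cube_measure)"
  using assms prob_densities_measurable[OF assms(1)] by (subst nn_integral_density) (auto simp: mult.commute)

lemma sum_bin_prob:
  assumes "g \<in> prob_densities" "1 \<le> J"
  shows "(\<Sum>j\<in>multi_indices J. bin_prob g J j) = 1"
proof -
  interpret prob_space "obs g" by (rule prob_space_obs[OF assms(1)])
  have "(\<integral>\<^sup>+ x. 1 \<partial>obs g) = (\<Sum>j\<in>multi_indices J. ennreal (bin_prob g J j))"
    using nn_integral_obs_cell[OF assms, of "\<lambda>_. 1"] by simp
  then have "ennreal (\<Sum>j\<in>multi_indices J. bin_prob g J j) = ennreal 1"
    using emeasure_space_1 by (simp add: sum_ennreal)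
  then show ?thesis by (simp add: sum_nonneg)
qed

lemma bin_prob_ge:
  fixes g :: "real ^ 'd \<Rightarrow> real"
  assumes g: "g \<in> prob_densities" and J: "1 \<le> J" and l: "0 < l" "\<And>x. x \<in> unit_cube \<Longrightarrow> l \<le> g x" and j: "j \<in> multi_indices J"
  shows "l / real J ^ CARD('d) \<le> bin_prob g J j"
proof -
  note [measurable] = bin_cube_sets[OF J j] prob_densities_measurable[OF g]
  have "ennreal (l / real J ^ CARD('d)) = ennreal l * emeasure cube_measure (bin J j)"
    using l J j by (simp add: emeasure_bin flip: ennreal_mult')
  also have "\<dots> = (\<integral>\<^sup>+ x. ennreal l * indicator (bin J j) x \<partial>cube_measure)"
    by (rule nn_integral_cmult_indicator[symmetric]) measurable
  also have "\<dots> \<le> (\<integral>\<^sup>+ x. ennreal (g x) * indicator (bin J j) x \<partial>cube_measure)"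
    using l(2) by (intro nn_integral_mono mult_right_mono ennreal_leI) auto
  also have "\<dots> = ennreal (bin_prob g J j)"
    unfolding emeasure_obs_bin[OF g, symmetric] by (rule emeasure_density[symmetric]) measurable
  finally show ?thesis by simp
qed

lemma projection_ge:
  fixes g :: "real ^ 'd \<Rightarrow> real"
  assumes g: "g \<in> prob_densities" and J: "1 \<le> J" and l: "0 < l" "\<And>x. x \<in> unit_cube \<Longrightarrow> l \<le> g x" and x: "x \<in> half_open_cube"
  shows "l \<le> projection g J x"
  using bin_prob_ge[OF g J l cell_in_multi_indices[OF J x]] J by (simp add: histogram_cell[OF J x] field_simps)

section \<open>Chernoff bounds for sets of bins\<close>

text \<open>This rests on exp \<lambda> \<le> 1 + \<lambda> + \<lambda>^2, valid for |\<lambda>| \<le>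
  1.\<close>

lemma bernoulli_mgf_le:
  fixes q lam :: real
  assumes "0 \<le> q" "q \<le> 1" "\<bar>lam\<bar> \<le> 1"
  shows "1 - q + q * exp lam \<le> exp (q * lam + lam\<^sup>2)"
proof -
  have "exp lam \<le> 1 + lam + lam\<^sup>2"
  proof (cases "0 \<le> lam")
    case True then show ?thesis using exp_bound[of lam] assms by auto
  next
    case False
    define y where "y = - lam"
    have y: "0 < y" using False by (simp add: y_def)
    have "(1 + y) * (1 - y + y\<^sup>2) = 1 + y ^ 3" by (simp add: algebra_simps power2_eq_square power3_eq_cube)
    then have "1 \<le> (1 + y) * (1 - y + y\<^sup>2)" using y by simp
    also have "\<dots> \<le> exp y * (1 - y + y\<^sup>2)"
    proof (intro mult_right_mono)
      show "1 + y \<le> exp y" by (rule exp_ge_add_one_self)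
      have "0 \<le> (1 - y)\<^sup>2 + y" using y by simp
      also have "(1 - y)\<^sup>2 + y = 1 - y + y\<^sup>2" by (simp add: power2_diff)
      finally show "0 \<le> 1 - y + y\<^sup>2" .
    qed
    finally have "exp (- y) \<le> 1 - y + y\<^sup>2" by (simp add: exp_minus field_simps)
    then show ?thesis by (simp add: y_def)
  qed
  then have "1 - q + q * exp lam \<le> 1 - q + q * (1 + lam + lam\<^sup>2)"
    using assms by (intro add_left_mono mult_left_mono) auto
  also have "\<dots> = 1 + (q * lam + q * lam\<^sup>2)" by (simp add: algebra_simps)
  also have "\<dots> \<le> 1 + (q * lam + lam\<^sup>2)" using assms mult_right_mono[of q 1 "lam\<^sup>2"] by simp
  also have "\<dots> \<le> exp (q * lam + lam\<^sup>2)" by (rule exp_ge_add_one_self)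
  finally show ?thesis .
qed

text \<open>Under the weights p the indicator of A is a Bernoulli variable, so this is its moment
  generating function, centred at c.\<close>

lemma tilted_sum_le:
  fixes p :: "'i \<Rightarrow> real"
  assumes "finite I" "A \<subseteq> I" "\<And>j. j \<in> I \<Longrightarrow> 0 \<le> p j" "(\<Sum>j\<in>I. p j) = 1" "\<bar>lam\<bar> \<le> 1"
  shows "(\<Sum>j\<in>I. p j * exp (lam * (indicator A j - c))) \<le> exp (lam * ((\<Sum>j\<in>A. p j) - c) + lam\<^sup>2)"
proof -
  let ?q = "\<Sum>j\<in>A. p j"
  have split: "(\<Sum>j\<in>I. f j) = (\<Sum>j\<in>A. f j) + (\<Sum>j\<in>I - A. f j)" for f :: "'i \<Rightarrow> real"
    using assms by (subst sum.subset_diff[of A I]) auto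
  have "(\<Sum>j\<in>A. p j * exp (lam * (indicator A j - c))) = (\<Sum>j\<in>A. p j * (exp lam * exp (- lam * c)))"
    by (intro sum.cong) (auto simp: algebra_simps simp flip: exp_add)
  then have s1: "(\<Sum>j\<in>A. p j * exp (lam * (indicator A j - c))) = ?q * (exp lam * exp (- lam * c))"
    by (simp only: sum_distrib_right)
  have "(\<Sum>j\<in>I - A. p j * exp (lam * (indicator A j - c))) = (\<Sum>j\<in>I - A. p j * exp (- lam * c))"
    by (intro sum.cong) auto
  then have s2: "(\<Sum>j\<in>I - A. p j * exp (lam * (indicator A j - c))) = (1 - ?q) * exp (- lam * c)"
    using split[of p] assms(4) by (simp only: sum_distrib_right[symmetric]) simp
  have "(\<Sum>j\<in>I. p j * exp (lam * (indicator A j - c))) = exp (- lam * c) * (1 - ?q + ?q * exp lam)"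
    unfolding split[of "\<lambda>j. p j * exp (lam * (indicator A j - c))"] s1 s2 by (simp add: algebra_simps)
  also have "\<dots> \<le> exp (- lam * c) * exp (?q * lam + lam\<^sup>2)"
  proof (intro mult_left_mono bernoulli_mgf_le)
    have "0 \<le> (\<Sum>j\<in>I - A. p j)" using assms by (intro sum_nonneg) auto
    then show "?q \<le> 1" using split[of p] assms(4) by simp
    show "0 \<le> ?q" using assms by (intro sum_nonneg) auto
  qed (use assms in auto)
  also have "\<dots> = exp (lam * (?q - c) + lam\<^sup>2)" by (simp add: algebra_simps flip: exp_add)
  finally show ?thesis .
qed

text \<open>Take the indices where \<theta> exceeds p. As both vectors have sum 1, these account for
  half of the distance.\<close>

lemma exists_excess_set:
  fixes \<theta> p :: "'i \<Rightarrow> real"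
  assumes "finite I" "(\<Sum>j\<in>I. \<theta> j) = 1" "(\<Sum>j\<in>I. p j) = 1" "t < (\<Sum>j\<in>I. \<bar>\<theta> j - p j\<bar>)"
  shows "\<exists>A\<subseteq>I. (\<Sum>j\<in>A. p j) + t / 2 \<le> (\<Sum>j\<in>A. \<theta> j)"
proof -
  define A where "A = {j\<in>I. p j < \<theta> j}"
  have split: "(\<Sum>j\<in>I. f j) = (\<Sum>j\<in>A. f j) + (\<Sum>j\<in>I - A. f j)" for f :: "'i \<Rightarrow> real"
    using assms(1) by (subst sum.subset_diff[of A I]) (auto simp: A_def)
  have "(\<Sum>j\<in>A. \<bar>\<theta> j - p j\<bar>) = (\<Sum>j\<in>A. \<theta> j - p j)" by (intro sum.cong) (auto simp: A_def)
  moreover have "(\<Sum>j\<in>I - A. \<bar>\<theta> j - p j\<bar>) = (\<Sum>j\<in>I - A. p j - \<theta> j)" by (intro sum.cong) (auto simp: A_def)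
  ultimately have "t / 2 \<le> (\<Sum>j\<in>A. \<theta> j) - (\<Sum>j\<in>A. p j)"
    using assms(2-4) split[of "\<lambda>j. \<bar>\<theta> j - p j\<bar>"] split[of \<theta>] split[of p]
    by (simp add: sum_subtractf)
  then show ?thesis by (intro exI[of _ A]) (auto simp: A_def)
qed

text \<open>A replacement for a first-moment bound on a * b ^ p when only the expectations of a and of b
  are under control. Where one of \<alpha> * a and \<beta> * b reaches 1 the trivial bound by
  e is good enough; elsewhere the power of \<beta> * b is at most 1 and can be dropped.\<close>

lemma weight_split:
  fixes m e T a b \<alpha> \<beta> :: ennreal
  assumes "m \<le> e" "m \<le> e * (T * (a * b ^ p))" "T \<le> \<alpha> * \<beta> ^ p"
  shows "m \<le> e * (\<alpha> * a + \<beta> * b)"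
proof (cases "1 \<le> \<alpha> * a \<or> 1 \<le> \<beta> * b")
  case True
  then have "1 \<le> \<alpha> * a + \<beta> * b" by (auto intro: order_trans add_increasing add_increasing2)
  then have "e * 1 \<le> e * (\<alpha> * a + \<beta> * b)" by (intro mult_left_mono) auto
  then show ?thesis using assms(1) by simp
next
  case False
  have "T * (a * b ^ p) \<le> (\<alpha> * \<beta> ^ p) * (a * b ^ p)" using assms(3) by (intro mult_right_mono) auto
  also have "\<dots> = (\<alpha> * a) * (\<beta> * b) ^ p" by (simp add: power_mult_distrib ac_simps)
  also have "\<dots> \<le> (\<alpha> * a) * 1" using False by (intro mult_left_mono power_le_one) auto
  also have "\<dots> \<le> \<alpha> * a + \<beta> * b" by simp
  finally have "e * (T * (a * b ^ p)) \<le> e * (\<alpha> * a + \<beta> * b)" by (intro mult_left_mono) auto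
  then show ?thesis using assms(2) by (rule order_trans[rotated])
qed

text \<open>The ratio of a histogram to the projection of g only depends on the bin, and a bin j
  contributes \<theta> j * u j, because its true probability cancels. The function u tilts the
  likelihood ratio by the bin; u = 1 gives the expectation 1 of the evidence relative to the
  likelihood of the projection.\<close>

lemma evidence_ratio_projection:
  fixes g :: "real ^ 'd \<Rightarrow> real" and J :: nat
  defines "I \<equiv> multi_indices J"
  assumes g: "g \<in> prob_densities" and J: "1 \<le> J" and l: "0 < l" "\<And>x. x \<in> unit_cube \<Longrightarrow> l \<le> g x"
    and w: "\<And>i. i \<in> I \<Longrightarrow> 0 < w i" and u: "\<And>j. 0 \<le> u j"
    and F [measurable]: "F \<in> borel_measurable (PiM I (\<lambda>_. borel))"
  shows "(\<integral>\<^sup>+ X. (\<integral>\<^sup>+ \<theta>. F \<theta> * ennreal (\<Prod>i<n. histogram J \<theta> (X i)) \<partial>dirichlet I 1 w) *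
      (\<Prod>i<n. ennreal (u (cell J (X i)) / projection g J (X i))) \<partial>sample g n)
    = (\<integral>\<^sup>+ \<theta>. F \<theta> * ennreal (\<Sum>j\<in>I. \<theta> j * u j) ^ n \<partial>dirichlet I 1 w)"
    and "(\<lambda>X. (\<integral>\<^sup>+ \<theta>. F \<theta> * ennreal (\<Prod>i<n. histogram J \<theta> (X i)) \<partial>dirichlet I 1 w) *
      (\<Prod>i<n. ennreal (u (cell J (X i)) / projection g J (X i)))) \<in> borel_measurable (sample g n)"
proof -
  have vm: "(\<lambda>x. ennreal (u (cell J x) / projection g J x)) \<in> borel_measurable cube_measure"
    by (rule borel_to_cube_measure) measurable
  note ton = tonelli_likelihood[where v = "\<lambda>x. ennreal (u (cell J x) / projection g J x)" and n = n and J = J and w = w and F = F,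
      folded I_def, OF g J w F vm, simplified]
  show "(\<lambda>X. (\<integral>\<^sup>+ \<theta>. F \<theta> * ennreal (\<Prod>i<n. histogram J \<theta> (X i)) \<partial>dirichlet I 1 w) *
      (\<Prod>i<n. ennreal (u (cell J (X i)) / projection g J (X i)))) \<in> borel_measurable (sample g n)"
    by (rule ton(2))
  have inner: "(\<integral>\<^sup>+ x. ennreal (histogram J \<theta> x) * ennreal (u (cell J x) / projection g J x) * ennreal (g x) \<partial>cube_measure)
      = ennreal (\<Sum>j\<in>I. \<theta> j * u j)" if \<theta>: "\<forall>j\<in>I. 0 \<le> \<theta> j" for \<theta>
  proof -
    have [measurable]: "(\<lambda>x. ennreal (histogram J \<theta> x)) \<in> borel_measurable cube_measure"
      by (rule borel_to_cube_measure) measurable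
    have pos: "0 < bin_prob g J j" if "j \<in> I" for j
      using bin_prob_ge[OF g J l, of j] that l(1) J by (auto simp: I_def intro: less_le_trans[rotated])
    have "(\<integral>\<^sup>+ x. ennreal (histogram J \<theta> x) * ennreal (u (cell J x) / projection g J x) * ennreal (g x) \<partial>cube_measure)
       = (\<integral>\<^sup>+ x. ennreal (histogram J \<theta> x) * ennreal (u (cell J x) / projection g J x) \<partial>obs g)"
      by (rule nn_integral_obs[OF g, symmetric]) (use vm in measurable)
    also have "\<dots> = (\<integral>\<^sup>+ x. ennreal (\<theta> (cell J x)) * ennreal (u (cell J x) / bin_prob g J (cell J x)) \<partial>obs g)"
    proof (intro nn_integral_cong_AE, use AE_obs[OF g AE_half_open_cube] in eventually_elim)
      case (elim x)
      have "cell J x \<in> I" using elim J by (auto simp: I_def)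
      then have "0 \<le> \<theta> (cell J x)" using \<theta> by auto
      then show ?case
        using J u by (simp add: histogram_cell[OF J elim] divide_nonneg_nonneg flip: ennreal_mult)
    qed
    also have "\<dots> = (\<Sum>j\<in>I. ennreal (\<theta> j) * ennreal (u j / bin_prob g J j) * ennreal (bin_prob g J j))"
      unfolding I_def by (rule nn_integral_obs_cell[OF g J])
    also have "\<dots> = (\<Sum>j\<in>I. ennreal (\<theta> j * u j))"
    proof (intro sum.cong refl)
      fix j assume "j \<in> I"
      then show "ennreal (\<theta> j) * ennreal (u j / bin_prob g J j) * ennreal (bin_prob g J j) = ennreal (\<theta> j * u j)"
        using pos[of j] \<theta> u by (simp add: mult.assoc flip: ennreal_mult)
    qed
    also have "\<dots> = ennreal (\<Sum>j\<in>I. \<theta> j * u j)"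
      using \<theta> u by (intro sum_ennreal) auto
    finally show ?thesis .
  qed
  have "AE \<theta> in dirichlet I 1 w. (\<forall>i\<in>I. 0 \<le> \<theta> i) \<and> (\<Sum>i\<in>I. \<theta> i) = 1"
    using J by (intro AE_dirichlet_simplex) (auto simp: I_def)
  then show "(\<integral>\<^sup>+ X. (\<integral>\<^sup>+ \<theta>. F \<theta> * ennreal (\<Prod>i<n. histogram J \<theta> (X i)) \<partial>dirichlet I 1 w) *
      (\<Prod>i<n. ennreal (u (cell J (X i)) / projection g J (X i))) \<partial>sample g n)
    = (\<integral>\<^sup>+ \<theta>. F \<theta> * ennreal (\<Sum>j\<in>I. \<theta> j * u j) ^ n \<partial>dirichlet I 1 w)"
    unfolding ton(1) by (intro nn_integral_cong_AE) (auto simp: inner elim: eventually_mono)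
qed

section \<open>Posterior concentration at one resolution\<close>

lemma histogram_nonneg:
  assumes "\<And>j. j \<in> multi_indices J \<Longrightarrow> 0 \<le> \<theta> j" shows "0 \<le> histogram J \<theta> x"
  unfolding histogram_def using assms by (auto intro!: mult_nonneg_nonneg sum_nonneg)

definition far_weights :: "(real ^ 'd \<Rightarrow> real) \<Rightarrow> nat \<Rightarrow> real \<Rightarrow> (nat ^ 'd \<Rightarrow> real) set" where
  "far_weights g J t = {\<theta>. t < (\<Sum>j\<in>multi_indices J. \<bar>\<theta> j - bin_prob g J j\<bar>)}"

definition radius :: "'d::finite itself \<Rightarrow> real \<Rightarrow> nat \<Rightarrow> nat \<Rightarrow> real" where
  "radius _ M n J = M * sqrt (real J ^ CARD('d) * ln (real n) / real n)"

lemma far_weights_measurable [measurable]: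
  "(indicator (far_weights g J t) :: _ \<Rightarrow> ennreal) \<in> borel_measurable (PiM (multi_indices J) (\<lambda>_. borel))"
proof -
  have "(\<lambda>\<theta>. (\<Sum>j\<in>multi_indices J. \<bar>\<theta> j - bin_prob g J j\<bar>)) \<in> borel_measurable (PiM (multi_indices J) (\<lambda>_. borel))"
    by measurable
  then have "(\<lambda>\<theta>. if t < (\<Sum>j\<in>multi_indices J. \<bar>\<theta> j - bin_prob g J j\<bar>) then 1 else 0 :: ennreal) \<in> borel_measurable (PiM (multi_indices J) (\<lambda>_. borel))"
    by measurable
  also have "(\<lambda>\<theta>. if t < (\<Sum>j\<in>multi_indices J. \<bar>\<theta> j - bin_prob g J j\<bar>) then 1 else 0 :: ennreal) = indicator (far_weights g J t)"
    by (auto simp: far_weights_def indicator_def)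
  finally show ?thesis .
qed

lemma dirichlet_weights_pos:
  "dirichlet_weights a1 a2 a3 w \<Longrightarrow> 0 < a2 \<Longrightarrow> 1 \<le> n \<Longrightarrow> 1 \<le> J \<Longrightarrow> j \<in> multi_indices J \<Longrightarrow> 0 < w n J j"
proof -
  assume a: "dirichlet_weights a1 a2 a3 w" "0 < a2" "1 \<le> n" "1 \<le> J" "j \<in> multi_indices J"
  then have "a2 * real n powr (- a3) \<le> w n J j" by (auto simp: dirichlet_weights_def)
  moreover have "0 < a2 * real n powr (- a3)" using a by simp
  ultimately show ?thesis by linarith
qed

text \<open>R is a sum over all sets A of bins. For each A there are two Chernoff statistics: U for the
  event that the frequency of A in the sample exceeds c A under the true density, and V for
  the event that it stays below c A under weights with an excess of t / 2 on A. Both have mean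
  at most exp (- n * t^2 / 64), up to the factor 1 / kap that the evidence bound costs. For
  every sample the product of the two is the evidence of the weights with that excess,
  relative to the likelihood of the projection. So at least one of them must be large where
  these weights have a non-negligible share of the evidence; weight_split makes this precise.

  In the condition 64 * (C + 4) \<le> M^2 the 64 is that of the Chernoff exponent. Per bin,
  the exponent C + 4 pays C for the evidence bound, 1 for the number of sets A, 1 for the sum
  of the two statistics, and leaves the rate 1 / n^2.\<close>

lemma posterior_concentration:
  fixes g :: "real ^ 'd \<Rightarrow> real" and J n :: nat
  assumes g: "g \<in> prob_densities" and J: "1 \<le> J" and l: "0 < l" "\<And>x. x \<in> unit_cube \<Longrightarrow> l \<le> g x"
    and w: "dirichlet_weights a1 a2 a3 w" and a2: "0 < a2" and n: "2 \<le> n" and C: "evidence_rate TYPE('d) a1 a2 a3 C"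
    and M: "0 < M" "64 * (C + 4) \<le> M\<^sup>2" and t: "radius TYPE('d) M n J \<le> 2"
  shows "\<exists>R\<in>borel_measurable (sample g n).
     (AE X in sample g n. (\<integral>\<^sup>+ \<theta>. indicator (far_weights g J (radius TYPE('d) M n J)) \<theta> * ennreal (\<Prod>i<n. histogram J \<theta> (X i))
         \<partial>dirichlet (multi_indices J) 1 (w n J)) \<le> evidence (w n) n X J * R X) \<and>
     (\<integral>\<^sup>+ X. R X \<partial>sample g n) \<le> ennreal (1 / real n ^ 2)"
proof -
  let ?I = "multi_indices J :: (nat ^ 'd) set"
  define K where "K = real J ^ CARD('d)"
  define t where "t = radius TYPE('d) M n J"
  \<comment> \<open>The minimiser of - lam * t / 4 + lam^2, the exponent of both Chernoff bounds.\<close>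
  define lam where "lam = t / 8"
  define kap where "kap = real n powr (- C * K)"
  define p where "p = bin_prob g J"
  define D where "D = dirichlet ?I 1 (w n J)"
  have K: "1 \<le> K" using J by (simp add: K_def)
  have n1: "1 < real n" "0 < ln (real n)" using n by auto
  have tsq: "t\<^sup>2 = M\<^sup>2 * K * ln (real n) / real n"
    using K n1 by (simp add: t_def radius_def K_def power_mult_distrib)
  have t0: "0 \<le> t" using M n1 K by (simp add: t_def radius_def K_def)
  have lam: "0 \<le> lam" "\<bar>lam\<bar> \<le> 1" using t0 \<open>radius TYPE('d) M n J \<le> 2\<close> by (auto simp: lam_def t_def)
  have kap: "0 < kap" using n1 by (simp add: kap_def)
  have wpos: "0 < w n J j" if "j \<in> ?I" for j
    using dirichlet_weights_pos[OF w a2 _ J that] n by simp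
  interpret D: prob_space D unfolding D_def using J wpos by (intro prob_space_dirichlet) auto
  have setsD: "sets D = sets (PiM ?I (\<lambda>_. borel))" by (simp add: D_def)
  have simplex: "AE \<theta> in D. (\<forall>i\<in>?I. 0 \<le> \<theta> i) \<and> (\<Sum>i\<in>?I. \<theta> i) = 1"
    unfolding D_def using J by (intro AE_dirichlet_simplex) auto
  have psum: "(\<Sum>j\<in>?I. p j) = 1" and pnn: "0 \<le> p j" for j
    using sum_bin_prob[OF g J] by (auto simp: p_def)
  \<comment> \<open>Half-way between the two probabilities of A, which differ by t / 2.\<close>
  define c where "c A = (\<Sum>j\<in>A. p j) + t / 4" for A :: "(nat ^ 'd) set"
  define B where "B A = {\<theta> :: nat ^ 'd \<Rightarrow> real. (\<Sum>j\<in>A. p j) + t / 2 \<le> (\<Sum>j\<in>A. \<theta> j)}" for A :: "(nat ^ 'd) set"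
  define U where "U A X = (\<Prod>i<n. ennreal (exp (lam * (indicator A (cell J (X i)) - c A))))" for A :: "(nat ^ 'd) set" and X :: "nat \<Rightarrow> real ^ 'd"
  \<comment> \<open>The reciprocal of the factor in U, so that the tilts cancel in the product of U and V.\<close>
  define u where "u A j = exp (- lam * (indicator A j - c A))" for A :: "(nat ^ 'd) set" and j :: "nat ^ 'd"
  define N where "N S X = (\<integral>\<^sup>+ \<theta>. indicator S \<theta> * ennreal (\<Prod>i<n. histogram J \<theta> (X i)) \<partial>D)" for S :: "(nat ^ 'd \<Rightarrow> real) set" and X :: "nat \<Rightarrow> real ^ 'd"
  define V where "V A X = N (B A) X * (\<Prod>i<n. ennreal (u A (cell J (X i)) / projection g J (X i)))" for A and X :: "nat \<Rightarrow> real ^ 'd"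
  define E where "E = exp (lam * (- t / 4) + lam\<^sup>2) ^ n"
  have BM [measurable]: "(indicator (B A) :: _ \<Rightarrow> ennreal) \<in> borel_measurable (PiM ?I (\<lambda>_. borel))" if "A \<subseteq> ?I" for A
  proof -
    have fin: "finite A" using that finite_subset by blast
    have "(\<lambda>\<theta>. if (\<Sum>j\<in>A. p j) + t / 2 \<le> (\<Sum>j\<in>A. \<theta> j) then 1 else 0 :: ennreal) \<in> borel_measurable (PiM ?I (\<lambda>_. borel :: real measure))"
    proof -
      have "(\<lambda>\<theta>. \<Sum>j\<in>A. \<theta> j) \<in> borel_measurable (PiM ?I (\<lambda>_. borel :: real measure))"
        using that by (intro borel_measurable_sum measurable_component_singleton) auto
      then show ?thesis by measurable
    qed
    also have "(\<lambda>\<theta>. if (\<Sum>j\<in>A. p j) + t / 2 \<le> (\<Sum>j\<in>A. \<theta> j) then 1 else 0 :: ennreal) = indicator (B A)"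
      by (auto simp: B_def indicator_def)
    finally show ?thesis .
  qed
  have Umeas: "U A \<in> borel_measurable (sample g n)" for A
  proof -
    have [measurable]: "(\<lambda>x. ennreal (exp (lam * (indicator A (cell J x) - c A)))) \<in> borel_measurable cube_measure"
      by (rule borel_to_cube_measure) measurable
    show ?thesis unfolding U_def by measurable
  qed
  have Uint: "(\<integral>\<^sup>+ X. U A X \<partial>sample g n) \<le> ennreal E" if A: "A \<subseteq> ?I" for A
  proof -
    have m: "(\<lambda>x. ennreal (exp (lam * (indicator A (cell J x) - c A)))) \<in> borel_measurable cube_measure"
      by (rule borel_to_cube_measure) measurable
    have "(\<integral>\<^sup>+ X. U A X \<partial>sample g n) = (\<integral>\<^sup>+ x. ennreal (exp (lam * (indicator A (cell J x) - c A))) \<partial>obs g) ^ n"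
      unfolding U_def by (subst nn_integral_sample_prod[OF g m]) (simp add: nn_integral_obs[OF g m])
    also have "(\<integral>\<^sup>+ x. ennreal (exp (lam * (indicator A (cell J x) - c A))) \<partial>obs g)
        = (\<Sum>j\<in>?I. ennreal (exp (lam * (indicator A j - c A))) * ennreal (p j))"
      unfolding p_def by (rule nn_integral_obs_cell[OF g J])
    also have "\<dots> = ennreal (\<Sum>j\<in>?I. p j * exp (lam * (indicator A j - c A)))"
      using pnn by (simp add: mult.commute flip: ennreal_mult'')
    also have "\<dots> \<le> ennreal (exp (lam * ((\<Sum>j\<in>A. p j) - c A) + lam\<^sup>2))"
      using A psum pnn lam by (intro ennreal_leI tilted_sum_le) auto
    also have "(\<Sum>j\<in>A. p j) - c A = - t / 4" by (simp add: c_def)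
    finally show ?thesis unfolding E_def by (simp add: ennreal_power power_mono)
  qed
  have Vmeas: "V A \<in> borel_measurable (sample g n)" if A: "A \<subseteq> ?I" for A
    unfolding V_def N_def D_def
    by (rule evidence_ratio_projection(2)[OF g J l, where F = "indicator (B A)"]) (use wpos A BM in \<open>auto simp: u_def\<close>)
  have Vint: "(\<integral>\<^sup>+ X. V A X \<partial>sample g n) \<le> ennreal E" if A: "A \<subseteq> ?I" for A
  proof -
    have "(\<integral>\<^sup>+ X. V A X \<partial>sample g n) = (\<integral>\<^sup>+ \<theta>. indicator (B A) \<theta> * ennreal (\<Sum>j\<in>?I. \<theta> j * u A j) ^ n \<partial>D)"
      unfolding V_def N_def D_def
      by (rule evidence_ratio_projection(1)[OF g J l, where F = "indicator (B A)"]) (use wpos A BM in \<open>auto simp: u_def\<close>)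
    also have "\<dots> \<le> (\<integral>\<^sup>+ \<theta>. ennreal E \<partial>D)"
    proof (intro nn_integral_mono_AE, use simplex in eventually_elim)
      case (elim \<theta>)
      show ?case
      proof (cases "\<theta> \<in> B A")
        case True
        have "(\<Sum>j\<in>?I. \<theta> j * u A j) \<le> exp (- lam * ((\<Sum>j\<in>A. \<theta> j) - c A) + (- lam)\<^sup>2)"
          unfolding u_def using elim A lam by (intro tilted_sum_le) auto
        also have "\<dots> \<le> exp (lam * (- t / 4) + lam\<^sup>2)"
        proof -
          have "t / 4 \<le> (\<Sum>j\<in>A. \<theta> j) - c A" using True by (simp add: B_def c_def)
          then have "lam * (t / 4) \<le> lam * ((\<Sum>j\<in>A. \<theta> j) - c A)" using lam by (intro mult_left_mono) auto
          then show ?thesis by simp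
        qed
        finally have "ennreal (\<Sum>j\<in>?I. \<theta> j * u A j) ^ n \<le> ennreal (exp (lam * (- t / 4) + lam\<^sup>2)) ^ n"
          by (intro power_mono ennreal_leI) auto
        then show ?thesis using True by (simp add: E_def ennreal_power)
      qed simp
    qed
    also have "\<dots> = ennreal E" using D.emeasure_space_1 by simp
    finally show ?thesis .
  qed
  define R where "R X = (\<Sum>A\<in>Pow ?I. U A X + ennreal (1 / kap) * V A X)" for X
  have Rmeas: "R \<in> borel_measurable (sample g n)"
    unfolding R_def using Umeas Vmeas by (intro borel_measurable_sum borel_measurable_add borel_measurable_times_ennreal) auto
  have "AE X in sample g n. \<forall>i<n. X i \<in> half_open_cube" by (rule AE_sample[OF g AE_half_open_cube])
  then have ae: "AE X in sample g n. N (far_weights g J t) X \<le> evidence (w n) n X J * R X"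
  proof eventually_elim
    case (elim X)
    define e where "e = evidence (w n) n X J"
    define L where "L = (\<Prod>i<n. projection g J (X i))"
    have proj_pos: "0 < projection g J (X i)" if "i < n" for i
      using projection_ge[OF g J l, of "X i"] elim that l by auto
    then have L: "0 < L" unfolding L_def by (intro prod_pos) auto
    have lower: "ennreal (kap * L) \<le> e"
      using C[unfolded evidence_rate_def, THEN conjunct2, rule_format, of w n J X p] w n J elim psum pnn
      unfolding e_def kap_def L_def K_def p_def by simp
    have hm: "(\<lambda>\<theta>. ennreal (\<Prod>i<n. histogram J \<theta> (X i))) \<in> borel_measurable D"
    proof -
      have "(\<lambda>\<theta>. histogram J \<theta> (X i)) \<in> borel_measurable D" for i
        unfolding histogram_def measurable_cong_sets[OF setsD refl] by measurable
      then show ?thesis by measurable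
    qed
    have single: "N (B A) X \<le> e * (U A X + ennreal (1 / kap) * V A X)" if A: "A \<subseteq> ?I" for A
    proof -
      have le: "N (B A) X \<le> e" unfolding N_def e_def D_def
        by (intro nn_integral_mono) (auto simp: indicator_def)
      define r where "r = (\<Prod>i<n. exp (lam * (indicator A (cell J (X i)) - c A)))"
      have r: "0 < r" unfolding r_def by (intro prod_pos) auto
      have Ur: "U A X = ennreal r" unfolding U_def r_def by (rule prod_ennreal) auto
      have "(\<Prod>i<n. ennreal (u A (cell J (X i)) / projection g J (X i))) = ennreal (1 / (r * L))"
      proof -
        have "(\<Prod>i<n. u A (cell J (X i)) / projection g J (X i)) = 1 / (r * L)"
        proof -
          have "u A (cell J (X i)) / projection g J (X i)
              = 1 / (exp (lam * (indicator A (cell J (X i)) - c A)) * projection g J (X i))" for i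
            by (simp add: u_def exp_minus divide_inverse)
          then show ?thesis unfolding r_def L_def prod.distrib[symmetric] by (simp add: prod_dividef)
        qed
        then show ?thesis using proj_pos by (subst prod_ennreal) (auto simp: u_def less_imp_le)
      qed
      then have Vr: "V A X = N (B A) X * ennreal (1 / (r * L))" by (simp add: V_def)
      have "N (B A) X \<le> e * (1 * (ennreal r * (ennreal (1 / kap) * V A X)))"
      proof -
        have "N (B A) X = ennreal (kap * L) * (ennreal r * (ennreal (1 / kap) * V A X))"
        proof -
          have "kap * L * r * (1 / kap) * (1 / (r * L)) = 1" using kap L r by simp
          then have "ennreal (kap * L) * ennreal r * ennreal (1 / kap) * ennreal (1 / (r * L)) = 1"
            using kap L r by (simp flip: ennreal_mult)
          then have "N (B A) X * (ennreal (kap * L) * ennreal r * ennreal (1 / kap) * ennreal (1 / (r * L))) = N (B A) X" by simp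
          then show ?thesis unfolding Vr by (simp only: ac_simps)
        qed
        also have "\<dots> \<le> e * (ennreal r * (ennreal (1 / kap) * V A X))" by (intro mult_right_mono lower) auto
        finally show ?thesis by simp
      qed
      then have "N (B A) X \<le> e * (1 * (U A X * (ennreal (1 / kap) * V A X) ^ 1))" by (simp add: Ur)
      from weight_split[OF le this, of 1 1] show ?thesis by simp
    qed
    have "N (far_weights g J t) X \<le> (\<integral>\<^sup>+ \<theta>. (\<Sum>A\<in>Pow ?I. indicator (B A) \<theta> * ennreal (\<Prod>i<n. histogram J \<theta> (X i))) \<partial>D)"
      unfolding N_def
    proof (intro nn_integral_mono_AE, use simplex in eventually_elim)
      case (elim \<theta>)
      show ?case
      proof (cases "\<theta> \<in> far_weights g J t")
        case True
        then obtain A where A: "A \<subseteq> ?I" "\<theta> \<in> B A"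
          using exists_excess_set[of ?I \<theta> p t] elim psum by (auto simp: far_weights_def B_def p_def)
        have "indicator (B A) \<theta> * ennreal (\<Prod>i<n. histogram J \<theta> (X i))
           \<le> (\<Sum>A\<in>Pow ?I. indicator (B A) \<theta> * ennreal (\<Prod>i<n. histogram J \<theta> (X i)))"
          using A by (intro member_le_sum) auto
        then show ?thesis using True A by simp
      qed simp
    qed
    also have "\<dots> = (\<Sum>A\<in>Pow ?I. N (B A) X)"
      unfolding N_def using hm BM by (intro nn_integral_sum borel_measurable_times_ennreal) (auto simp: measurable_cong_sets[OF setsD refl])
    also have "\<dots> \<le> (\<Sum>A\<in>Pow ?I. e * (U A X + ennreal (1 / kap) * V A X))"
      using single by (intro sum_mono) auto
    also have "\<dots> = e * R X" unfolding R_def by (simp add: sum_distrib_left)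
    finally show ?case unfolding e_def .
  qed
  have "(\<integral>\<^sup>+ X. R X \<partial>sample g n) = (\<Sum>A\<in>Pow ?I. (\<integral>\<^sup>+ X. U A X \<partial>sample g n) + ennreal (1 / kap) * (\<integral>\<^sup>+ X. V A X \<partial>sample g n))"
    unfolding R_def using Umeas Vmeas
    by (subst nn_integral_sum) (auto simp: nn_integral_add nn_integral_cmult intro!: borel_measurable_add borel_measurable_times_ennreal)
  also have "\<dots> \<le> (\<Sum>A\<in>Pow ?I. ennreal E + ennreal (1 / kap) * ennreal E)"
    using Uint Vint by (intro sum_mono add_mono mult_left_mono) auto
  also have "\<dots> = ennreal (2 ^ card ?I * (E + 1 / kap * E))"
  proof -
    have E: "0 \<le> E" by (simp add: E_def)
    have "ennreal E + ennreal (1 / kap) * ennreal E = ennreal (E + 1 / kap * E)"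
      using kap E by (simp flip: ennreal_mult)
    then show ?thesis using kap E
      by (simp add: card_Pow ennreal_mult' flip: ennreal_power)
  qed
  also have "\<dots> \<le> ennreal (1 / real n ^ 2)"
  proof (intro ennreal_leI)
    have "lam * (- t / 4) + lam\<^sup>2 = - (t\<^sup>2 / 64)" by (simp add: lam_def power2_eq_square)
    then have "E = exp (- (real n * t\<^sup>2 / 64))" by (simp add: E_def flip: exp_of_nat_mult)
    also have "real n * t\<^sup>2 / 64 = M\<^sup>2 / 64 * K * ln (real n)" using n1 by (simp add: tsq)
    finally have "E = real n powr (- (M\<^sup>2 / 64 * K))" using n1 by (simp add: powr_def mult.commute)
    also have "\<dots> \<le> real n powr (- ((C + 4) * K))"
      using n1 M K by (intro powr_mono) (auto intro!: mult_right_mono)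
    finally have E: "E \<le> real n powr (- ((C + 4) * K))" .
    have C0: "0 < C" using C by (simp add: evidence_rate_def)
    have two: "(2::real) ^ card ?I \<le> real n powr K"
    proof -
      have "(2::real) ^ card ?I \<le> real n ^ card ?I" using n by (intro power_mono) auto
      also have "\<dots> = real n powr K" 
        using powr_realpow[of "real n" "J ^ CARD('d)"] n1 by (simp add: card_multi_indices K_def)
      finally show ?thesis .
    qed
    have "1 + 1 / kap \<le> real n powr ((C + 1) * K)"
    proof -
      have k: "1 / kap = real n powr (C * K)" by (simp add: kap_def powr_minus divide_inverse)
      have "1 \<le> real n powr (C * K)" using n1 C0 K by (intro ge_one_powr_ge_zero) auto
      then have "1 + 1 / kap \<le> 2 * real n powr (C * K)" unfolding k by simp
      also have "\<dots> \<le> real n powr K * real n powr (C * K)"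
      proof (intro mult_right_mono)
        have "2 \<le> real n powr 1" using n by simp
        also have "\<dots> \<le> real n powr K" using n1 K by (intro powr_mono) auto
        finally show "2 \<le> real n powr K" .
      qed auto
      also have "\<dots> = real n powr ((C + 1) * K)" by (simp add: algebra_simps flip: powr_add)
      finally show ?thesis .
    qed
    then have "2 ^ card ?I * (E + 1 / kap * E) \<le> real n powr K * (real n powr ((C + 1) * K) * real n powr (- ((C + 4) * K)))"
    proof -
      assume a: "1 + 1 / kap \<le> real n powr ((C + 1) * K)"
      have E0: "0 \<le> E" by (simp add: E_def)
      have "E + 1 / kap * E = (1 + 1 / kap) * E" by (simp add: algebra_simps)
      also have "\<dots> \<le> real n powr ((C + 1) * K) * real n powr (- ((C + 4) * K))"
        using a E E0 by (intro mult_mono) auto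
      finally show ?thesis using two E0 kap by (intro mult_mono) auto
    qed
    also have "\<dots> = real n powr (- 2 * K)"
      by (simp add: algebra_simps flip: powr_add)
    also have "\<dots> \<le> real n powr (- 2)" using n1 K by (intro powr_mono) auto
    also have "\<dots> = 1 / real n ^ 2" using n1 by (simp add: powr_minus divide_inverse)
    finally show "2 ^ card ?I * (E + 1 / kap * E) \<le> 1 / real n ^ 2" .
  qed
  finally show ?thesis using Rmeas ae unfolding N_def t_def D_def by blast
qed

section \<open>Posterior concentration at all resolutions\<close>

abbreviation far_evidence :: "(real ^ 'd \<Rightarrow> real) \<Rightarrow> real \<Rightarrow> (nat \<Rightarrow> nat ^ 'd \<Rightarrow> real) \<Rightarrow> nat \<Rightarrow> (nat \<Rightarrow> real ^ 'd) \<Rightarrow> nat \<Rightarrow> ennreal" where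
  "far_evidence g M w n X J \<equiv> (\<integral>\<^sup>+ \<theta>. indicator (far_weights g J (radius TYPE('d) M n J)) \<theta> * ennreal (\<Prod>i<n. histogram J \<theta> (X i))
         \<partial>dirichlet (multi_indices J) 1 (w J))"

lemma marginal_likelihood_suminf:
  "marginal_likelihood \<pi> w n X B = (\<Sum>J. ennreal (pmf \<pi> J) * (\<integral>\<^sup>+ \<theta>. indicator B (J, histogram J \<theta>)
                     * ennreal (\<Prod>i<n. histogram J \<theta> (X i)) \<partial>dirichlet (multi_indices J) 1 (w J)))"
  unfolding marginal_likelihood_def
  by (simp add: nn_integral_measure_pmf nn_integral_count_space_nat)

lemma marginal_likelihood_UNIV: "marginal_likelihood \<pi> w n X UNIV = (\<Sum>J. ennreal (pmf \<pi> J) * evidence w n X J)"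
  by (simp add: marginal_likelihood_suminf)

lemma ennreal_term_le_suminf: "f k \<le> (\<Sum>J. f J :: ennreal)"
  using sum_le_suminf[of f "{k}"] by simp

lemma marginal_likelihood_ge: "ennreal (pmf \<pi> J) * evidence w n X J \<le> marginal_likelihood \<pi> w n X UNIV"
  unfolding marginal_likelihood_UNIV by (rule ennreal_term_le_suminf)

lemma prod_densities_measurable_inverse:
  "g \<in> prob_densities \<Longrightarrow> (\<lambda>x. ennreal (1 / g x)) \<in> borel_measurable cube_measure"
  using prob_densities_measurable[of g] by measurable

lemma nn_integral_histogram:
  fixes \<theta> :: "nat ^ 'd \<Rightarrow> real"
  assumes J: "1 \<le> J" and "\<And>j. j \<in> multi_indices J \<Longrightarrow> 0 \<le> \<theta> j"
  shows "(\<integral>\<^sup>+ x. ennreal (histogram J \<theta> x) \<partial>cube_measure) = ennreal (\<Sum>j\<in>multi_indices J. \<theta> j)"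
proof -
  have "(\<integral>\<^sup>+ x. ennreal (histogram J \<theta> x) \<partial>cube_measure) = (\<integral>\<^sup>+ x. ennreal (real J ^ CARD('d) * \<theta> (cell J x)) \<partial>cube_measure)"
    by (intro nn_integral_cong_AE) (use AE_half_open_cube in eventually_elim, simp add: histogram_cell[OF J])
  also have "\<dots> = (\<Sum>j\<in>multi_indices J. ennreal (real J ^ CARD('d) * \<theta> j) * ennreal (1 / real J ^ CARD('d)))"
    by (rule nn_integral_cube_cell[OF J])
  also have "\<dots> = (\<Sum>j\<in>multi_indices J. ennreal (\<theta> j))"
    using J by (intro sum.cong refl) (simp flip: ennreal_mult'')
  finally show ?thesis using assms(2) by simp
qed

lemma evidence_ratio_true:
  fixes g :: "real ^ 'd \<Rightarrow> real" and J :: nat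
  assumes g: "g \<in> prob_densities" and J: "1 \<le> J" and l: "0 < l" "\<And>x. x \<in> unit_cube \<Longrightarrow> l \<le> g x"
    and w: "\<And>i. i \<in> multi_indices J \<Longrightarrow> 0 < w J i"
  shows "(\<integral>\<^sup>+ X. evidence w n X J * (\<Prod>i<n. ennreal (1 / g (X i))) \<partial>sample g n) = 1"
    and "(\<lambda>X. evidence w n X J * (\<Prod>i<n. ennreal (1 / g (X i)))) \<in> borel_measurable (sample g n)"
proof -
  let ?I = "multi_indices J :: (nat ^ 'd) set"
  note vm = prod_densities_measurable_inverse[OF g]
  have Fm: "(\<lambda>_. 1 :: ennreal) \<in> borel_measurable (PiM ?I (\<lambda>_. borel :: real measure))" by simp
  note ton = tonelli_likelihood[OF g J _ Fm vm, where n = n and w = "w J", OF w, simplified]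
  interpret D: prob_space "dirichlet ?I 1 (w J)" using J w by (intro prob_space_dirichlet) auto
  show "(\<lambda>X. evidence w n X J * (\<Prod>i<n. ennreal (1 / g (X i)))) \<in> borel_measurable (sample g n)"
    using ton(2) by simp
  have inner: "(\<integral>\<^sup>+ x. ennreal (histogram J \<theta> x) * ennreal (1 / g x) * ennreal (g x) \<partial>cube_measure) = 1"
    if "(\<forall>i\<in>?I. 0 \<le> \<theta> i) \<and> (\<Sum>i\<in>?I. \<theta> i) = 1" for \<theta> :: "nat ^ 'd \<Rightarrow> real"
  proof -
    have "(\<integral>\<^sup>+ x. ennreal (histogram J \<theta> x) * ennreal (1 / g x) * ennreal (g x) \<partial>cube_measure)
       = (\<integral>\<^sup>+ x. ennreal (histogram J \<theta> x) \<partial>cube_measure)"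
    proof (intro nn_integral_cong)
      fix x :: "real ^ 'd" assume "x \<in> space cube_measure"
      then have "0 < g x" using l(2)[of x] l(1) by simp
      then show "ennreal (histogram J \<theta> x) * ennreal (1 / g x) * ennreal (g x) = ennreal (histogram J \<theta> x)"
        by (simp add: mult.assoc flip: ennreal_mult)
    qed
    then show ?thesis using that J by (simp add: nn_integral_histogram)
  qed
  have "AE \<theta> in dirichlet ?I 1 (w J). (\<forall>i\<in>?I. 0 \<le> \<theta> i) \<and> (\<Sum>i\<in>?I. \<theta> i) = 1"
    using J by (intro AE_dirichlet_simplex) auto
  then have "(\<integral>\<^sup>+ \<theta>. (\<integral>\<^sup>+ x. ennreal (histogram J \<theta> x) * ennreal (1 / g x) * ennreal (g x) \<partial>cube_measure) ^ n \<partial>dirichlet ?I 1 (w J))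
     = (\<integral>\<^sup>+ \<theta>. 1 \<partial>dirichlet ?I 1 (w J))"
    by (intro nn_integral_cong_AE) (auto simp: inner elim: eventually_mono)
  then show "(\<integral>\<^sup>+ X. evidence w n X J * (\<Prod>i<n. ennreal (1 / g (X i))) \<partial>sample g n) = 1"
    using ton(1) D.emeasure_space_1 by simp
qed

text \<open>Relative to the likelihood of g the evidence of each resolution has mean 1, hence so has
  their mixture.\<close>

lemma marginal_likelihood_finite:
  fixes g :: "real ^ 'd \<Rightarrow> real"
  assumes g: "g \<in> prob_densities" and l: "0 < l" "\<And>x. x \<in> unit_cube \<Longrightarrow> l \<le> g x"
    and w: "dirichlet_weights a1 a2 a3 w" "0 < a2" and n: "1 \<le> n" and pi0: "pmf \<pi> 0 = 0"
  shows "AE X in sample g n. marginal_likelihood \<pi> (w n) n X UNIV < \<infinity>"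
proof -
  let ?e = "\<lambda>J X. evidence (w n) n X J * (\<Prod>i<n. ennreal (1 / g (X i)))"
  define h where "h X = (\<Sum>J. ennreal (pmf \<pi> J) * ?e J X)" for X
  have pim: "(\<lambda>X. ennreal (pmf \<pi> J) * ?e J X) \<in> borel_measurable (sample g n)" for J
  proof (cases "J = 0")
    case False
    then show ?thesis using evidence_ratio_true(2)[OF g _ l, of J "w n" n] dirichlet_weights_pos[OF w n]
      by (intro borel_measurable_times_ennreal[OF borel_measurable_const]) auto
  qed (simp add: pi0)
  have "(\<integral>\<^sup>+ X. h X \<partial>sample g n) = (\<Sum>J. \<integral>\<^sup>+ X. ennreal (pmf \<pi> J) * ?e J X \<partial>sample g n)"
    unfolding h_def by (intro nn_integral_suminf pim)
  also have "\<dots> = (\<Sum>J. ennreal (pmf \<pi> J))"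
  proof (intro suminf_cong)
    fix J
    show "(\<integral>\<^sup>+ X. ennreal (pmf \<pi> J) * ?e J X \<partial>sample g n) = ennreal (pmf \<pi> J)"
    proof (cases "J = 0")
      case False
      then show ?thesis
        using evidence_ratio_true[OF g _ l, of J "w n" n] dirichlet_weights_pos[OF w n]
        by (subst nn_integral_cmult) auto
    qed (simp add: pi0)
  qed
  also have "\<dots> = 1"
  proof -
    have "(\<Sum>J. ennreal (pmf \<pi> J)) = (\<integral>\<^sup>+ J. ennreal (pmf \<pi> J) \<partial>count_space UNIV)"
      by (rule nn_integral_count_space_nat[symmetric])
    also have "\<dots> = 1" unfolding nn_integral_pmf using measure_pmf.emeasure_space_1[of \<pi>] by simp
    finally show ?thesis .
  qed
  finally have "(\<integral>\<^sup>+ X. h X \<partial>sample g n) \<noteq> \<infinity>" by simp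
  moreover have "h \<in> borel_measurable (sample g n)" unfolding h_def by (intro borel_measurable_suminf_order pim)
  ultimately have "AE X in sample g n. h X \<noteq> \<infinity>" by (rule nn_integral_PInf_AE[rotated])
  moreover have "AE X in sample g n. \<forall>i<n. X i \<in> unit_cube"
    by (rule AE_sample[OF g]) (use AE_half_open_cube half_open_cube_subset in \<open>auto elim: eventually_mono\<close>)
  ultimately show ?thesis
  proof eventually_elim
    case (elim X)
    have pos: "0 < 1 / g (X i)" if "i < n" for i using elim(2) that l(2)[of "X i"] l(1) by auto
    define r where "r = (\<Prod>i<n. 1 / g (X i))"
    have r: "0 < r" unfolding r_def using pos by (intro prod_pos) auto
    have "h X = marginal_likelihood \<pi> (w n) n X UNIV * ennreal r"
      unfolding h_def marginal_likelihood_UNIV r_def using pos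
      by (subst prod_ennreal[symmetric]) (auto simp: less_imp_le mult.assoc[symmetric])
    then show ?case using elim(1) r by (auto simp: ennreal_mult_eq_top_iff less_top)
  qed
qed

lemma marginal_likelihood_pos:
  fixes g :: "real ^ 'd \<Rightarrow> real" and X :: "nat \<Rightarrow> real ^ 'd"
  assumes g: "g \<in> prob_densities" and l: "0 < l" "\<And>x. x \<in> unit_cube \<Longrightarrow> l \<le> g x"
    and C: "evidence_rate TYPE('d) a1 a2 a3 C" and w: "dirichlet_weights a1 a2 a3 w" and n: "2 \<le> n"
    and prior: "prior_on_J TYPE('d) b1 b2 \<pi>" and X: "\<forall>i<n. X i \<in> half_open_cube"
  shows "0 < marginal_likelihood \<pi> (w n) n X UNIV"
proof -
  \<comment> \<open>The prior is bounded below at J = 2, but may vanish at J = 1.\<close>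
  have "0 < exp (- b1 * real 2 ^ CARD('d) * ln (real 2))" by simp
  also have "\<dots> \<le> pmf \<pi> 2" using prior unfolding prior_on_J_def by (metis order_refl)
  finally have pi: "0 < pmf \<pi> 2" .
  have "0 < (\<Prod>i<n. projection g 2 (X i))"
    using projection_ge[OF g _ l, of 2] l X by (intro prod_pos) (auto intro: less_le_trans)
  then have "0 < real n powr (- C * real 2 ^ CARD('d)) * (\<Prod>i<n. projection g 2 (X i))" using n by simp
  then have "0 < ennreal (real n powr (- C * real 2 ^ CARD('d)) * (\<Prod>i<n. projection g 2 (X i)))" by simp
  also have "\<dots> \<le> evidence (w n) n X 2"
    using C[unfolded evidence_rate_def, THEN conjunct2, rule_format, of w n 2 X "bin_prob g 2"] w n X sum_bin_prob[OF g, of 2]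
    by simp
  finally have "0 < ennreal (pmf \<pi> 2) * evidence (w n) n X 2" using pi by (simp add: ennreal_zero_less_mult_iff)
  then show ?thesis using marginal_likelihood_ge[where J = 2] by (rule less_le_trans)
qed

text \<open>Two probability vectors never differ by more than 2 in the sum norm, so there is nothing to
  show at resolutions whose radius exceeds 2. The remaining resolutions are at most n in
  number, each contributing 1 / n^2.\<close>

lemma posterior_concentration_all:
  fixes g :: "real ^ 'd \<Rightarrow> real" and n :: nat
  assumes g: "g \<in> prob_densities" and l: "0 < l" "\<And>x. x \<in> unit_cube \<Longrightarrow> l \<le> g x"
    and w: "dirichlet_weights a1 a2 a3 w" and a2: "0 < a2" and n: "2 \<le> n" and C: "evidence_rate TYPE('d) a1 a2 a3 C"
    and M: "0 < M" "64 * (C + 4) \<le> M\<^sup>2" and pi0: "pmf \<pi> 0 = 0"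
  shows "\<exists>W\<in>borel_measurable (sample g n).
     (AE X in sample g n. (\<Sum>J. ennreal (pmf \<pi> J) * far_evidence g M (w n) n X J) \<le> marginal_likelihood \<pi> (w n) n X UNIV * W X) \<and>
     (\<integral>\<^sup>+ X. W X \<partial>sample g n) \<le> ennreal (1 / real n)"
proof -
  define S where "S = {J. 1 \<le> J \<and> radius TYPE('d) M n J \<le> 2}"
  have "S \<subseteq> {1..n}"
  proof
    fix J assume J: "J \<in> S"
    have C0: "0 < C" using C by (simp add: evidence_rate_def)
    have ln: "1 / 2 \<le> ln (real n)"
    proof -
      have "1 / 2 \<le> ln (2 :: real)" using ln2_ge_two_thirds by simp
      also have "\<dots> \<le> ln (real n)" using n by simp
      finally show ?thesis .
    qed
    have nn: "0 \<le> real J ^ CARD('d) * ln (real n) / real n" using ln by simp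
    have "0 \<le> radius TYPE('d) M n J" unfolding radius_def using M nn by simp
    then have "(radius TYPE('d) M n J)\<^sup>2 \<le> 2\<^sup>2" using J by (intro power_mono) (auto simp: S_def)
    then have "M\<^sup>2 * (real J ^ CARD('d) * ln (real n) / real n) \<le> 4"
      using nn by (simp add: radius_def power_mult_distrib)
    moreover have "256 * (real J ^ CARD('d) * ln (real n) / real n) \<le> M\<^sup>2 * (real J ^ CARD('d) * ln (real n) / real n)"
      using M C0 nn by (intro mult_right_mono) auto
    ultimately have "64 * (real J ^ CARD('d) * ln (real n) / real n) \<le> 1" by linarith
    then have "64 * (real J ^ CARD('d) * ln (real n)) \<le> real n"
      using n by (simp add: divide_le_eq)
    moreover have "real J ^ CARD('d) * (1 / 2) \<le> real J ^ CARD('d) * ln (real n)" using ln by (intro mult_left_mono) auto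
    ultimately have "real J ^ CARD('d) \<le> real n" 
      using zero_le_power[of "real J" "CARD('d)"] by linarith
    moreover have "real J ^ 1 \<le> real J ^ CARD('d)" using J by (intro power_increasing) (auto simp: S_def Suc_le_eq)
    ultimately have "J \<le> n" by simp
    then show "J \<in> {1..n}" using J by (auto simp: S_def)
  qed
  then have finS: "finite S" and cardS: "card S \<le> n"
    using finite_subset[of S "{1..n}"] card_mono[of "{1..n}" S] by auto
  have "\<forall>J\<in>S. \<exists>R. R \<in> borel_measurable (sample g n) \<and>
     (AE X in sample g n. far_evidence g M (w n) n X J \<le> evidence (w n) n X J * R X) \<and>
     (\<integral>\<^sup>+ X. R X \<partial>sample g n) \<le> ennreal (1 / real n ^ 2)"
    using posterior_concentration[OF g _ l w a2 n C M] by (auto simp: S_def Bex_def)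
  from bchoice[OF this] obtain R where R: "\<And>J. J \<in> S \<Longrightarrow> R J \<in> borel_measurable (sample g n)"
    "\<And>J. J \<in> S \<Longrightarrow> AE X in sample g n. far_evidence g M (w n) n X J \<le> evidence (w n) n X J * R J X"
    "\<And>J. J \<in> S \<Longrightarrow> (\<integral>\<^sup>+ X. R J X \<partial>sample g n) \<le> ennreal (1 / real n ^ 2)"
    by blast
  define W where "W X = (\<Sum>J\<in>S. R J X)" for X
  have W: "W \<in> borel_measurable (sample g n)" unfolding W_def using R(1) by (intro borel_measurable_sum)
  have "(\<integral>\<^sup>+ X. W X \<partial>sample g n) = (\<Sum>J\<in>S. \<integral>\<^sup>+ X. R J X \<partial>sample g n)"
    unfolding W_def using R(1) by (intro nn_integral_sum)
  also have "\<dots> \<le> (\<Sum>J\<in>S. ennreal (1 / real n ^ 2))" using R(3) by (rule sum_mono)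
  also have "\<dots> \<le> ennreal (real n * (1 / real n ^ 2))"
  proof -
    have "(\<Sum>J\<in>S. ennreal (1 / real n ^ 2)) = ennreal (\<Sum>J\<in>S. 1 / real n ^ 2)" by (rule sum_ennreal) simp
    also have "\<dots> \<le> ennreal (real n * (1 / real n ^ 2))"
      using cardS unfolding sum_constant by (intro ennreal_leI mult_right_mono) auto
    finally show ?thesis .
  qed
  also have "real n * (1 / real n ^ 2) = 1 / real n" by (simp add: power2_eq_square)
  finally have Wint: "(\<integral>\<^sup>+ X. W X \<partial>sample g n) \<le> ennreal (1 / real n)" .
  have far0: "far_evidence g M (w n) n X J = 0" if "1 \<le> J" "J \<notin> S" for X J
  proof -
    have "AE \<theta> in dirichlet (multi_indices J) 1 (w n J). (\<forall>i\<in>multi_indices J. 0 \<le> \<theta> i) \<and> (\<Sum>i\<in>multi_indices J. \<theta> i) = 1"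
      using that by (intro AE_dirichlet_simplex) auto
    then have "far_evidence g M (w n) n X J = (\<integral>\<^sup>+ \<theta>. 0 \<partial>dirichlet (multi_indices J) 1 (w n J))"
    proof (intro nn_integral_cong_AE, eventually_elim)
      case (elim \<theta>)
      have "(\<Sum>j\<in>multi_indices J. \<bar>\<theta> j - bin_prob g J j\<bar>) \<le> (\<Sum>j\<in>multi_indices J. \<theta> j + bin_prob g J j)"
        using elim by (intro sum_mono) (smt (verit) bin_prob_nonneg)
      also have "\<dots> = 2" using elim sum_bin_prob[OF g that(1)] by (simp add: sum.distrib)
      finally have "\<theta> \<notin> far_weights g J (radius TYPE('d) M n J)" using that by (auto simp: S_def far_weights_def)
      then show ?case by simp
    qed
    then show ?thesis by simp
  qed
  have "AE X in sample g n. \<forall>J\<in>S. far_evidence g M (w n) n X J \<le> evidence (w n) n X J * R J X"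
    using finS R(2) by (simp add: AE_finite_all)
  then have "AE X in sample g n. (\<Sum>J. ennreal (pmf \<pi> J) * far_evidence g M (w n) n X J) \<le> marginal_likelihood \<pi> (w n) n X UNIV * W X"
  proof eventually_elim
    case (elim X)
    have "(\<Sum>J. ennreal (pmf \<pi> J) * far_evidence g M (w n) n X J) \<le> (\<Sum>J. ennreal (pmf \<pi> J) * evidence (w n) n X J * W X)"
    proof (intro suminf_le summableI)
      fix J
      show "ennreal (pmf \<pi> J) * far_evidence g M (w n) n X J \<le> ennreal (pmf \<pi> J) * evidence (w n) n X J * W X"
      proof (cases "J \<in> S")
        case True
        then have "R J X \<le> W X" unfolding W_def using finS by (intro member_le_sum) auto
        then have "evidence (w n) n X J * R J X \<le> evidence (w n) n X J * W X" by (intro mult_left_mono) auto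
        then show ?thesis using elim True unfolding mult.assoc by (intro mult_left_mono) (auto intro: order_trans)
      next
        case False
        then show ?thesis using far0[of J X] pi0 by (cases "J = 0") auto
      qed
    qed
    also have "\<dots> = marginal_likelihood \<pi> (w n) n X UNIV * W X" unfolding marginal_likelihood_UNIV by simp
    finally show ?case .
  qed
  then show ?thesis using W Wint by blast
qed

section \<open>Acceptance under an alternative\<close>

text \<open>A non-integrable T has integral 0, and an integrable one is dominated by V. This is why
  measurable majorants are constructed throughout, instead of proving that the posterior is a
  measurable function of the sample: its defining event involves an infimum over an
  uncountable class of functions.\<close>

lemma expectation_iid_le:
  assumes T: "\<And>X. 0 \<le> T X" and V: "V \<in> borel_measurable (sample g n)" "AE X in sample g n. ennreal (T X) \<le> V X"
    and b: "(\<integral>\<^sup>+ X. V X \<partial>sample g n) \<le> ennreal b" "0 \<le> b"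
  shows "0 \<le> expectation_iid g n T" "expectation_iid g n T \<le> b"
proof -
  show "0 \<le> expectation_iid g n T" unfolding expectation_iid_def using T by (intro Bochner_Integration.integral_nonneg) auto
  show "expectation_iid g n T \<le> b"
  proof (cases "integrable (sample g n) T")
    case True
    have "ennreal (expectation_iid g n T) = (\<integral>\<^sup>+ X. ennreal (T X) \<partial>sample g n)"
      unfolding expectation_iid_def using True T by (intro nn_integral_eq_integral[symmetric]) auto
    also have "\<dots> \<le> (\<integral>\<^sup>+ X. V X \<partial>sample g n)" by (intro nn_integral_mono_AE V)
    finally show ?thesis using b by (meson ennreal_le_iff order_trans)
  next
    case False
    then show ?thesis using b by (simp add: expectation_iid_def not_integrable_integral_eq)
  qed
qed

lemma ennreal_posterior_le:
  assumes "marginal_likelihood \<pi> w n X B \<le> marginal_likelihood \<pi> w n X UNIV * W"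
  shows "ennreal (posterior \<pi> w n X B) \<le> W"
proof -
  let ?e = "marginal_likelihood \<pi> w n X UNIV"
  have "marginal_likelihood \<pi> w n X B / ?e \<le> W"
  proof (cases "?e = 0 \<or> ?e = \<infinity>")
    case True
    then show ?thesis using assms by auto
  next
    case False
    have "marginal_likelihood \<pi> w n X B / ?e \<le> (?e * W) / ?e" using assms by (intro divide_right_mono_ennreal)
    also have "\<dots> = W" using False by (simp add: ennreal_mult_divide_eq mult.commute)
    finally show ?thesis .
  qed
  moreover have "ennreal (enn2real y) \<le> y" for y by (cases y) auto
  ultimately show ?thesis unfolding posterior_def by (rule order_trans[rotated])
qed

text \<open>The posterior weight of resolution J is at most a statistic V of mean at most b, except
  where the statistic Z is at least 1. The exceptional event is kept apart because it is
  shared by all resolutions and its probability should enter only once.\<close>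

definition weight_bound :: "(real ^ 'd \<Rightarrow> real) \<Rightarrow> nat \<Rightarrow> nat pmf \<Rightarrow> (nat \<Rightarrow> nat ^ 'd \<Rightarrow> real) \<Rightarrow> ((nat \<Rightarrow> real ^ 'd) \<Rightarrow> ennreal) \<Rightarrow> nat \<Rightarrow> real \<Rightarrow> bool" where
  "weight_bound g n \<pi> w Z J b \<longleftrightarrow> (\<exists>V\<in>borel_measurable (sample g n).
     (AE X in sample g n. 1 \<le> Z X \<or> ennreal (pmf \<pi> J) * evidence w n X J \<le> marginal_likelihood \<pi> w n X UNIV * V X) \<and>
     (\<integral>\<^sup>+ X. V X \<partial>sample g n) \<le> ennreal b)"

text \<open>Where the test accepts, the posterior mass of the event is at least \<gamma>. That mass is
  split into bad resolutions, weights far from the bin probabilities, and a remainder that is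
  empty by the last assumption. Markov's inequality then bounds the probability of acceptance.\<close>

lemma acceptance_bound:
  fixes g :: "real ^ 'd \<Rightarrow> real" and n :: nat
  assumes g: "g \<in> prob_densities" and l: "0 < l" "\<And>x. x \<in> unit_cube \<Longrightarrow> l \<le> g x"
    and w: "dirichlet_weights a1 a2 a3 w" and a2: "0 < a2" and n: "2 \<le> n" and C: "evidence_rate TYPE('d) a1 a2 a3 C"
    and M: "0 < M" "64 * (C + 4) \<le> M\<^sup>2" and pi0: "pmf \<pi> 0 = 0" and \<gamma>: "0 < \<gamma>"
    and Bad: "\<And>J. J \<in> Bad \<Longrightarrow> weight_bound g n \<pi> (w n) Z J (b J)"
      "(\<Sum>J. if J \<in> Bad then ennreal (b J) else 0) \<le> ennreal c" "0 \<le> c"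
    and Z: "Z \<in> borel_measurable (sample g n)" "(\<integral>\<^sup>+ X. Z X \<partial>sample g n) \<le> ennreal \<zeta>" "0 \<le> \<zeta>"
    and good: "\<And>J \<theta>. 1 \<le> J \<Longrightarrow> J \<notin> Bad \<Longrightarrow> (\<And>j. j \<in> multi_indices J \<Longrightarrow> 0 \<le> \<theta> j) \<Longrightarrow>
      \<theta> \<notin> far_weights g J (radius TYPE('d) M n J) \<Longrightarrow>
      \<not> d1 (histogram J \<theta>) F_star \<le> ennreal (M0 * sqrt (real J ^ CARD('d) * ln (real n) / real n))"
  shows "expectation_iid g n (\<lambda>X. 1 - monotonicity_test \<pi> (w n) M0 \<gamma> n X) \<le> (\<zeta> + 1 / real n + c) / \<gamma>"
proof -
  define B where "B = {(J, g :: real ^ 'd \<Rightarrow> real). d1 g F_star \<le> ennreal (M0 * sqrt (real J ^ CARD('d) * ln (real n) / real n))}"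
  obtain W where W: "W \<in> borel_measurable (sample g n)"
     "AE X in sample g n. (\<Sum>J. ennreal (pmf \<pi> J) * far_evidence g M (w n) n X J) \<le> marginal_likelihood \<pi> (w n) n X UNIV * W X"
     "(\<integral>\<^sup>+ X. W X \<partial>sample g n) \<le> ennreal (1 / real n)"
    using posterior_concentration_all[OF g l w a2 n C M pi0] by auto
  have "\<forall>J\<in>Bad. \<exists>V. V \<in> borel_measurable (sample g n) \<and>
     (AE X in sample g n. 1 \<le> Z X \<or> ennreal (pmf \<pi> J) * evidence (w n) n X J \<le> marginal_likelihood \<pi> (w n) n X UNIV * V X) \<and>
     (\<integral>\<^sup>+ X. V X \<partial>sample g n) \<le> ennreal (b J)"
    using Bad(1) unfolding weight_bound_def by blast
  from bchoice[OF this] obtain V where V: "\<And>J. J \<in> Bad \<Longrightarrow> V J \<in> borel_measurable (sample g n)"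
    "\<And>J. J \<in> Bad \<Longrightarrow> AE X in sample g n. 1 \<le> Z X \<or> ennreal (pmf \<pi> J) * evidence (w n) n X J \<le> marginal_likelihood \<pi> (w n) n X UNIV * V J X"
    "\<And>J. J \<in> Bad \<Longrightarrow> (\<integral>\<^sup>+ X. V J X \<partial>sample g n) \<le> ennreal (b J)"
    by blast
  define V' where "V' J X = (if J \<in> Bad then V J X else 0)" for J X
  have V'm: "V' J \<in> borel_measurable (sample g n)" for J
  proof -
    have "V' J = (if J \<in> Bad then V J else (\<lambda>_. 0))" by (auto simp: V'_def fun_eq_iff)
    then show ?thesis using V(1)[of J] by (cases "J \<in> Bad") auto
  qed
  \<comment> \<open>Y majorises the posterior mass of B.\<close>
  define Y where "Y X = Z X + (W X + (\<Sum>J. V' J X))" for X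
  have WVm: "(\<lambda>X. W X + (\<Sum>J. V' J X)) \<in> borel_measurable (sample g n)"
    by (intro borel_measurable_add W(1) borel_measurable_suminf_order V'm)
  have Ym: "Y \<in> borel_measurable (sample g n)" unfolding Y_def by (intro borel_measurable_add Z(1) WVm)
  have "(\<integral>\<^sup>+ X. Y X \<partial>sample g n) = (\<integral>\<^sup>+ X. Z X \<partial>sample g n) + ((\<integral>\<^sup>+ X. W X \<partial>sample g n) + (\<Sum>J. \<integral>\<^sup>+ X. V' J X \<partial>sample g n))"
    unfolding Y_def
    by (subst nn_integral_add[OF Z(1) WVm], subst nn_integral_add[OF W(1)], intro borel_measurable_suminf_order V'm,
        subst nn_integral_suminf[OF V'm], rule refl)
  also have "\<dots> \<le> ennreal \<zeta> + (ennreal (1 / real n) + (\<Sum>J. if J \<in> Bad then ennreal (b J) else 0))"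
  proof (intro add_mono suminf_le summableI W(3) Z(2))
    show "(\<integral>\<^sup>+ X. V' J X \<partial>sample g n) \<le> (if J \<in> Bad then ennreal (b J) else 0)" for J
      using V(3)[of J] by (simp add: V'_def)
  qed
  also have "\<dots> \<le> ennreal \<zeta> + (ennreal (1 / real n) + ennreal c)" using Bad(2) by (intro add_left_mono)
  also have "\<dots> = ennreal (\<zeta> + 1 / real n + c)"
    using Bad(3) Z(3) by (simp flip: ennreal_plus add: add.assoc)
  finally have Yint: "(\<integral>\<^sup>+ X. Y X \<partial>sample g n) \<le> ennreal (\<zeta> + 1 / real n + c)" .
  have AEV: "AE X in sample g n. \<forall>J\<in>Bad. 1 \<le> Z X \<or> ennreal (pmf \<pi> J) * evidence (w n) n X J \<le> marginal_likelihood \<pi> (w n) n X UNIV * V J X"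
    using V(2) by (intro AE_ball_countable') auto
  have post: "AE X in sample g n. ennreal (posterior \<pi> (w n) n X B) \<le> Y X"
    using W(2) AEV
  proof eventually_elim
    case (elim X)
    let ?e = "marginal_likelihood \<pi> (w n) n X UNIV"
    show ?case
    proof (cases "1 \<le> Z X")
      case True
      have "marginal_likelihood \<pi> (w n) n X B \<le> ?e * 1"
        unfolding marginal_likelihood_suminf mult_1_right
        by (intro suminf_le summableI mult_left_mono nn_integral_mono) (auto simp: indicator_def)
      then have "ennreal (posterior \<pi> (w n) n X B) \<le> 1" by (rule ennreal_posterior_le)
      also have "1 \<le> Y X" using True by (simp add: Y_def add_increasing2)
      finally show ?thesis .
    next
      case Zsmall: False
      have "marginal_likelihood \<pi> (w n) n X B \<le> (\<Sum>J. ennreal (pmf \<pi> J) * far_evidence g M (w n) n X J + ?e * V' J X)"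
        unfolding marginal_likelihood_suminf[of \<pi> "w n" n X B]
      proof (intro suminf_le summableI)
        fix J
        let ?N = "\<integral>\<^sup>+ \<theta>. indicator B (J, histogram J \<theta>) * ennreal (\<Prod>i<n. histogram J \<theta> (X i)) \<partial>dirichlet (multi_indices J) 1 (w n J)"
        show "ennreal (pmf \<pi> J) * ?N \<le> ennreal (pmf \<pi> J) * far_evidence g M (w n) n X J + ?e * V' J X"
        proof (cases "J \<in> Bad")
          case True
          have "?N \<le> evidence (w n) n X J" by (intro nn_integral_mono) (auto simp: indicator_def)
          then have "ennreal (pmf \<pi> J) * ?N \<le> ennreal (pmf \<pi> J) * evidence (w n) n X J" by (intro mult_left_mono) auto
          also have "\<dots> \<le> ?e * V' J X" using elim(2) True Zsmall by (auto simp: V'_def)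
          also have "\<dots> \<le> ennreal (pmf \<pi> J) * far_evidence g M (w n) n X J + ?e * V' J X" by simp
          finally show ?thesis .
        next
          case False
          show ?thesis
          proof (cases "J = 0")
            case J: False
            have "AE \<theta> in dirichlet (multi_indices J) 1 (w n J). (\<forall>i\<in>multi_indices J. 0 \<le> \<theta> i) \<and> (\<Sum>i\<in>multi_indices J. \<theta> i) = 1"
              using J by (intro AE_dirichlet_simplex) auto
            then have "?N \<le> far_evidence g M (w n) n X J"
            proof (intro nn_integral_mono_AE, eventually_elim)
              case (elim \<theta>)
              then show ?case using good[of J \<theta>] False J by (auto simp: indicator_def B_def)
            qed
            then have "ennreal (pmf \<pi> J) * ?N \<le> ennreal (pmf \<pi> J) * far_evidence g M (w n) n X J" by (intro mult_left_mono) auto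
            then show ?thesis by (rule order_trans) simp
          qed (simp add: pi0)
        qed
      qed
      also have "\<dots> = (\<Sum>J. ennreal (pmf \<pi> J) * far_evidence g M (w n) n X J) + ?e * (\<Sum>J. V' J X)"
        by (subst suminf_add[symmetric]) (auto intro: summableI)
      also have "\<dots> \<le> ?e * W X + ?e * (\<Sum>J. V' J X)" using elim(1) by (intro add_right_mono)
      also have "\<dots> = ?e * (W X + (\<Sum>J. V' J X))" by (simp add: distrib_left)
      also have "\<dots> \<le> ?e * Y X" unfolding Y_def by (intro mult_left_mono add_increasing order_refl zero_le)
      finally show ?thesis by (rule ennreal_posterior_le)
    qed
  qed
  have T: "0 \<le> 1 - monotonicity_test \<pi> (w n) M0 \<gamma> n X" for X by (simp add: monotonicity_test_def)
  have TZ: "AE X in sample g n. ennreal (1 - monotonicity_test \<pi> (w n) M0 \<gamma> n X) \<le> ennreal (1 / \<gamma>) * Y X"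
    using post
  proof eventually_elim
    case (elim X)
    show ?case
    proof (cases "posterior \<pi> (w n) n X B < \<gamma>")
      case True
      then show ?thesis by (simp add: monotonicity_test_def B_def)
    next
      case False
      then have "ennreal 1 \<le> ennreal (1 / \<gamma> * posterior \<pi> (w n) n X B)" using \<gamma> by (intro ennreal_leI) (simp add: field_simps)
      also have "\<dots> = ennreal (1 / \<gamma>) * ennreal (posterior \<pi> (w n) n X B)" using \<gamma> by (intro ennreal_mult') auto
      also have "\<dots> \<le> ennreal (1 / \<gamma>) * Y X" using elim by (intro mult_left_mono) auto
      finally show ?thesis using False by (simp add: monotonicity_test_def B_def)
    qed
  qed
  have VI: "(\<integral>\<^sup>+ X. ennreal (1 / \<gamma>) * Y X \<partial>sample g n) \<le> ennreal ((\<zeta> + 1 / real n + c) / \<gamma>)"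
  proof -
    have "(\<integral>\<^sup>+ X. ennreal (1 / \<gamma>) * Y X \<partial>sample g n) \<le> ennreal (1 / \<gamma>) * ennreal (\<zeta> + 1 / real n + c)"
      using Ym Yint by (subst nn_integral_cmult) (auto intro: mult_left_mono)
    also have "ennreal (1 / \<gamma>) * ennreal (\<zeta> + 1 / real n + c) = ennreal (1 / \<gamma> * (\<zeta> + 1 / real n + c))"
      using \<gamma> by (intro ennreal_mult'[symmetric]) auto
    finally show ?thesis by simp
  qed
  have nn: "0 \<le> (\<zeta> + 1 / real n + c) / \<gamma>" using \<gamma> Bad(3) Z(3) by simp
  have m: "(\<lambda>X. ennreal (1 / \<gamma>) * Y X) \<in> borel_measurable (sample g n)" using Ym by simp
  show ?thesis by (rule expectation_iid_le(2)[OF T m TZ VI nn])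
qed

section \<open>Rejection under the hypothesis\<close>

lemma nn_integral_lebesgue_translation:
  fixes f :: "'a :: euclidean_space \<Rightarrow> ennreal"
  assumes [measurable]: "f \<in> borel_measurable lebesgue"
  shows "(\<integral>\<^sup>+ x. f (v + x) \<partial>lebesgue) = (\<integral>\<^sup>+ x. f x \<partial>lebesgue)"
proof -
  have T: "(\<lambda>x. v + (\<Sum>j\<in>Basis. (1 * (x \<bullet> j)) *\<^sub>R j)) = (\<lambda>x. v + x)"
    by (simp add: euclidean_representation)
  have L: "lebesgue = density (distr lebesgue lebesgue (\<lambda>x. v + x)) (\<lambda>_. 1)"
    using lebesgue_affine_euclidean[where c = "\<lambda>_. 1" and t = v] unfolding T by simp
  have M [measurable]: "(\<lambda>x. v + x) \<in> lebesgue \<rightarrow>\<^sub>M lebesgue"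
    using lebesgue_affine_measurable[where c = "\<lambda>_. 1" and t = v] unfolding T by simp
  have "(\<integral>\<^sup>+ x. f x \<partial>lebesgue) = (\<integral>\<^sup>+ x. f x \<partial>distr lebesgue lebesgue (\<lambda>x. v + x))"
    by (subst (1) L) (simp add: density_1)
  also have "\<dots> = (\<integral>\<^sup>+ x. f (v + x) \<partial>lebesgue)"
    by (rule nn_integral_distr) measurable
  finally show ?thesis by simp
qed

text \<open>The translation that takes bin i onto bin j increases all coordinates, hence decreases g.\<close>

lemma bin_prob_antimono:
  fixes g :: "real ^ 'd \<Rightarrow> real"
  assumes g: "g \<in> G_star" and J: "1 \<le> J" and ij: "i \<in> multi_indices J" "j \<in> multi_indices J" "i \<le> j"
  shows "bin_prob g J j \<le> bin_prob g J i"
proof -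
  have gp: "g \<in> prob_densities" and mono: "\<And>x y. x \<in> unit_cube \<Longrightarrow> y \<in> unit_cube \<Longrightarrow> y \<le> x \<Longrightarrow> g x \<le> g y"
    using g by (auto simp: G_star_def F_star_def)
  define v :: "real ^ 'd" where "v = (\<chi> k. (real (j $ k) - real (i $ k)) / real J)"
  have v0: "0 \<le> v $ k" for k using ij(3) by (simp add: v_def less_eq_vec_def)
  define h where "h k x = ennreal (g x) * indicator (bin J k) x" for k x
  have gm: "(\<lambda>x. ennreal (g x)) \<in> borel_measurable cube_measure"
    using prob_densities_measurable[OF gp] by measurable
  have hm: "h k \<in> borel_measurable lebesgue" if "k \<in> multi_indices J" for k
  proof -
    have "(\<lambda>x. ennreal (g x) * indicator unit_cube x) \<in> borel_measurable lebesgue"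
      using gm by (subst (asm) borel_measurable_restrict_space_iff_ennreal[OF unit_cube_sets])
    moreover have "indicator (bin J k) \<in> borel_measurable (lebesgue :: (real ^ 'd) measure)"
      by (intro measurable_completion) simp
    ultimately have "(\<lambda>x. ennreal (g x) * indicator unit_cube x * indicator (bin J k) x) \<in> borel_measurable lebesgue"
      by (rule borel_measurable_times_ennreal)
    also have "(\<lambda>x. ennreal (g x) * indicator unit_cube x * indicator (bin J k) x) = h k"
      using bin_subset_unit_cube[OF J that] by (auto simp: h_def indicator_def fun_eq_iff)
    finally show ?thesis .
  qed
  have p: "ennreal (bin_prob g J k) = (\<integral>\<^sup>+ x. h k x \<partial>lebesgue)" if k: "k \<in> multi_indices J" for k
  proof -
    have "ennreal (bin_prob g J k) = (\<integral>\<^sup>+ x. ennreal (g x) * indicator (bin J k) x \<partial>cube_measure)"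
      unfolding emeasure_obs_bin[OF gp, symmetric] using gm bin_cube_sets[OF J k] by (intro emeasure_density) auto
    also have "\<dots> = (\<integral>\<^sup>+ x. h k x * indicator unit_cube x \<partial>lebesgue)"
      unfolding h_def by (rule nn_integral_restrict_space[OF unit_cube_sets])
    also have "\<dots> = (\<integral>\<^sup>+ x. h k x \<partial>lebesgue)"
      using bin_subset_unit_cube[OF J k] by (intro nn_integral_cong) (auto simp: h_def indicator_def)
    finally show ?thesis .
  qed
  have le: "h j (v + x) \<le> h i x" for x
  proof (cases "v + x \<in> bin J j")
    case True
    have xi: "x \<in> bin J i"
    proof (cases "j = 1")
      case True
      have "i = 1" using ij True by (auto simp: vec_eq_iff less_eq_vec_def multi_indices_def intro: antisym)
      then have "v = 0" using True by (simp add: v_def vec_eq_iff)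
      then show ?thesis using \<open>v + x \<in> bin J j\<close> \<open>i = 1\<close> True by simp
    next
      case False
      have "(real (j $ k) - 1) / real J < v $ k + x $ k \<and> v $ k + x $ k \<le> real (j $ k) / real J" for k
        using \<open>v + x \<in> bin J j\<close> False by (simp add: bin_def)
      moreover have "(real (j $ k) - 1) / real J = (real (i $ k) - 1) / real J + v $ k"
          "real (j $ k) / real J = real (i $ k) / real J + v $ k" for k
        by (simp_all add: v_def flip: add_divide_distrib)
      ultimately have *: "(real (i $ k) - 1) / real J < x $ k \<and> x $ k \<le> real (i $ k) / real J" for k
        by (smt (verit))
      show ?thesis
      proof (cases "i = 1")
        case True
        then have "0 < x $ k \<and> x $ k \<le> 1 / real J" for k using *[of k] by simp
        then show ?thesis using True by (simp add: bin_def less_imp_le)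
      next
        case False
        then show ?thesis using * by (simp add: bin_def)
      qed
    qed
    then have "x \<in> unit_cube" "v + x \<in> unit_cube"
      using bin_subset_unit_cube[OF J ij(1)] bin_subset_unit_cube[OF J ij(2)] True by auto
    then have "g (v + x) \<le> g x" using v0 by (intro mono) (auto simp: less_eq_vec_def)
    then show ?thesis using xi True by (simp add: h_def ennreal_leI)
  qed (simp add: h_def)
  have "ennreal (bin_prob g J j) = (\<integral>\<^sup>+ x. h j (v + x) \<partial>lebesgue)"
    using p[OF ij(2)] nn_integral_lebesgue_translation[OF hm[OF ij(2)]] by simp
  also have "\<dots> \<le> (\<integral>\<^sup>+ x. h i x \<partial>lebesgue)" using le by (intro nn_integral_mono)
  also have "\<dots> = ennreal (bin_prob g J i)" using p[OF ij(1)] by simp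
  finally show ?thesis by simp
qed

lemma L1_norm_cong_AE: "AE x in cube_measure. f x = h x \<Longrightarrow> L1_norm f = L1_norm h"
  unfolding L1_norm_def by (intro nn_integral_cong_AE) (auto elim: eventually_mono)

lemma L1_norm_histogram_diff:
  fixes \<theta> \<eta> :: "nat ^ 'd \<Rightarrow> real"
  assumes J: "1 \<le> J"
  shows "L1_norm (\<lambda>x. histogram J \<theta> x - histogram J \<eta> x) = ennreal (\<Sum>j\<in>multi_indices J. \<bar>\<theta> j - \<eta> j\<bar>)"
proof -
  have "L1_norm (\<lambda>x. histogram J \<theta> x - histogram J \<eta> x)
     = (\<integral>\<^sup>+ x. ennreal (real J ^ CARD('d) * \<bar>\<theta> (cell J x) - \<eta> (cell J x)\<bar>) \<partial>cube_measure)"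
    unfolding L1_norm_def
    by (intro nn_integral_cong_AE)
      (use AE_half_open_cube in eventually_elim, simp add: histogram_cell[OF J] abs_mult flip: right_diff_distrib)
  also have "\<dots> = (\<Sum>j\<in>multi_indices J. ennreal (real J ^ CARD('d) * \<bar>\<theta> j - \<eta> j\<bar>) * ennreal (1 / real J ^ CARD('d)))"
    by (rule nn_integral_cube_cell[OF J])
  also have "\<dots> = (\<Sum>j\<in>multi_indices J. ennreal \<bar>\<theta> j - \<eta> j\<bar>)"
    using J by (intro sum.cong refl) (simp flip: ennreal_mult'')
  finally show ?thesis by simp
qed

lemma d1_le: "s \<in> S \<Longrightarrow> d1 f S \<le> L1_norm (\<lambda>x. f x - s x)"
  unfolding d1_def by (rule INF_lower)

text \<open>The histogram of the bin probabilities is decreasing except possibly on the lower faces of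
  the cube, where some points lie in no bin. The comparison function h repairs this on a null
  set.\<close>

lemma d1_histogram_monotone:
  fixes g :: "real ^ 'd \<Rightarrow> real"
  assumes g: "g \<in> G_star" and J: "1 \<le> J"
  shows "d1 (histogram J \<theta>) F_star \<le> ennreal (\<Sum>j\<in>multi_indices J. \<bar>\<theta> j - bin_prob g J j\<bar>)"
proof -
  define c :: "real ^ 'd \<Rightarrow> nat ^ 'd" where "c x = (\<chi> k. max 1 (cell J x $ k))" for x
  define h where "h x = real J ^ CARD('d) * bin_prob g J (c x)" for x
  have c: "c x \<in> multi_indices J" if "x \<in> unit_cube" for x
  proof -
    have "nat \<lceil>real J * x $ k\<rceil> \<le> J" for k
    proof -
      have "real J * x $ k \<le> real J * 1" using that by (intro mult_left_mono) (auto simp: unit_cube_def mem_box_cart)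
      then show ?thesis by (simp add: nat_le_iff ceiling_le_iff)
    qed
    then show ?thesis using J by (auto simp: multi_indices_def c_def cell_def)
  qed
  have "c y \<le> c x" if "y \<le> x" for x y
  proof -
    have "nat \<lceil>real J * y $ k\<rceil> \<le> nat \<lceil>real J * x $ k\<rceil>" for k
      using that by (intro nat_mono ceiling_mono mult_left_mono) (auto simp: less_eq_vec_def)
    then have "max 1 (nat \<lceil>real J * y $ k\<rceil>) \<le> max 1 (nat \<lceil>real J * x $ k\<rceil>)" for k by (meson max.mono order_refl)
    then show ?thesis by (simp add: less_eq_vec_def c_def cell_def)
  qed
  then have "h \<in> F_star"
    using c J by (auto simp: F_star_def h_def intro!: mult_left_mono bin_prob_antimono[OF g J])
  then have "d1 (histogram J \<theta>) F_star \<le> L1_norm (\<lambda>x. histogram J \<theta> x - h x)" by (rule d1_le)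
  also have "\<dots> = L1_norm (\<lambda>x. histogram J \<theta> x - projection g J x)"
  proof (rule L1_norm_cong_AE, use AE_half_open_cube in eventually_elim)
    case (elim x)
    have "cell J x \<in> multi_indices J" using elim J by auto
    then have "c x = cell J x" by (simp add: c_def multi_indices_def vec_eq_iff max_def)
    then show ?case by (simp add: h_def histogram_cell[OF J elim])
  qed
  also have "\<dots> = ennreal (\<Sum>j\<in>multi_indices J. \<bar>\<theta> j - bin_prob g J j\<bar>)" by (rule L1_norm_histogram_diff[OF J])
  finally show ?thesis .
qed

text \<open>Weights within the radius of the bin probabilities satisfy the event in the posterior, so
  its complement has at most the posterior mass of the far weights.\<close>

lemma rejection_bound:
  fixes g :: "real ^ 'd \<Rightarrow> real" and n :: nat
  assumes g: "g \<in> G_star" and l: "0 < l" "\<And>x. x \<in> unit_cube \<Longrightarrow> l \<le> g x"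
    and w: "dirichlet_weights a1 a2 a3 w" and a2: "0 < a2" and n: "2 \<le> n" and C: "evidence_rate TYPE('d) a1 a2 a3 C"
    and M: "0 < M" "64 * (C + 4) \<le> M\<^sup>2" and prior: "prior_on_J TYPE('d) b1 b2 \<pi>" and \<gamma>: "\<gamma> < 1"
  shows "0 \<le> expectation_iid g n (monotonicity_test \<pi> (w n) M \<gamma> n)"
    "expectation_iid g n (monotonicity_test \<pi> (w n) M \<gamma> n) \<le> 1 / real n / (1 - \<gamma>)"
proof -
  have gp: "g \<in> prob_densities" using g by (simp add: G_star_def)
  have pi0: "pmf \<pi> 0 = 0" using prior by (simp add: prior_on_J_def)
  define B where "B = {(J, g :: real ^ 'd \<Rightarrow> real). d1 g F_star \<le> ennreal (M * sqrt (real J ^ CARD('d) * ln (real n) / real n))}"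
  obtain W where W: "W \<in> borel_measurable (sample g n)"
     "AE X in sample g n. (\<Sum>J. ennreal (pmf \<pi> J) * far_evidence g M (w n) n X J) \<le> marginal_likelihood \<pi> (w n) n X UNIV * W X"
     "(\<integral>\<^sup>+ X. W X \<partial>sample g n) \<le> ennreal (1 / real n)"
    using posterior_concentration_all[OF gp l w a2 n C M pi0] by auto
  have fin: "AE X in sample g n. marginal_likelihood \<pi> (w n) n X UNIV < \<infinity>"
    using n by (intro marginal_likelihood_finite[OF gp l w a2 _ pi0]) auto
  have cube: "AE X in sample g n. \<forall>i<n. X i \<in> half_open_cube" by (rule AE_sample[OF gp AE_half_open_cube])
  \<comment> \<open>The complement of B has posterior mass at most W.\<close>
  have key: "AE X in sample g n. 1 \<le> ennreal (posterior \<pi> (w n) n X B) + W X"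
    using W(2) fin cube
  proof eventually_elim
    case (elim X)
    let ?e = "marginal_likelihood \<pi> (w n) n X UNIV"
    have epos: "0 < ?e" by (rule marginal_likelihood_pos[OF gp l C w n prior elim(3)])
    have "?e \<le> (\<Sum>J. ennreal (pmf \<pi> J) * (\<integral>\<^sup>+ \<theta>. indicator B (J, histogram J \<theta>) * ennreal (\<Prod>i<n. histogram J \<theta> (X i))
         \<partial>dirichlet (multi_indices J) 1 (w n J)) + ennreal (pmf \<pi> J) * far_evidence g M (w n) n X J)"
      unfolding marginal_likelihood_UNIV
    proof (intro suminf_le summableI)
      fix J
      let ?D = "dirichlet (multi_indices J) 1 (w n J)"
      let ?far = "far_weights g J (radius TYPE('d) M n J)"
      let ?lik = "\<lambda>\<theta>. ennreal (\<Prod>i<n. histogram J \<theta> (X i))"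
      let ?N = "\<integral>\<^sup>+ \<theta>. indicator B (J, histogram J \<theta>) * ?lik \<theta> \<partial>?D"
      show "ennreal (pmf \<pi> J) * evidence (w n) n X J \<le> ennreal (pmf \<pi> J) * ?N + ennreal (pmf \<pi> J) * far_evidence g M (w n) n X J"
      proof (cases "J = 0")
        case J: False
        have sD: "sets ?D = sets (PiM (multi_indices J) (\<lambda>_. borel))" by simp
        have lm: "?lik \<in> borel_measurable ?D"
        proof -
          have "(\<lambda>\<theta>. histogram J \<theta> (X i)) \<in> borel_measurable ?D" for i
            unfolding histogram_def measurable_cong_sets[OF sD refl] by measurable
          then show ?thesis by measurable
        qed
        have fm: "(indicator ?far :: _ \<Rightarrow> ennreal) \<in> borel_measurable ?D"
          unfolding measurable_cong_sets[OF sD refl] by (rule far_weights_measurable)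
        have cm: "(\<lambda>\<theta>. 1 - indicator ?far \<theta> :: ennreal) \<in> borel_measurable ?D" using fm by measurable
        have "evidence (w n) n X J = (\<integral>\<^sup>+ \<theta>. (1 - indicator ?far \<theta>) * ?lik \<theta> + indicator ?far \<theta> * ?lik \<theta> \<partial>?D)"
          by (intro nn_integral_cong) (auto simp: indicator_def)
        also have "\<dots> = (\<integral>\<^sup>+ \<theta>. (1 - indicator ?far \<theta>) * ?lik \<theta> \<partial>?D) + far_evidence g M (w n) n X J"
          using lm fm cm by (intro nn_integral_add borel_measurable_times_ennreal)
        also have "(\<integral>\<^sup>+ \<theta>. (1 - indicator ?far \<theta>) * ?lik \<theta> \<partial>?D) \<le> ?N"
        proof (intro nn_integral_mono)
          fix \<theta>
          have "\<theta> \<notin> ?far \<Longrightarrow> (J, histogram J \<theta>) \<in> B"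
          proof -
            assume "\<theta> \<notin> ?far"
            then have "(\<Sum>j\<in>multi_indices J. \<bar>\<theta> j - bin_prob g J j\<bar>) \<le> M * sqrt (real J ^ CARD('d) * ln (real n) / real n)"
              by (simp add: far_weights_def radius_def)
            then have "ennreal (\<Sum>j\<in>multi_indices J. \<bar>\<theta> j - bin_prob g J j\<bar>) \<le> ennreal (M * sqrt (real J ^ CARD('d) * ln (real n) / real n))"
              by (rule ennreal_leI)
            then show ?thesis using d1_histogram_monotone[OF g, of J \<theta>] J by (auto simp: B_def)
          qed
          then show "(1 - indicator ?far \<theta>) * ?lik \<theta> \<le> indicator B (J, histogram J \<theta>) * ?lik \<theta>"
            by (auto simp: indicator_def)
        qed
        finally have "evidence (w n) n X J \<le> ?N + far_evidence g M (w n) n X J" by (simp add: add_right_mono)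
        then show ?thesis by (simp add: mult_left_mono flip: distrib_left)
      qed (simp add: pi0)
    qed
    also have "\<dots> = marginal_likelihood \<pi> (w n) n X B + (\<Sum>J. ennreal (pmf \<pi> J) * far_evidence g M (w n) n X J)"
      unfolding marginal_likelihood_suminf[of \<pi> "w n" n X B] by (intro suminf_add[symmetric] summableI)
    also have "\<dots> \<le> marginal_likelihood \<pi> (w n) n X B + ?e * W X" using elim(1) by (intro add_left_mono)
    finally have le: "?e \<le> marginal_likelihood \<pi> (w n) n X B + ?e * W X" .
    have mB: "marginal_likelihood \<pi> (w n) n X B \<le> ?e"
      unfolding marginal_likelihood_suminf by (intro suminf_le summableI mult_left_mono nn_integral_mono) (auto simp: indicator_def)
    have "1 = ?e / ?e" using epos elim(2) by (simp add: ennreal_divide_self)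
    also have "\<dots> \<le> (marginal_likelihood \<pi> (w n) n X B + ?e * W X) / ?e" by (intro divide_right_mono_ennreal le)
    also have "\<dots> = marginal_likelihood \<pi> (w n) n X B / ?e + W X"
      using epos elim(2) by (simp add: add_divide_distrib_ennreal ennreal_mult_divide_eq mult.commute[of ?e])
    also have "marginal_likelihood \<pi> (w n) n X B / ?e = ennreal (posterior \<pi> (w n) n X B)"
    proof -
      have "marginal_likelihood \<pi> (w n) n X B / ?e \<le> ?e / ?e" by (intro divide_right_mono_ennreal mB)
      also have "\<dots> = 1" using epos elim(2) by (simp add: ennreal_divide_self)
      finally have "marginal_likelihood \<pi> (w n) n X B / ?e < \<infinity>" by (auto simp: less_top[symmetric] top_unique)
      then show ?thesis unfolding posterior_def by simp
    qed
    finally show ?case .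
  qed
  have T: "0 \<le> monotonicity_test \<pi> (w n) M \<gamma> n X" for X by (simp add: monotonicity_test_def)
  have TZ: "AE X in sample g n. ennreal (monotonicity_test \<pi> (w n) M \<gamma> n X) \<le> ennreal (1 / (1 - \<gamma>)) * W X"
    using key
  proof eventually_elim
    case (elim X)
    show ?case
    proof (cases "posterior \<pi> (w n) n X B < \<gamma>")
      case False
      then show ?thesis by (simp add: monotonicity_test_def B_def)
    next
      case True
      have "ennreal (1 - \<gamma>) \<le> W X"
      proof (rule ccontr)
        assume "\<not> ennreal (1 - \<gamma>) \<le> W X"
        then have "W X < ennreal (1 - \<gamma>)" by simp
        have p0: "0 \<le> posterior \<pi> (w n) n X B" by (simp add: posterior_def)
        have "ennreal (posterior \<pi> (w n) n X B) + W X < ennreal \<gamma> + ennreal (1 - \<gamma>)"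
          using True p0 \<open>W X < ennreal (1 - \<gamma>)\<close> by (intro add_strict_mono) (auto intro!: ennreal_lessI)
        also have "\<dots> = ennreal 1" using True p0 \<gamma> by (subst ennreal_plus[symmetric]) auto
        finally show False using elim by simp
      qed
      then have "ennreal (1 / (1 - \<gamma>)) * ennreal (1 - \<gamma>) \<le> ennreal (1 / (1 - \<gamma>)) * W X" by (intro mult_left_mono) auto
      then show ?thesis using True \<gamma> by (simp add: monotonicity_test_def B_def flip: ennreal_mult')
    qed
  qed
  have VI: "(\<integral>\<^sup>+ X. ennreal (1 / (1 - \<gamma>)) * W X \<partial>sample g n) \<le> ennreal (1 / real n / (1 - \<gamma>))"
  proof -
    have "(\<integral>\<^sup>+ X. ennreal (1 / (1 - \<gamma>)) * W X \<partial>sample g n) \<le> ennreal (1 / (1 - \<gamma>)) * ennreal (1 / real n)"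
      using W(1,3) by (subst nn_integral_cmult) (auto intro: mult_left_mono)
    also have "\<dots> = ennreal (1 / (1 - \<gamma>) * (1 / real n))"
      using \<gamma> by (intro ennreal_mult'[symmetric]) auto
    finally show ?thesis by (simp add: mult.commute)
  qed
  have m: "(\<lambda>X. ennreal (1 / (1 - \<gamma>)) * W X) \<in> borel_measurable (sample g n)" using W(1) by simp
  have nn: "0 \<le> 1 / real n / (1 - \<gamma>)" using \<gamma> by simp
  show "0 \<le> expectation_iid g n (monotonicity_test \<pi> (w n) M \<gamma> n)"
    "expectation_iid g n (monotonicity_test \<pi> (w n) M \<gamma> n) \<le> 1 / real n / (1 - \<gamma>)"
    using expectation_iid_le[OF T m TZ VI nn] by auto
qed

section \<open>Distances to decreasing functions and densities\<close>

text \<open>Subadditivity holds with one measurable summand: a simple function below u + v splits into u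
  and its excess over u, which is measurable and lies below v. The second summand is often a
  difference from an arbitrary decreasing function.\<close>

lemma nn_integral_add_le:
  assumes [measurable]: "u \<in> borel_measurable M"
  shows "(\<integral>\<^sup>+ x. u x + v x \<partial>M) \<le> (\<integral>\<^sup>+ x. u x \<partial>M) + (\<integral>\<^sup>+ x. v x \<partial>M)"
proof -
  have "integral\<^sup>S M s \<le> (\<integral>\<^sup>+ x. u x \<partial>M) + (\<integral>\<^sup>+ x. v x \<partial>M)"
    if s: "simple_function M s" "s \<le> (\<lambda>x. u x + v x)" for s
  proof -
    have [measurable]: "s \<in> borel_measurable M" using s(1) by (rule borel_measurable_simple_function)
    have "integral\<^sup>S M s = (\<integral>\<^sup>+ x. s x \<partial>M)" using s(1) by (simp add: nn_integral_eq_simple_integral)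
    also have "\<dots> \<le> (\<integral>\<^sup>+ x. u x + (if u x = \<top> then 0 else s x - u x) \<partial>M)"
    proof (intro nn_integral_mono)
      fix x show "s x \<le> u x + (if u x = \<top> then 0 else s x - u x)"
        by (cases "u x \<le> s x") (simp_all add: add_diff_inverse_ennreal add_increasing2)
    qed
    also have "\<dots> = (\<integral>\<^sup>+ x. u x \<partial>M) + (\<integral>\<^sup>+ x. (if u x = \<top> then 0 else s x - u x) \<partial>M)" by (intro nn_integral_add) auto
    also have "\<dots> \<le> (\<integral>\<^sup>+ x. u x \<partial>M) + (\<integral>\<^sup>+ x. v x \<partial>M)"
    proof (intro add_left_mono nn_integral_mono)
      fix x
      have "s x \<le> u x + v x" using s(2) by (auto simp: le_fun_def)
      then show "(if u x = \<top> then 0 else s x - u x) \<le> v x" by (simp add: ennreal_minus_le_iff)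
    qed
    finally show ?thesis .
  qed
  then show ?thesis unfolding nn_integral_def[of M "\<lambda>x. u x + v x"] by (intro SUP_least) auto
qed

lemma L1_norm_triangle:
  assumes "(\<lambda>x. f x - h x) \<in> borel_measurable cube_measure"
  shows "L1_norm (\<lambda>x. f x - k x) \<le> L1_norm (\<lambda>x. f x - h x) + L1_norm (\<lambda>x. h x - k x)"
proof -
  have "L1_norm (\<lambda>x. f x - k x) \<le> (\<integral>\<^sup>+ x. ennreal \<bar>f x - h x\<bar> + ennreal \<bar>h x - k x\<bar> \<partial>cube_measure)"
    unfolding L1_norm_def by (intro nn_integral_mono) (auto simp flip: ennreal_plus intro!: ennreal_leI)
  also have "\<dots> \<le> L1_norm (\<lambda>x. f x - h x) + L1_norm (\<lambda>x. h x - k x)"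
    unfolding L1_norm_def
    by (intro nn_integral_add_le measurable_compose[OF borel_measurable_abs[OF assms] measurable_ennreal])
  finally show ?thesis .
qed

lemma L1_norm_minus_commute: "L1_norm (\<lambda>x. f x - h x) = L1_norm (\<lambda>x. h x - f x)"
  by (simp add: L1_norm_def abs_minus_commute)

lemma d1_triangle:
  assumes "(\<lambda>x. f x - h x) \<in> borel_measurable cube_measure"
  shows "d1 f S \<le> L1_norm (\<lambda>x. f x - h x) + d1 h S"
proof (cases "L1_norm (\<lambda>x. f x - h x) = \<top>")
  case False
  have "d1 f S - L1_norm (\<lambda>x. f x - h x) \<le> d1 h S"
    unfolding d1_def[of h S]
  proof (rule INF_greatest)
    fix s assume "s \<in> S"
    then have "d1 f S \<le> L1_norm (\<lambda>x. f x - h x) + L1_norm (\<lambda>x. h x - s x)"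
      by (rule order_trans[OF d1_le L1_norm_triangle[OF assms]])
    then show "d1 f S - L1_norm (\<lambda>x. f x - h x) \<le> L1_norm (\<lambda>x. h x - s x)"
      using False by (simp add: ennreal_minus_le_iff)
  qed
  then show ?thesis using False by (simp add: ennreal_minus_le_iff)
qed simp

lemma one_in_G_star: "(\<lambda>_ :: real ^ 'd. 1) \<in> G_star"
proof -
  interpret prob_space "cube_measure :: (real ^ 'd) measure" by (rule prob_space_cube_measure)
  have "has_bochner_integral cube_measure (\<lambda>_ :: real ^ 'd. 1 :: real) 1"
    unfolding has_bochner_integral_iff using prob_space by simp
  then show ?thesis by (auto simp: G_star_def F_star_def prob_densities_def)
qed

lemma L1_norm_eq_integral:
  "integrable cube_measure f \<Longrightarrow> L1_norm f = ennreal (LINT x|cube_measure. \<bar>f x\<bar>)"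
  unfolding L1_norm_def by (intro nn_integral_eq_integral) auto

lemma prob_densities_integrable: "g \<in> prob_densities \<Longrightarrow> integrable cube_measure g"
  and prob_densities_integral: "g \<in> prob_densities \<Longrightarrow> (LINT x|cube_measure. g x) = 1"
  and prob_densities_nonneg: "g \<in> prob_densities \<Longrightarrow> x \<in> unit_cube \<Longrightarrow> 0 \<le> g x"
  by (auto simp: prob_densities_def has_bochner_integral_iff)

text \<open>Truncating f at 0 does not increase the distance e to g, and the integral of the truncated
  function h differs from 1 by at most e, so that normalising h costs another e. If e is at
  least 1, the uniform density is close enough, as any two densities have distance at most 2.\<close>

lemma d1_G_star_le_measurable:
  fixes g :: "real ^ 'd \<Rightarrow> real"
  assumes g: "g \<in> prob_densities" and f: "f \<in> F_star" "f \<in> borel_measurable cube_measure"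
  shows "d1 g G_star \<le> 2 * L1_norm (\<lambda>x. g x - f x)"
proof -
  interpret prob_space "cube_measure :: (real ^ 'd) measure" by (rule prob_space_cube_measure)
  note [measurable] = f(2) prob_densities_measurable[OF g]
  define h where "h x = max 0 (f x)" for x
  have hm [measurable]: "h \<in> borel_measurable cube_measure" unfolding h_def by measurable
  have zero: "0 \<in> unit_cube" by (simp add: unit_cube_def mem_box_cart)
  have hle: "h x \<le> max 0 (f 0)" if "x \<in> unit_cube" for x
  proof -
    have "0 \<le> x" using that by (auto simp: less_eq_vec_def unit_cube_def mem_box_cart)
    then have "f x \<le> f 0" using f(1) that zero unfolding F_star_def by blast
    then show ?thesis by (auto simp: h_def)
  qed
  have hint: "integrable cube_measure h"
    using hle by (intro integrable_const_bound[of _ "max 0 (f 0)"] AE_I2) (auto simp: h_def)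
  define e where "e = (LINT x|cube_measure. \<bar>g x - h x\<bar>)"
  have gint: "integrable cube_measure g" by (rule prob_densities_integrable[OF g])
  have L1h: "L1_norm (\<lambda>x. g x - h x) = ennreal e"
    unfolding e_def using gint hint by (intro L1_norm_eq_integral) auto
  have "L1_norm (\<lambda>x. g x - h x) \<le> L1_norm (\<lambda>x. g x - f x)"
    unfolding L1_norm_def
  proof (intro nn_integral_mono ennreal_leI)
    fix x :: "real ^ 'd" assume "x \<in> space cube_measure"
    then have "0 \<le> g x" using prob_densities_nonneg[OF g, of x] by simp
    then show "\<bar>g x - h x\<bar> \<le> \<bar>g x - f x\<bar>" unfolding h_def by linarith
  qed
  then have "2 * ennreal e \<le> 2 * L1_norm (\<lambda>x. g x - f x)" unfolding L1h by (intro mult_left_mono) auto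
  moreover have e0: "0 \<le> e" unfolding e_def by simp
  ultimately have le: "ennreal (2 * e) \<le> 2 * L1_norm (\<lambda>x. g x - f x)" by (simp add: ennreal_mult)
  define I where "I = (LINT x|cube_measure. h x)"
  have "\<bar>1 - I\<bar> \<le> e"
  proof -
    have "1 - I = (LINT x|cube_measure. g x - h x)"
      unfolding I_def using gint hint prob_densities_integral[OF g] by simp
    then show ?thesis unfolding e_def using integral_abs_bound by metis
  qed
  have "d1 g G_star \<le> ennreal (2 * e)"
  proof (cases "1 \<le> e")
    case True
    have "d1 g G_star \<le> L1_norm (\<lambda>x. g x - 1)" using d1_le[OF one_in_G_star] .
    also have "\<dots> = ennreal (LINT x|cube_measure. \<bar>g x - 1\<bar>)" using gint by (intro L1_norm_eq_integral) auto
    also have "(LINT x|cube_measure. \<bar>g x - 1\<bar>) \<le> (LINT x|cube_measure. g x + 1)"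
    proof (intro integral_mono)
      show "integrable cube_measure (\<lambda>x. \<bar>g x - 1\<bar>)" "integrable cube_measure (\<lambda>x. g x + 1)" using gint by simp_all
      fix x :: "real ^ 'd" assume "x \<in> space cube_measure"
      then have "0 \<le> g x" using prob_densities_nonneg[OF g, of x] by simp
      then show "\<bar>g x - 1\<bar> \<le> g x + 1" by linarith
    qed
    also have "\<dots> = 2" using gint prob_densities_integral[OF g] prob_space by simp
    also have "\<dots> \<le> 2 * e" using True by simp
    finally show ?thesis by (simp add: ennreal_leI)
  next
    case False
    then have I: "0 < I" using \<open>\<bar>1 - I\<bar> \<le> e\<close> by linarith
    define s where "s x = h x / I" for x
    have sG: "s \<in> G_star"
    proof -
      have "s \<in> F_star" 
        unfolding F_star_def s_def h_def
      proof (intro CollectI ballI impI divide_right_mono)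
        fix x y :: "real ^ 'd" assume "x \<in> unit_cube" "y \<in> unit_cube" "y \<le> x"
        then have "f x \<le> f y" using f(1) unfolding F_star_def by blast
        then show "max 0 (f x) \<le> max 0 (f y)" by linarith
      qed (use I in simp)
      moreover have "has_bochner_integral cube_measure s (I / I)"
        unfolding s_def using hint by (intro has_bochner_integral_divide_zero) (auto simp: I_def has_bochner_integral_iff)
      ultimately show ?thesis using I by (auto simp: G_star_def prob_densities_def s_def h_def)
    qed
    have hs: "L1_norm (\<lambda>x. h x - s x) \<le> ennreal e"
    proof -
      have "L1_norm (\<lambda>x. h x - s x) = ennreal (LINT x|cube_measure. \<bar>h x - s x\<bar>)"
        using hint by (intro L1_norm_eq_integral) (auto simp: s_def)
      also have "(\<lambda>x. \<bar>h x - s x\<bar>) = (\<lambda>x. h x * \<bar>1 - 1 / I\<bar>)"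
      proof
        fix x
        have "h x - s x = h x * (1 - 1 / I)" by (simp add: s_def algebra_simps)
        then show "\<bar>h x - s x\<bar> = h x * \<bar>1 - 1 / I\<bar>" by (simp add: abs_mult h_def)
      qed
      also have "(LINT x|cube_measure. h x * \<bar>1 - 1 / I\<bar>) = I * \<bar>1 - 1 / I\<bar>" by (simp add: I_def)
      also have "\<dots> = \<bar>I - 1\<bar>" 
      proof -
        have "\<bar>I - 1\<bar> = \<bar>I * (1 - 1 / I)\<bar>" using I by (simp add: right_diff_distrib)
        also have "\<dots> = I * \<bar>1 - 1 / I\<bar>" using I by (simp only: abs_mult abs_of_pos)
        finally show ?thesis by (rule sym)
      qed
      finally show ?thesis using \<open>\<bar>1 - I\<bar> \<le> e\<close> by (simp add: ennreal_leI abs_minus_commute)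
    qed
    have "d1 g G_star \<le> L1_norm (\<lambda>x. g x - s x)" by (rule d1_le[OF sG])
    also have "\<dots> \<le> L1_norm (\<lambda>x. g x - h x) + L1_norm (\<lambda>x. h x - s x)" by (intro L1_norm_triangle) measurable
    also have "\<dots> \<le> ennreal e + ennreal e" unfolding L1h using hs by (intro add_left_mono)
    also have "\<dots> = ennreal (2 * e)" using e0 by (simp flip: ennreal_plus)
    finally show ?thesis .
  qed
  then show ?thesis using le by (rule order_trans)
qed

text \<open>Composing a decreasing function with this map makes it a step function, which is measurable
  and still decreasing on the whole cube.\<close>

definition lower_corner :: "nat \<Rightarrow> real ^ 'd \<Rightarrow> real ^ 'd" where
  "lower_corner J x = (\<chi> k. real (cell J x $ k - 1) / real J)"

text \<open>The upper corner of a bin is the lower corner of its diagonal successor. So the sum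
  telescopes, and only bins at the boundary of the cube remain, whose number is of lower
  order.\<close>

lemma sum_corner_differences:
  fixes f :: "real ^ 'd \<Rightarrow> real"
  assumes f: "f \<in> F_star" and J: "1 \<le> J"
  defines "lo \<equiv> \<lambda>j :: nat ^ 'd. (\<chi> k. real (j $ k - 1) / real J) :: real ^ 'd"
    and "hi \<equiv> \<lambda>j :: nat ^ 'd. (\<chi> k. real (j $ k) / real J) :: real ^ 'd"
  shows "(\<Sum>j\<in>multi_indices J. f (lo j) - f (hi j)) \<le> (real J ^ CARD('d) - real (J - 1) ^ CARD('d)) * (f 0 - f 1)"
proof -
  let ?A = "multi_indices J :: (nat ^ 'd) set"
  let ?B = "multi_indices (J - 1) :: (nat ^ 'd) set"
  define S where "S = (\<lambda>j :: nat ^ 'd. (\<chi> k. Suc (j $ k)) :: nat ^ 'd)"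
  have inj: "inj_on S ?B" by (auto simp: inj_on_def S_def vec_eq_iff)
  have SB: "S ` ?B \<subseteq> ?A" 
  proof
    fix i assume "i \<in> S ` ?B"
    then obtain j where j: "j \<in> ?B" "i = S j" by auto
    have "Suc (j $ k) \<le> J" for k
    proof -
      have "j $ k \<le> J - 1" using j(1) by (simp add: multi_indices_def)
      then show ?thesis using J by linarith
    qed
    then show "i \<in> ?A" by (simp add: j(2) S_def multi_indices_def)
  qed
  have BA: "?B \<subseteq> ?A" by (auto simp: multi_indices_def intro: order_trans)
  have lohi: "lo (S j) = hi j" for j by (simp add: lo_def hi_def S_def)
  have cube: "lo j \<in> unit_cube" "hi j \<in> unit_cube" if "j \<in> ?A" for j
  proof -
    have "real (j $ k - 1) \<le> real J" "real (j $ k) \<le> real J" for k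
    proof -
      have "j $ k \<le> J" using that by (simp add: multi_indices_def)
      then show "real (j $ k - 1) \<le> real J" "real (j $ k) \<le> real J" unfolding of_nat_le_iff by linarith+
    qed
    then show "lo j \<in> unit_cube" "hi j \<in> unit_cube"
      unfolding lo_def hi_def unit_cube_def mem_box_cart using J by (auto simp: divide_le_eq simp del: of_nat_diff)
  qed
  have c01: "0 \<in> unit_cube" "1 \<in> unit_cube" by (auto simp: unit_cube_def mem_box_cart)
  have f0: "f x \<le> f 0" "f 1 \<le> f x" if "x \<in> unit_cube" for x
  proof -
    have "0 \<le> x" "x \<le> 1" using that by (auto simp: less_eq_vec_def unit_cube_def mem_box_cart)
    then show "f x \<le> f 0" "f 1 \<le> f x" using f that c01 unfolding F_star_def by blast+
  qed
  have "(\<Sum>j\<in>?A. f (lo j)) = (\<Sum>j\<in>S ` ?B. f (lo j)) + (\<Sum>j\<in>?A - S ` ?B. f (lo j))"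
    using SB by (subst sum.subset_diff[OF SB]) auto
  also have "(\<Sum>j\<in>S ` ?B. f (lo j)) = (\<Sum>j\<in>?B. f (hi j))"
    using inj by (simp add: sum.reindex lohi)
  also have "(\<Sum>j\<in>?A - S ` ?B. f (lo j)) \<le> (\<Sum>j\<in>?A - S ` ?B. f 0)"
    using f0 cube by (intro sum_mono) auto
  finally have 1: "(\<Sum>j\<in>?A. f (lo j)) \<le> (\<Sum>j\<in>?B. f (hi j)) + real (card (?A - S ` ?B)) * f 0" by simp
  have "(\<Sum>j\<in>?A. f (hi j)) = (\<Sum>j\<in>?B. f (hi j)) + (\<Sum>j\<in>?A - ?B. f (hi j))"
    using BA by (subst sum.subset_diff[OF BA]) auto
  moreover have "(\<Sum>j\<in>?A - ?B. f 1) \<le> (\<Sum>j\<in>?A - ?B. f (hi j))" using f0 cube by (intro sum_mono) auto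
  ultimately have 2: "(\<Sum>j\<in>?B. f (hi j)) + real (card (?A - ?B)) * f 1 \<le> (\<Sum>j\<in>?A. f (hi j))" by simp
  have c1: "real (card (?A - ?B)) = real J ^ CARD('d) - real (J - 1) ^ CARD('d)"
    using BA by (subst card_Diff_subset) (auto simp: card_multi_indices of_nat_diff power_mono)
  have c2: "real (card (?A - S ` ?B)) = real J ^ CARD('d) - real (J - 1) ^ CARD('d)"
    using SB inj by (subst card_Diff_subset) (auto simp: card_image card_multi_indices of_nat_diff power_mono)
  show ?thesis using 1 2 unfolding c1 c2 by (simp add: sum_subtractf algebra_simps)
qed

lemma L1_norm_lower_corner:
  fixes f g :: "real ^ 'd \<Rightarrow> real"
  assumes f: "f \<in> F_star" and J: "1 \<le> J" and g: "g \<in> borel_measurable cube_measure"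
  shows "L1_norm (\<lambda>x. g x - f (lower_corner J x))
    \<le> ennreal ((1 - (1 - 1 / real J) ^ CARD('d)) * (f 0 - f 1)) + L1_norm (\<lambda>x. g x - f x)"
proof -
  define lo where "lo j = f (\<chi> k. real (j $ k - 1) / real J)" for j :: "nat ^ 'd"
  define hi where "hi j = f (\<chi> k. real (j $ k) / real J)" for j :: "nat ^ 'd"
  define D where "D x = ennreal (lo (cell J x) - hi (cell J x))" for x :: "real ^ 'd"
  have Dm: "D \<in> borel_measurable cube_measure" unfolding D_def by (rule borel_to_cube_measure) measurable
  have lohi: "lo j \<ge> hi j" if "j \<in> multi_indices J" for j
  proof -
    have m: "(\<chi> k. real (j $ k - 1) / real J) \<in> unit_cube" "(\<chi> k. real (j $ k) / real J) \<in> unit_cube"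
      "(\<chi> k. real (j $ k - 1) / real J) \<le> (\<chi> k. real (j $ k) / real J)"
    proof -
      have "real (j $ k - 1) \<le> real (j $ k)" "real (j $ k) \<le> real J" "real (j $ k - 1) \<le> real J" for k
      proof -
        have "j $ k \<le> J" using that by (simp add: multi_indices_def)
        then show "real (j $ k - 1) \<le> real (j $ k)" "real (j $ k) \<le> real J" "real (j $ k - 1) \<le> real J"
          unfolding of_nat_le_iff by linarith+
      qed
      then show "(\<chi> k. real (j $ k - 1) / real J) \<in> unit_cube" "(\<chi> k. real (j $ k) / real J) \<in> unit_cube"
        "(\<chi> k. real (j $ k - 1) / real J) \<le> (\<chi> k. real (j $ k) / real J)"
        using J by (auto simp: unit_cube_def mem_box_cart divide_le_eq less_eq_vec_def intro!: divide_right_mono simp del: of_nat_diff)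
    qed
    then show ?thesis using f unfolding lo_def hi_def F_star_def by blast
  qed
  have "L1_norm (\<lambda>x. g x - f (lower_corner J x)) \<le> (\<integral>\<^sup>+ x. D x + ennreal \<bar>g x - f x\<bar> \<partial>cube_measure)"
    unfolding L1_norm_def
  proof (intro nn_integral_mono_AE, use AE_half_open_cube in eventually_elim)
    case (elim x)
    have c: "cell J x \<in> multi_indices J" using elim J by auto
    have x: "x \<in> unit_cube" using elim half_open_cube_subset by auto
    have cn: "real (cell J x $ k) - 1 < real J * x $ k \<and> real J * x $ k \<le> real (cell J x $ k)" for k by (rule cell_nth[OF J elim])
    have c1: "1 \<le> cell J x $ k" "cell J x $ k \<le> J" for k using c by (auto simp: multi_indices_def)
    have lc: "lower_corner J x \<in> unit_cube" "lower_corner J x \<le> x"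
    proof -
      have "real (cell J x $ k - 1) / real J \<le> x $ k" for k
        using cn[of k] c1[of k] J by (simp add: of_nat_diff divide_le_eq mult.commute)
      then show "lower_corner J x \<le> x" by (simp add: lower_corner_def less_eq_vec_def)
      have "real (cell J x $ k - 1) \<le> real J" for k using c1[of k] unfolding of_nat_le_iff by linarith
      then show "lower_corner J x \<in> unit_cube"
        unfolding lower_corner_def unit_cube_def mem_box_cart using J by (auto simp: divide_le_eq simp del: of_nat_diff)
    qed
    have uc: "(\<chi> k. real (cell J x $ k) / real J) \<in> unit_cube" "x \<le> (\<chi> k. real (cell J x $ k) / real J)"
      using cn c1 J by (auto simp: unit_cube_def mem_box_cart divide_le_eq le_divide_eq less_eq_vec_def mult.commute)
    have "f x \<le> f (lower_corner J x)" using f lc x by (auto simp: F_star_def)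
    moreover have "hi (cell J x) \<le> f x" using f uc x by (auto simp: F_star_def hi_def)
    moreover have "lo (cell J x) = f (lower_corner J x)" by (simp add: lo_def lower_corner_def)
    ultimately have "\<bar>g x - f (lower_corner J x)\<bar> \<le> (lo (cell J x) - hi (cell J x)) + \<bar>g x - f x\<bar>" by linarith
    then show ?case unfolding D_def using lohi[OF c] by (simp flip: ennreal_plus add: ennreal_leI)
  qed
  also have "\<dots> \<le> (\<integral>\<^sup>+ x. D x \<partial>cube_measure) + L1_norm (\<lambda>x. g x - f x)"
    unfolding L1_norm_def by (rule nn_integral_add_le[OF Dm])
  also have "(\<integral>\<^sup>+ x. D x \<partial>cube_measure) = (\<Sum>j\<in>multi_indices J. ennreal (lo j - hi j) * ennreal (1 / real J ^ CARD('d)))"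
    unfolding D_def by (rule nn_integral_cube_cell[OF J])
  also have "\<dots> = (\<Sum>j\<in>multi_indices J. ennreal ((lo j - hi j) * (1 / real J ^ CARD('d))))"
    using lohi by (intro sum.cong refl ennreal_mult'[symmetric]) auto
  also have "\<dots> = ennreal (\<Sum>j\<in>multi_indices J. (lo j - hi j) * (1 / real J ^ CARD('d)))"
    using lohi by (intro sum_ennreal) (auto intro!: divide_nonneg_nonneg)
  also have "(\<Sum>j\<in>multi_indices J. (lo j - hi j) * (1 / real J ^ CARD('d))) = (\<Sum>j\<in>multi_indices J. lo j - hi j) / real J ^ CARD('d)"
    by (simp add: sum_divide_distrib)
  also have "\<dots> \<le> ((real J ^ CARD('d) - real (J - 1) ^ CARD('d)) * (f 0 - f 1)) / real J ^ CARD('d)"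
    unfolding lo_def hi_def by (intro divide_right_mono sum_corner_differences[OF f J]) auto
  also have "\<dots> = (1 - (1 - 1 / real J) ^ CARD('d)) * (f 0 - f 1)"
  proof -
    have "1 - 1 / real J = real (J - 1) / real J" using J by (simp add: of_nat_diff field_simps)
    then have "(1 - 1 / real J) ^ CARD('d) = real (J - 1) ^ CARD('d) / real J ^ CARD('d)" by (simp only: power_divide)
    moreover have "(a - b) * c / a = (1 - b / a) * c" if "a \<noteq> 0" for a b c :: real
      using that by (simp add: field_simps)
    moreover have "real J ^ CARD('d) \<noteq> 0" using J by simp
    ultimately show ?thesis by (simp only:) 
  qed
  finally show ?thesis by (simp add: ennreal_leI add_right_mono)
qed

text \<open>The measurable case applies to the step functions built from f, whose L1 distance to f tends
  to 0.\<close>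

lemma d1_G_star_le:
  fixes f g :: "real ^ 'd \<Rightarrow> real"
  assumes g: "g \<in> prob_densities" and f: "f \<in> F_star"
  shows "d1 g G_star \<le> 2 * L1_norm (\<lambda>x. g x - f x)"
proof -
  define r where "r J = (1 - (1 - 1 / real J) ^ CARD('d)) * (f 0 - f 1)" for J :: nat
  have bound: "d1 g G_star \<le> 2 * (ennreal (r J) + L1_norm (\<lambda>x. g x - f x))" if J: "1 \<le> J" for J
  proof -
    have lc: "lower_corner J x \<in> unit_cube" if "x \<in> unit_cube" for x :: "real ^ 'd"
    proof -
      have "nat \<lceil>real J * x $ k\<rceil> \<le> J" for k
      proof -
        have "real J * x $ k \<le> real J * 1" using that by (intro mult_left_mono) (auto simp: unit_cube_def mem_box_cart)
        then show ?thesis by (simp add: nat_le_iff ceiling_le_iff)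
      qed
      then have "real (nat \<lceil>real J * x $ k\<rceil> - 1) \<le> real J" for k by (meson diff_le_self le_trans of_nat_le_iff)
      then show ?thesis using J by (auto simp: lower_corner_def unit_cube_def mem_box_cart cell_def divide_le_eq)
    qed
    have mono: "lower_corner J y \<le> lower_corner J x" if "y \<le> x" for x y :: "real ^ 'd"
    proof -
      have "nat \<lceil>real J * y $ k\<rceil> \<le> nat \<lceil>real J * x $ k\<rceil>" for k
        using that by (intro nat_mono ceiling_mono mult_left_mono) (auto simp: less_eq_vec_def)
      then show ?thesis by (auto simp: lower_corner_def less_eq_vec_def cell_def intro!: divide_right_mono diff_le_mono)
    qed
    have "(\<lambda>x. f (lower_corner J x)) \<in> F_star" using f lc mono by (auto simp: F_star_def)
    moreover have "(\<lambda>x. f (lower_corner J x)) \<in> borel_measurable cube_measure"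
    proof -
      have "(\<lambda>x. f (lower_corner J x)) = (\<lambda>x. (\<lambda>j. f (\<chi> k. real (j $ k - 1) / real J)) (cell J x))"
        by (simp add: lower_corner_def)
      then show ?thesis by (simp only:) (rule borel_to_cube_measure, measurable)
    qed
    ultimately have "d1 g G_star \<le> 2 * L1_norm (\<lambda>x. g x - f (lower_corner J x))" by (rule d1_G_star_le_measurable[OF g])
    also have "\<dots> \<le> 2 * (ennreal (r J) + L1_norm (\<lambda>x. g x - f x))"
      unfolding r_def by (intro mult_left_mono L1_norm_lower_corner[OF f J prob_densities_measurable[OF g]]) auto
    finally show ?thesis .
  qed
  have "(\<lambda>J. (1 - (1 - 1 / real J) ^ CARD('d)) * (f 0 - f 1)) \<longlonglongrightarrow> (1 - (1 - 0) ^ CARD('d)) * (f 0 - f 1)"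
    by (intro tendsto_intros lim_1_over_n)
  then have "r \<longlonglongrightarrow> 0" unfolding r_def[abs_def] by simp
  then have "(\<lambda>J. ennreal (r J)) \<longlonglongrightarrow> ennreal 0" by (rule tendsto_ennrealI)
  then have "(\<lambda>J. 2 * (ennreal (r J) + L1_norm (\<lambda>x. g x - f x))) \<longlonglongrightarrow> 2 * (ennreal 0 + L1_norm (\<lambda>x. g x - f x))"
    by (intro ennreal_tendsto_cmult tendsto_add) auto
  then have "d1 g G_star \<le> 2 * (ennreal 0 + L1_norm (\<lambda>x. g x - f x))"
    by (rule tendsto_lowerbound) (use bound in \<open>auto intro!: eventually_sequentiallyI[of 1]\<close>)
  then show ?thesis by simp
qed

lemma d1_F_star_ge:
  fixes g :: "real ^ 'd \<Rightarrow> real"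
  assumes g: "g \<in> prob_densities" and c: "0 \<le> c" "ennreal (2 * c) \<le> d1 g G_star"
  shows "ennreal c \<le> d1 g F_star"
  unfolding d1_def
proof (rule INF_greatest)
  fix f :: "real ^ 'd \<Rightarrow> real" assume f: "f \<in> F_star"
  show "ennreal c \<le> L1_norm (\<lambda>x. g x - f x)"
  proof (rule ccontr)
    assume "\<not> ennreal c \<le> L1_norm (\<lambda>x. g x - f x)"
    then have lt: "L1_norm (\<lambda>x. g x - f x) < ennreal c" by simp
    have "2 * ennreal c \<le> 2 * L1_norm (\<lambda>x. g x - f x)"
      using order_trans[OF c(2) d1_G_star_le[OF g f]] c(1) by (simp add: ennreal_mult)
    then show False using lt by (simp add: ennreal_mult_le_mult_iff)
  qed
qed

section \<open>Hellinger affinity and chi-square distance\<close>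

text \<open>Factor |g - q| into the difference and the sum of the square roots. The squares of these
  have integrals 2 * (1 - \<rho>) and at most 4, where \<rho> is the affinity, and the
  Cauchy-Schwarz inequality is used in the form of a weighted arithmetic-geometric mean, with
  the weight s = 4 / \<delta>.\<close>

lemma hellinger_affinity_le:
  fixes g q :: "real ^ 'd \<Rightarrow> real"
  assumes g: "g \<in> prob_densities" and q: "q \<in> prob_densities"
    and \<delta>: "0 \<le> \<delta>" "ennreal \<delta> \<le> L1_norm (\<lambda>x. g x - q x)"
  shows "(\<integral>\<^sup>+ x. ennreal (sqrt (g x * q x)) \<partial>cube_measure) \<le> ennreal (1 - \<delta>\<^sup>2 / 8)"
    and "\<delta>\<^sup>2 / 8 \<le> 1"
proof -
  note [measurable] = prob_densities_measurable[OF g] prob_densities_measurable[OF q]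
  note gi = prob_densities_integrable[OF g] and qi = prob_densities_integrable[OF q]
  have nn: "0 \<le> g x" "0 \<le> q x" if "x \<in> unit_cube" for x using prob_densities_nonneg g q that by auto
  define r where "r x = sqrt (g x * q x)" for x
  have rm [measurable]: "r \<in> borel_measurable cube_measure" unfolding r_def by measurable
  have rle: "r x \<le> (g x + q x) / 2" if "x \<in> unit_cube" for x
    using arith_geo_mean_sqrt[of "g x" "q x"] nn[OF that] by (simp add: r_def)
  have r0: "0 \<le> r x" if "x \<in> unit_cube" for x using nn[OF that] by (simp add: r_def)
  have "integrable cube_measure (\<lambda>x. (g x + q x) / 2)" using gi qi by auto
  then have ri: "integrable cube_measure r"
    by (rule Bochner_Integration.integrable_bound) (use rle r0 nn in \<open>auto intro!: AE_I2\<close>)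
  define \<rho> where "\<rho> = (LINT x|cube_measure. r x)"
  have \<rho>0: "0 \<le> \<rho>" unfolding \<rho>_def using r0 by (intro Bochner_Integration.integral_nonneg) auto
  have "\<rho> \<le> (LINT x|cube_measure. (g x + q x) / 2)"
    unfolding \<rho>_def using ri gi qi rle by (intro integral_mono) auto
  also have "\<dots> = 1" using gi qi prob_densities_integral[OF g] prob_densities_integral[OF q] by simp
  finally have \<rho>1: "\<rho> \<le> 1" .
  have "\<delta>\<^sup>2 / 8 \<le> 1 - \<rho>"
  proof (cases "\<delta> = 0")
    case False
    then have \<delta>p: "0 < \<delta>" using \<delta> by simp
    \<comment> \<open>Balances the two summands below, up to constants.\<close>
    define s where "s = 4 / \<delta>"
    have s: "0 < s" using \<delta>p by (simp add: s_def)
    have pt: "\<bar>g x - q x\<bar> \<le> s / 2 * (g x + q x - 2 * r x) + (g x + q x + 2 * r x) / (2 * s)" if "x \<in> unit_cube" for x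
    proof -
      define a b where "a = sqrt (g x)" and "b = sqrt (q x)"
      have ab: "g x = a\<^sup>2" "q x = b\<^sup>2" "r x = a * b" "0 \<le> a" "0 \<le> b"
        using nn[OF that] by (auto simp: a_def b_def r_def real_sqrt_mult)
      have "\<bar>g x - q x\<bar> = \<bar>a - b\<bar> * (a + b)"
        unfolding ab(1,2) using ab(4,5) by (simp add: square_diff_square_factored power2_eq_square abs_mult mult.commute)
      also have "\<dots> \<le> s / 2 * \<bar>a - b\<bar>\<^sup>2 + (a + b)\<^sup>2 / (2 * s)"
      proof -
        have "0 \<le> (s * \<bar>a - b\<bar> - (a + b))\<^sup>2 / (2 * s)" using s by simp
        also have "\<dots> = s / 2 * \<bar>a - b\<bar>\<^sup>2 + (a + b)\<^sup>2 / (2 * s) - \<bar>a - b\<bar> * (a + b)"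
        proof -
          have "(s * \<bar>a - b\<bar> - (a + b))\<^sup>2 = s * s * \<bar>a - b\<bar>\<^sup>2 - 2 * s * (\<bar>a - b\<bar> * (a + b)) + (a + b)\<^sup>2"
            by (simp only: power2_eq_square algebra_simps)
          then show ?thesis using s by (simp add: add_divide_distrib diff_divide_distrib)
        qed
        finally show ?thesis by simp
      qed
      also have "\<bar>a - b\<bar>\<^sup>2 = g x + q x - 2 * r x" by (simp add: ab power2_eq_square algebra_simps)
      also have "(a + b)\<^sup>2 = g x + q x + 2 * r x" by (simp add: ab power2_eq_square algebra_simps)
      finally show ?thesis .
    qed
    have "ennreal \<delta> \<le> ennreal (LINT x|cube_measure. \<bar>g x - q x\<bar>)"
      using \<delta>(2) gi qi by (subst (asm) L1_norm_eq_integral) auto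
    then have "\<delta> \<le> (LINT x|cube_measure. \<bar>g x - q x\<bar>)" by simp
    also have "\<dots> \<le> (LINT x|cube_measure. s / 2 * (g x + q x - 2 * r x) + (g x + q x + 2 * r x) / (2 * s))"
      using gi qi ri pt by (intro integral_mono) auto
    also have "\<dots> = s / 2 * (1 + 1 - 2 * \<rho>) + (1 + 1 + 2 * \<rho>) / (2 * s)"
      using gi qi ri prob_densities_integral[OF g] prob_densities_integral[OF q] by (simp add: \<rho>_def)
    also have "\<dots> \<le> s * (1 - \<rho>) + 2 / s"
    proof -
      have "(1 + 1 + 2 * \<rho>) / (2 * s) \<le> 4 / (2 * s)" using s \<rho>1 by (intro divide_right_mono) auto
      moreover have "4 / (2 * s) = 2 / s" using s by simp
      moreover have "s / 2 * (1 + 1 - 2 * \<rho>) = s * (1 - \<rho>)" by (simp add: algebra_simps)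
      ultimately show ?thesis by linarith
    qed
    also have "\<dots> = 4 * (1 - \<rho>) / \<delta> + \<delta> / 2" using \<delta>p by (simp add: s_def)
    finally have "\<delta> / 2 \<le> 4 * (1 - \<rho>) / \<delta>" by linarith
    then show ?thesis using \<delta>p by (simp add: field_simps power2_eq_square)
  qed (use \<rho>1 in simp)
  moreover have "(\<integral>\<^sup>+ x. ennreal (sqrt (g x * q x)) \<partial>cube_measure) = ennreal \<rho>"
    unfolding \<rho>_def r_def[symmetric] using ri r0 by (intro nn_integral_eq_integral) (auto intro!: AE_I2)
  ultimately show "(\<integral>\<^sup>+ x. ennreal (sqrt (g x * q x)) \<partial>cube_measure) \<le> ennreal (1 - \<delta>\<^sup>2 / 8)"
    and "\<delta>\<^sup>2 / 8 \<le> 1" using \<rho>0 by (auto intro!: ennreal_leI)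
qed

section \<open>Averaging over bins\<close>

definition cell_average :: "(real ^ 'd \<Rightarrow> real) \<Rightarrow> nat \<Rightarrow> real ^ 'd \<Rightarrow> real" where
  "cell_average f J x = real J ^ CARD('d) * (LINT y|cube_measure. indicator (bin J (cell J x)) y * f y)"

lemma has_bochner_integral_cell:
  fixes F :: "nat ^ 'd \<Rightarrow> real"
  assumes J: "1 \<le> J"
  shows "has_bochner_integral cube_measure (\<lambda>x. F (cell J x)) ((\<Sum>j\<in>multi_indices J. F j) / real J ^ CARD('d))"
proof -
  interpret prob_space "cube_measure :: (real ^ 'd) measure" by (rule prob_space_cube_measure)
  have m: "measure cube_measure (bin J j) = 1 / real J ^ CARD('d)" if "j \<in> multi_indices J" for j :: "nat ^ 'd"
    using emeasure_bin[OF J that] by (simp add: measure_def)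
  have "has_bochner_integral cube_measure (\<lambda>x. F j * indicator (bin J j) x) (F j * (1 / real J ^ CARD('d)))"
    if "j \<in> multi_indices J" for j
  proof -
    have "has_bochner_integral cube_measure (indicator (bin J j) :: _ \<Rightarrow> real) (measure cube_measure (bin J j))"
      using bin_cube_sets[OF J that] by (intro has_bochner_integral_real_indicator) (auto simp: emeasure_eq_measure)
    then show ?thesis unfolding m[OF that] by (intro has_bochner_integral_mult_right) auto
  qed
  then have "has_bochner_integral cube_measure (\<lambda>x. \<Sum>j\<in>multi_indices J. F j * indicator (bin J j) x)
     (\<Sum>j\<in>multi_indices J. F j * (1 / real J ^ CARD('d)))"
    by (intro has_bochner_integral_sum) auto
  moreover have "(\<Sum>j\<in>multi_indices J. F j * (1 / real J ^ CARD('d))) = (\<Sum>j\<in>multi_indices J. F j) / real J ^ CARD('d)"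
    by (simp add: sum_divide_distrib)
  moreover have "AE x in cube_measure. F (cell J x) = (\<Sum>j\<in>multi_indices J. F j * indicator (bin J j) x)"
  proof (use AE_half_open_cube in eventually_elim)
    case (elim x)
    have "(\<Sum>j\<in>multi_indices J. F j * indicator (bin J j) x) = (\<Sum>j\<in>multi_indices J. if j = cell J x then F j else 0)"
      by (intro sum.cong) (auto simp: indicator_def mem_bin_iff[OF J elim])
    then show ?case using elim J by auto
  qed
  moreover have "(\<lambda>x. F (cell J x)) \<in> borel_measurable cube_measure" by (rule borel_to_cube_measure) measurable
  ultimately show ?thesis
    by (subst has_bochner_integral_cong_AE[where g = "\<lambda>x. \<Sum>j\<in>multi_indices J. F j * indicator (bin J j) x"])
      (auto simp: has_bochner_integral_iff)
qed

lemma integrable_bin: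
  fixes f :: "real ^ 'd \<Rightarrow> real"
  assumes "1 \<le> J" "j \<in> multi_indices J" "integrable cube_measure f"
  shows "integrable cube_measure (\<lambda>y. indicator (bin J j) y * f y)"
  using integrable_mult_indicator[OF bin_cube_sets[OF assms(1,2)] assms(3)] by simp

lemma sum_integral_bins:
  fixes f :: "real ^ 'd \<Rightarrow> real"
  assumes J: "1 \<le> J" and f: "integrable cube_measure f"
  shows "(\<Sum>j\<in>multi_indices J. LINT y|cube_measure. indicator (bin J j) y * f y) = (LINT y|cube_measure. f y)"
proof -
  have "(\<Sum>j\<in>multi_indices J. LINT y|cube_measure. indicator (bin J j) y * f y)
     = (LINT y|cube_measure. (\<Sum>j\<in>multi_indices J. indicator (bin J j) y * f y))"
    using integrable_bin[OF J _ f] by (intro Bochner_Integration.integral_sum[symmetric]) auto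
  also have "\<dots> = (LINT y|cube_measure. f y)"
  proof (rule integral_cong_AE)
    show "(\<lambda>y. \<Sum>j\<in>multi_indices J. indicator (bin J j) y * f y) \<in> borel_measurable cube_measure"
      using integrable_bin[OF J _ f] by (intro borel_measurable_sum borel_measurable_integrable) auto
    show "AE x in cube_measure. (\<Sum>j\<in>multi_indices J. indicator (bin J j) x * f x) = f x"
    proof (use AE_half_open_cube in eventually_elim)
      case (elim x)
      have "(\<Sum>j\<in>multi_indices J. indicator (bin J j) x * f x) = (\<Sum>j\<in>multi_indices J. if j = cell J x then f x else 0)"
        by (intro sum.cong) (auto simp: indicator_def mem_bin_iff[OF J elim])
      then show ?case using elim J by auto
    qed
  qed (use f in auto)
  finally show ?thesis .
qed

lemma has_bochner_integral_cell_average: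
  fixes f :: "real ^ 'd \<Rightarrow> real"
  assumes J: "1 \<le> J" and f: "integrable cube_measure f"
  shows "has_bochner_integral cube_measure (cell_average f J) (LINT y|cube_measure. f y)"
proof -
  have "(\<Sum>j\<in>multi_indices J. real J ^ CARD('d) * (LINT y|cube_measure. indicator (bin J j) y * f y)) / real J ^ CARD('d)
      = (LINT y|cube_measure. f y)"
    using J sum_integral_bins[OF J f] by (simp add: sum_distrib_left[symmetric])
  then show ?thesis
    using has_bochner_integral_cell[OF J, of "\<lambda>j. real J ^ CARD('d) * (LINT y|cube_measure. indicator (bin J j) y * f y)"]
    by (simp add: cell_average_def[abs_def])
qed

lemma cell_average_integrable: "1 \<le> J \<Longrightarrow> integrable cube_measure f \<Longrightarrow> integrable cube_measure (cell_average f J)"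
  using has_bochner_integral_cell_average has_bochner_integral_iff by blast

lemma cell_average_contraction:
  fixes f :: "real ^ 'd \<Rightarrow> real"
  assumes J: "1 \<le> J" and f: "integrable cube_measure f"
  shows "(LINT x|cube_measure. \<bar>cell_average f J x\<bar>) \<le> (LINT x|cube_measure. \<bar>f x\<bar>)"
proof -
  have "(LINT x|cube_measure. \<bar>cell_average f J x\<bar>)
      = (\<Sum>j\<in>multi_indices J. \<bar>real J ^ CARD('d) * (LINT y|cube_measure. indicator (bin J j) y * f y)\<bar>) / real J ^ CARD('d)"
    using has_bochner_integral_cell[OF J, of "\<lambda>j. \<bar>real J ^ CARD('d) * (LINT y|cube_measure. indicator (bin J j) y * f y)\<bar>"]
    by (simp add: cell_average_def[abs_def] has_bochner_integral_iff)
  also have "\<dots> = (\<Sum>j\<in>multi_indices J. \<bar>LINT y|cube_measure. indicator (bin J j) y * f y\<bar>)"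
    using J by (simp add: abs_mult sum_distrib_left[symmetric])
  also have "\<dots> \<le> (\<Sum>j\<in>multi_indices J. LINT y|cube_measure. indicator (bin J j) y * \<bar>f y\<bar>)"
  proof (intro sum_mono)
    fix j :: "nat ^ 'd"
    have "\<bar>LINT y|cube_measure. indicator (bin J j) y * f y\<bar> \<le> (LINT y|cube_measure. \<bar>indicator (bin J j) y * f y\<bar>)"
      by (rule integral_abs_bound)
    then show "\<bar>LINT y|cube_measure. indicator (bin J j) y * f y\<bar> \<le> (LINT y|cube_measure. indicator (bin J j) y * \<bar>f y\<bar>)"
      by (simp add: abs_mult)
  qed
  also have "\<dots> = (LINT x|cube_measure. \<bar>f x\<bar>)" using f by (intro sum_integral_bins[OF J]) auto
  finally show ?thesis .
qed

lemma cell_average_diff: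
  fixes f :: "real ^ 'd \<Rightarrow> real"
  assumes J: "1 \<le> J" and f: "integrable cube_measure f" "integrable cube_measure h" and x: "x \<in> half_open_cube"
  shows "cell_average (\<lambda>x. f x - h x) J x = cell_average f J x - cell_average h J x"
  using integrable_bin[OF J cell_in_multi_indices[OF J x]] f
  by (simp add: cell_average_def right_diff_distrib)

text \<open>Here c stands for the value of f at x, or for the common value of f on a bin.\<close>

lemma cell_average_near:
  fixes f :: "real ^ 'd \<Rightarrow> real"
  assumes J: "1 \<le> J" and f: "integrable cube_measure f" and x: "x \<in> half_open_cube"
    and near: "\<And>y. y \<in> bin J (cell J x) \<Longrightarrow> \<bar>f y - c\<bar> \<le> \<omega>"
  shows "\<bar>cell_average f J x - c\<bar> \<le> \<omega>"
proof -
  interpret prob_space "cube_measure :: (real ^ 'd) measure" by (rule prob_space_cube_measure)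
  let ?j = "cell J x"
  note j = cell_in_multi_indices[OF J x]
  have m: "measure cube_measure (bin J ?j) = 1 / real J ^ CARD('d)"
    using emeasure_bin[OF J j] by (simp add: measure_def)
  have ind: "integrable cube_measure (indicator (bin J ?j) :: _ \<Rightarrow> real)"
    using bin_cube_sets[OF J j] by (intro integrable_real_indicator) (auto simp: emeasure_eq_measure)
  have Iind: "(LINT y|cube_measure. indicator (bin J ?j) y) = 1 / real J ^ CARD('d)"
    using bin_cube_sets[OF J j] bin_subset_unit_cube[OF J j] m by (simp add: Int_absorb2)
  have fi: "integrable cube_measure (\<lambda>y. indicator (bin J ?j) y * f y)" by (rule integrable_bin[OF J j f])
  have "cell_average f J x - c = real J ^ CARD('d) * (LINT y|cube_measure. indicator (bin J ?j) y * f y - c * indicator (bin J ?j) y)"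
    using fi ind Iind J by (simp add: cell_average_def right_diff_distrib)
  also have "\<bar>\<dots>\<bar> \<le> real J ^ CARD('d) * (LINT y|cube_measure. \<omega> * indicator (bin J ?j) y)"
  proof -
    have "\<bar>LINT y|cube_measure. indicator (bin J ?j) y * f y - c * indicator (bin J ?j) y\<bar>
        \<le> (LINT y|cube_measure. \<bar>indicator (bin J ?j) y * f y - c * indicator (bin J ?j) y\<bar>)"
      by (rule integral_abs_bound)
    also have "\<dots> \<le> (LINT y|cube_measure. \<omega> * indicator (bin J ?j) y)"
    proof (intro integral_mono)
      show "integrable cube_measure (\<lambda>y. \<bar>indicator (bin J ?j) y * f y - c * indicator (bin J ?j) y\<bar>)"
        by (intro integrable_abs Bochner_Integration.integrable_diff fi integrable_mult_right ind)
      show "integrable cube_measure (\<lambda>y. \<omega> * indicator (bin J ?j) y)" by (intro integrable_mult_right ind)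
      show "\<bar>indicator (bin J ?j) y * f y - c * indicator (bin J ?j) y\<bar> \<le> \<omega> * indicator (bin J ?j) y" for y
        using near[of y] by (auto simp: indicator_def)
    qed
    finally show ?thesis by (simp add: abs_mult mult_left_mono)
  qed
  also have "\<dots> = \<omega>" using ind Iind J by simp
  finally show ?thesis .
qed

lemma projection_eq_cell_average:
  fixes g :: "real ^ 'd \<Rightarrow> real"
  assumes g: "g \<in> prob_densities" and J: "1 \<le> J" and x: "x \<in> half_open_cube"
  shows "projection g J x = cell_average g J x"
proof -
  note j = cell_in_multi_indices[OF J x]
  have gm: "(\<lambda>x. ennreal (g x)) \<in> borel_measurable cube_measure"
    using prob_densities_measurable[OF g] by measurable
  have "ennreal (bin_prob g J (cell J x)) = (\<integral>\<^sup>+ y. ennreal (g y) * indicator (bin J (cell J x)) y \<partial>cube_measure)"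
    unfolding emeasure_obs_bin[OF g, symmetric] using gm bin_cube_sets[OF J j] by (intro emeasure_density) auto
  also have "\<dots> = (\<integral>\<^sup>+ y. ennreal (indicator (bin J (cell J x)) y * g y) \<partial>cube_measure)"
    by (intro nn_integral_cong) (auto simp: indicator_def)
  also have "\<dots> = ennreal (LINT y|cube_measure. indicator (bin J (cell J x)) y * g y)"
    using integrable_bin[OF J j prob_densities_integrable[OF g]] prob_densities_nonneg[OF g]
    by (intro nn_integral_eq_integral AE_I2) auto
  finally have "bin_prob g J (cell J x) = (LINT y|cube_measure. indicator (bin J (cell J x)) y * g y)"
    using prob_densities_nonneg[OF g]
    by (subst (asm) ennreal_inj) (auto intro!: Bochner_Integration.integral_nonneg)
  then show ?thesis by (simp add: histogram_cell[OF J x] cell_average_def)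
qed

lemma projection_density:
  fixes g :: "real ^ 'd \<Rightarrow> real"
  assumes g: "g \<in> prob_densities" and J: "1 \<le> J"
  shows "projection g J \<in> prob_densities"
proof -
  have pm: "projection g J \<in> borel_measurable cube_measure" by (rule borel_to_cube_measure) measurable
  have cm: "cell_average g J \<in> borel_measurable cube_measure"
    using cell_average_integrable[OF J prob_densities_integrable[OF g]] by auto
  have "has_bochner_integral cube_measure (projection g J) 1 \<longleftrightarrow> has_bochner_integral cube_measure (cell_average g J) 1"
    using pm cm by (intro has_bochner_integral_cong_AE)
      (use AE_half_open_cube in \<open>auto elim!: eventually_mono simp: projection_eq_cell_average[OF g J]\<close>)
  then show ?thesis
    using has_bochner_integral_cell_average[OF J prob_densities_integrable[OF g]] prob_densities_integral[OF g]
    by (auto simp: prob_densities_def intro: histogram_nonneg)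
qed

lemma bin_diameter:
  fixes x y :: "real ^ 'd"
  assumes J: "1 \<le> J" and x: "x \<in> half_open_cube" and y: "y \<in> bin J (cell J x)"
  shows "norm (x - y) \<le> real CARD('d) / real J" and "\<bar>x $ k - y $ k\<bar> \<le> 1 / real J"
proof -
  have b: "\<bar>x $ k - y $ k\<bar> \<le> 1 / real J" for k
  proof -
    have xb: "x \<in> bin J (cell J x)" by (simp add: mem_bin_iff[OF J x])
    show ?thesis
    proof (cases "cell J x = 1")
      case True
      then show ?thesis using xb y by (simp add: bin_def abs_le_iff) (smt (verit))
    next
      case False
      have "real (cell J x $ k) / real J - (real (cell J x $ k) - 1) / real J = 1 / real J"
        by (simp flip: diff_divide_distrib)
      moreover have "(real (cell J x $ k) - 1) / real J < x $ k" "x $ k \<le> real (cell J x $ k) / real J"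
         "(real (cell J x $ k) - 1) / real J < y $ k" "y $ k \<le> real (cell J x $ k) / real J"
        using xb y False by (auto simp: bin_def)
      ultimately show ?thesis by linarith
    qed
  qed
  then show "\<bar>x $ k - y $ k\<bar> \<le> 1 / real J" .
  have "norm (x - y) \<le> (\<Sum>k\<in>UNIV. \<bar>(x - y) $ k\<bar>)" by (rule norm_le_l1_cart)
  also have "\<dots> \<le> (\<Sum>k\<in>(UNIV :: 'd set). 1 / real J)" using b by (intro sum_mono) simp
  finally show "norm (x - y) \<le> real CARD('d) / real J" by simp
qed

lemma projection_holder:
  fixes g :: "real ^ 'd \<Rightarrow> real"
  assumes g: "g \<in> prob_densities" "g \<in> holder_class \<alpha> L" and al: "0 < \<alpha>" "0 < L" and J: "1 \<le> J" and x: "x \<in> half_open_cube"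
  shows "\<bar>projection g J x - g x\<bar> \<le> L * (real CARD('d) / real J) powr \<alpha>"
  unfolding projection_eq_cell_average[OF g(1) J x]
proof (rule cell_average_near[OF J prob_densities_integrable[OF g(1)] x])
  fix y assume y: "y \<in> bin J (cell J x)"
  have "x \<in> unit_cube" "y \<in> unit_cube"
    using x y half_open_cube_subset bin_subset_unit_cube[OF J cell_in_multi_indices[OF J x]] by auto
  then have "\<bar>g y - g x\<bar> \<le> L * norm (y - x) powr \<alpha>" using g(2) by (simp add: holder_class_def)
  also have "\<dots> \<le> L * (real CARD('d) / real J) powr \<alpha>"
    using bin_diameter(1)[OF J x y] al by (intro mult_left_mono powr_mono2) (auto simp: norm_minus_commute)
  finally show "\<bar>g y - g x\<bar> \<le> L * (real CARD('d) / real J) powr \<alpha>" .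
qed

text \<open>For a density f this is the L1 distance between f and its projection.\<close>

definition average_error :: "(real ^ 'd \<Rightarrow> real) \<Rightarrow> nat \<Rightarrow> real" where
  "average_error f J = (LINT x|cube_measure. \<bar>cell_average f J x - f x\<bar>)"

lemma average_error_perturb:
  fixes f :: "real ^ 'd \<Rightarrow> real"
  assumes J: "1 \<le> J" and f: "integrable cube_measure f" "integrable cube_measure h"
  shows "average_error f J \<le> average_error h J + 2 * (LINT x|cube_measure. \<bar>f x - h x\<bar>)"
proof -
  note ci = cell_average_integrable[OF J]
  have fh: "integrable cube_measure (\<lambda>x. f x - h x)" using f by auto
  note i = ci[OF f(1)] ci[OF f(2)] ci[OF fh] f fh
  have "average_error f J \<le> (LINT x|cube_measure. \<bar>cell_average (\<lambda>x. f x - h x) J x\<bar> + \<bar>cell_average h J x - h x\<bar> + \<bar>f x - h x\<bar>)"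
    unfolding average_error_def
  proof (rule integral_mono_AE)
    show "AE x in cube_measure. \<bar>cell_average f J x - f x\<bar>
       \<le> \<bar>cell_average (\<lambda>x. f x - h x) J x\<bar> + \<bar>cell_average h J x - h x\<bar> + \<bar>f x - h x\<bar>"
      using AE_half_open_cube by eventually_elim (simp add: cell_average_diff[OF J f])
  qed (use i in auto)
  also have "\<dots> = (LINT x|cube_measure. \<bar>cell_average (\<lambda>x. f x - h x) J x\<bar>) + average_error h J + (LINT x|cube_measure. \<bar>f x - h x\<bar>)"
    unfolding average_error_def using i by simp
  finally show ?thesis using cell_average_contraction[OF J fh] by simp
qed

lemma average_error_nonneg [simp]: "0 \<le> average_error f J"
  by (simp add: average_error_def)

text \<open>Averaging preserves the integral, so the error is twice the integral of its positive part u.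
  At a point of T the whole bin is eventually contained in T and u vanishes; outside T it
  vanishes anyway.\<close>

lemma average_error_open:
  fixes T :: "(real ^ 'd) set"
  assumes T: "open T"
  shows "average_error (indicator T) \<longlonglongrightarrow> 0"
proof -
  interpret prob_space "cube_measure :: (real ^ 'd) measure" by (rule prob_space_cube_measure)
  have Tm: "(indicator T :: _ \<Rightarrow> real) \<in> borel_measurable cube_measure"
    using T by (intro borel_to_cube_measure borel_measurable_indicator) auto
  have Ti: "integrable cube_measure (indicator T :: _ \<Rightarrow> real)"
    using Tm by (intro integrable_const_bound[of _ 1]) (auto intro!: AE_I2)
  define u where "u J x = max 0 (indicator T x - cell_average (indicator T) J x)" for J :: nat and x
  have avg01: "0 \<le> cell_average (indicator T) J x" for J x
    by (simp add: cell_average_def)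
  have ui: "integrable cube_measure (u (Suc J))" for J
    unfolding u_def[abs_def] using Ti cell_average_integrable[of "Suc J", OF _ Ti]
    by (intro integrable_max) auto
  have err: "average_error (indicator T) (Suc J) = 2 * (LINT x|cube_measure. u (Suc J) x)" for J
  proof -
    note hb = has_bochner_integral_cell_average[of "Suc J", OF _ Ti]
    have "\<bar>cell_average (indicator T) (Suc J) x - indicator T x\<bar>
       = 2 * u (Suc J) x - (indicator T x - cell_average (indicator T) (Suc J) x)" for x
      unfolding u_def by (simp add: max_def)
    then have "average_error (indicator T) (Suc J) = (LINT x|cube_measure. 2 * u (Suc J) x - (indicator T x - cell_average (indicator T) (Suc J) x))"
      unfolding average_error_def by simp
    also have "\<dots> = 2 * (LINT x|cube_measure. u (Suc J) x)"
      using ui[of J] Ti hb by (simp add: has_bochner_integral_iff)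
    finally show ?thesis .
  qed
  have "(\<lambda>J. LINT x|cube_measure. u (Suc J) x) \<longlonglongrightarrow> (LINT x|(cube_measure :: (real ^ 'd) measure). 0 :: real)"
  proof (rule integral_dominated_convergence[where w = "\<lambda>_. 1"])
    show "AE x in cube_measure. (\<lambda>J. u (Suc J) x) \<longlonglongrightarrow> 0"
    proof (use AE_half_open_cube in eventually_elim)
      case (elim x)
      show ?case
      proof (cases "x \<in> T")
        case False
        then have "u (Suc J) x = 0" for J using avg01[of "Suc J" x] by (simp add: u_def)
        then show ?thesis by simp
      next
        case True
        obtain e where e: "0 < e" "ball x e \<subseteq> T" using T True by (auto simp: open_contains_ball)
        obtain N :: nat where N: "real CARD('d) / e < real N" using reals_Archimedean2 by blast
        have "u (Suc J) x = 0" if "N \<le> J" for J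
        proof -
          have "real CARD('d) / real (Suc J) < e"
          proof -
            have "real CARD('d) / e < real (Suc J)" using N that by linarith
            then show ?thesis using e by (simp add: field_simps)
          qed
          then have "bin (Suc J) (cell (Suc J) x) \<subseteq> T"
            using bin_diameter(1)[of "Suc J", OF _ elim] e by (force simp: dist_norm)
          then have "\<bar>cell_average (indicator T) (Suc J) x - 1\<bar> \<le> 0"
            by (intro cell_average_near[OF _ Ti elim]) auto
          then show ?thesis using True by (simp add: u_def)
        qed
        then show ?thesis by (intro tendsto_eventually eventually_sequentiallyI[of N]) auto
      qed
    qed
    show "AE x in cube_measure. norm (u (Suc J) x) \<le> 1" for J
    proof (intro AE_I2)
      fix x
      have "indicator T x \<le> (1 :: real)" by (simp add: indicator_def)
      then show "norm (u (Suc J) x) \<le> 1" using avg01[of "Suc J" x] unfolding u_def real_norm_def by linarith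
    qed
  qed (use ui in auto)
  then have "(\<lambda>J. average_error (indicator T) (Suc J)) \<longlonglongrightarrow> 2 * 0"
    unfolding err by (intro tendsto_mult tendsto_const) simp
  then show ?thesis using filterlim_sequentially_Suc[of "average_error (indicator T)"] by simp
qed

text \<open>Averaging is a contraction in L1, so the functions with this property are closed under L1
  limits. They contain the indicators of open sets, hence by outer regularity those of
  measurable sets.\<close>

lemma average_error_tendsto:
  fixes f :: "real ^ 'd \<Rightarrow> real"
  assumes "integrable cube_measure f"
  shows "average_error f \<longlonglongrightarrow> 0"
proof -
  interpret prob_space "cube_measure :: (real ^ 'd) measure" by (rule prob_space_cube_measure)
  have approx: "average_error f \<longlonglongrightarrow> 0"
    if f: "integrable cube_measure f" and ex: "\<And>e. 0 < e \<Longrightarrow> \<exists>h. integrable cube_measure h \<and> average_error h \<longlonglongrightarrow> 0 \<and> (LINT x|cube_measure. \<bar>f x - h x\<bar>) \<le> e"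
    for f :: "real ^ 'd \<Rightarrow> real"
  proof (rule LIMSEQ_I)
    fix r :: real assume r: "0 < r"
    obtain h where h: "integrable cube_measure h" "average_error h \<longlonglongrightarrow> 0" "(LINT x|cube_measure. \<bar>f x - h x\<bar>) \<le> r / 4"
      using ex[of "r / 4"] r by auto
    obtain N where N: "\<And>J. N \<le> J \<Longrightarrow> norm (average_error h J - 0) < r / 2"
      using LIMSEQ_D[OF h(2), of "r / 2"] r by auto
    show "\<exists>N. \<forall>J\<ge>N. norm (average_error f J - 0) < r"
    proof (intro exI[of _ "max 1 N"] allI impI)
      fix J assume J: "max 1 N \<le> J"
      have "average_error f J \<le> average_error h J + 2 * (r / 4)"
        using average_error_perturb[OF _ f h(1), of J] h(3) J by simp
      then show "norm (average_error f J - 0) < r" using N[of J] J by simp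
    qed
  qed
  show ?thesis using assms
  proof (induction rule: integrable_induct)
    case (base A c)
    have Al: "A \<in> sets lebesgue" using base(1) unfolding sets_restrict_space_iff[OF unit_cube_sets] by simp
    have Ac: "A \<subseteq> unit_cube" using sets.sets_into_space[OF base(1)] by simp
    have Ai: "integrable cube_measure (\<lambda>x. indicator A x *\<^sub>R c)"
      using base by (intro integrable_scaleR_left) (auto simp: emeasure_eq_measure)
    show ?case
    proof (rule approx[OF Ai])
      fix e :: real assume e: "0 < e"
      define e' where "e' = e / (\<bar>c\<bar> + 1)"
      have e': "0 < e'" using e by (simp add: e'_def)
      obtain T where T: "open T" "A \<subseteq> T" "T - A \<in> lmeasurable" "emeasure lebesgue (T - A) < ennreal e'"
        using sets_lebesgue_outer_open[OF Al e'] by auto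
      have Ti: "integrable cube_measure (indicator T :: _ \<Rightarrow> real)"
        using T by (intro integrable_const_bound[of _ 1] borel_to_cube_measure borel_measurable_indicator) (auto intro!: AE_I2)
      have TA: "(T - A) \<inter> unit_cube \<in> sets cube_measure"
        using T(3) unit_cube_sets unfolding sets_restrict_space_iff[OF unit_cube_sets] by auto
      have "measure cube_measure ((T - A) \<inter> unit_cube) \<le> e'"
      proof -
        have "emeasure cube_measure ((T - A) \<inter> unit_cube) = emeasure lebesgue ((T - A) \<inter> unit_cube)"
          by (rule emeasure_restrict_space[OF unit_cube_sets]) auto
        also have "\<dots> \<le> emeasure lebesgue (T - A)" using T(3) by (intro emeasure_mono) auto
        also have "\<dots> \<le> ennreal e'" using T(4) by simp
        finally show ?thesis using e' by (simp add: emeasure_eq_measure)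
      qed
      then have "(LINT x|cube_measure. \<bar>indicator A x *\<^sub>R c - c * indicator T x\<bar>) \<le> e"
      proof -
        have "(LINT x|cube_measure. \<bar>indicator A x *\<^sub>R c - c * indicator T x\<bar>)
            = (LINT x|cube_measure. \<bar>c\<bar> * indicator ((T - A) \<inter> unit_cube) x)"
          using T(2) by (intro Bochner_Integration.integral_cong) (auto simp: indicator_def)
        also have "\<dots> = \<bar>c\<bar> * measure cube_measure ((T - A) \<inter> unit_cube)"
          using TA by simp
        also have "\<dots> \<le> \<bar>c\<bar> * e'" using \<open>measure cube_measure ((T - A) \<inter> unit_cube) \<le> e'\<close> by (intro mult_left_mono) auto
        also have "\<dots> \<le> e" using e by (simp add: e'_def field_simps)
        finally show ?thesis .
      qed
      moreover have "average_error (\<lambda>x. c * indicator T x) = (\<lambda>J. \<bar>c\<bar> * average_error (indicator T) J)"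
      proof
        fix J
        have "cell_average (\<lambda>x. c * indicator T x) J x = c * cell_average (indicator T) J x" for x
          by (simp add: cell_average_def mult.left_commute)
        then have "\<bar>cell_average (\<lambda>x. c * indicator T x) J x - c * indicator T x\<bar> = \<bar>c\<bar> * \<bar>cell_average (indicator T) J x - indicator T x\<bar>" for x
          by (simp add: abs_mult flip: right_diff_distrib)
        then show "average_error (\<lambda>x. c * indicator T x) J = \<bar>c\<bar> * average_error (indicator T) J"
          by (simp add: average_error_def)
      qed
      moreover have "(\<lambda>J. \<bar>c\<bar> * average_error (indicator T) J) \<longlonglongrightarrow> \<bar>c\<bar> * 0"
        by (intro tendsto_mult tendsto_const average_error_open T)
      ultimately show "\<exists>h. integrable cube_measure h \<and> average_error h \<longlonglongrightarrow> 0 \<and> (LINT x|cube_measure. \<bar>indicator A x *\<^sub>R c - h x\<bar>) \<le> e"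
        using Ti by (intro exI[of _ "\<lambda>x. c * indicator T x"]) auto
    qed
  next
    case (add f h)
    have i: "integrable cube_measure (\<lambda>x. f x + h x)" using add by auto
    have le: "average_error (\<lambda>x. f x + h x) J \<le> average_error f J + average_error h J" if J: "1 \<le> J" for J
    proof -
      note ci = cell_average_integrable[OF J]
      have "average_error (\<lambda>x. f x + h x) J \<le> (LINT x|cube_measure. \<bar>cell_average f J x - f x\<bar> + \<bar>cell_average h J x - h x\<bar>)"
        unfolding average_error_def
      proof (rule integral_mono_AE)
        show "AE x in cube_measure. \<bar>cell_average (\<lambda>x. f x + h x) J x - (f x + h x)\<bar> \<le> \<bar>cell_average f J x - f x\<bar> + \<bar>cell_average h J x - h x\<bar>"
        proof (use AE_half_open_cube in eventually_elim)
          case (elim x)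
          have "cell_average (\<lambda>x. f x + h x) J x = cell_average f J x + cell_average h J x"
            using integrable_bin[OF J cell_in_multi_indices[OF J elim]] add by (simp add: cell_average_def distrib_left)
          then show ?case by linarith
        qed
      qed (use ci[OF add(1)] ci[OF add(2)] ci[OF i] add(1,2) i in auto)
      also have "\<dots> = average_error f J + average_error h J"
        unfolding average_error_def using ci[OF add(1)] ci[OF add(2)] add(1,2) by simp
      finally show ?thesis .
    qed
    have "(\<lambda>J. average_error f J + average_error h J) \<longlonglongrightarrow> 0 + 0" by (intro tendsto_add add)
    then have lim: "(\<lambda>J. average_error f J + average_error h J) \<longlonglongrightarrow> 0" by simp
    show ?case
      by (rule tendsto_sandwich[OF _ _ tendsto_const lim]) (use le in \<open>auto intro!: eventually_sequentiallyI[of 1]\<close>)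
  next
    case (lim f s)
    show ?case
    proof (rule approx[OF lim.hyps(4)])
      fix e :: real assume e: "0 < e"
      have "(\<lambda>i. LINT x|cube_measure. \<bar>f x - s i x\<bar>) \<longlonglongrightarrow> (LINT x|(cube_measure :: (real ^ 'd) measure). 0 :: real)"
      proof (rule integral_dominated_convergence[where w = "\<lambda>x. 3 * \<bar>f x\<bar>"])
        show "AE x in cube_measure. (\<lambda>i. \<bar>f x - s i x\<bar>) \<longlonglongrightarrow> 0"
        proof (intro AE_I2)
          fix x :: "real ^ 'd" assume "x \<in> space cube_measure"
          then have "(\<lambda>i. \<bar>f x - s i x\<bar>) \<longlonglongrightarrow> \<bar>f x - f x\<bar>" by (intro tendsto_intros lim.hyps(2))
          then show "(\<lambda>i. \<bar>f x - s i x\<bar>) \<longlonglongrightarrow> 0" by simp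
        qed
        show "AE x in cube_measure. norm \<bar>f x - s i x\<bar> \<le> 3 * \<bar>f x\<bar>" for i
        proof (intro AE_I2)
          fix x :: "real ^ 'd" assume "x \<in> space cube_measure"
          from lim.hyps(3)[OF this, of i] show "norm \<bar>f x - s i x\<bar> \<le> 3 * \<bar>f x\<bar>" by simp
        qed
      qed (use lim.hyps(1,4) in auto)
      then have "(\<lambda>i. LINT x|cube_measure. \<bar>f x - s i x\<bar>) \<longlonglongrightarrow> 0" by simp
      from LIMSEQ_D[OF this e] obtain i where "norm ((LINT x|cube_measure. \<bar>f x - s i x\<bar>) - 0) < e" by blast
      then show "\<exists>h. integrable cube_measure h \<and> average_error h \<longlonglongrightarrow> 0 \<and> (LINT x|cube_measure. \<bar>f x - h x\<bar>) \<le> e"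
        using lim.hyps(1) lim.IH by (intro exI[of _ "s i"]) auto
    qed
  qed
qed

lemma L1_norm_projection_error:
  fixes g :: "real ^ 'd \<Rightarrow> real"
  assumes g: "g \<in> prob_densities" and J: "1 \<le> J"
  shows "L1_norm (\<lambda>x. projection g J x - g x) = ennreal (average_error g J)"
proof -
  note ci = cell_average_integrable[OF J prob_densities_integrable[OF g]]
  have "L1_norm (\<lambda>x. projection g J x - g x) = L1_norm (\<lambda>x. cell_average g J x - g x)"
    by (rule L1_norm_cong_AE, use AE_half_open_cube in eventually_elim) (simp add: projection_eq_cell_average[OF g J])
  also have "\<dots> = ennreal (average_error g J)"
    unfolding average_error_def using ci prob_densities_integrable[OF g] by (intro L1_norm_eq_integral) auto
  finally show ?thesis .
qed

section \<open>Posterior weights of single resolutions\<close>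

lemma marginal_likelihood_lower:
  fixes g :: "real ^ 'd \<Rightarrow> real"
  assumes g: "g \<in> prob_densities" and C: "evidence_rate TYPE('d) a1 a2 a3 C" and w: "dirichlet_weights a1 a2 a3 w"
    and prior: "prior_on_J TYPE('d) b1 b2 \<pi>" and b1: "0 < b1" and J: "2 \<le> J" "J \<le> n"
    and \<theta>: "\<And>j. j \<in> multi_indices J \<Longrightarrow> 0 \<le> \<theta> j" "(\<Sum>j\<in>multi_indices J. \<theta> j) \<le> 1"
  shows "AE X in sample g n. ennreal (real n powr (- (b1 + C) * real J ^ CARD('d))) * (\<Prod>i<n. ennreal (histogram J \<theta> (X i)))
    \<le> marginal_likelihood \<pi> (w n) n X UNIV"
  using AE_sample[OF g AE_half_open_cube]
proof eventually_elim
  case (elim X)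
  define K where "K = real J ^ CARD('d)"
  have n: "2 \<le> n" "0 < real n" using J by auto
  have K: "0 \<le> K" by (simp add: K_def)
  have "real n powr (- b1 * K) = exp (- b1 * K * ln (real n))" using n by (simp add: powr_def)
  also have "\<dots> \<le> exp (- b1 * K * ln (real J))"
    using J K b1 by (simp add: mult_left_mono)
  also have "\<dots> \<le> pmf \<pi> J" using prior J unfolding prior_on_J_def K_def by blast
  finally have pi: "real n powr (- b1 * K) \<le> pmf \<pi> J" .
  define L where "L = (\<Prod>i<n. histogram J \<theta> (X i))"
  have Le: "(\<Prod>i<n. ennreal (histogram J \<theta> (X i))) = ennreal L"
    unfolding L_def using \<theta> by (intro prod_ennreal histogram_nonneg)
  have L: "0 \<le> L" unfolding L_def using \<theta> by (intro prod_nonneg histogram_nonneg) auto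
  have ev: "ennreal (real n powr (- C * K) * L) \<le> evidence (w n) n X J"
    using C[unfolded evidence_rate_def, THEN conjunct2, rule_format, of w n J X \<theta>] w n J elim \<theta>
    unfolding L_def K_def by simp
  have "real n powr (- (b1 + C) * K) = real n powr (- b1 * K) * real n powr (- C * K)"
    by (simp add: algebra_simps flip: powr_add)
  then have "ennreal (real n powr (- (b1 + C) * K)) * ennreal L = ennreal (real n powr (- b1 * K)) * ennreal (real n powr (- C * K) * L)"
    using L by (simp add: mult.assoc flip: ennreal_mult)
  also have "\<dots> \<le> ennreal (pmf \<pi> J) * evidence (w n) n X J" using pi ev by (intro mult_mono ennreal_leI) auto
  also have "\<dots> \<le> marginal_likelihood \<pi> (w n) n X UNIV" by (rule marginal_likelihood_ge)
  finally show ?case unfolding Le K_def .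
qed

text \<open>Up to the factor \<kappa> the mixture over all resolutions explains the sample as well as q
  does, except where Z is at least 1.\<close>

definition evidence_dominates :: "(real ^ 'd \<Rightarrow> real) \<Rightarrow> nat \<Rightarrow> nat pmf \<Rightarrow> (nat \<Rightarrow> nat ^ 'd \<Rightarrow> real) \<Rightarrow> ((nat \<Rightarrow> real ^ 'd) \<Rightarrow> ennreal) \<Rightarrow> real \<Rightarrow> (real ^ 'd \<Rightarrow> real) \<Rightarrow> bool" where
  "evidence_dominates g n \<pi> w Z \<kappa> q \<longleftrightarrow>
    (AE X in sample g n. 1 \<le> Z X \<or> ennreal \<kappa> * (\<Prod>i<n. ennreal (q (X i))) \<le> marginal_likelihood \<pi> w n X UNIV)"

text \<open>The weighted evidence of J relative to the total evidence factors into the evidence relative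
  to the likelihood of the projection of g, which has mean 1, and the likelihood ratio of that
  projection to q, of which only the mean of the p-th root is under control. The exponent is p
  = 1 for fine resolutions and p = 2, which gives the Hellinger affinity, for misspecified
  ones.\<close>

lemma weight_boundI:
  fixes g :: "real ^ 'd \<Rightarrow> real"
  assumes g: "g \<in> prob_densities" and J: "1 \<le> J" and l: "0 < l" "\<And>x. x \<in> unit_cube \<Longrightarrow> l \<le> g x"
    and w: "dirichlet_weights a1 a2 a3 w" "0 < a2" "1 \<le> n"
    and H: "evidence_dominates g n \<pi> (w n) Z \<kappa> q" and \<kappa>: "0 < \<kappa>" and q: "\<And>x. x \<in> half_open_cube \<Longrightarrow> 0 < q x"
    and s: "s \<in> borel_measurable cube_measure" "\<And>x. x \<in> half_open_cube \<Longrightarrow> 0 \<le> s x"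
      "\<And>x. x \<in> half_open_cube \<Longrightarrow> s x ^ p = projection g J x / q x"
    and int: "(\<integral>\<^sup>+ x. ennreal (s x) * ennreal (g x) \<partial>cube_measure) \<le> ennreal \<rho>" "0 \<le> \<rho>"
    and ab: "0 \<le> \<alpha>" "0 \<le> \<beta>" "pmf \<pi> J \<le> \<kappa> * (\<alpha> * \<beta> ^ p)"
  shows "weight_bound g n \<pi> (w n) Z J (\<alpha> + \<beta> * \<rho> ^ n)"
proof -
  let ?I = "multi_indices J :: (nat ^ 'd) set"
  define a where "a X = evidence (w n) n X J * (\<Prod>i<n. ennreal (1 / projection g J (X i)))" for X
  define b where "b X = (\<Prod>i<n. ennreal (s (X i)))" for X
  have wpos: "\<And>i. i \<in> ?I \<Longrightarrow> 0 < w n J i" using dirichlet_weights_pos[OF w J] .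
  note er = evidence_ratio_projection[OF g J l wpos, where F = "\<lambda>_. 1" and u = "\<lambda>_. 1" and n = n, simplified]
  have am: "a \<in> borel_measurable (sample g n)" unfolding a_def using er(2) by simp
  have ai: "(\<integral>\<^sup>+ X. a X \<partial>sample g n) \<le> 1"
  proof -
    interpret D: prob_space "dirichlet ?I 1 (w n J)" using J wpos by (intro prob_space_dirichlet) auto
    have "AE \<theta> in dirichlet ?I 1 (w n J). (\<forall>i\<in>?I. 0 \<le> \<theta> i) \<and> (\<Sum>i\<in>?I. \<theta> i) = 1"
      using J by (intro AE_dirichlet_simplex) auto
    then have "(\<integral>\<^sup>+ \<theta>. ennreal (\<Sum>j\<in>?I. \<theta> j) ^ n \<partial>dirichlet ?I 1 (w n J)) = (\<integral>\<^sup>+ \<theta>. 1 \<partial>dirichlet ?I 1 (w n J))"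
      by (intro nn_integral_cong_AE) (auto elim: eventually_mono)
    then show ?thesis unfolding a_def using er(1) D.emeasure_space_1 by simp
  qed
  have sm: "(\<lambda>x. ennreal (s x)) \<in> borel_measurable cube_measure" using s(1) by measurable
  have bm: "b \<in> borel_measurable (sample g n)"
    unfolding b_def
    by (intro borel_measurable_prod_ennreal measurable_compose[OF sample_component_measurable sm]) auto
  have bi: "(\<integral>\<^sup>+ X. b X \<partial>sample g n) \<le> ennreal (\<rho> ^ n)"
    unfolding b_def nn_integral_sample_prod[OF g sm] using int by (simp add: power_mono flip: ennreal_power)
  define V where "V X = ennreal \<alpha> * a X + ennreal \<beta> * b X" for X
  have Vm: "V \<in> borel_measurable (sample g n)" unfolding V_def using am bm by simp
  have "(\<integral>\<^sup>+ X. V X \<partial>sample g n) = ennreal \<alpha> * (\<integral>\<^sup>+ X. a X \<partial>sample g n) + ennreal \<beta> * (\<integral>\<^sup>+ X. b X \<partial>sample g n)"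
    unfolding V_def using am bm by (simp add: nn_integral_add nn_integral_cmult)
  also have "\<dots> \<le> ennreal \<alpha> * 1 + ennreal \<beta> * ennreal (\<rho> ^ n)" using ai bi by (intro add_mono mult_left_mono) auto
  also have "\<dots> = ennreal (\<alpha> + \<beta> * \<rho> ^ n)" using ab int(2) by (simp add: ennreal_mult)
  finally have Vi: "(\<integral>\<^sup>+ X. V X \<partial>sample g n) \<le> ennreal (\<alpha> + \<beta> * \<rho> ^ n)" .
  have "AE X in sample g n. 1 \<le> Z X \<or> ennreal (pmf \<pi> J) * evidence (w n) n X J \<le> marginal_likelihood \<pi> (w n) n X UNIV * V X"
    using H[unfolded evidence_dominates_def] AE_sample[OF g AE_half_open_cube]
  proof eventually_elim
    case (elim X)
    let ?e = "marginal_likelihood \<pi> (w n) n X UNIV"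
    let ?m = "ennreal (pmf \<pi> J) * evidence (w n) n X J"
    show ?case
    proof (cases "1 \<le> Z X")
      case False
      then have e: "ennreal \<kappa> * (\<Prod>i<n. ennreal (q (X i))) \<le> ?e" using elim by auto
      define P where "P = (\<Prod>i<n. projection g J (X i))"
      define Q where "Q = (\<Prod>i<n. q (X i))"
      define S where "S = (\<Prod>i<n. s (X i))"
      have pp: "0 < projection g J (X i)" if "i < n" for i
        using projection_ge[OF g J l, of "X i"] elim(2) that l(1) by auto
      have P: "0 < P" unfolding P_def using pp by (intro prod_pos) auto
      have Q: "0 < Q" unfolding Q_def using q elim(2) by (intro prod_pos) auto
      have S: "0 \<le> S" unfolding S_def using s(2) elim(2) by (intro prod_nonneg) auto
      have Sp: "S ^ p * Q = P"
      proof -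
        have "S ^ p = (\<Prod>i<n. projection g J (X i) / q (X i))"
          unfolding S_def prod_power_distrib using s(3) elim(2) by (intro prod.cong) auto
        then have "S ^ p = P / Q" by (simp only: prod_dividef P_def Q_def)
        then show ?thesis using Q by simp
      qed
      have aX: "a X = evidence (w n) n X J * ennreal (1 / P)"
      proof -
        have "(\<Prod>i<n. ennreal (1 / projection g J (X i))) = ennreal (\<Prod>i<n. 1 / projection g J (X i))"
          using pp by (intro prod_ennreal) (auto simp: less_imp_le)
        then show ?thesis by (simp add: a_def P_def prod_dividef)
      qed
      have bX: "b X = ennreal S" unfolding b_def S_def using s(2) elim(2) by (intro prod_ennreal) auto
      have QX: "(\<Prod>i<n. ennreal (q (X i))) = ennreal Q"
        unfolding Q_def using q elim(2) by (intro prod_ennreal) (auto simp: less_imp_le)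
      have "?m = ennreal (\<kappa> * Q) * (ennreal (pmf \<pi> J / \<kappa>) * (a X * b X ^ p))"
      proof -
        have "\<kappa> * Q * (pmf \<pi> J / \<kappa>) * (1 / P) * S ^ p = pmf \<pi> J"
          using \<kappa> P Sp by (simp add: field_simps)
        then have "ennreal (pmf \<pi> J) = ennreal (\<kappa> * Q) * ennreal (pmf \<pi> J / \<kappa>) * ennreal (1 / P) * ennreal (S ^ p)"
          using \<kappa> Q P S by (simp flip: ennreal_mult)
        then show ?thesis unfolding aX bX using S by (simp add: ennreal_power ac_simps)
      qed
      also have "\<dots> \<le> ?e * (ennreal (pmf \<pi> J / \<kappa>) * (a X * b X ^ p))"
        using e \<kappa> Q unfolding QX by (intro mult_right_mono) (auto simp: ennreal_mult)
      finally have 2: "?m \<le> ?e * (ennreal (pmf \<pi> J / \<kappa>) * (a X * b X ^ p))" .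
      have 1: "?m \<le> ?e" by (rule marginal_likelihood_ge)
      have "pmf \<pi> J / \<kappa> \<le> \<alpha> * \<beta> ^ p" using ab(3) \<kappa> by (simp add: divide_le_eq mult.commute)
      then have 3: "ennreal (pmf \<pi> J / \<kappa>) \<le> ennreal \<alpha> * ennreal \<beta> ^ p"
        using ab by (simp add: ennreal_power ennreal_leI flip: ennreal_mult)
      show ?thesis using weight_split[OF 1 2 3] unfolding V_def by simp
    qed simp
  qed
  then show ?thesis unfolding weight_bound_def using Vm Vi by blast
qed

lemma AE_nn_integral_le_integral:
  assumes "integrable M h" "AE x in M. f x \<le> ennreal (h x)" "AE x in M. 0 \<le> h x" "(LINT x|M. h x) \<le> c"
  shows "(\<integral>\<^sup>+ x. f x \<partial>M) \<le> ennreal c"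
proof -
  have "(\<integral>\<^sup>+ x. f x \<partial>M) \<le> (\<integral>\<^sup>+ x. ennreal (h x) \<partial>M)" by (intro nn_integral_mono_AE assms)
  also have "\<dots> = ennreal (LINT x|M. h x)" by (intro nn_integral_eq_integral assms)
  also have "\<dots> \<le> ennreal c" by (intro ennreal_leI assms)
  finally show ?thesis .
qed

text \<open>The integrand is g^2 / q = 2 * g - q + (g - q)^2 / q.\<close>

lemma chi_square_bound:
  fixes g q :: "real ^ 'd \<Rightarrow> real"
  assumes g: "g \<in> prob_densities" and q: "q \<in> prob_densities" and l: "0 < l" "\<And>x. x \<in> half_open_cube \<Longrightarrow> l \<le> q x"
    and \<omega>: "\<And>x. x \<in> half_open_cube \<Longrightarrow> \<bar>g x - q x\<bar> \<le> \<omega>"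
  shows "(\<integral>\<^sup>+ x. ennreal (g x / q x) * ennreal (g x) \<partial>cube_measure) \<le> ennreal (1 + \<omega>\<^sup>2 / l)"
proof (rule AE_nn_integral_le_integral[where h = "\<lambda>x. 2 * g x - q x + \<omega>\<^sup>2 / l"])
  interpret prob_space "cube_measure :: (real ^ 'd) measure" by (rule prob_space_cube_measure)
  note gi = prob_densities_integrable[OF g] and qi = prob_densities_integrable[OF q]
  show "integrable cube_measure (\<lambda>x. 2 * g x - q x + \<omega>\<^sup>2 / l)" using gi qi by auto
  show "(LINT x|cube_measure. 2 * g x - q x + \<omega>\<^sup>2 / l) \<le> 1 + \<omega>\<^sup>2 / l"
    using gi qi prob_densities_integral[OF g] prob_densities_integral[OF q] prob_space by simp
  have pt: "g x * g x / q x \<le> 2 * g x - q x + \<omega>\<^sup>2 / l" if "x \<in> half_open_cube" for x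
  proof -
    have qx: "l \<le> q x" "0 < q x" using l(1) l(2)[OF that] by auto
    have "g x * g x / q x = 2 * g x - q x + (g x - q x)\<^sup>2 / q x"
      using qx by (simp add: field_simps power2_eq_square)
    also have "(g x - q x)\<^sup>2 / q x \<le> \<omega>\<^sup>2 / l"
      using qx l \<omega>[OF that] by (intro frac_le) (auto simp: abs_le_square_iff[symmetric])
    finally show ?thesis by simp
  qed
  have gnn: "0 \<le> g x" "0 < q x" if "x \<in> half_open_cube" for x
    using prob_densities_nonneg[OF g, of x] that half_open_cube_subset l(1) l(2)[OF that] by auto
  show "AE x in cube_measure. ennreal (g x / q x) * ennreal (g x) \<le> ennreal (2 * g x - q x + \<omega>\<^sup>2 / l)"
  proof (use AE_half_open_cube in eventually_elim)
    case (elim x)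
    then show ?case using pt[OF elim] gnn[OF elim] by (simp flip: ennreal_mult add: ennreal_leI)
  qed
  show "AE x in cube_measure. 0 \<le> 2 * g x - q x + \<omega>\<^sup>2 / l"
  proof (use AE_half_open_cube in eventually_elim)
    case (elim x)
    have "0 \<le> g x * g x / q x" using gnn[OF elim] by simp
    then show ?case using pt[OF elim] by linarith
  qed
qed

lemma projection_error_integral:
  fixes g :: "real ^ 'd \<Rightarrow> real"
  assumes g: "g \<in> prob_densities" and J: "1 \<le> J"
  shows "(LINT x|cube_measure. \<bar>projection g J x - g x\<bar>) = average_error g J"
proof -
  have "ennreal (LINT x|cube_measure. \<bar>projection g J x - g x\<bar>) = ennreal (average_error g J)"
    using L1_norm_projection_error[OF g J] prob_densities_integrable[OF g] prob_densities_integrable[OF projection_density[OF g J]]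
    by (subst (asm) L1_norm_eq_integral) auto
  then show ?thesis by (simp add: Bochner_Integration.integral_nonneg)
qed

section \<open>Smoothed histograms\<close>

definition adjacent :: "nat ^ 'd \<Rightarrow> nat ^ 'd \<Rightarrow> bool" where
  "adjacent i j \<longleftrightarrow> (\<forall>k. i $ k \<le> j $ k + 1 \<and> j $ k \<le> i $ k + 1)"

lemma card_adjacent: "card {i \<in> multi_indices J. adjacent i j} \<le> 3 ^ CARD('d)" for j :: "nat ^ 'd"
proof -
  have bij: "bij_betw vec_nth {i. adjacent i j} (PiE UNIV (\<lambda>k. {j $ k - 1..j $ k + 1}))"
    by (rule bij_betwI[where g = vec_lambda]) (auto simp: adjacent_def PiE_iff le_diff_conv)
  have fin: "finite {i. adjacent i j}" using bij_betw_finite[OF bij] by (simp add: finite_PiE)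
  have "card {i \<in> multi_indices J. adjacent i j} \<le> card {i. adjacent i j}" using fin by (intro card_mono) auto
  also have "\<dots> = (\<Prod>k\<in>UNIV. card {j $ k - 1..j $ k + 1})" using bij_betw_same_card[OF bij] by (simp add: card_PiE)
  also have "\<dots> \<le> (\<Prod>k\<in>(UNIV :: 'd set). 3)" by (intro prod_mono) auto
  finally show ?thesis by simp
qed

text \<open>A finer bin can reach into several of the bins at resolution J, and g may have a much larger
  average on it than on the one of them that contains a given point. The part of weight \<nu>
  makes up for this. The divisor 3 ^ d bounds the number of adjacent bins, so the total mass
  stays at most 1.\<close>

definition smoothed_prob :: "(real ^ 'd \<Rightarrow> real) \<Rightarrow> real \<Rightarrow> nat \<Rightarrow> nat ^ 'd \<Rightarrow> real" where
  "smoothed_prob g \<nu> J i = (1 - \<nu>) * bin_prob g J i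
     + \<nu> / 3 ^ CARD('d) * (\<Sum>j\<in>{j \<in> multi_indices J. adjacent i j}. bin_prob g J j)"

lemma smoothed_prob_nonneg: "0 \<le> \<nu> \<Longrightarrow> \<nu> \<le> 1 \<Longrightarrow> 0 \<le> smoothed_prob g \<nu> J i"
  unfolding smoothed_prob_def by (intro add_nonneg_nonneg mult_nonneg_nonneg sum_nonneg) auto

lemma sum_smoothed_prob_le:
  fixes g :: "real ^ 'd \<Rightarrow> real"
  assumes g: "g \<in> prob_densities" and J: "1 \<le> J" and \<nu>: "0 \<le> \<nu>" "\<nu> \<le> 1"
  shows "(\<Sum>i\<in>multi_indices J. smoothed_prob g \<nu> J i) \<le> 1"
proof -
  let ?I = "multi_indices J :: (nat ^ 'd) set"
  have "(\<Sum>i\<in>?I. \<Sum>j\<in>{j \<in> ?I. adjacent i j}. bin_prob g J j) = (\<Sum>j\<in>?I. \<Sum>i\<in>{i \<in> ?I. adjacent i j}. bin_prob g J j)"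
    by (rule sum.swap_restrict) auto
  also have "\<dots> = (\<Sum>j\<in>?I. real (card {i \<in> ?I. adjacent i j}) * bin_prob g J j)" by simp
  also have "\<dots> \<le> (\<Sum>j\<in>?I. 3 ^ CARD('d) * bin_prob g J j)"
  proof (intro sum_mono mult_right_mono)
    fix j :: "nat ^ 'd"
    have "real (card {i \<in> ?I. adjacent i j}) \<le> real (3 ^ CARD('d))" using card_adjacent[of J j] of_nat_le_iff by blast
    then show "real (card {i \<in> ?I. adjacent i j}) \<le> 3 ^ CARD('d)" by simp
  qed auto
  also have "\<dots> = 3 ^ CARD('d)" using sum_bin_prob[OF g J] by (simp add: sum_distrib_left[symmetric])
  finally have le: "(\<Sum>i\<in>?I. \<Sum>j\<in>{j \<in> ?I. adjacent i j}. bin_prob g J j) \<le> 3 ^ CARD('d)" .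
  have "(\<Sum>i\<in>?I. smoothed_prob g \<nu> J i) = (1 - \<nu>) * 1
      + \<nu> / 3 ^ CARD('d) * (\<Sum>i\<in>?I. \<Sum>j\<in>{j \<in> ?I. adjacent i j}. bin_prob g J j)"
    unfolding smoothed_prob_def sum.distrib sum_distrib_left[symmetric] sum_bin_prob[OF g J] by simp
  also have "\<dots> \<le> (1 - \<nu>) * 1 + \<nu> / 3 ^ CARD('d) * 3 ^ CARD('d)"
    using \<nu> le by (intro add_left_mono mult_left_mono) auto
  finally show ?thesis by simp
qed

lemma smoothed_ge_projection:
  fixes x :: "real ^ 'd"
  assumes J: "1 \<le> J" and x: "x \<in> half_open_cube" and \<nu>: "0 \<le> \<nu>"
  shows "(1 - \<nu>) * projection g J x \<le> histogram J (smoothed_prob g \<nu> J) x"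
proof -
  have "0 \<le> \<nu> / 3 ^ CARD('d) * (\<Sum>j\<in>{j \<in> multi_indices J. adjacent (cell J x) j}. bin_prob g J j)"
    using \<nu> by (intro mult_nonneg_nonneg sum_nonneg) auto
  then have "real J ^ CARD('d) * ((1 - \<nu>) * bin_prob g J (cell J x)) \<le> real J ^ CARD('d) * smoothed_prob g \<nu> J (cell J x)"
    unfolding smoothed_prob_def by (intro mult_left_mono) auto
  then show ?thesis by (simp add: histogram_cell[OF J x] mult.left_commute)
qed

lemma cell_adjacent:
  fixes x y :: "real ^ 'd"
  assumes "\<And>k. \<bar>x $ k - y $ k\<bar> \<le> 1 / real J" "1 \<le> J"
  shows "adjacent (cell J x) (cell J y)"
proof -
  have "\<lceil>real J * x $ k\<rceil> \<le> \<lceil>real J * y $ k\<rceil> + 1 \<and> \<lceil>real J * y $ k\<rceil> \<le> \<lceil>real J * x $ k\<rceil> + 1" for k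
  proof -
    have "\<bar>real J * x $ k - real J * y $ k\<bar> = real J * \<bar>x $ k - y $ k\<bar>" by (simp add: abs_mult flip: right_diff_distrib)
    also have "\<dots> \<le> real J * (1 / real J)" using assms by (intro mult_left_mono) auto
    also have "\<dots> = 1" using assms by simp
    finally have "real J * x $ k \<le> real J * y $ k + 1" "real J * y $ k \<le> real J * x $ k + 1" by linarith+
    then show ?thesis by (metis ceiling_add_one ceiling_mono)
  qed
  then have "nat \<lceil>real J * x $ k\<rceil> \<le> nat \<lceil>real J * y $ k\<rceil> + 1 \<and> nat \<lceil>real J * y $ k\<rceil> \<le> nat \<lceil>real J * x $ k\<rceil> + 1" for k
    by (smt (verit, ccfv_threshold) Suc_eq_plus1 nat_mono nat_le_iff of_nat_Suc int_nat_eq)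
  then show ?thesis by (simp add: adjacent_def cell_def)
qed

text \<open>A bin of the finer resolution J meets only the bin of x at resolution J' and adjacent ones,
  so that its probability is bounded by theirs.\<close>

lemma projection_le_smoothed:
  fixes g :: "real ^ 'd \<Rightarrow> real" and x :: "real ^ 'd"
  assumes g: "g \<in> prob_densities" and J: "1 \<le> J'" "J' \<le> J" and x: "x \<in> half_open_cube" and \<nu>: "0 < \<nu>" "\<nu> \<le> 1"
  shows "projection g J x \<le> (real J / real J') ^ CARD('d) * (3 ^ CARD('d) / \<nu>) * histogram J' (smoothed_prob g \<nu> J') x"
proof -
  interpret P: prob_space "obs g" by (rule prob_space_obs[OF g])
  have J1: "1 \<le> J" using J by simp
  let ?N = "{j \<in> multi_indices J'. adjacent (cell J' x) j}"
  have sub: "y \<in> (\<Union>j\<in>?N. bin J' j)" if y: "y \<in> bin J (cell J x)" "y \<in> half_open_cube" for y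
  proof -
    have "\<bar>x $ k - y $ k\<bar> \<le> 1 / real J'" for k
    proof -
      have "\<bar>x $ k - y $ k\<bar> \<le> 1 / real J" by (rule bin_diameter(2)[OF J1 x y(1)])
      also have "\<dots> \<le> 1 / real J'" using J by (intro divide_left_mono) auto
      finally show ?thesis .
    qed
    then have "adjacent (cell J' x) (cell J' y)" using J by (intro cell_adjacent) auto
    moreover have "y \<in> bin J' (cell J' y)" using J y by (simp add: mem_bin_iff)
    ultimately show ?thesis using cell_in_multi_indices[OF J(1) y(2)] by auto
  qed
  have bs: "bin J' j \<in> sets (obs g)" if "j \<in> ?N" for j using bin_cube_sets[OF J(1)] that by auto
  have "bin_prob g J (cell J x) \<le> measure (obs g) (\<Union>j\<in>?N. bin J' j)"
    unfolding bin_prob_def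
  proof (rule P.finite_measure_mono_AE)
    show "AE y in obs g. y \<in> bin J (cell J x) \<longrightarrow> y \<in> (\<Union>j\<in>?N. bin J' j)"
      using AE_obs[OF g AE_half_open_cube] by eventually_elim (use sub in auto)
    show "(\<Union>j\<in>?N. bin J' j) \<in> sets (obs g)" using bs by (intro sets.finite_UN) auto
  qed
  also have "\<dots> \<le> (\<Sum>j\<in>?N. bin_prob g J' j)"
    unfolding bin_prob_def using bs by (intro P.finite_measure_subadditive_finite) auto
  finally have p: "bin_prob g J (cell J x) \<le> (\<Sum>j\<in>?N. bin_prob g J' j)" .
  have "\<nu> / 3 ^ CARD('d) * (\<Sum>j\<in>?N. bin_prob g J' j) \<le> smoothed_prob g \<nu> J' (cell J' x)"
    unfolding smoothed_prob_def using \<nu> by (simp add: mult_nonneg_nonneg)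
  then have "(3 ^ CARD('d) / \<nu>) * (\<nu> / 3 ^ CARD('d) * (\<Sum>j\<in>?N. bin_prob g J' j)) \<le> (3 ^ CARD('d) / \<nu>) * smoothed_prob g \<nu> J' (cell J' x)"
    using \<nu> by (intro mult_left_mono) auto
  then have "(\<Sum>j\<in>?N. bin_prob g J' j) \<le> (3 ^ CARD('d) / \<nu>) * smoothed_prob g \<nu> J' (cell J' x)" using \<nu> by simp
  then have "bin_prob g J (cell J x) \<le> (3 ^ CARD('d) / \<nu>) * smoothed_prob g \<nu> J' (cell J' x)" using p by linarith
  then have "real J ^ CARD('d) * bin_prob g J (cell J x) \<le> real J ^ CARD('d) * ((3 ^ CARD('d) / \<nu>) * smoothed_prob g \<nu> J' (cell J' x))"
    by (intro mult_left_mono) auto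
  also have "\<dots> = (real J / real J') ^ CARD('d) * (3 ^ CARD('d) / \<nu>) * (real J' ^ CARD('d) * smoothed_prob g \<nu> J' (cell J' x))"
    using J by (simp add: power_divide)
  finally show ?thesis by (simp add: histogram_cell[OF J(1) x] histogram_cell[OF J1 x])
qed

text \<open>Where g \<le> T, the ratio is compared with the ratio of the two projections of g, which
  differs from 1 by an L1-small amount. Where g > T, the ratio is only bounded by R, but g has
  little mass there.\<close>

lemma smoothed_ratio_integral:
  fixes g q :: "real ^ 'd \<Rightarrow> real"
  assumes g: "g \<in> prob_densities" and J: "1 \<le> J" "1 \<le> J'" and l: "0 < l" "\<And>x. x \<in> unit_cube \<Longrightarrow> l \<le> g x"
    and \<nu>: "0 \<le> \<nu>" "\<nu> < 1" and R: "0 \<le> R" and T: "0 \<le> T"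
    and q: "\<And>x. x \<in> half_open_cube \<Longrightarrow> (1 - \<nu>) * projection g J' x \<le> q x"
      "\<And>x. x \<in> half_open_cube \<Longrightarrow> projection g J x \<le> R * q x"
  shows "(\<integral>\<^sup>+ x. ennreal (projection g J x / q x) * ennreal (g x) \<partial>cube_measure)
    \<le> ennreal ((1 + T / l * (average_error g J + average_error g J') + R * (LINT x|cube_measure. g x * indicator {x. T < g x} x)) / (1 - \<nu>))"
proof -
  note gi = prob_densities_integrable[OF g]
  note pi = prob_densities_integrable[OF projection_density[OF g J(1)]] prob_densities_integrable[OF projection_density[OF g J(2)]]
  define t where "t x = g x * indicator {x. T < g x} x" for x
  have tm: "t \<in> borel_measurable cube_measure"
  proof -
    have "t = (\<lambda>x. if T < g x then g x else 0)" by (auto simp: t_def indicator_def fun_eq_iff)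
    then show ?thesis using prob_densities_measurable[OF g] by simp
  qed
  have ti: "integrable cube_measure t"
    by (rule Bochner_Integration.integrable_bound[OF gi tm]) (auto simp: t_def indicator_def)
  define h where "h x = (g x + T / l * \<bar>projection g J x - projection g J' x\<bar> + R * t x) / (1 - \<nu>)" for x
  have pt: "0 \<le> projection g J x / q x * g x \<and> projection g J x / q x * g x \<le> h x" if x: "x \<in> half_open_cube" for x
  proof -
    define a b where "a = projection g J x" and "b = projection g J' x"
    have ab: "l \<le> a" "l \<le> b" using projection_ge[OF g J(1) l x] projection_ge[OF g J(2) l x] by (simp_all add: a_def b_def)
    have b0: "0 < (1 - \<nu>) * b" using ab l \<nu> by simp
    have qx: "(1 - \<nu>) * b \<le> q x" "a \<le> R * q x" "0 < q x" using q[OF x] b0 by (auto simp: a_def b_def)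
    have g0: "0 < g x" using l(1) l(2)[of x] x half_open_cube_subset by force
    have "a / q x * g x \<le> (g x + T / l * \<bar>a - b\<bar> + R * t x) / (1 - \<nu>)"
    proof (cases "T < g x")
      case True
      have "a / q x \<le> R" using qx by (simp add: divide_le_eq)
      then have "a / q x * g x \<le> R * g x" using g0 by (intro mult_right_mono) auto
      also have "\<dots> \<le> R * g x / (1 - \<nu>)" using \<nu> R g0 by (simp add: le_divide_eq mult_left_le)
      also have "\<dots> \<le> (g x + T / l * \<bar>a - b\<bar> + R * t x) / (1 - \<nu>)"
        using True g0 T l \<nu> by (intro divide_right_mono) (auto simp: t_def)
      finally show ?thesis .
    next
      case False
      have "a / q x \<le> a / ((1 - \<nu>) * b)" using qx b0 ab l by (intro divide_left_mono) auto
      also have "\<dots> \<le> (1 + \<bar>a - b\<bar> / l) / (1 - \<nu>)"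
      proof -
        have "a / b = 1 + (a - b) / b" using ab l by (simp add: field_simps)
        also have "(a - b) / b \<le> \<bar>a - b\<bar> / l" using ab l by (intro frac_le) auto
        finally have "a / b / (1 - \<nu>) \<le> (1 + \<bar>a - b\<bar> / l) / (1 - \<nu>)" using \<nu> by (intro divide_right_mono) auto
        then show ?thesis by (simp add: mult.commute)
      qed
      finally have "a / q x * g x \<le> (1 + \<bar>a - b\<bar> / l) / (1 - \<nu>) * g x" using g0 by (intro mult_right_mono) auto
      also have "\<dots> = (g x + g x * (\<bar>a - b\<bar> / l)) / (1 - \<nu>)" by (simp add: algebra_simps add_divide_distrib)
      also have "\<dots> \<le> (g x + T * (\<bar>a - b\<bar> / l)) / (1 - \<nu>)"
        using False l \<nu> by (intro divide_right_mono add_left_mono mult_right_mono) auto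
      also have "\<dots> \<le> (g x + T / l * \<bar>a - b\<bar> + R * t x) / (1 - \<nu>)"
        using R g0 \<nu> by (intro divide_right_mono) (auto simp: t_def)
      finally show ?thesis .
    qed
    moreover have "0 \<le> a / q x * g x" using ab l qx g0 by simp
    ultimately show ?thesis unfolding h_def a_def b_def by simp
  qed
  show ?thesis
  proof (rule AE_nn_integral_le_integral[where h = h])
    have di: "integrable cube_measure (\<lambda>x. \<bar>projection g J x - projection g J' x\<bar>)" using pi by auto
    show "integrable cube_measure h"
      unfolding h_def by (intro integrable_divide Bochner_Integration.integrable_add gi integrable_mult_right di ti)
    have "(LINT x|cube_measure. \<bar>projection g J x - projection g J' x\<bar>)
      \<le> (LINT x|cube_measure. \<bar>projection g J x - g x\<bar> + \<bar>projection g J' x - g x\<bar>)"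
      using pi gi by (intro integral_mono) auto
    also have "\<dots> = average_error g J + average_error g J'"
      using pi gi by (simp add: projection_error_integral[OF g J(1)] projection_error_integral[OF g J(2)])
    finally have d: "(LINT x|cube_measure. \<bar>projection g J x - projection g J' x\<bar>) \<le> average_error g J + average_error g J'" .
    have "(LINT x|cube_measure. h x) = (1 + T / l * (LINT x|cube_measure. \<bar>projection g J x - projection g J' x\<bar>) + R * (LINT x|cube_measure. t x)) / (1 - \<nu>)"
      unfolding h_def using gi di ti prob_densities_integral[OF g] by simp
    also have "\<dots> \<le> (1 + T / l * (average_error g J + average_error g J') + R * (LINT x|cube_measure. t x)) / (1 - \<nu>)"
      using \<nu> d T l by (intro divide_right_mono add_right_mono add_left_mono mult_left_mono) auto
    finally show "(LINT x|cube_measure. h x) \<le> (1 + T / l * (average_error g J + average_error g J') + R * (LINT x|cube_measure. g x * indicator {x. T < g x} x)) / (1 - \<nu>)"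
      unfolding t_def .
    show "AE x in cube_measure. ennreal (projection g J x / q x) * ennreal (g x) \<le> ennreal (h x)"
    proof (use AE_half_open_cube in eventually_elim)
      case (elim x)
      have "0 \<le> g x" using l(1) l(2)[of x] elim half_open_cube_subset by force
      then show ?case using pt[OF elim] by (simp flip: ennreal_mult'' add: ennreal_leI)
    qed
    show "AE x in cube_measure. 0 \<le> h x"
      using AE_half_open_cube by eventually_elim (use pt in \<open>force intro: order_trans\<close>)
  qed
qed

section \<open>Misspecified and excessively fine resolutions\<close>

text \<open>With the projection at J' replaced by g itself, the left-hand side would be the affinity of
  g and its projection at J. The replacement costs the product of sqrt (projection g J /
  projection g J'), bounded by the square root of J^d / l, and of u * (u - v), where u and v
  are the square roots of g and of its projection at J'.\<close>

lemma misspecified_affinity: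
  fixes g :: "real ^ 'd \<Rightarrow> real"
  assumes g: "g \<in> prob_densities" and J: "1 \<le> J" "1 \<le> J'" and l: "0 < l" "\<And>x. x \<in> unit_cube \<Longrightarrow> l \<le> g x"
    and \<delta>: "0 \<le> \<delta>" "\<delta> \<le> average_error g J" and \<kappa>: "0 < \<kappa>"
  shows "(\<integral>\<^sup>+ x. ennreal (sqrt (projection g J x / projection g J' x)) * ennreal (g x) \<partial>cube_measure)
    \<le> ennreal (1 - \<delta>\<^sup>2 / 8 + sqrt (real J ^ CARD('d) / l) * ((\<kappa> + average_error g J' / \<kappa>) / 2))"
proof -
  note gi = prob_densities_integrable[OF g]
  note pd = projection_density[OF g J(1)]
  note pi = prob_densities_integrable[OF pd] prob_densities_integrable[OF projection_density[OF g J(2)]]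
  define A where "A = sqrt (real J ^ CARD('d) / l)"
  define t where "t x = A * ((\<kappa> * g x + \<bar>projection g J' x - g x\<bar> / \<kappa>) / 2)" for x
  have A: "0 \<le> A" using l by (simp add: A_def)
  have pt: "g x * sqrt (projection g J x / projection g J' x) \<le> sqrt (g x * projection g J x) + t x" if x: "x \<in> half_open_cube" for x
  proof -
    define u v z where "u = sqrt (g x)" and "v = sqrt (projection g J' x)" and "z = sqrt (projection g J x)"
    have p: "l \<le> projection g J x" "l \<le> projection g J' x" using projection_ge[OF g J(1) l x] projection_ge[OF g J(2) l x] by auto
    have g0: "0 < g x" using l(1) l(2)[of x] x half_open_cube_subset by force
    have uvz: "u\<^sup>2 = g x" "v\<^sup>2 = projection g J' x" "0 < u" "0 < v" "0 \<le> z" using p l(1) g0 by (auto simp: u_def v_def z_def)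
    have zv: "z / v \<le> A"
    proof -
      have "bin_prob g J (cell J x) \<le> 1" unfolding bin_prob_def by (rule prob_space.prob_le_1[OF prob_space_obs[OF g]])
      then have "projection g J x \<le> real J ^ CARD('d)" by (simp add: histogram_cell[OF J(1) x] mult_left_le)
      then have "projection g J x / projection g J' x \<le> real J ^ CARD('d) / l" using p l(1) by (intro frac_le) auto
      then show ?thesis by (simp add: A_def z_def v_def flip: real_sqrt_divide)
    qed
    have uu: "u * (u - v) \<le> (\<kappa> * g x + \<bar>projection g J' x - g x\<bar> / \<kappa>) / 2"
    proof -
      have "0 \<le> (\<kappa> * u - (u - v))\<^sup>2 / \<kappa>" using \<kappa> by simp
      also have "\<dots> = \<kappa> * u\<^sup>2 - 2 * (u * (u - v)) + (u - v)\<^sup>2 / \<kappa>"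
        using \<kappa> by (simp add: power2_eq_square field_simps)
      finally have "2 * (u * (u - v)) \<le> \<kappa> * u\<^sup>2 + (u - v)\<^sup>2 / \<kappa>" by simp
      moreover have "(u - v)\<^sup>2 \<le> \<bar>v\<^sup>2 - u\<^sup>2\<bar>"
      proof -
        have "(u - v)\<^sup>2 = \<bar>u - v\<bar> * \<bar>u - v\<bar>" by (simp add: power2_eq_square)
        also have "\<dots> \<le> \<bar>u - v\<bar> * (u + v)" using uvz by (intro mult_left_mono) auto
        also have "\<dots> = \<bar>(u - v) * (u + v)\<bar>" using uvz by (simp add: abs_mult)
        also have "(u - v) * (u + v) = u\<^sup>2 - v\<^sup>2" by (simp add: power2_eq_square algebra_simps)
        finally show ?thesis by (simp add: abs_minus_commute)
      qed
      then have "(u - v)\<^sup>2 / \<kappa> \<le> \<bar>v\<^sup>2 - u\<^sup>2\<bar> / \<kappa>" using \<kappa> by (intro divide_right_mono) auto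
      ultimately show ?thesis unfolding uvz(1,2) by simp
    qed
    have "g x * sqrt (projection g J x / projection g J' x) = u\<^sup>2 * (z / v)"
      by (simp add: uvz z_def v_def real_sqrt_divide)
    also have "\<dots> = u * z + z / v * (u * (u - v))" using uvz(4) by (simp add: field_simps power2_eq_square)
    also have "\<dots> \<le> u * z + A * ((\<kappa> * g x + \<bar>projection g J' x - g x\<bar> / \<kappa>) / 2)"
    proof -
      have "z / v * (u * (u - v)) \<le> z / v * ((\<kappa> * g x + \<bar>projection g J' x - g x\<bar> / \<kappa>) / 2)"
        using uu uvz by (intro mult_left_mono) auto
      also have "\<dots> \<le> A * ((\<kappa> * g x + \<bar>projection g J' x - g x\<bar> / \<kappa>) / 2)"
        using zv g0 \<kappa> by (intro mult_right_mono) auto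
      finally show ?thesis by simp
    qed
    also have "u * z = sqrt (g x * projection g J x)" by (simp add: u_def z_def real_sqrt_mult)
    finally show ?thesis by (simp add: t_def)
  qed
  have t0: "0 \<le> t x" if "x \<in> half_open_cube" for x
    using A \<kappa> l(1) l(2)[of x] that half_open_cube_subset unfolding t_def by (force intro!: mult_nonneg_nonneg add_nonneg_nonneg)
  have tint: "integrable cube_measure t"
    unfolding t_def using gi pi by auto
  have tI: "(LINT x|cube_measure. t x) = A * ((\<kappa> + average_error g J' / \<kappa>) / 2)"
    unfolding t_def using gi pi prob_densities_integral[OF g] projection_error_integral[OF g J(2)] by simp
  have sm: "(\<lambda>x. sqrt (g x * projection g J x)) \<in> borel_measurable cube_measure"
    using prob_densities_measurable[OF g] prob_densities_measurable[OF pd] by measurable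
  have L: "ennreal \<delta> \<le> L1_norm (\<lambda>x. g x - projection g J x)"
    unfolding L1_norm_minus_commute[of g] L1_norm_projection_error[OF g J(1)] using \<delta> by (intro ennreal_leI)
  note hel = hellinger_affinity_le[OF g pd \<delta>(1) L]
  have "(\<integral>\<^sup>+ x. ennreal (sqrt (projection g J x / projection g J' x)) * ennreal (g x) \<partial>cube_measure)
     \<le> (\<integral>\<^sup>+ x. ennreal (sqrt (g x * projection g J x)) + ennreal (t x) \<partial>cube_measure)"
  proof (intro nn_integral_mono_AE, use AE_half_open_cube in eventually_elim)
    case (elim x)
    have g0: "0 \<le> g x" "0 \<le> projection g J x" "0 \<le> projection g J' x"
      using l(1) l(2)[of x] elim half_open_cube_subset by (auto intro: histogram_nonneg)
    then show ?case using pt[OF elim] t0[OF elim]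
      by (simp add: mult.commute ennreal_leI flip: ennreal_mult ennreal_plus)
  qed
  also have "\<dots> = (\<integral>\<^sup>+ x. ennreal (sqrt (g x * projection g J x)) \<partial>cube_measure) + (\<integral>\<^sup>+ x. ennreal (t x) \<partial>cube_measure)"
    using sm tint by (intro nn_integral_add) auto
  also have "\<dots> \<le> ennreal (1 - \<delta>\<^sup>2 / 8) + ennreal (A * ((\<kappa> + average_error g J' / \<kappa>) / 2))"
  proof (intro add_mono hel(1))
    have "AE x in cube_measure. 0 \<le> t x" using AE_half_open_cube by eventually_elim (rule t0)
    from nn_integral_eq_integral[OF tint this]
    show "(\<integral>\<^sup>+ x. ennreal (t x) \<partial>cube_measure) \<le> ennreal (A * ((\<kappa> + average_error g J' / \<kappa>) / 2))"
      unfolding tI by (rule eq_refl)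
  qed
  also have "\<dots> = ennreal (1 - \<delta>\<^sup>2 / 8 + A * ((\<kappa> + average_error g J' / \<kappa>) / 2))"
    using hel(2) A \<kappa> by (intro ennreal_plus[symmetric]) auto
  finally show ?thesis unfolding A_def .
qed

lemma weight_bound_mono: "weight_bound g n \<pi> w Z J b \<Longrightarrow> b \<le> b' \<Longrightarrow> weight_bound g n \<pi> w Z J b'"
  unfolding weight_bound_def by (meson ennreal_leI order_trans)

text \<open>The bounds for the resolutions in Large decay at least geometrically in J, with ratio n powr
  (- c).\<close>

lemma bad_weights_sum:
  assumes n: "2 \<le> n" and c: "0 < c" "real n powr (- c) \<le> 1 / 2" and D: "1 \<le> D"
    and Large: "\<And>J. J \<in> Large \<Longrightarrow> 1 \<le> J" and Mis: "finite Mis" and m: "0 \<le> m"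
  defines "b \<equiv> \<lambda>J. if J \<in> Large then 2 * exp (- c * real J ^ D * ln (real n)) else m"
  shows "(\<Sum>J. if J \<in> Large \<union> Mis then ennreal (b J) else 0) \<le> ennreal (4 * real n powr (- c) + real (card Mis) * m)"
proof -
  define r where "r = real n powr (- c)"
  have r: "0 < r" "r \<le> 1 / 2" using c n by (auto simp: r_def)
  have dom: "2 * exp (- c * real J ^ D * ln (real n)) \<le> 2 * r * r ^ (J - 1)" if J: "1 \<le> J" for J
  proof -
    have "real J ^ 1 \<le> real J ^ D" using J D by (intro power_increasing) auto
    then have "c * ln (real n) * real J \<le> c * ln (real n) * real J ^ D" using c n by (intro mult_left_mono) auto
    then have "exp (- c * real J ^ D * ln (real n)) \<le> exp (- (c * ln (real n)) * real J)" by (simp add: algebra_simps)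
    also have "\<dots> = r ^ J" using n by (simp add: r_def powr_def exp_of_nat_mult[symmetric] algebra_simps)
    also have "\<dots> = r * r ^ (J - 1)" using J by (simp add: power_eq_if)
    finally show ?thesis by simp
  qed
  define f where "f J = (if 1 \<le> J then ennreal (2 * r * r ^ (J - 1)) else 0)" for J
  define h where "h J = (if J \<in> Mis then ennreal m else 0)" for J
  have "(\<Sum>J. if J \<in> Large \<union> Mis then ennreal (b J) else 0) \<le> (\<Sum>J. f J + h J)"
  proof (intro suminf_le summableI)
    fix J
    show "(if J \<in> Large \<union> Mis then ennreal (b J) else 0) \<le> f J + h J"
    proof (cases "J \<in> Large")
      case True
      then have "ennreal (b J) \<le> f J" using dom[OF Large[OF True]] Large[OF True] by (simp add: b_def f_def ennreal_leI)
      then show ?thesis using True by (simp add: add_increasing2)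
    next
      case False
      then show ?thesis by (auto simp: b_def h_def add_increasing)
    qed
  qed
  also have "\<dots> = (\<Sum>J. f J) + (\<Sum>J. h J)" by (intro suminf_add[symmetric] summableI)
  also have "(\<Sum>J. f J) \<le> ennreal (4 * r)"
  proof -
    have "(\<lambda>J. 2 * r * r ^ J) sums (2 * r * (1 / (1 - r)))" using r by (intro sums_mult geometric_sums) auto
    then have "(\<lambda>J. if 1 \<le> J then 2 * r * r ^ (J - 1) else 0) sums (2 * r * (1 / (1 - r)) + 0)"
      using sums_Suc[of "\<lambda>J. if 1 \<le> J then 2 * r * r ^ (J - 1) else 0"] by simp
    then have "(\<Sum>J. ennreal (if 1 \<le> J then 2 * r * r ^ (J - 1) else 0)) = ennreal (2 * r * (1 / (1 - r)) + 0)"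
      using r by (intro suminf_ennreal_eq) auto
    moreover have "f = (\<lambda>J. ennreal (if 1 \<le> J then 2 * r * r ^ (J - 1) else 0))" by (auto simp: f_def)
    ultimately have "(\<Sum>J. f J) = ennreal (2 * r * (1 / (1 - r)))" by simp
    also have "\<dots> \<le> ennreal (4 * r)"
    proof (intro ennreal_leI)
      have "1 / (1 - r) \<le> 2" using r by (simp add: divide_le_eq)
      then have "2 * r * (1 / (1 - r)) \<le> 2 * r * 2" using r by (intro mult_left_mono) auto
      then show "2 * r * (1 / (1 - r)) \<le> 4 * r" by simp
    qed
    finally show ?thesis .
  qed
  also have "(\<Sum>J. h J) = (\<Sum>J\<in>Mis. h J)" using Mis by (intro suminf_finite) (auto simp: h_def)
  also have "(\<Sum>J\<in>Mis. h J) = ennreal (real (card Mis) * m)"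
  proof -
    have "(\<Sum>J\<in>Mis. h J) = (\<Sum>J\<in>Mis. ennreal m)" by (intro sum.cong) (auto simp: h_def)
    also have "\<dots> = ennreal (\<Sum>J\<in>Mis. m)" using m by (intro sum_ennreal) auto
    finally show ?thesis by simp
  qed
  finally have "(\<Sum>J. if J \<in> Large \<union> Mis then ennreal (b J) else 0) \<le> ennreal (4 * r) + ennreal (real (card Mis) * m)"
    by (simp add: add_right_mono)
  also have "\<dots> = ennreal (4 * r + real (card Mis) * m)" using r m by (intro ennreal_plus[symmetric]) auto
  finally show ?thesis unfolding r_def .
qed

text \<open>The route from g to the decreasing functions leads through its projection and the histogram
  of \<theta>; the last two steps are within the radius and the threshold of the test, which
  coincide.\<close>

lemma d1_F_star_near:
  fixes g :: "real ^ 'd \<Rightarrow> real"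
  assumes g: "g \<in> prob_densities" and J: "1 \<le> J"
    and \<theta>: "\<theta> \<notin> far_weights g J (radius TYPE('d) M n J)"
    and d: "d1 (histogram J \<theta>) F_star \<le> ennreal (M * sqrt (real J ^ CARD('d) * ln (real n) / real n))"
    and s: "M * sqrt (real J ^ CARD('d) * ln (real n) / real n) \<le> s"
  shows "d1 g F_star \<le> ennreal (average_error g J + 2 * s)"
proof -
  have hm: "histogram J \<theta> \<in> borel_measurable cube_measure" for \<theta> :: "nat ^ 'd \<Rightarrow> real"
    by (rule borel_to_cube_measure) measurable
  have m1: "(\<lambda>x. g x - projection g J x) \<in> borel_measurable cube_measure"
    using prob_densities_measurable[OF g] hm by measurable
  have m2: "(\<lambda>x. projection g J x - histogram J \<theta> x) \<in> borel_measurable cube_measure"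
    using hm by measurable
  have "(\<Sum>j\<in>multi_indices J. \<bar>\<theta> j - bin_prob g J j\<bar>) \<le> s"
    using \<theta> s by (simp add: far_weights_def radius_def)
  then have t: "L1_norm (\<lambda>x. projection g J x - histogram J \<theta> x) \<le> ennreal s"
    unfolding L1_norm_minus_commute[of "projection g J"] L1_norm_histogram_diff[OF J] by (rule ennreal_leI)
  have s0: "0 \<le> s" using \<open>(\<Sum>j\<in>multi_indices J. \<bar>\<theta> j - bin_prob g J j\<bar>) \<le> s\<close> by (meson abs_ge_zero order_trans sum_nonneg)
  have "d1 g F_star \<le> L1_norm (\<lambda>x. g x - projection g J x) + d1 (projection g J) F_star" by (rule d1_triangle[OF m1])
  also have "d1 (projection g J) F_star \<le> L1_norm (\<lambda>x. projection g J x - histogram J \<theta> x) + d1 (histogram J \<theta>) F_star"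
    by (rule d1_triangle[OF m2])
  also have "L1_norm (\<lambda>x. g x - projection g J x) = ennreal (average_error g J)"
    unfolding L1_norm_minus_commute[of g] by (rule L1_norm_projection_error[OF g J])
  also have "L1_norm (\<lambda>x. projection g J x - histogram J \<theta> x) + d1 (histogram J \<theta>) F_star \<le> ennreal s + ennreal s"
    using t d s by (intro add_mono) (auto intro: order_trans ennreal_leI)
  also have "ennreal (average_error g J) + (ennreal s + ennreal s) = ennreal (average_error g J + 2 * s)"
    using s0 by (simp flip: ennreal_plus)
  finally show ?thesis by (simp add: add_left_mono)
qed

lemma nn_integral_ratio_true:
  fixes g :: "real ^ 'd \<Rightarrow> real"
  assumes g: "g \<in> prob_densities" and J: "1 \<le> J" and l: "0 < l" "\<And>x. x \<in> unit_cube \<Longrightarrow> l \<le> g x"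
  shows "(\<integral>\<^sup>+ x. ennreal (projection g J x / g x) * ennreal (g x) \<partial>cube_measure) = 1"
proof -
  have "(\<integral>\<^sup>+ x. ennreal (projection g J x / g x) * ennreal (g x) \<partial>cube_measure) = (\<integral>\<^sup>+ x. ennreal (projection g J x) \<partial>cube_measure)"
  proof (intro nn_integral_cong)
    fix x :: "real ^ 'd" assume "x \<in> space cube_measure"
    then have "0 < g x" using l(1) l(2)[of x] by simp
    then show "ennreal (projection g J x / g x) * ennreal (g x) = ennreal (projection g J x)"
      by (simp flip: ennreal_mult'')
  qed
  then show ?thesis by (simp add: nn_integral_prob_density[OF projection_density[OF g J]])
qed

lemma exp_power_bound: "0 \<le> t \<Longrightarrow> t \<le> 1 \<Longrightarrow> (1 - t) ^ n \<le> exp (- (real n * t))" for t :: real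
proof -
  assume "0 \<le> t" "t \<le> 1"
  then have "(1 - t) ^ n \<le> exp (- t) ^ n" using exp_ge_add_one_self[of "- t"] by (intro power_mono) auto
  then show ?thesis by (simp flip: exp_of_nat_mult)
qed

section \<open>Power at Hoelder alternatives\<close>

text \<open>The scale is x = (n / ln n) powr (1 / (2 * \<alpha> + d)), the resolution at which the
  squared approximation error x powr (- 2 * \<alpha>) equals the complexity x^d * ln n / n. In
  units of E = x^d * ln n, the total evidence at resolution Jn, the least integer not below x,
  costs C2 * E against the likelihood of g. A resolution is too fine if J^d * ln n exceeds K *
  E, where K is so large that half of the prior exponent outweighs C2 * E; it is misspecified
  if its approximation error is at least \<delta> = M' * x powr (- \<alpha>), where M' is so
  large that the affinity outweighs C2 * E.\<close>

lemma smooth_alternative_power: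
  fixes g :: "real ^ 'd \<Rightarrow> real" and n :: nat and \<alpha> L l x E :: real
  assumes g: "g \<in> prob_densities" "g \<in> holder_class \<alpha> L" and al: "0 < \<alpha>" "0 < L"
    and l: "0 < l" "\<And>x. x \<in> unit_cube \<Longrightarrow> l \<le> g x"
    and w: "dirichlet_weights a1 a2 a3 w" and a2: "0 < a2" and C: "evidence_rate TYPE('d) a1 a2 a3 C"
    and prior: "prior_on_J TYPE('d) b1 b2 \<pi>" and b: "0 < b1" "0 < b2"
    and M: "0 < M" "64 * (C + 4) \<le> M\<^sup>2" and \<gamma>: "0 < \<gamma>"
    and n: "2 \<le> n" and x: "1 < x" "2 * x \<le> real n" "x powr (2 * \<alpha> + real CARD('d)) = real n / ln (real n)"
  defines "E \<equiv> x ^ CARD('d) * ln (real n)" and "\<xi> \<equiv> L\<^sup>2 * real CARD('d) powr (2 * \<alpha>) / l"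
  assumes C2: "(b1 + C) * 2 ^ CARD('d) + 2 * \<xi> \<le> C2"
    and c0: "0 < c0" "c0 * ln (real n) \<le> ln x" and c: "4 * c = b2 * c0" "real n powr (- c) \<le> 1 / 2"
    and K: "1 \<le> K" "C2 \<le> 2 * c * K" "K * x ^ CARD('d) \<le> real n"
    and M': "0 \<le> M'" "16 * C2 \<le> M'\<^sup>2"
    and far: "ennreal (2 * (M' + 2 * (M * sqrt K) + 1) * x powr (- \<alpha>)) < d1 g G_star"
  shows "expectation_iid g n (\<lambda>X. 1 - monotonicity_test \<pi> (w n) M \<gamma> n X)
    \<le> (exp (- \<xi> * E) + 1 / real n + (4 * real n powr (- c) + real n * (2 * exp (- C2 * E)))) / \<gamma>"
proof -
  define Jn where "Jn = nat \<lceil>x\<rceil>"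
  have n0: "0 < real n" "0 < ln (real n)" using n by auto
  have E: "0 < E" using x n0 by (simp add: E_def)
  have xn: "x ^ CARD('d) = x powr real CARD('d)" using x by (simp add: powr_realpow)
  have nE: "real n * (x powr (- \<alpha>))\<^sup>2 = E"
  proof -
    have "real n = x powr (2 * \<alpha> + real CARD('d)) * ln (real n)" using x(3) n0 by simp
    moreover have "(x powr (- \<alpha>))\<^sup>2 = x powr (- (2 * \<alpha>))" using x by (simp add: powr_power)
    ultimately have "real n * (x powr (- \<alpha>))\<^sup>2 = x powr (2 * \<alpha> + real CARD('d)) * x powr (- (2 * \<alpha>)) * ln (real n)"
      by simp
    also have "x powr (2 * \<alpha> + real CARD('d)) * x powr (- (2 * \<alpha>)) = x powr real CARD('d)" by (simp flip: powr_add)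
    finally show ?thesis by (simp add: E_def xn)
  qed
  have Jn: "x \<le> real Jn" "real Jn \<le> 2 * x" "2 \<le> Jn" "Jn \<le> n"
  proof -
    have "real Jn = of_int \<lceil>x\<rceil>" using x by (simp add: Jn_def)
    then show a: "x \<le> real Jn" and "real Jn \<le> 2 * x" using x by linarith+
    then show "Jn \<le> n" using x by linarith
    show "2 \<le> Jn" using a x by linarith
  qed
  have Jn1: "1 \<le> Jn" using Jn by simp
  have C0: "0 < C" using C by (simp add: evidence_rate_def)
  have chi0: "0 < \<xi>" unfolding \<xi>_def using al l by simp
  define \<omega> where "\<omega> = L * (real CARD('d) / real Jn) powr \<alpha>"
  have om: "0 \<le> \<omega>" "real n * (\<omega>\<^sup>2 / l) \<le> \<xi> * E"
  proof -
    show "0 \<le> \<omega>" using al by (simp add: \<omega>_def)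
    have "\<omega> \<le> L * (real CARD('d) / x) powr \<alpha>"
      unfolding \<omega>_def using al Jn x by (intro mult_left_mono powr_mono2 divide_left_mono) auto
    also have "\<dots> = L * real CARD('d) powr \<alpha> * x powr (- \<alpha>)"
    proof -
      have "(real CARD('d) / x) powr \<alpha> = real CARD('d) powr \<alpha> / x powr \<alpha>" by (rule powr_divide)
      then show ?thesis by (simp only: powr_minus divide_inverse mult.assoc)
    qed
    finally have "\<omega>\<^sup>2 \<le> (L * real CARD('d) powr \<alpha> * x powr (- \<alpha>))\<^sup>2" using \<open>0 \<le> \<omega>\<close> by (intro power_mono) auto
    also have "\<dots> = L\<^sup>2 * real CARD('d) powr (2 * \<alpha>) * (x powr (- \<alpha>))\<^sup>2" by (simp add: power_mult_distrib powr_power)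
    finally have "real n * (\<omega>\<^sup>2 / l) \<le> real n * (L\<^sup>2 * real CARD('d) powr (2 * \<alpha>) * (x powr (- \<alpha>))\<^sup>2 / l)"
      using l n0 by (intro mult_left_mono divide_right_mono) auto
    also have "\<dots> = \<xi> * (real n * (x powr (- \<alpha>))\<^sup>2)" by (simp add: \<xi>_def)
    finally show "real n * (\<omega>\<^sup>2 / l) \<le> \<xi> * E" by (simp add: nE)
  qed
  \<comment> \<open>Z is the likelihood ratio of g to its projection at Jn, scaled so that its mean is
      exponentially small.\<close>
  define z where "z = exp (- 2 * \<xi> * E)"
  define ratio where "ratio x = ennreal (g x / projection g Jn x)" for x
  have ratm: "ratio \<in> borel_measurable cube_measure"
    unfolding ratio_def using prob_densities_measurable[OF g(1)] prob_densities_measurable[OF projection_density[OF g(1) Jn1]]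
    by measurable
  define Z where "Z X = ennreal z * (\<Prod>i<n. ratio (X i))" for X :: "nat \<Rightarrow> real ^ 'd"
  have Zm: "Z \<in> borel_measurable (sample g n)"
    unfolding Z_def
    by (intro borel_measurable_times_ennreal borel_measurable_const borel_measurable_prod_ennreal
        measurable_compose[OF sample_component_measurable ratm]) auto
  have Zi: "(\<integral>\<^sup>+ X. Z X \<partial>sample g n) \<le> ennreal (exp (- \<xi> * E))"
  proof -
    have pm: "(\<lambda>X. \<Prod>i<n. ratio (X i)) \<in> borel_measurable (sample g n)"
      by (intro borel_measurable_prod_ennreal measurable_compose[OF sample_component_measurable ratm]) auto
    have "(\<integral>\<^sup>+ X. Z X \<partial>sample g n) = ennreal z * (\<integral>\<^sup>+ x. ratio x * ennreal (g x) \<partial>cube_measure) ^ n"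
      unfolding Z_def using pm by (subst nn_integral_cmult) (auto simp: nn_integral_sample_prod[OF g(1) ratm])
    also have "\<dots> \<le> ennreal z * ennreal (1 + \<omega>\<^sup>2 / l) ^ n"
      unfolding ratio_def
    proof (intro mult_left_mono power_mono)
      show "(\<integral>\<^sup>+ x. ennreal (g x / projection g Jn x) * ennreal (g x) \<partial>cube_measure) \<le> ennreal (1 + \<omega>\<^sup>2 / l)"
      proof (rule chi_square_bound[OF g(1) projection_density[OF g(1) Jn1] l(1)])
        fix y :: "real ^ 'd" assume y: "y \<in> half_open_cube"
        show "l \<le> projection g Jn y" by (rule projection_ge[OF g(1) Jn1 l y])
        show "\<bar>g y - projection g Jn y\<bar> \<le> \<omega>"
          using projection_holder[OF g al Jn1 y] by (simp add: \<omega>_def abs_minus_commute)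
      qed
    qed auto
    also have "\<dots> = ennreal (z * (1 + \<omega>\<^sup>2 / l) ^ n)"
    proof -
      have nn: "0 \<le> 1 + \<omega>\<^sup>2 / l" using l by simp
      then show ?thesis unfolding ennreal_power[OF nn] by (intro ennreal_mult[symmetric]) (auto simp: z_def)
    qed
    also have "z * (1 + \<omega>\<^sup>2 / l) ^ n \<le> z * exp (\<xi> * E)"
    proof (intro mult_left_mono)
      have "(1 + \<omega>\<^sup>2 / l) ^ n \<le> exp (\<omega>\<^sup>2 / l) ^ n" using l exp_ge_add_one_self[of "\<omega>\<^sup>2 / l"] by (intro power_mono) auto
      also have "\<dots> = exp (real n * (\<omega>\<^sup>2 / l))" by (simp flip: exp_of_nat_mult)
      also have "\<dots> \<le> exp (\<xi> * E)" using om by simp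
      finally show "(1 + \<omega>\<^sup>2 / l) ^ n \<le> exp (\<xi> * E)" .
    qed (simp add: z_def)
    also have "\<dots> = exp (- \<xi> * E)" by (simp add: z_def flip: exp_add)
    finally show ?thesis by (simp add: ennreal_leI)
  qed
  define \<kappa> where "\<kappa> = exp (- C2 * E)"
  have \<kappa>: "0 < \<kappa>" by (simp add: \<kappa>_def)
  have gpos: "0 < g y" if "y \<in> half_open_cube" for y
    using l(1) l(2)[of y] that half_open_cube_subset by force
  have ml: "AE X in sample g n. ennreal (real n powr (- (b1 + C) * real Jn ^ CARD('d))) * (\<Prod>i<n. ennreal (projection g Jn (X i)))
    \<le> marginal_likelihood \<pi> (w n) n X UNIV"
    by (rule marginal_likelihood_lower[OF g(1) C w prior b(1) Jn(3,4)]) (auto simp: sum_bin_prob[OF g(1) Jn1])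
  have H: "evidence_dominates g n \<pi> (w n) Z \<kappa> g"
    unfolding evidence_dominates_def using ml AE_sample[OF g(1) AE_half_open_cube]
  proof eventually_elim
    case (elim X)
    let ?e = "marginal_likelihood \<pi> (w n) n X UNIV"
    define G where "G = (\<Prod>i<n. g (X i))"
    define P where "P = (\<Prod>i<n. projection g Jn (X i))"
    have pp: "0 < projection g Jn (X i)" if "i < n" for i
      using projection_ge[OF g(1) Jn1 l, of "X i"] elim that l(1) by auto
    have gp: "0 < g (X i)" if "i < n" for i using gpos elim that by auto
    have P: "0 < P" and G: "0 < G" unfolding P_def G_def using pp gp by (auto intro!: prod_pos)
    have Ge: "(\<Prod>i<n. ennreal (g (X i))) = ennreal G" unfolding G_def using gp by (intro prod_ennreal) (auto simp: less_imp_le)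
    have Pe: "(\<Prod>i<n. ennreal (projection g Jn (X i))) = ennreal P" unfolding P_def using pp by (intro prod_ennreal) (auto simp: less_imp_le)
    have "(\<Prod>i<n. ratio (X i)) = ennreal (\<Prod>i<n. g (X i) / projection g Jn (X i))"
      unfolding ratio_def using pp gp by (intro prod_ennreal) (auto simp: less_imp_le)
    then have "(\<Prod>i<n. ratio (X i)) = ennreal (G / P)" by (simp only: prod_dividef G_def P_def)
    then have ZX: "Z X = ennreal (z * (G / P))" unfolding Z_def by (simp only:) (intro ennreal_mult'[symmetric], simp add: z_def)
    show ?case
    proof (cases "1 \<le> Z X")
      case False
      then have "z * (G / P) < 1" unfolding ZX by (simp add: not_le)
      then have zG: "z * G \<le> P" using P by (simp add: field_simps)
      have "\<kappa> * G \<le> real n powr (- (b1 + C) * real Jn ^ CARD('d)) * (z * G)"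
      proof -
        have "real Jn ^ CARD('d) \<le> (2 * x) ^ CARD('d)" using Jn by (intro power_mono) auto
        then have "(b1 + C) * real Jn ^ CARD('d) * ln (real n) \<le> (b1 + C) * (2 * x) ^ CARD('d) * ln (real n)"
          using b C0 n0 by (intro mult_right_mono mult_left_mono) auto
        also have "\<dots> = (b1 + C) * 2 ^ CARD('d) * E" by (simp add: E_def power_mult_distrib)
        finally have "(b1 + C) * real Jn ^ CARD('d) * ln (real n) + 2 * \<xi> * E \<le> ((b1 + C) * 2 ^ CARD('d) + 2 * \<xi>) * E"
          by (simp add: distrib_right)
        also have "\<dots> \<le> C2 * E" using C2 E by (intro mult_right_mono) auto
        finally have "\<kappa> \<le> exp (- (b1 + C) * real Jn ^ CARD('d) * ln (real n)) * z"
          unfolding \<kappa>_def z_def by (simp add: algebra_simps flip: exp_add)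
        also have "exp (- (b1 + C) * real Jn ^ CARD('d) * ln (real n)) = real n powr (- (b1 + C) * real Jn ^ CARD('d))"
          using n0 by (simp add: powr_def)
        finally show ?thesis using G by (simp add: mult.assoc[symmetric] mult_right_mono)
      qed
      also have "\<dots> \<le> real n powr (- (b1 + C) * real Jn ^ CARD('d)) * P" using zG by (intro mult_left_mono) auto
      finally have "ennreal \<kappa> * ennreal G \<le> ennreal (real n powr (- (b1 + C) * real Jn ^ CARD('d))) * ennreal P"
        using \<kappa> G P by (simp add: ennreal_leI flip: ennreal_mult)
      also have "\<dots> \<le> ?e" using elim unfolding Pe by simp
      finally show ?thesis unfolding Ge by simp
    qed simp
  qed
  define Large where "Large = {J :: nat. 1 \<le> J \<and> K * E < real J ^ CARD('d) * ln (real n)}"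
  define \<delta> where "\<delta> = M' * x powr (- \<alpha>)"
  define Mis where "Mis = {J :: nat. 1 \<le> J \<and> real J ^ CARD('d) * ln (real n) \<le> K * E \<and> \<delta> \<le> average_error g J}"
  define m where "m = 2 * exp (- C2 * E)"
  define bb where "bb J = (if J \<in> Large then 2 * exp (- c * real J ^ CARD('d) * ln (real n)) else m)" for J :: nat
  have n\<delta>: "real n * \<delta>\<^sup>2 = M'\<^sup>2 * E" unfolding \<delta>_def nE[symmetric] by (simp add: power_mult_distrib)
  have cpos: "0 < c" using c b c0 by (simp add: mult_pos_pos) (smt (verit) mult_pos_pos)
  have C2pos: "0 < C2"
  proof -
    have "0 < (b1 + C) * 2 ^ CARD('d) + 2 * \<xi>" using b C0 chi0 by (intro add_pos_pos mult_pos_pos) auto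
    then show ?thesis using C2 by linarith
  qed
  have large: "weight_bound g n \<pi> (w n) Z J (2 * exp (- c * real J ^ CARD('d) * ln (real n)))" if J: "J \<in> Large" for J
  proof -
    have J1: "1 \<le> J" and JE: "K * E < real J ^ CARD('d) * ln (real n)" using J by (auto simp: Large_def)
    define v where "v = real J ^ CARD('d) * ln (real n)"
    have v0: "0 < v" using J1 n0 by (simp add: v_def)
    have xJ: "x < real J"
    proof (rule ccontr)
      assume "\<not> x < real J"
      then have "real J ^ CARD('d) \<le> x ^ CARD('d)" by (intro power_mono) auto
      then have "v \<le> E" unfolding v_def E_def using n0 by (intro mult_right_mono) auto
      also have "\<dots> \<le> K * E" using K(1) E by simp
      finally show False using JE by (simp add: v_def)
    qed
    then have J2: "2 \<le> J" using x by linarith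
    have lnJ: "c0 * ln (real n) \<le> ln (real J)" using c0(2) xJ x by (smt (verit) ln_mono)
    define e where "e = exp (- c * v)"
    have "pmf \<pi> J \<le> exp (- b2 * real J ^ CARD('d) * ln (real J))" using prior J2 unfolding prior_on_J_def by blast
    also have "\<dots> \<le> exp (- (4 * c) * v)"
    proof -
      have "b2 * real J ^ CARD('d) * (c0 * ln (real n)) \<le> b2 * real J ^ CARD('d) * ln (real J)"
        using b lnJ by (intro mult_left_mono) auto
      then show ?thesis unfolding c(1) v_def by (simp add: algebra_simps)
    qed
    \<comment> \<open>Half of the prior exponent pays for \<kappa>; each of \<alpha> and \<beta> in
        weight_boundI takes a quarter.\<close>
    also have "\<dots> = exp (- 2 * c * v) * (e * e)" by (simp add: e_def flip: exp_add)
    also have "\<dots> \<le> \<kappa> * (e * e)"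
    proof (intro mult_right_mono)
      have "C2 * E \<le> 2 * c * K * E" using K(2) E by (intro mult_right_mono) auto
      also have "\<dots> \<le> 2 * c * v" using JE cpos by (simp add: v_def)
      finally show "exp (- 2 * c * v) \<le> \<kappa>" by (simp add: \<kappa>_def)
    qed (simp add: e_def)
    finally have pe: "pmf \<pi> J \<le> \<kappa> * (e * e ^ 1)" by simp
    have sm: "(\<lambda>x. projection g J x / g x) \<in> borel_measurable cube_measure"
      using prob_densities_measurable[OF g(1)] prob_densities_measurable[OF projection_density[OF g(1) J1]] by measurable
    have "weight_bound g n \<pi> (w n) Z J (e + e * 1 ^ n)"
    proof (rule weight_boundI[OF g(1) J1 l w a2 _ H \<kappa> _ sm _ _ _ _ _ _ pe])
      show "(\<integral>\<^sup>+ x. ennreal (projection g J x / g x) * ennreal (g x) \<partial>cube_measure) \<le> ennreal 1"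
        using nn_integral_ratio_true[OF g(1) J1 l] by simp
      show "0 \<le> projection g J y / g y" if "y \<in> half_open_cube" for y
        using gpos[OF that] by (intro divide_nonneg_nonneg histogram_nonneg) auto
    qed (use n gpos in \<open>auto simp: e_def\<close>)
    then show ?thesis by (simp add: e_def v_def mult.assoc)
  qed
  have mis: "weight_bound g n \<pi> (w n) Z J m" if J: "J \<in> Mis" for J
  proof -
    have J1: "1 \<le> J" and \<delta>J: "\<delta> \<le> average_error g J" using J by (auto simp: Mis_def)
    have \<delta>0: "0 \<le> \<delta>" using M' by (simp add: \<delta>_def)
    note pd = projection_density[OF g(1) J1]
    have sm: "(\<lambda>x. sqrt (projection g J x / g x)) \<in> borel_measurable cube_measure"
      using prob_densities_measurable[OF g(1)] prob_densities_measurable[OF pd] by measurable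
    have L1: "ennreal \<delta> \<le> L1_norm (\<lambda>x. g x - projection g J x)"
      unfolding L1_norm_minus_commute[of g] L1_norm_projection_error[OF g(1) J1] using \<delta>J by (intro ennreal_leI)
    note hel = hellinger_affinity_le[OF g(1) pd \<delta>0 L1]
    \<comment> \<open>\<beta> takes half of the affinity exponent n * \<delta>^2 / 8, and \<alpha>' is what
        remains after paying for \<kappa>.\<close>
    define \<alpha>' \<beta> where "\<alpha>' = exp (C2 * E - real n * \<delta>\<^sup>2 / 8)" and "\<beta> = exp (real n * \<delta>\<^sup>2 / 16)"
    have "\<kappa> * (\<alpha>' * \<beta> ^ 2) = 1"
      unfolding \<kappa>_def \<alpha>'_def \<beta>_def by (simp add: power2_eq_square flip: exp_add)
    then have pe: "pmf \<pi> J \<le> \<kappa> * (\<alpha>' * \<beta> ^ 2)" by (simp add: pmf_le_1)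
    have "weight_bound g n \<pi> (w n) Z J (\<alpha>' + \<beta> * (1 - \<delta>\<^sup>2 / 8) ^ n)"
    proof (rule weight_boundI[OF g(1) J1 l w a2 _ H \<kappa> _ sm _ _ _ _ _ _ pe])
      have "(\<integral>\<^sup>+ x. ennreal (sqrt (projection g J x / g x)) * ennreal (g x) \<partial>cube_measure)
         = (\<integral>\<^sup>+ x. ennreal (sqrt (g x * projection g J x)) \<partial>cube_measure)"
      proof (intro nn_integral_cong)
        fix y :: "real ^ 'd" assume "y \<in> space cube_measure"
        then have gy: "0 < g y" using l(1) l(2)[of y] by simp
        have "0 \<le> projection g J y" by (intro histogram_nonneg) auto
        then have "sqrt (projection g J y / g y) * g y = sqrt (g y * projection g J y)"
          using gy by (simp add: real_sqrt_divide real_sqrt_mult field_simps)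
        then show "ennreal (sqrt (projection g J y / g y)) * ennreal (g y) = ennreal (sqrt (g y * projection g J y))"
          using gy by (simp flip: ennreal_mult'')
      qed
      then show "(\<integral>\<^sup>+ x. ennreal (sqrt (projection g J x / g x)) * ennreal (g x) \<partial>cube_measure) \<le> ennreal (1 - \<delta>\<^sup>2 / 8)"
        using hel(1) by simp
      show "0 \<le> sqrt (projection g J y / g y)" "(sqrt (projection g J y / g y))\<^sup>2 = projection g J y / g y" if "y \<in> half_open_cube" for y
        using gpos[OF that] by (auto intro!: divide_nonneg_nonneg histogram_nonneg)
    qed (use n gpos hel(2) in \<open>auto simp: \<alpha>'_def \<beta>_def\<close>)
    moreover have "\<alpha>' + \<beta> * (1 - \<delta>\<^sup>2 / 8) ^ n \<le> m"
    proof -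
      have e16: "16 * C2 * E \<le> M'\<^sup>2 * E" using M'(2) E by (intro mult_right_mono) auto
      have "\<alpha>' \<le> exp (- C2 * E)" unfolding \<alpha>'_def n\<delta> using e16 by simp
      moreover have "\<beta> * (1 - \<delta>\<^sup>2 / 8) ^ n \<le> exp (- C2 * E)"
      proof -
        have "\<beta> * (1 - \<delta>\<^sup>2 / 8) ^ n \<le> \<beta> * exp (- (real n * (\<delta>\<^sup>2 / 8)))"
          using hel(2) by (intro mult_left_mono exp_power_bound) (auto simp: \<beta>_def)
        also have "\<dots> = exp (- (real n * \<delta>\<^sup>2) / 16)" unfolding \<beta>_def by (simp flip: exp_add)
        also have "\<dots> \<le> exp (- C2 * E)" unfolding n\<delta> using e16 by simp
        finally show ?thesis .
      qed
      ultimately show ?thesis by (simp add: m_def)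
    qed
    ultimately show ?thesis by (rule weight_bound_mono)
  qed
  have MisN: "Mis \<subseteq> {1..n}"
  proof
    fix J assume J: "J \<in> Mis"
    then have "real J ^ CARD('d) * ln (real n) \<le> K * x ^ CARD('d) * ln (real n)" by (simp add: Mis_def E_def)
    then have "real J ^ CARD('d) \<le> K * x ^ CARD('d)" using n0 by simp
    moreover have "real J ^ 1 \<le> real J ^ CARD('d)" using J by (intro power_increasing) (auto simp: Mis_def Suc_le_eq)
    ultimately have "real J \<le> real n" using K(3) unfolding power_one_right by linarith
    then have "J \<le> n" by simp
    then show "J \<in> {1..n}" using J by (simp add: Mis_def)
  qed
  have finM: "finite Mis" and cardM: "card Mis \<le> n" using finite_subset[OF MisN] card_mono[OF _ MisN] by auto
  have m0: "0 \<le> m" by (simp add: m_def)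
  have D1: "1 \<le> CARD('d)" by (simp add: Suc_le_eq)
  have sum: "(\<Sum>J. if J \<in> Large \<union> Mis then ennreal (bb J) else 0) \<le> ennreal (4 * real n powr (- c) + real n * m)"
  proof -
    have "(\<Sum>J. if J \<in> Large \<union> Mis then ennreal (bb J) else 0) \<le> ennreal (4 * real n powr (- c) + real (card Mis) * m)"
      unfolding bb_def by (rule bad_weights_sum[OF n cpos c(2) D1 _ finM m0]) (simp add: Large_def)
    also have "\<dots> \<le> ennreal (4 * real n powr (- c) + real n * m)"
      using cardM m0 by (intro ennreal_leI add_left_mono mult_right_mono) auto
    finally show ?thesis .
  qed
  have pi0: "pmf \<pi> 0 = 0" using prior by (simp add: prior_on_J_def)
  have bb: "weight_bound g n \<pi> (w n) Z J (bb J)" if "J \<in> Large \<union> Mis" for J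
    using that large[of J] mis[of J] by (auto simp: bb_def)
  have c00: "0 \<le> 4 * real n powr (- c) + real n * m" using m0 by simp
  have good: "\<not> d1 (histogram J \<theta>) F_star \<le> ennreal (M * sqrt (real J ^ CARD('d) * ln (real n) / real n))"
    if J: "1 \<le> J" "J \<notin> Large \<union> Mis" and \<theta>: "\<theta> \<notin> far_weights g J (radius TYPE('d) M n J)" for J and \<theta> :: "nat ^ 'd \<Rightarrow> real"
  proof
    assume d: "d1 (histogram J \<theta>) F_star \<le> ennreal (M * sqrt (real J ^ CARD('d) * ln (real n) / real n))"
    have JE: "real J ^ CARD('d) * ln (real n) \<le> K * E" and err: "average_error g J < \<delta>"
      using J by (auto simp: Large_def Mis_def)
    have xa: "0 < x powr (- \<alpha>)" using x by simp
    have "real J ^ CARD('d) * ln (real n) / real n \<le> K * (x powr (- \<alpha>))\<^sup>2"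
      using JE n0 unfolding nE[symmetric] by (simp add: divide_le_eq algebra_simps)
    then have "sqrt (real J ^ CARD('d) * ln (real n) / real n) \<le> sqrt (K * (x powr (- \<alpha>))\<^sup>2)" by (rule real_sqrt_le_mono)
    also have "\<dots> = sqrt K * x powr (- \<alpha>)" using xa by (simp add: real_sqrt_mult)
    finally have s: "M * sqrt (real J ^ CARD('d) * ln (real n) / real n) \<le> M * (sqrt K * x powr (- \<alpha>))"
      using M by (intro mult_left_mono) auto
    have "d1 g F_star \<le> ennreal (average_error g J + 2 * (M * (sqrt K * x powr (- \<alpha>))))"
      by (rule d1_F_star_near[OF g(1) J(1) \<theta> d s])
    also have "\<dots> \<le> ennreal ((M' + 2 * (M * sqrt K)) * x powr (- \<alpha>))"
      using err by (intro ennreal_leI) (simp add: \<delta>_def algebra_simps)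
    also have "\<dots> < ennreal ((M' + 2 * (M * sqrt K) + 1) * x powr (- \<alpha>))"
      using xa M M' K by (intro ennreal_lessI) (auto intro!: mult_pos_pos add_nonneg_pos)
    also have "\<dots> \<le> d1 g F_star"
    proof (rule d1_F_star_ge[OF g(1)])
      show "0 \<le> (M' + 2 * (M * sqrt K) + 1) * x powr (- \<alpha>)" using xa M M' K by simp
      show "ennreal (2 * ((M' + 2 * (M * sqrt K) + 1) * x powr (- \<alpha>))) \<le> d1 g G_star"
        using far unfolding mult.assoc by (rule less_imp_le)
    qed
    finally show False by simp
  qed
  show ?thesis
  proof (fold m_def, rule acceptance_bound[OF g(1) l w a2 n C M pi0 \<gamma> bb sum c00 Zm Zi])
    show "0 \<le> exp (- \<xi> * E)" by simp
  qed (use good in blast)+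
qed

section \<open>Power at a fixed alternative\<close>

lemma evidence_dominates_zeroI:
  fixes g :: "real ^ 'd \<Rightarrow> real"
  assumes ae: "AE X in sample g n. ennreal (real n powr (- (b1 + C) * real J ^ CARD('d))) * (\<Prod>i<n. ennreal (q (X i)))
      \<le> marginal_likelihood \<pi> w n X UNIV"
    and \<kappa>: "\<kappa> \<le> real n powr (- (b1 + C) * real J ^ CARD('d))"
  shows "evidence_dominates g n \<pi> w (\<lambda>_. 0) \<kappa> q"
  unfolding evidence_dominates_def using ae
proof eventually_elim
  case (elim X)
  have "ennreal \<kappa> * (\<Prod>i<n. ennreal (q (X i))) \<le> ennreal (real n powr (- (b1 + C) * real J ^ CARD('d))) * (\<Prod>i<n. ennreal (q (X i)))"
    using \<kappa> by (intro mult_right_mono ennreal_leI) auto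
  then show ?case using elim by (auto intro: order_trans)
qed

text \<open>All resolutions are measured by s = J^d * ln n / n, the squared radius up to a factor. Those
  with s > \<tau> are too fine; below \<tau>, twice the radius is at most \<Delta> / 4. The
  reference resolution J' has s of the order \<eta>, so small that the factor \<kappa> = exp
  (- (b1 + C) * \<eta> * n) is outweighed by the prior of the resolutions with s > \<tau> and
  by the affinity of the misspecified ones, which are below J0.

  R s bounds the ratio of the projection at J to the smoothed histogram at J'. For s \<ge> s0
  this crude bound is already below exp (c1 * s / 8), an eighth of the prior exponent; for
  smaller s it is R s0, and a truncation level T makes the mean ratio at most (1 + 2 * \<nu>)
  / (1 - \<nu>). The assumption on sqrt n ensures that ln J is at least ln n / (2 * d) for the
  fine resolutions, so that their prior exponent is c1 * s * n or more.\<close>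

lemma fixed_alternative_power:
  fixes g :: "real ^ 'd \<Rightarrow> real" and n J' J0 :: nat
  assumes g: "g \<in> prob_densities" and l: "0 < l" "\<And>x. x \<in> unit_cube \<Longrightarrow> l \<le> g x"
    and w: "dirichlet_weights a1 a2 a3 w" and a2: "0 < a2" and C: "evidence_rate TYPE('d) a1 a2 a3 C"
    and prior: "prior_on_J TYPE('d) b1 b2 \<pi>" and b: "0 < b1" "0 < b2"
    and M: "0 < M" "64 * (C + 4) \<le> M\<^sup>2" and \<gamma>: "0 < \<gamma>" and n: "2 \<le> n"
    and \<Delta>: "0 < \<Delta>" "ennreal \<Delta> \<le> d1 g F_star"
    and \<tau>: "0 < \<tau>" "2 * (M * sqrt \<tau>) \<le> \<Delta> / 4"
  defines "c1 \<equiv> b2 / (2 * real CARD('d))" and "\<delta> \<equiv> \<Delta> / 2"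
  assumes \<eta>: "0 < \<eta>" "\<eta> \<le> \<tau>" "(b1 + C) * \<eta> \<le> c1 * \<tau> / 4" "(b1 + C) * \<eta> \<le> \<delta>\<^sup>2 / 32"
    and J': "2 \<le> J'" "J' \<le> n" "real J' ^ CARD('d) * ln (real n) \<le> \<eta> * real n"
      "\<eta> * real n \<le> 2 ^ CARD('d) * real J' ^ CARD('d) * ln (real n)"
    and \<nu>: "0 < \<nu>" "\<nu> \<le> 1 / 2" "4 * \<nu> \<le> c1 * \<tau> / 8"
  defines "R \<equiv> \<lambda>s. 6 ^ CARD('d) * s / (\<eta> * \<nu>)"
  assumes s0: "0 < s0" "\<And>s. s0 \<le> s \<Longrightarrow> R s \<le> exp (c1 * s / 8)"
    and T: "0 \<le> T" "R s0 * (LINT x|cube_measure. g x * indicator {x. T < g x} x) \<le> \<nu>"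
    and e0: "\<And>J. \<tau> * real n < real J ^ CARD('d) * ln (real n) \<Longrightarrow> average_error g J \<le> e0"
      "average_error g J' \<le> e0" "T / l * (e0 + e0) \<le> \<nu>"
    and root: "sqrt (real n) \<le> \<tau> * real n / ln (real n)"
    and J0: "\<And>J. J0 \<le> J \<Longrightarrow> average_error g J < \<delta>"
    and k: "0 < k" "sqrt (real J0 ^ CARD('d) / l) * k \<le> \<delta>\<^sup>2 / 16" "average_error g J' \<le> k\<^sup>2"
    and c: "real n powr (- (c1 / 4)) \<le> 1 / 2"
  shows "expectation_iid g n (\<lambda>X. 1 - monotonicity_test \<pi> (w n) M \<gamma> n X)
    \<le> (1 / real n + (4 * real n powr (- (c1 / 4)) + real J0 * (2 * exp (- (real n * \<delta>\<^sup>2 / 32))))) / \<gamma>"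
proof -
  have n0: "0 < real n" "0 < ln (real n)" using n by auto
  have D1: "1 \<le> CARD('d)" by (simp add: Suc_le_eq)
  have c1: "0 < c1" using b by (simp add: c1_def)
  have C0: "0 < C" using C by (simp add: evidence_rate_def)
  have J'1: "1 \<le> J'" using J' by simp
  define \<kappa> where "\<kappa> = exp (- (b1 + C) * (\<eta> * real n))"
  have \<kappa>: "0 < \<kappa>" by (simp add: \<kappa>_def)
  have \<kappa>le: "\<kappa> \<le> real n powr (- (b1 + C) * real J' ^ CARD('d))"
  proof -
    have "(b1 + C) * (real J' ^ CARD('d) * ln (real n)) \<le> (b1 + C) * (\<eta> * real n)" using J'(3) b C0 by (intro mult_left_mono) auto
    then show ?thesis using n0 by (simp add: \<kappa>_def powr_def algebra_simps)
  qed
  define q where "q = histogram J' (smoothed_prob g \<nu> J')"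
  have Hq: "evidence_dominates g n \<pi> (w n) (\<lambda>_. 0) \<kappa> q"
    unfolding q_def using \<nu>
    by (intro evidence_dominates_zeroI[OF _ \<kappa>le] marginal_likelihood_lower[OF g C w prior b(1) J'(1,2)]
        smoothed_prob_nonneg sum_smoothed_prob_le[OF g J'1]) auto
  have Hp: "evidence_dominates g n \<pi> (w n) (\<lambda>_. 0) \<kappa> (projection g J')"
    by (intro evidence_dominates_zeroI[OF _ \<kappa>le] marginal_likelihood_lower[OF g C w prior b(1) J'(1,2)])
      (auto simp: sum_bin_prob[OF g J'1])
  have ppos: "0 < projection g J y" if "1 \<le> J" "y \<in> half_open_cube" for J y
    using projection_ge[OF g that(1) l that(2)] l(1) by simp
  have gpos: "0 < g y" if "y \<in> unit_cube" for y using l(1) l(2)[OF that] by simp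
  have qge: "(1 - \<nu>) * projection g J' y \<le> q y" if "y \<in> half_open_cube" for y
    unfolding q_def using \<nu> by (intro smoothed_ge_projection[OF J'1 that]) auto
  have qpos: "0 < q y" if "y \<in> half_open_cube" for y
  proof -
    have "0 < (1 - \<nu>) * projection g J' y" using ppos[OF J'1 that] \<nu> by simp
    then show ?thesis using qge[OF that] by linarith
  qed
  have qm: "q \<in> borel_measurable cube_measure" unfolding q_def by (rule borel_to_cube_measure) measurable
  have pm: "projection g J \<in> borel_measurable cube_measure" for J by (rule borel_to_cube_measure) measurable
  define Large where "Large = {J :: nat. 1 \<le> J \<and> \<tau> * real n < real J ^ CARD('d) * ln (real n)}"
  define Mis where "Mis = {J :: nat. 1 \<le> J \<and> \<delta> \<le> average_error g J}"
  define m where "m = 2 * exp (- (real n * \<delta>\<^sup>2 / 32))"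
  define bb where "bb J = (if J \<in> Large then 2 * exp (- (c1 / 4) * real J ^ CARD('d) * ln (real n)) else m)" for J :: nat
  have large: "weight_bound g n \<pi> (w n) (\<lambda>_. 0) J (2 * exp (- (c1 / 4) * real J ^ CARD('d) * ln (real n)))" if J: "J \<in> Large" for J
  proof -
    have J1: "1 \<le> J" and JE: "\<tau> * real n < real J ^ CARD('d) * ln (real n)" using J by (auto simp: Large_def)
    define s where "s = real J ^ CARD('d) * ln (real n) / real n"
    have sn: "s * real n = real J ^ CARD('d) * ln (real n)" using n0 by (simp add: s_def)
    have s\<tau>: "\<tau> < s" using JE n0 by (simp add: s_def less_divide_eq)
    have s0': "0 < s" using s\<tau> \<tau> by simp
    have rootJ: "sqrt (real n) < real J ^ CARD('d)"
    proof -
      have "\<tau> * real n / ln (real n) < real J ^ CARD('d)" using JE n0 by (simp add: divide_less_eq)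
      then show ?thesis using root by simp
    qed
    have J2: "2 \<le> J"
    proof (rule ccontr)
      assume "\<not> 2 \<le> J"
      then have "J = 1" using J1 by simp
      then have "sqrt (real n) < 1" using rootJ by simp
      moreover have "1 \<le> sqrt (real n)" using n by simp
      ultimately show False by simp
    qed
    have lnJ: "ln (real n) \<le> 2 * real CARD('d) * ln (real J)"
    proof -
      have "ln (sqrt (real n)) \<le> ln (real J ^ CARD('d))" using rootJ n0 by (intro ln_mono) auto
      then have "ln (real n) / 2 \<le> real CARD('d) * ln (real J)" using n0 J1 by (simp add: ln_sqrt ln_realpow)
      then show ?thesis by simp
    qed
    have JJ': "J' \<le> J"
    proof (rule ccontr)
      assume "\<not> J' \<le> J"
      then have "real J ^ CARD('d) \<le> real J' ^ CARD('d)" by (intro power_mono) auto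
      then have "real J ^ CARD('d) * ln (real n) \<le> real J' ^ CARD('d) * ln (real n)" using n0 by (intro mult_right_mono) auto
      also have "\<dots> \<le> \<eta> * real n" by (rule J'(3))
      also have "\<dots> \<le> \<tau> * real n" using \<eta>(2) by (intro mult_right_mono) auto
      finally show False using JE by simp
    qed
    have ratio: "projection g J y \<le> R s * q y" if y: "y \<in> half_open_cube" for y
    proof -
      have "(real J / real J') ^ CARD('d) * (3 ^ CARD('d) / \<nu>) \<le> R s"
      proof -
        have J'D: "0 < real J' ^ CARD('d)" using J'1 by simp
        have "real J ^ CARD('d) / real J' ^ CARD('d) \<le> 2 ^ CARD('d) * s / \<eta>"
        proof -
          have "real J ^ CARD('d) * (\<eta> * real n) \<le> real J ^ CARD('d) * (2 ^ CARD('d) * real J' ^ CARD('d) * ln (real n))"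
            using J'(4) by (intro mult_left_mono) auto
          also have "\<dots> = 2 ^ CARD('d) * real J' ^ CARD('d) * (s * real n)" unfolding sn by simp
          finally have "real J ^ CARD('d) * \<eta> \<le> 2 ^ CARD('d) * real J' ^ CARD('d) * s" using n0 by (simp add: mult.assoc[symmetric])
          then show ?thesis using J'D \<eta> by (simp add: divide_le_eq le_divide_eq algebra_simps)
        qed
        then have "real J ^ CARD('d) / real J' ^ CARD('d) * (3 ^ CARD('d) / \<nu>) \<le> 2 ^ CARD('d) * s / \<eta> * (3 ^ CARD('d) / \<nu>)"
          using \<nu> by (intro mult_right_mono) auto
        also have "\<dots> = R s"
        proof -
          have "(6 :: real) ^ CARD('d) = 2 ^ CARD('d) * 3 ^ CARD('d)" by (simp flip: power_mult_distrib)
          then show ?thesis by (simp add: R_def)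
        qed
        finally show ?thesis by (simp add: power_divide)
      qed
      moreover have "projection g J y \<le> (real J / real J') ^ CARD('d) * (3 ^ CARD('d) / \<nu>) * q y"
        unfolding q_def using \<nu> by (intro projection_le_smoothed[OF g J'1 JJ' y]) auto
      moreover have "0 \<le> q y" using qpos[OF y] by simp
      ultimately show ?thesis by (meson mult_right_mono order_trans)
    qed
    have int: "(\<integral>\<^sup>+ x. ennreal (projection g J x / q x) * ennreal (g x) \<partial>cube_measure) \<le> ennreal (exp (c1 * s / 8))"
    proof (cases "s0 \<le> s")
      case True
      have Rs: "0 \<le> R s" using s0' \<eta> \<nu> by (simp add: R_def)
      have "(\<integral>\<^sup>+ x. ennreal (projection g J x / q x) * ennreal (g x) \<partial>cube_measure) \<le> (\<integral>\<^sup>+ x. ennreal (R s) * ennreal (g x) \<partial>cube_measure)"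
      proof (intro nn_integral_mono_AE, use AE_half_open_cube in eventually_elim)
        case (elim x)
        have "projection g J x / q x \<le> R s" using ratio[OF elim] qpos[OF elim] by (simp add: divide_le_eq)
        then show ?case by (intro mult_right_mono ennreal_leI) auto
      qed
      also have "\<dots> = ennreal (R s)"
        using prob_densities_measurable[OF g] by (subst nn_integral_cmult) (auto simp: nn_integral_prob_density[OF g])
      also have "\<dots> \<le> ennreal (exp (c1 * s / 8))" using s0(2)[OF True] by (rule ennreal_leI)
      finally show ?thesis .
    next
      case False
      have "R s \<le> R s0" unfolding R_def using False \<eta> \<nu> by (intro divide_right_mono mult_left_mono) auto
      then have r0: "projection g J y \<le> R s0 * q y" if "y \<in> half_open_cube" for y
        using ratio[OF that] qpos[OF that] by (meson less_imp_le mult_right_mono order_trans)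
      have Rs0: "0 \<le> R s0" using s0(1) \<eta> \<nu> by (simp add: R_def)
      have "(\<integral>\<^sup>+ x. ennreal (projection g J x / q x) * ennreal (g x) \<partial>cube_measure)
        \<le> ennreal ((1 + T / l * (average_error g J + average_error g J') + R s0 * (LINT x|cube_measure. g x * indicator {x. T < g x} x)) / (1 - \<nu>))"
        using \<nu> by (intro smoothed_ratio_integral[OF g J1 J'1 l _ _ Rs0 T(1) qge r0]) auto
      also have "\<dots> \<le> ennreal (exp (c1 * s / 8))"
      proof (intro ennreal_leI)
        have "T / l * (average_error g J + average_error g J') \<le> T / l * (e0 + e0)"
          using e0(1)[OF JE] e0(2) T l by (intro mult_left_mono add_mono) auto
        then have "1 + T / l * (average_error g J + average_error g J') + R s0 * (LINT x|cube_measure. g x * indicator {x. T < g x} x) \<le> 1 + 2 * \<nu>"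
          using e0(3) T(2) by linarith
        then have "(1 + T / l * (average_error g J + average_error g J') + R s0 * (LINT x|cube_measure. g x * indicator {x. T < g x} x)) / (1 - \<nu>) \<le> (1 + 2 * \<nu>) / (1 - \<nu>)"
          using \<nu> by (intro divide_right_mono) auto
        also have "\<dots> \<le> exp (4 * \<nu>)"
        proof -
          have e: "1 + 2 * \<nu> \<le> exp (2 * \<nu>)" by (rule exp_ge_add_one_self)
          have "\<nu> * (2 * \<nu>) \<le> \<nu> * 1" using \<nu> by (intro mult_left_mono) auto
          then have "1 \<le> (1 + 2 * \<nu>) * (1 - \<nu>)" by (simp add: algebra_simps)
          also have "\<dots> \<le> exp (2 * \<nu>) * (1 - \<nu>)" using e \<nu> by (intro mult_right_mono) auto
          finally have "1 \<le> exp (2 * \<nu>) * (1 - \<nu>)" .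
          then have "exp (2 * \<nu>) * 1 \<le> exp (2 * \<nu>) * (exp (2 * \<nu>) * (1 - \<nu>))" by (intro mult_left_mono) auto
          then have "exp (2 * \<nu>) \<le> exp (4 * \<nu>) * (1 - \<nu>)" by (simp add: mult.assoc[symmetric] flip: exp_add)
          then have "1 + 2 * \<nu> \<le> exp (4 * \<nu>) * (1 - \<nu>)" by (rule order_trans[OF e])
          then show ?thesis using \<nu> by (simp add: divide_le_eq)
        qed
        also have "\<dots> \<le> exp (c1 * s / 8)"
        proof -
          have "c1 * \<tau> \<le> c1 * s" using s\<tau> c1 by simp
          then show ?thesis using \<nu>(3) by simp
        qed
        finally show "(1 + T / l * (average_error g J + average_error g J') + R s0 * (LINT x|cube_measure. g x * indicator {x. T < g x} x)) / (1 - \<nu>) \<le> exp (c1 * s / 8)" .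
      qed
      finally show ?thesis .
    qed
    \<comment> \<open>Of the prior exponent c1 * s * n, a quarter pays for \<kappa> and a quarter is
        \<alpha>'; the mean ratio to the power n takes c1 * s * n / 8 from \<beta> and again
        leaves a quarter.\<close>
    define \<alpha>' \<beta> where "\<alpha>' = exp (- (c1 / 4) * (s * real n))" and "\<beta> = exp (- (3 / 8 * c1) * (s * real n))"
    have "pmf \<pi> J \<le> exp (- b2 * real J ^ CARD('d) * ln (real J))" using prior J2 unfolding prior_on_J_def by blast
    also have "\<dots> \<le> exp (- c1 * (s * real n))"
    proof -
      have "b2 * real J ^ CARD('d) * ln (real n) \<le> b2 * real J ^ CARD('d) * (2 * real CARD('d) * ln (real J))"
        using lnJ b by (intro mult_left_mono) auto
      then have "b2 * real J ^ CARD('d) * ln (real n) / (2 * real CARD('d)) \<le> b2 * real J ^ CARD('d) * ln (real J)"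
        using D1 by (simp add: divide_le_eq algebra_simps)
      then show ?thesis unfolding sn by (simp add: c1_def)
    qed
    also have "\<dots> \<le> \<kappa> * (\<alpha>' * \<beta> ^ 1)"
    proof -
      have "(b1 + C) * \<eta> * real n \<le> c1 * s / 4 * real n"
      proof (intro mult_right_mono)
        have "c1 * \<tau> \<le> c1 * s" using s\<tau> c1 by simp
        then show "(b1 + C) * \<eta> \<le> c1 * s / 4" using \<eta>(3) by simp
      qed auto
      moreover have "0 \<le> c1 * s * real n" using c1 s0' by simp
      ultimately have "- c1 * (s * real n) \<le> - (b1 + C) * (\<eta> * real n) + (- (c1 / 4) * (s * real n) + - (3 / 8 * c1) * (s * real n))"
        by (simp add: algebra_simps)
      then show ?thesis unfolding \<kappa>_def \<alpha>'_def \<beta>_def power_one_right exp_add[symmetric] by simp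
    qed
    finally have pe: "pmf \<pi> J \<le> \<kappa> * (\<alpha>' * \<beta> ^ 1)" .
    have sm: "(\<lambda>x. projection g J x / q x) \<in> borel_measurable cube_measure" using pm qm by measurable
    have "weight_bound g n \<pi> (w n) (\<lambda>_. 0) J (\<alpha>' + \<beta> * exp (c1 * s / 8) ^ n)"
      by (rule weight_boundI[OF g J1 l w a2 _ Hq \<kappa> qpos sm _ _ int _ _ _ pe])
        (use n qpos in \<open>auto simp: \<alpha>'_def \<beta>_def intro!: divide_nonneg_nonneg histogram_nonneg intro: less_imp_le\<close>)
    moreover have "\<beta> * exp (c1 * s / 8) ^ n = \<alpha>'"
      unfolding \<alpha>'_def \<beta>_def exp_of_nat_mult[symmetric] exp_add[symmetric] by (simp add: algebra_simps)
    ultimately show ?thesis by (simp add: \<alpha>'_def sn mult.assoc)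
  qed
  have mis: "weight_bound g n \<pi> (w n) (\<lambda>_. 0) J m" if J: "J \<in> Mis" for J
  proof -
    have J1: "1 \<le> J" and \<delta>J: "\<delta> \<le> average_error g J" using J by (auto simp: Mis_def)
    have \<delta>0: "0 \<le> \<delta>" using \<Delta> by (simp add: \<delta>_def)
    have JJ0: "J < J0" using J0[of J] \<delta>J by (meson not_le)
    have L1: "ennreal \<delta> \<le> L1_norm (\<lambda>x. g x - projection g J x)"
      unfolding L1_norm_minus_commute[of g] L1_norm_projection_error[OF g J1] using \<delta>J by (intro ennreal_leI)
    note hel = hellinger_affinity_le[OF g projection_density[OF g J1] \<delta>0 L1]
    have sm: "(\<lambda>x. sqrt (projection g J x / projection g J' x)) \<in> borel_measurable cube_measure" using pm by measurable
    have int: "(\<integral>\<^sup>+ x. ennreal (sqrt (projection g J x / projection g J' x)) * ennreal (g x) \<partial>cube_measure) \<le> ennreal (1 - \<delta>\<^sup>2 / 16)"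
    proof -
      have "(\<integral>\<^sup>+ x. ennreal (sqrt (projection g J x / projection g J' x)) * ennreal (g x) \<partial>cube_measure)
        \<le> ennreal (1 - \<delta>\<^sup>2 / 8 + sqrt (real J ^ CARD('d) / l) * ((k + average_error g J' / k) / 2))"
        by (rule misspecified_affinity[OF g J1 J'1 l \<delta>0 \<delta>J k(1)])
      also have "\<dots> \<le> ennreal (1 - \<delta>\<^sup>2 / 16)"
      proof (intro ennreal_leI)
        have "average_error g J' / k \<le> k" using k by (simp add: divide_le_eq power2_eq_square)
        then have "sqrt (real J ^ CARD('d) / l) * ((k + average_error g J' / k) / 2) \<le> sqrt (real J0 ^ CARD('d) / l) * k"
          using JJ0 l k by (intro mult_mono real_sqrt_le_mono divide_right_mono power_mono) auto
        then have "sqrt (real J ^ CARD('d) / l) * ((k + average_error g J' / k) / 2) \<le> \<delta>\<^sup>2 / 16"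
          using k(2) by (rule order_trans)
        then have "1 - \<delta>\<^sup>2 / 8 + sqrt (real J ^ CARD('d) / l) * ((k + average_error g J' / k) / 2) \<le> 1 - \<delta>\<^sup>2 / 8 + \<delta>\<^sup>2 / 16"
          by (intro add_left_mono)
        also have "\<dots> = 1 - \<delta>\<^sup>2 / 16" by simp
        finally show "1 - \<delta>\<^sup>2 / 8 + sqrt (real J ^ CARD('d) / l) * ((k + average_error g J' / k) / 2) \<le> 1 - \<delta>\<^sup>2 / 16" .
      qed
      finally show ?thesis .
    qed
    \<comment> \<open>\<beta> takes half of the affinity exponent n * \<delta>^2 / 16, and \<kappa> costs at
        most half of it in \<alpha>'.\<close>
    define \<alpha>' \<beta> where "\<alpha>' = exp ((b1 + C) * (\<eta> * real n) - real n * \<delta>\<^sup>2 / 16)" and "\<beta> = exp (real n * \<delta>\<^sup>2 / 32)"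
    have "\<kappa> * (\<alpha>' * \<beta> ^ 2) = 1"
      unfolding \<kappa>_def \<alpha>'_def \<beta>_def power2_eq_square exp_add[symmetric] by (simp add: algebra_simps)
    then have pe: "pmf \<pi> J \<le> \<kappa> * (\<alpha>' * \<beta> ^ 2)" by (simp add: pmf_le_1)
    have "weight_bound g n \<pi> (w n) (\<lambda>_. 0) J (\<alpha>' + \<beta> * (1 - \<delta>\<^sup>2 / 16) ^ n)"
    proof (rule weight_boundI[OF g J1 l w a2 _ Hp \<kappa> _ sm _ _ int _ _ _ pe])
      show "0 \<le> sqrt (projection g J y / projection g J' y)" "(sqrt (projection g J y / projection g J' y))\<^sup>2 = projection g J y / projection g J' y"
        for y by (auto intro!: divide_nonneg_nonneg histogram_nonneg)
    qed (use n ppos[OF J'1] hel(2) in \<open>auto simp: \<alpha>'_def \<beta>_def\<close>)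
    moreover have "\<alpha>' + \<beta> * (1 - \<delta>\<^sup>2 / 16) ^ n \<le> m"
    proof -
      have "(b1 + C) * \<eta> * real n \<le> \<delta>\<^sup>2 / 32 * real n" using \<eta>(4) by (intro mult_right_mono) auto
      then have "\<alpha>' \<le> exp (- (real n * \<delta>\<^sup>2 / 32))" unfolding \<alpha>'_def by (simp add: algebra_simps)
      moreover have "\<beta> * (1 - \<delta>\<^sup>2 / 16) ^ n \<le> exp (- (real n * \<delta>\<^sup>2 / 32))"
      proof -
        have "\<beta> * (1 - \<delta>\<^sup>2 / 16) ^ n \<le> \<beta> * exp (- (real n * (\<delta>\<^sup>2 / 16)))"
          using hel(2) by (intro mult_left_mono exp_power_bound) (auto simp: \<beta>_def)
        also have "\<dots> = exp (- (real n * \<delta>\<^sup>2 / 32))" unfolding \<beta>_def exp_add[symmetric] by simp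
        finally show ?thesis .
      qed
      ultimately show ?thesis by (simp add: m_def)
    qed
    ultimately show ?thesis by (rule weight_bound_mono)
  qed
  have MisN: "Mis \<subseteq> {..<J0}" using J0 by (force simp: Mis_def not_le[symmetric])
  have finM: "finite Mis" and cardM: "card Mis \<le> J0" using finite_subset[OF MisN] card_mono[OF _ MisN] by auto
  have m0: "0 \<le> m" by (simp add: m_def)
  have c4: "0 < c1 / 4" using c1 by simp
  have sum: "(\<Sum>J. if J \<in> Large \<union> Mis then ennreal (bb J) else 0) \<le> ennreal (4 * real n powr (- (c1 / 4)) + real J0 * m)"
  proof -
    have "(\<Sum>J. if J \<in> Large \<union> Mis then ennreal (bb J) else 0) \<le> ennreal (4 * real n powr (- (c1 / 4)) + real (card Mis) * m)"
      unfolding bb_def by (rule bad_weights_sum[OF n c4 c D1 _ finM m0]) (simp add: Large_def)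
    also have "\<dots> \<le> ennreal (4 * real n powr (- (c1 / 4)) + real J0 * m)"
      using cardM m0 by (intro ennreal_leI add_left_mono mult_right_mono) auto
    finally show ?thesis .
  qed
  have pi0: "pmf \<pi> 0 = 0" using prior by (simp add: prior_on_J_def)
  have bb: "weight_bound g n \<pi> (w n) (\<lambda>_. 0) J (bb J)" if "J \<in> Large \<union> Mis" for J
    using that large[of J] mis[of J] by (auto simp: bb_def)
  have c00: "0 \<le> 4 * real n powr (- (c1 / 4)) + real J0 * m" using m0 by simp
  have good: "\<not> d1 (histogram J \<theta>) F_star \<le> ennreal (M * sqrt (real J ^ CARD('d) * ln (real n) / real n))"
    if J: "1 \<le> J" "J \<notin> Large \<union> Mis" and \<theta>: "\<theta> \<notin> far_weights g J (radius TYPE('d) M n J)" for J and \<theta> :: "nat ^ 'd \<Rightarrow> real"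
  proof
    assume d: "d1 (histogram J \<theta>) F_star \<le> ennreal (M * sqrt (real J ^ CARD('d) * ln (real n) / real n))"
    have JE: "real J ^ CARD('d) * ln (real n) \<le> \<tau> * real n" and err: "average_error g J < \<delta>"
      using J by (auto simp: Large_def Mis_def)
    have "real J ^ CARD('d) * ln (real n) / real n \<le> \<tau>" using JE n0 by (simp add: divide_le_eq)
    then have s: "M * sqrt (real J ^ CARD('d) * ln (real n) / real n) \<le> M * sqrt \<tau>"
      using M by (intro mult_left_mono real_sqrt_le_mono) auto
    have "d1 g F_star \<le> ennreal (average_error g J + 2 * (M * sqrt \<tau>))"
      by (rule d1_F_star_near[OF g J(1) \<theta> d s])
    also have "\<dots> < ennreal \<Delta>"
      using err \<tau>(2) \<Delta>(1) by (intro ennreal_lessI) (auto simp: \<delta>_def)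
    finally show False using \<Delta>(2) by simp
  qed
  have zero: "(\<lambda>_. 0 :: ennreal) \<in> borel_measurable (sample g n)" "(\<integral>\<^sup>+ X. 0 \<partial>sample g n) \<le> ennreal 0" by simp_all
  have "expectation_iid g n (\<lambda>X. 1 - monotonicity_test \<pi> (w n) M \<gamma> n X)
    \<le> (0 + 1 / real n + (4 * real n powr (- (c1 / 4)) + real J0 * m)) / \<gamma>"
  proof (rule acceptance_bound[OF g l w a2 n C M pi0 \<gamma> bb sum c00 zero])
    show "(0 :: real) \<le> 0" by simp
  qed (use good in blast)+
  then show ?thesis by (simp add: m_def)
qed

section \<open>The asymptotic statements\<close>

lemma tail_integral_small:
  fixes g :: "real ^ 'd \<Rightarrow> real"
  assumes g: "g \<in> prob_densities" and e: "0 < e"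
  obtains T where "0 \<le> T" "(LINT x|cube_measure. g x * indicator {x. T < g x} x) < e"
proof -
  define t where "t N x = g x * indicator {x. real N < g x} x" for N :: nat and x
  have tm: "t N \<in> borel_measurable cube_measure" for N
  proof -
    have "t N = (\<lambda>x. if real N < g x then g x else 0)" by (auto simp: t_def indicator_def fun_eq_iff)
    then show ?thesis using prob_densities_measurable[OF g] by simp
  qed
  have "(\<lambda>N. LINT x|cube_measure. t N x) \<longlonglongrightarrow> (LINT x|(cube_measure :: (real ^ 'd) measure). 0 :: real)"
  proof (rule integral_dominated_convergence[where w = "\<lambda>x. \<bar>g x\<bar>"])
    show "AE x in cube_measure. (\<lambda>N. t N x) \<longlonglongrightarrow> 0"
    proof (intro AE_I2 tendsto_eventually)
      fix x :: "real ^ 'd"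
      obtain N where N: "g x < real N" using reals_Archimedean2 by blast
      then have "t N' x = 0" if "N \<le> N'" for N' using that by (auto simp: t_def indicator_def)
      then show "\<forall>\<^sub>F N in sequentially. t N x = 0" by (rule eventually_sequentiallyI)
    qed
    show "AE x in cube_measure. norm (t N x) \<le> \<bar>g x\<bar>" for N by (intro AE_I2) (auto simp: t_def indicator_def)
  qed (use tm prob_densities_integrable[OF g] in auto)
  then have "(\<lambda>N. LINT x|cube_measure. t N x) \<longlonglongrightarrow> 0" by simp
  from LIMSEQ_D[OF this e] obtain N where "norm ((LINT x|cube_measure. t N x) - 0) < e" by blast
  then have "(LINT x|cube_measure. g x * indicator {x. real N < g x} x) < e" unfolding t_def by simp
  then show ?thesis using that[of "real N"] by simp
qed

text \<open>It remains to choose the constants of fixed_alternative_power in the right order: \<tau>,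
  \<eta>, \<nu>, s0, T and e0, and then, for large n, the resolution J' as the integer part of
  y n, for which y n ^ d = \<eta> * n / ln n. It tends to infinity, so that its approximation
  error falls below any bound fixed beforehand.\<close>

lemma fixed_alternative_limit:
  fixes g :: "real ^ 'd \<Rightarrow> real"
  assumes g: "g \<in> prob_densities" and l: "0 < l" "\<And>x. x \<in> unit_cube \<Longrightarrow> l \<le> g x"
    and w: "dirichlet_weights a1 a2 a3 w" and a2: "0 < a2" and C: "evidence_rate TYPE('d) a1 a2 a3 C"
    and prior: "prior_on_J TYPE('d) b1 b2 \<pi>" and b: "0 < b1" "0 < b2"
    and M: "0 < M" "64 * (C + 4) \<le> M\<^sup>2" and \<gamma>: "0 < \<gamma>"
    and \<Delta>: "0 < \<Delta>" "ennreal \<Delta> \<le> d1 g F_star"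
  shows "(\<lambda>n. expectation_iid g n (\<lambda>X. 1 - monotonicity_test \<pi> (w n) M \<gamma> n X)) \<longlonglongrightarrow> 0"
proof -
  define D where "D = CARD('d)"
  have D: "1 \<le> D" by (simp add: D_def Suc_le_eq)
  define c1 where "c1 = b2 / (2 * real D)"
  define \<delta> where "\<delta> = \<Delta> / 2"
  have c1: "0 < c1" and \<delta>: "0 < \<delta>" using b D \<Delta> by (auto simp: c1_def \<delta>_def)
  have bC: "0 < b1 + C" using b C by (simp add: evidence_rate_def)
  define \<tau> where "\<tau> = (\<Delta> / (8 * M))\<^sup>2"
  have \<tau>: "0 < \<tau>" "2 * (M * sqrt \<tau>) \<le> \<Delta> / 4" using \<Delta> M by (auto simp: \<tau>_def)
  define \<eta> where "\<eta> = min \<tau> (min (c1 * \<tau> / 4 / (b1 + C)) (\<delta>\<^sup>2 / 32 / (b1 + C)))"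
  have \<eta>: "0 < \<eta>" "\<eta> \<le> \<tau>" "(b1 + C) * \<eta> \<le> c1 * \<tau> / 4" "(b1 + C) * \<eta> \<le> \<delta>\<^sup>2 / 32"
  proof -
    show "0 < \<eta>" using \<tau> c1 bC \<delta> by (simp add: \<eta>_def)
    show "\<eta> \<le> \<tau>" by (simp add: \<eta>_def)
    have "\<eta> \<le> c1 * \<tau> / 4 / (b1 + C)" by (simp add: \<eta>_def)
    then show "(b1 + C) * \<eta> \<le> c1 * \<tau> / 4" unfolding pos_le_divide_eq[OF bC] by (simp only: mult.commute)
    have "\<eta> \<le> \<delta>\<^sup>2 / 32 / (b1 + C)" by (simp add: \<eta>_def)
    then show "(b1 + C) * \<eta> \<le> \<delta>\<^sup>2 / 32" unfolding pos_le_divide_eq[OF bC] by (simp only: mult.commute)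
  qed
  define \<nu> where "\<nu> = min (1 / 2) (c1 * \<tau> / 32)"
  have \<nu>: "0 < \<nu>" "\<nu> \<le> 1 / 2" "4 * \<nu> \<le> c1 * \<tau> / 8" using c1 \<tau> by (auto simp: \<nu>_def)
  define A where "A = 6 ^ D / (\<eta> * \<nu>)"
  have A: "0 < A" using \<eta> \<nu> by (simp add: A_def)
  define s0 where "s0 = 128 * A / c1\<^sup>2"
  have s0: "0 < s0" "\<And>s. s0 \<le> s \<Longrightarrow> 6 ^ D * s / (\<eta> * \<nu>) \<le> exp (c1 * s / 8)"
  proof -
    show s0p: "0 < s0" using A c1 by (simp add: s0_def)
    fix s assume s: "s0 \<le> s"
    then have sp: "0 < s" using s0p by simp
    have "A * s * 128 \<le> c1\<^sup>2 * s * s"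
    proof -
      have "128 * A \<le> c1\<^sup>2 * s" using s c1 by (simp add: s0_def divide_le_eq mult.commute)
      then have "128 * A * s \<le> c1\<^sup>2 * s * s" using sp by (intro mult_right_mono) auto
      then show ?thesis by (simp add: mult.commute mult.left_commute)
    qed
    then have "A * s \<le> (c1 * s / 8)\<^sup>2 / 2" by (simp add: power2_eq_square field_simps)
    also have "\<dots> \<le> 1 + c1 * s / 8 + (c1 * s / 8)\<^sup>2 / 2" using c1 sp by simp
    also have "\<dots> \<le> exp (c1 * s / 8)" using c1 sp by (intro exp_lower_Taylor_quadratic) auto
    finally show "6 ^ D * s / (\<eta> * \<nu>) \<le> exp (c1 * s / 8)" by (simp add: A_def)
  qed
  have Rp: "0 < 6 ^ D * s0 / (\<eta> * \<nu>)" using s0 \<eta> \<nu> by simp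
  have vR: "0 < \<nu> / (6 ^ D * s0 / (\<eta> * \<nu>))" by (rule divide_pos_pos[OF \<nu>(1) Rp])
  obtain T where T: "0 \<le> T" "(LINT x|cube_measure. g x * indicator {x. T < g x} x) < \<nu> / (6 ^ D * s0 / (\<eta> * \<nu>))"
    by (rule tail_integral_small[OF g vR])
  have T2: "6 ^ D * s0 / (\<eta> * \<nu>) * (LINT x|cube_measure. g x * indicator {x. T < g x} x) \<le> \<nu>"
  proof -
    have "(LINT x|cube_measure. g x * indicator {x. T < g x} x) * (6 ^ D * s0 / (\<eta> * \<nu>)) < \<nu>"
      using T(2) unfolding pos_less_divide_eq[OF Rp] .
    then show ?thesis by (subst mult.commute) (rule less_imp_le)
  qed
  define e0 where "e0 = \<nu> * l / (2 * (T + 1))"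
  have e0: "0 < e0" "T / l * (e0 + e0) \<le> \<nu>"
  proof -
    show "0 < e0" using \<nu> l T by (simp add: e0_def)
    have "e0 + e0 = \<nu> * l / (T + 1)" unfolding e0_def by (simp only: mult_2[symmetric] times_divide_eq_right) (rule mult_divide_mult_cancel_left, simp)
    then have "T / l * (e0 + e0) = \<nu> * (T / (T + 1))" using l by simp
    also have "\<dots> \<le> \<nu> * 1" using \<nu> T by (intro mult_left_mono) auto
    finally show "T / l * (e0 + e0) \<le> \<nu>" by simp
  qed
  have err: "average_error g \<longlonglongrightarrow> 0" by (rule average_error_tendsto[OF prob_densities_integrable[OF g]])
  have small: "\<exists>N. \<forall>J\<ge>N. average_error g J < e" if "0 < e" for e
    using LIMSEQ_D[OF err that] by auto
  obtain J1 where J1: "\<And>J. J1 \<le> J \<Longrightarrow> average_error g J < e0" using small[OF e0(1)] by blast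
  obtain J0 where J0: "\<And>J. J0 \<le> J \<Longrightarrow> average_error g J < \<delta>" using small[OF \<delta>] by blast
  define k where "k = \<delta>\<^sup>2 / 16 / (sqrt (real J0 ^ D / l) + 1)"
  have sq: "0 \<le> sqrt (real J0 ^ D / l)" using l by simp
  have k: "0 < k" "sqrt (real J0 ^ D / l) * k \<le> \<delta>\<^sup>2 / 16"
  proof -
    show "0 < k" unfolding k_def using \<delta> sq by (intro divide_pos_pos add_nonneg_pos) auto
    have "sqrt (real J0 ^ D / l) * k = \<delta>\<^sup>2 / 16 * (sqrt (real J0 ^ D / l) / (sqrt (real J0 ^ D / l) + 1))" by (simp add: k_def)
    also have "\<dots> \<le> \<delta>\<^sup>2 / 16 * 1"
    proof (rule mult_left_mono)
      have "q / (q + 1) \<le> 1" if "0 \<le> q" for q :: real using that by simp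
      from this[OF sq] show "sqrt (real J0 ^ D / l) / (sqrt (real J0 ^ D / l) + 1) \<le> 1" .
    qed simp
    finally show "sqrt (real J0 ^ D / l) * k \<le> \<delta>\<^sup>2 / 16" by simp
  qed
  obtain J2 where J2: "\<And>J. J2 \<le> J \<Longrightarrow> average_error g J < k\<^sup>2" using small[of "k\<^sup>2"] k by auto
  define y where "y n = (\<eta> * real n / ln (real n)) powr (1 / real D)" for n :: nat
  have ytop: "filterlim y at_top sequentially"
  proof -
    have "0 < 1 / real D" using D by simp
    then show ?thesis unfolding y_def[abs_def] using \<eta>(1) by real_asymp
  qed
  define bd where "bd n = (1 / real n + (4 * real n powr (- (c1 / 4)) + real J0 * (2 * exp (- (real n * \<delta>\<^sup>2 / 32))))) / \<gamma>" for n
  have ev: "\<forall>\<^sub>F n in sequentially. 0 \<le> expectation_iid g n (\<lambda>X. 1 - monotonicity_test \<pi> (w n) M \<gamma> n X) \<and>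
     expectation_iid g n (\<lambda>X. 1 - monotonicity_test \<pi> (w n) M \<gamma> n X) \<le> bd n"
  proof -
    have e1: "\<forall>\<^sub>F n in sequentially. max 2 (max (real J1) (real J2)) + 1 \<le> y n"
      using ytop unfolding filterlim_at_top by blast
    have e2: "\<forall>\<^sub>F n in sequentially. sqrt (real n) \<le> \<tau> * real n / ln (real n)" using \<tau>(1) by real_asymp
    have "0 < c1 / 4" using c1 by simp
    then have e3: "\<forall>\<^sub>F n in sequentially. real n powr (- (c1 / 4)) \<le> 1 / 2" by real_asymp
    have e4: "\<forall>\<^sub>F n in sequentially. \<eta> \<le> ln (real n)" by real_asymp
    have e5: "\<forall>\<^sub>F n :: nat in sequentially. 2 \<le> n" by (rule eventually_ge_at_top)
    show ?thesis using e1 e2 e3 e4 e5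
    proof eventually_elim
      case (elim n)
      have n0: "0 < real n" "0 < ln (real n)" using elim(5) by auto
      have yD: "y n ^ D = \<eta> * real n / ln (real n)"
      proof -
        have base: "0 < \<eta> * real n / ln (real n)" using n0 \<eta> by simp
        have "y n ^ D = (\<eta> * real n / ln (real n)) powr (real D * (1 / real D))"
          unfolding y_def using base n0 \<eta>(1) by (intro powr_power) auto
        also have "\<dots> = \<eta> * real n / ln (real n)" using D base n0 \<eta>(1) by simp
        finally show ?thesis .
      qed
      define J' where "J' = nat \<lfloor>y n\<rfloor>"
      have J'r: "real J' \<le> y n" "y n - 1 < real J'" using elim(1) unfolding J'_def by linarith+
      have J'2: "2 \<le> J'" "J1 \<le> J'" "J2 \<le> J'" using elim(1) J'r by linarith+
      \<comment> \<open>This ensures that ln J' \<le> ln n in the prior bound.\<close>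
      have yn: "y n \<le> real n"
      proof -
        have "y n ^ 1 \<le> y n ^ D" using elim(1) D by (intro power_increasing) auto
        also have "\<dots> \<le> real n" unfolding yD using elim(4) n0 by (simp add: divide_le_eq mult.commute)
        finally show ?thesis by simp
      qed
      have J'n: "J' \<le> n" using J'r yn by linarith
      have low: "real J' ^ CARD('d) * ln (real n) \<le> \<eta> * real n"
      proof -
        have "real J' ^ D \<le> y n ^ D" using J'r by (intro power_mono) auto
        then show ?thesis unfolding yD using n0 by (simp add: D_def le_divide_eq)
      qed
      have up: "\<eta> * real n \<le> 2 ^ CARD('d) * real J' ^ CARD('d) * ln (real n)"
      proof -
        have "y n ^ D \<le> (2 * real J') ^ D" using J'r elim(1) by (intro power_mono) auto
        then show ?thesis unfolding yD power_mult_distrib using n0 by (simp add: D_def divide_le_eq)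
      qed
      have eJ: "average_error g J \<le> e0" if J: "\<tau> * real n < real J ^ CARD('d) * ln (real n)" for J
      proof -
        have "y n ^ D < real J ^ D"
        proof -
          have "\<eta> * real n \<le> \<tau> * real n" using \<eta>(2) by (intro mult_right_mono) auto
          then have "\<eta> * real n < real J ^ D * ln (real n)" using J by (simp add: D_def)
          then show ?thesis unfolding yD using n0 by (simp add: divide_less_eq)
        qed
        then have "y n < real J" by (rule power_less_imp_less_base) simp
        then have "J1 \<le> J" using elim(1) by linarith
        then show ?thesis using J1[of J] by simp
      qed
      have test01: "0 \<le> 1 - monotonicity_test \<pi> (w n) M \<gamma> n X" for X by (simp add: monotonicity_test_def)
      have "0 \<le> expectation_iid g n (\<lambda>X. 1 - monotonicity_test \<pi> (w n) M \<gamma> n X)"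
        unfolding expectation_iid_def using test01 by (intro Bochner_Integration.integral_nonneg) auto
      moreover have "expectation_iid g n (\<lambda>X. 1 - monotonicity_test \<pi> (w n) M \<gamma> n X) \<le> bd n"
        unfolding bd_def c1_def \<delta>_def D_def
      proof (rule fixed_alternative_power[OF g l w a2 C prior b M \<gamma> elim(5) \<Delta> \<tau> \<eta>(1,2)
            \<eta>(3)[unfolded c1_def D_def] \<eta>(4)[unfolded \<delta>_def] J'2(1) J'n low up \<nu>(1,2) \<nu>(3)[unfolded c1_def D_def] s0(1)])
        show "6 ^ CARD('d) * s / (\<eta> * \<nu>) \<le> exp (b2 / (2 * real CARD('d)) * s / 8)" if "s0 \<le> s" for s
          using s0(2)[OF that] by (simp add: c1_def D_def)
        show "0 \<le> T" by (rule T(1))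
        show "6 ^ CARD('d) * s0 / (\<eta> * \<nu>) * (LINT x|cube_measure. g x * indicator {x. T < g x} x) \<le> \<nu>"
          using T2 unfolding D_def .
        show "average_error g J \<le> e0" if "\<tau> * real n < real J ^ CARD('d) * ln (real n)" for J using eJ[OF that] .
        show "average_error g J' \<le> e0" using J1[OF J'2(2)] by simp
        show "T / l * (e0 + e0) \<le> \<nu>" by (rule e0(2))
        show "sqrt (real n) \<le> \<tau> * real n / ln (real n)" by (rule elim(2))
        show "average_error g J < \<Delta> / 2" if "J0 \<le> J" for J using J0[OF that] by (simp add: \<delta>_def)
        show "0 < k" by (rule k(1))
        show "sqrt (real J0 ^ CARD('d) / l) * k \<le> (\<Delta> / 2)\<^sup>2 / 16" using k(2) by (simp add: \<delta>_def D_def)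
        show "average_error g J' \<le> k\<^sup>2" using J2[OF J'2(3)] by simp
        show "real n powr (- (b2 / (2 * real CARD('d)) / 4)) \<le> 1 / 2" using elim(3) by (simp add: c1_def D_def)
      qed
      ultimately show ?case by simp
    qed
  qed
  have lim: "bd \<longlonglongrightarrow> 0"
  proof -
    have "0 < c1 / 4" using c1 by simp
    then have 1: "(\<lambda>n. real n powr (- (c1 / 4))) \<longlonglongrightarrow> 0" by real_asymp
    have "0 < \<delta>\<^sup>2 / 32" using \<delta> by simp
    then have "(\<lambda>n. exp (- (real n * (\<delta>\<^sup>2 / 32)))) \<longlonglongrightarrow> 0" by real_asymp
    then have 2: "(\<lambda>n. exp (- (real n * \<delta>\<^sup>2 / 32))) \<longlonglongrightarrow> 0" by simp
    have "bd \<longlonglongrightarrow> (0 + (4 * 0 + real J0 * (2 * 0))) / \<gamma>"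
      unfolding bd_def[abs_def] using \<gamma> by (intro tendsto_intros 1 2 lim_1_over_n) auto
    then show ?thesis by simp
  qed
  show ?thesis
    by (rule tendsto_sandwich[OF _ _ tendsto_const lim]) (use ev in \<open>auto elim: eventually_mono\<close>)
qed

text \<open>The bound of smooth_alternative_power depends on the true density only through \<alpha>, L
  and l, and the exponentials in it decay faster than any power of n because x n ^ d tends to
  infinity.\<close>

lemma smooth_alternative_limit:
  fixes \<alpha> L l M C b1 b2 a1 a2 a3 :: real
  assumes C: "evidence_rate TYPE('d::finite) a1 a2 a3 C" and a2: "0 < a2" and b: "0 < b1" "0 < b2"
    and M: "0 < M" "64 * (C + 4) \<le> M\<^sup>2" and l: "0 < l" and al: "0 < \<alpha>" "0 < L"
  shows "\<exists>C'>0. \<forall>\<pi> (w :: nat \<Rightarrow> nat \<Rightarrow> nat ^ 'd \<Rightarrow> real) \<gamma>.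
          prior_on_J TYPE('d) b1 b2 \<pi> \<and> dirichlet_weights a1 a2 a3 w \<and> 0 < \<gamma> \<and> \<gamma> < 1 \<longrightarrow>
          (\<lambda>n. SUP g0\<in>{g0\<in>prob_densities \<inter> holder_class \<alpha> L.
                        (\<forall>x\<in>unit_cube. l \<le> g0 x) \<and>
                        ennreal (C' * (real n / ln (real n)) powr (- \<alpha> / (2 * \<alpha> + real CARD('d))))
                          < d1 g0 G_star}.
                 ennreal (expectation_iid g0 n
                   (\<lambda>X. 1 - monotonicity_test \<pi> (w n) M \<gamma> n X))) \<longlonglongrightarrow> 0"
proof -
  have C0: "0 < C" using C by (simp add: evidence_rate_def)
  define D where "D = CARD('d)"
  have D: "1 \<le> D" by (simp add: D_def Suc_le_eq)
  define \<xi> where "\<xi> = L\<^sup>2 * real D powr (2 * \<alpha>) / l"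
  have \<xi>: "0 < \<xi>" unfolding \<xi>_def using al l D by simp
  define C2 where "C2 = (b1 + C) * 2 ^ D + 2 * \<xi>"
  have C2: "0 < C2" unfolding C2_def using b C0 \<xi> by (intro add_pos_pos mult_pos_pos) auto
  define a where "a = 1 / (2 * \<alpha> + real D)"
  have a: "0 < a" "(2 * \<alpha> + real D) * a = 1" unfolding a_def using al D by auto
  \<comment> \<open>Eventually ln (x n) is at least half of a * ln n, because ln (ln n) is at most ln n / 2.\<close>
  define c0 where "c0 = a / 2"
  have c0: "0 < c0" using a by (simp add: c0_def)
  define c where "c = b2 * c0 / 4"
  have c: "0 < c" "4 * c = b2 * c0" using b c0 by (auto simp: c_def)
  define K where "K = max 1 (C2 / (2 * c))"
  have K: "1 \<le> K" "C2 \<le> 2 * c * K"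
  proof -
    show "1 \<le> K" by (simp add: K_def)
    have "C2 / (2 * c) \<le> K" by (simp add: K_def)
    then show "C2 \<le> 2 * c * K" using c by (simp add: divide_le_eq mult.commute mult.left_commute)
  qed
  define M' where "M' = 4 * sqrt C2"
  have M': "0 \<le> M'" "16 * C2 \<le> M'\<^sup>2" using C2 by (auto simp: M'_def power_mult_distrib)
  define C' where "C' = 2 * (M' + 2 * (M * sqrt K) + 1)"
  have C': "0 < C'" unfolding C'_def using M' M K by (intro mult_pos_pos add_nonneg_pos add_nonneg_nonneg) auto
  define x where "x n = (real n / ln (real n)) powr a" for n :: nat
  have xtop: "filterlim x at_top sequentially" unfolding x_def[abs_def] using a(1) by real_asymp
  show ?thesis
  proof (intro exI[of _ C'] conjI C' allI impI)
    fix \<pi> and \<gamma> :: real and w :: "nat \<Rightarrow> nat \<Rightarrow> nat ^ 'd \<Rightarrow> real"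
    assume H: "prior_on_J TYPE('d) b1 b2 \<pi> \<and> dirichlet_weights a1 a2 a3 w \<and> 0 < \<gamma> \<and> \<gamma> < 1"
    then have prior: "prior_on_J TYPE('d) b1 b2 \<pi>" and w: "dirichlet_weights a1 a2 a3 w" and \<gamma>: "0 < \<gamma>" by auto
    define bd where "bd n = (1 / real n + 1 / real n + (4 * real n powr (- c) + 2 * (1 / real n))) / \<gamma>" for n :: nat
    let ?S = "\<lambda>n. {g0\<in>prob_densities \<inter> holder_class \<alpha> L. (\<forall>x :: real ^ 'd \<in> unit_cube. l \<le> g0 x) \<and>
                        ennreal (C' * (real n / ln (real n)) powr (- \<alpha> / (2 * \<alpha> + real CARD('d)))) < d1 g0 G_star}"
    have ev: "\<forall>\<^sub>F n in sequentially. (SUP g0\<in>?S n. ennreal (expectation_iid g0 n (\<lambda>X. 1 - monotonicity_test \<pi> (w n) M \<gamma> n X))) \<le> ennreal (bd n)"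
    proof -
      have e1: "\<forall>\<^sub>F n in sequentially. max 2 (max (2 / C2) (1 / \<xi>)) \<le> x n"
        using xtop unfolding filterlim_at_top by blast
      have e2: "\<forall>\<^sub>F n in sequentially. ln (ln (real n)) \<le> ln (real n) / 2" by real_asymp
      have e3: "\<forall>\<^sub>F n in sequentially. max 2 K \<le> ln (real n)" by real_asymp
      have e4: "\<forall>\<^sub>F n in sequentially. real n powr (- c) \<le> 1 / 2" using c(1) by real_asymp
      have e5: "\<forall>\<^sub>F n :: nat in sequentially. 2 \<le> n" by (rule eventually_ge_at_top)
      show ?thesis using e1 e2 e3 e4 e5
      proof eventually_elim
        case (elim n)
        have n0: "0 < real n" "0 < ln (real n)" using elim(5) by auto
        have base: "0 < real n / ln (real n)" using n0 by simp
        have x1: "1 < x n" "1 \<le> x n" using elim(1) by auto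
        have xpow: "x n powr (2 * \<alpha> + real D) = real n / ln (real n)"
        proof -
          have e: "a * (2 * \<alpha> + real D) = 1" using a(2) by (simp add: mult.commute)
          show ?thesis unfolding x_def powr_powr e using base by (simp only: powr_one_gt_zero_iff less_imp_le)
        qed
        have xal: "(real n / ln (real n)) powr (- \<alpha> / (2 * \<alpha> + real CARD('d))) = x n powr (- \<alpha>)"
          unfolding x_def powr_powr by (simp add: a_def D_def)
        have xD: "x n \<le> x n ^ D" using power_increasing[OF D x1(2)] by simp
        have xDn: "x n ^ D \<le> real n / ln (real n)"
        proof -
          have "x n ^ D = x n powr real D" using x1 by (simp add: powr_realpow)
          also have "\<dots> \<le> x n powr (2 * \<alpha> + real D)" using x1 al by (intro powr_mono) auto
          finally show ?thesis using xpow by simp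
        qed
        have mulle: "t * x n ^ D \<le> real n" if t: "0 \<le> t" "t \<le> ln (real n)" for t
        proof -
          have "t * x n ^ D \<le> ln (real n) * (real n / ln (real n))" using t xDn x1 n0 by (intro mult_mono) auto
          then show ?thesis using n0 by simp
        qed
        have x2: "2 * x n \<le> real n" using mulle[of 2] elim(3) xD by simp
        have Kx: "K * x n ^ CARD('d) \<le> real n" using mulle[of K] elim(3) K by (simp add: D_def)
        have lnx: "c0 * ln (real n) \<le> ln (x n)"
        proof -
          have "ln (x n) = a * (ln (real n) - ln (ln (real n)))" unfolding x_def using base n0 by (simp add: ln_powr ln_div)
          moreover have "a * (ln (real n) / 2) \<le> a * (ln (real n) - ln (ln (real n)))" using elim(2) a by (intro mult_left_mono) auto
          ultimately show ?thesis by (simp add: c0_def)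
        qed
        define E where "E = x n ^ CARD('d) * ln (real n)"
        have expE: "exp (- t * E) \<le> 1 / real n ^ p" if "real p / t \<le> x n" "0 < t" for t and p :: nat
        proof -
          have "real p \<le> t * x n" using that by (simp add: pos_divide_le_eq mult.commute)
          also have "\<dots> \<le> t * x n ^ D" using xD that(2) by (intro mult_left_mono) auto
          finally have "real p \<le> t * x n ^ D" .
          then have "real p * ln (real n) \<le> t * E" using n0 unfolding E_def D_def mult.assoc[symmetric] by (intro mult_right_mono) auto
          then have "exp (- t * E) \<le> exp (- (real p * ln (real n)))" by simp
          also have "\<dots> = 1 / real n ^ p" using n0 by (simp add: exp_minus exp_of_nat_mult divide_inverse)
          finally show ?thesis .
        qed
        have b1': "exp (- \<xi> * E) \<le> 1 / real n" using expE[of 1 \<xi>] elim(1) \<xi> by simp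
        have b2': "real n * (2 * exp (- C2 * E)) \<le> 2 * (1 / real n)"
        proof -
          have "exp (- C2 * E) \<le> 1 / real n ^ 2" using expE[of 2 C2] elim(1) C2 by simp
          then have "real n * (2 * exp (- C2 * E)) \<le> real n * (2 * (1 / real n ^ 2))" by (intro mult_left_mono) auto
          then show ?thesis using n0 by (simp add: power2_eq_square)
        qed
        show ?case
        proof (rule SUP_least)
          fix g0 assume g0S: "g0 \<in> ?S n"
          have g: "g0 \<in> prob_densities" "g0 \<in> holder_class \<alpha> L" and lg: "\<And>x. x \<in> unit_cube \<Longrightarrow> l \<le> g0 x"
            and far: "ennreal (C' * x n powr (- \<alpha>)) < d1 g0 G_star" 
            using g0S[unfolded xal] by simp_all
          have "expectation_iid g0 n (\<lambda>X. 1 - monotonicity_test \<pi> (w n) M \<gamma> n X)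
            \<le> (exp (- \<xi> * E) + 1 / real n + (4 * real n powr (- c) + real n * (2 * exp (- C2 * E)))) / \<gamma>"
            unfolding \<xi>_def E_def D_def
            by (rule smooth_alternative_power[OF g al l lg w a2 C prior b M \<gamma> elim(5) x1(1) x2 _ _ c0 lnx c(2) elim(4) K Kx M' far[unfolded C'_def]])
              (use xpow in \<open>auto simp: D_def C2_def \<xi>_def\<close>)
          also have "\<dots> \<le> bd n"
            unfolding bd_def using \<gamma> b1' b2' by (intro divide_right_mono add_mono) auto
          finally show "ennreal (expectation_iid g0 n (\<lambda>X. 1 - monotonicity_test \<pi> (w n) M \<gamma> n X)) \<le> ennreal (bd n)"
            by (rule ennreal_leI)
        qed
      qed
    qed
    have lim: "(\<lambda>n. ennreal (bd n)) \<longlonglongrightarrow> 0"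
    proof -
      have 1: "(\<lambda>n. real n powr (- c)) \<longlonglongrightarrow> 0" using c(1) by real_asymp
      have "bd \<longlonglongrightarrow> (0 + 0 + (4 * 0 + 2 * 0)) / \<gamma>"
        unfolding bd_def[abs_def] using \<gamma> by (intro tendsto_intros 1 lim_1_over_n) auto
      then have "bd \<longlonglongrightarrow> 0" by simp
      from tendsto_ennrealI[OF this] show ?thesis by simp
    qed
    show "(\<lambda>n. SUP g0\<in>?S n. ennreal (expectation_iid g0 n (\<lambda>X. 1 - monotonicity_test \<pi> (w n) M \<gamma> n X))) \<longlonglongrightarrow> 0"
      by (rule tendsto_sandwich[OF _ ev tendsto_const lim]) simp
  qed
qed

theorem theorem3p3:
  fixes b1 b2 a1 a2 a3 :: real
  assumes "0 < b1" "0 < b2" "0 < a1" "0 < a2" "0 < a3"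
  shows "\<exists>Mstar>0. \<forall>M0\<ge>Mstar.
    (\<forall>\<pi> (w :: nat \<Rightarrow> nat \<Rightarrow> nat ^ 'd \<Rightarrow> real) \<gamma>.
       prior_on_J TYPE('d) b1 b2 \<pi> \<and> dirichlet_weights a1 a2 a3 w \<and> 0 < \<gamma> \<and> \<gamma> < 1 \<longrightarrow>
       (\<forall>g0\<in>G_star. bounded_away_from_zero g0 \<longrightarrow>
          (\<lambda>n. expectation_iid g0 n (monotonicity_test \<pi> (w n) M0 \<gamma> n)) \<longlonglongrightarrow> 0) \<and>
       (\<forall>g0\<in>prob_densities. bounded_away_from_zero g0 \<and> g0 \<notin> L1_closure G_star \<longrightarrow>
          (\<lambda>n. expectation_iid g0 n (\<lambda>X. 1 - monotonicity_test \<pi> (w n) M0 \<gamma> n X)) \<longlonglongrightarrow> 0)) \<and>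
    (\<forall>l>0. \<forall>\<alpha> L. 0 < \<alpha> \<and> \<alpha> \<le> 1 \<and> 0 < L \<longrightarrow>
       (\<exists>C>0. \<forall>\<pi> (w :: nat \<Rightarrow> nat \<Rightarrow> nat ^ 'd \<Rightarrow> real) \<gamma>.
          prior_on_J TYPE('d) b1 b2 \<pi> \<and> dirichlet_weights a1 a2 a3 w \<and> 0 < \<gamma> \<and> \<gamma> < 1 \<longrightarrow>
          (\<lambda>n. SUP g0\<in>{g0\<in>prob_densities \<inter> holder_class \<alpha> L.
                        (\<forall>x\<in>unit_cube. l \<le> g0 x) \<and>
                        ennreal (C * (real n / ln (real n)) powr (- \<alpha> / (2 * \<alpha> + real CARD('d))))
                          < d1 g0 G_star}.
                 ennreal (expectation_iid g0 n
                   (\<lambda>X. 1 - monotonicity_test \<pi> (w n) M0 \<gamma> n X))) \<longlonglongrightarrow> 0))"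
proof -
  obtain C where C: "evidence_rate TYPE('d) a1 a2 a3 C" using evidence_rate_exists assms by blast
  have C0: "0 < C" using C by (simp add: evidence_rate_def)
  have M: "0 < M0" "64 * (C + 4) \<le> M0\<^sup>2" if "8 * sqrt (C + 4) \<le> M0" for M0
  proof -
    have p: "0 < 8 * sqrt (C + 4)" using C0 by simp
    then show "0 < M0" using that by linarith
    have "(8 * sqrt (C + 4))\<^sup>2 \<le> M0\<^sup>2" using that p by (intro power_mono) auto
    then show "64 * (C + 4) \<le> M0\<^sup>2" using C0 by (simp add: power_mult_distrib)
  qed
  show ?thesis
  proof (rule exI[of _ "8 * sqrt (C + 4)"], intro conjI allI impI ballI)
    show "0 < 8 * sqrt (C + 4)" using C0 by simp
  next
    fix M0 :: real and \<pi> and \<gamma> :: real and w :: "nat \<Rightarrow> nat \<Rightarrow> nat ^ 'd \<Rightarrow> real" and g0 :: "real ^ 'd \<Rightarrow> real"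
    assume M0: "8 * sqrt (C + 4) \<le> M0"
      and H: "prior_on_J TYPE('d) b1 b2 \<pi> \<and> dirichlet_weights a1 a2 a3 w \<and> 0 < \<gamma> \<and> \<gamma> < 1"
      and g0: "g0 \<in> G_star" "bounded_away_from_zero g0"
    obtain l where l: "0 < l" "\<And>x. x \<in> unit_cube \<Longrightarrow> l \<le> g0 x" using g0(2) by (auto simp: bounded_away_from_zero_def)
    have lim: "(\<lambda>n. 1 / real n / (1 - \<gamma>)) \<longlonglongrightarrow> 0"
    proof -
      have "(\<lambda>n. 1 / real n / (1 - \<gamma>)) \<longlonglongrightarrow> 0 / (1 - \<gamma>)" using H by (intro tendsto_intros lim_1_over_n) auto
      then show ?thesis by simp
    qed
    have ev: "\<forall>\<^sub>F n in sequentially. 0 \<le> expectation_iid g0 n (monotonicity_test \<pi> (w n) M0 \<gamma> n) \<and>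
        expectation_iid g0 n (monotonicity_test \<pi> (w n) M0 \<gamma> n) \<le> 1 / real n / (1 - \<gamma>)"
    proof (rule eventually_sequentiallyI[of 2])
      fix n :: nat assume n: "2 \<le> n"
      show "0 \<le> expectation_iid g0 n (monotonicity_test \<pi> (w n) M0 \<gamma> n) \<and>
        expectation_iid g0 n (monotonicity_test \<pi> (w n) M0 \<gamma> n) \<le> 1 / real n / (1 - \<gamma>)"
      proof
        have w: "dirichlet_weights a1 a2 a3 w" and prior: "prior_on_J TYPE('d) b1 b2 \<pi>" and \<gamma>: "\<gamma> < 1" using H by auto
        show "0 \<le> expectation_iid g0 n (monotonicity_test \<pi> (w n) M0 \<gamma> n)"
          by (rule rejection_bound(1)[OF g0(1) l w assms(4) n C M[OF M0] prior \<gamma>])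
        show "expectation_iid g0 n (monotonicity_test \<pi> (w n) M0 \<gamma> n) \<le> 1 / real n / (1 - \<gamma>)"
          by (rule rejection_bound(2)[OF g0(1) l w assms(4) n C M[OF M0] prior \<gamma>])
      qed
    qed
    show "(\<lambda>n. expectation_iid g0 n (monotonicity_test \<pi> (w n) M0 \<gamma> n)) \<longlonglongrightarrow> 0"
      by (rule tendsto_sandwich[OF _ _ tendsto_const lim]) (use ev in \<open>auto elim: eventually_mono\<close>)
  next
    fix M0 :: real and \<pi> and \<gamma> :: real and w :: "nat \<Rightarrow> nat \<Rightarrow> nat ^ 'd \<Rightarrow> real" and g0 :: "real ^ 'd \<Rightarrow> real"
    assume M0: "8 * sqrt (C + 4) \<le> M0"
      and H: "prior_on_J TYPE('d) b1 b2 \<pi> \<and> dirichlet_weights a1 a2 a3 w \<and> 0 < \<gamma> \<and> \<gamma> < 1"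
      and g0: "g0 \<in> prob_densities" "bounded_away_from_zero g0 \<and> g0 \<notin> L1_closure G_star"
    obtain l where l: "0 < l" "\<And>x. x \<in> unit_cube \<Longrightarrow> l \<le> g0 x" using g0(2) by (auto simp: bounded_away_from_zero_def)
    \<comment> \<open>A density outside the closure has positive distance to it.\<close>
    obtain \<epsilon> where \<epsilon>: "0 < \<epsilon>" "\<And>s. s \<in> G_star \<Longrightarrow> ennreal \<epsilon> \<le> L1_norm (\<lambda>x. g0 x - s x)"
      using g0 prob_densities_integrable[OF g0(1)] by (auto simp: L1_closure_def not_less)
    have "ennreal (2 * (\<epsilon> / 2)) \<le> d1 g0 G_star" unfolding d1_def using \<epsilon> by (intro INF_greatest) auto
    then have "ennreal (\<epsilon> / 2) \<le> d1 g0 F_star" using \<epsilon> by (intro d1_F_star_ge[OF g0(1)]) auto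
    then show "(\<lambda>n. expectation_iid g0 n (\<lambda>X. 1 - monotonicity_test \<pi> (w n) M0 \<gamma> n X)) \<longlonglongrightarrow> 0"
      using H \<epsilon> by (intro fixed_alternative_limit[OF g0(1) l _ assms(4) C _ assms(1,2) M[OF M0], where \<Delta> = "\<epsilon> / 2"]) auto
  next
    fix M0 l \<alpha> L :: real
    assume "8 * sqrt (C + 4) \<le> M0" "0 < l" "0 < \<alpha> \<and> \<alpha> \<le> 1 \<and> 0 < L"
    then show "\<exists>C>0. \<forall>\<pi> (w :: nat \<Rightarrow> nat \<Rightarrow> nat ^ 'd \<Rightarrow> real) \<gamma>.
          prior_on_J TYPE('d) b1 b2 \<pi> \<and> dirichlet_weights a1 a2 a3 w \<and> 0 < \<gamma> \<and> \<gamma> < 1 \<longrightarrow>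
          (\<lambda>n. SUP g0\<in>{g0\<in>prob_densities \<inter> holder_class \<alpha> L.
                        (\<forall>x\<in>unit_cube. l \<le> g0 x) \<and>
                        ennreal (C * (real n / ln (real n)) powr (- \<alpha> / (2 * \<alpha> + real CARD('d))))
                          < d1 g0 G_star}.
                 ennreal (expectation_iid g0 n
                   (\<lambda>X. 1 - monotonicity_test \<pi> (w n) M0 \<gamma> n X))) \<longlonglongrightarrow> 0"
      using smooth_alternative_limit[OF C assms(4,1,2) M] by blast
  qed
qed

end
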